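(* Let $Q$ be a finite tree quiver and $A=\Bbbk Q$ its path algebra. The $2$-category $\mathscr{D}_A'$ defined in the context is a finitary $2$-category.
   Context: $\Bbbk$ is an algebraically closed field; all categories and functors are $\Bbbk$-linear. A finite tree quiver is a finite quiver whose underlying graph is a tree. "Ideal" means two-sided ideal; ideals of $A$ are identified with subbimodules of ${}_AA_A$. $A$-mod is the category of finitely generated left $A$-modules. For an ideal $I$ of $A$, $\mathrm{Dp}_I$ is the functor $I\otimes_A{}_-:A\text{-mod}\to A\text{-mod}$. The $2$-category $\mathscr{D}_A'$ has: one object $\mathtt{i}$ (identified with a small category $\mathcal{C}$ equivalent to $A$-mod); as $1$-morphisms, the functors given, up to equivalence with $A$-mod, by functors from the additive closure (all functors isomorphic to direct summands of finite direct sums) of ${}_AA\otimes_\Bbbk A_A\otimes_A{}_-$ and all $\mathrm{Dp}_I$, $I$ an ideal of $A$; as $2$-morphisms, all natural transformations of functors. A $2$-category $\mathscr{C}$ is finitary over $\Bbbk$ if it has finitely many objects; each $\mathscr{C}(\mathtt{i},\mathtt{j})$ is an idempotent split $\Bbbk$-linear category with finitely many isomorphism classes of indecomposable objects and finite dimensional spaces of morphisms; all compositions are biadditive and $\Bbbk$-linear; and all identity $1$-morphisms are indecomposable. *)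

theory Defs
  imports
    "HOL-Algebra.Algebra"
    "HOL-Algebra.Algebraic_Closure_Type"
    "HOL-Library.Poly_Mapping"
    "Graph_Theory.Digraph_Component"
begin

section \<open>Tree quivers and path algebras\<close>

text \<open>
  A quiver is a \<^typ>\<open>('v, 'e) pre_digraph\<close> satisfying \<^locale>\<open>wf_digraph\<close>; loops and parallel
  arrows are allowed. Its underlying graph is an undirected multigraph, realised here by letting
  every arrow be traversed in both directions.
\<close>

definition doubled :: "('v, 'e) pre_digraph \<Rightarrow> ('v, 'e \<times> bool) pre_digraph" where
  "doubled Q = \<lparr>verts = verts Q, arcs = arcs Q \<times> UNIV,
     tail = (\<lambda>(e, d). if d then tail Q e else head Q e),
     head = (\<lambda>(e, d). if d then head Q e else tail Q e)\<rparr>"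

text \<open>
  A cycle of the underlying multigraph uses every edge at most once, so going back and forth along
  one edge is not a cycle, while a loop and a pair of parallel (or antiparallel) arrows are.
  The constant \<^const>\<open>tree\<close> is not applicable because it only excludes directed cycles.
\<close>

definition underlying_cycle :: "('v, 'e) pre_digraph \<Rightarrow> ('e \<times> bool) list \<Rightarrow> bool" where
  "underlying_cycle Q p \<longleftrightarrow> pre_digraph.cycle (doubled Q) p \<and> distinct (map fst p)"

definition finite_tree_quiver :: "('v, 'e) pre_digraph \<Rightarrow> bool" where
  "finite_tree_quiver Q \<longleftrightarrow> fin_digraph Q \<and> connected Q \<and> (\<nexists>p. underlying_cycle Q p)"

text \<open>A path is given by its starting vertex and the list of arrows in the order of traversal.\<close>

type_synonym ('v, 'e) qpath = "'v \<times> 'e list"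

definition qpaths :: "('v, 'e) pre_digraph \<Rightarrow> ('v, 'e) qpath set" where
  "qpaths Q = {(u, es). \<exists>v. pre_digraph.awalk Q u es v}"

definition qpath_end :: "('v, 'e) pre_digraph \<Rightarrow> ('v, 'e) qpath \<Rightarrow> 'v" where
  "qpath_end Q p = pre_digraph.awlast Q (fst p) (snd p)"

text \<open>
  The product \<open>p q\<close> of two paths is ``first \<open>q\<close>, then \<open>p\<close>'', so that left modules are
  representations of the quiver.
\<close>

definition path_algebra ::
    "('v, 'e) pre_digraph \<Rightarrow> ('k::field, ('v, 'e) qpath \<Rightarrow>\<^sub>0 'k) module" where
  "path_algebra Q =
    \<lparr>carrier = {f. Poly_Mapping.keys f \<subseteq> qpaths Q},
     monoid.mult = (\<lambda>f g. \<Sum>p\<in>Poly_Mapping.keys f. \<Sum>q\<in>Poly_Mapping.keys g.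
       if fst p = qpath_end Q q
       then Poly_Mapping.single (fst q, snd q @ snd p)
              (Poly_Mapping.lookup f p * Poly_Mapping.lookup g q)
       else 0),
     monoid.one = (\<Sum>v\<in>verts Q. Poly_Mapping.single (v, []) 1),
     ring.zero = 0,
     add = (+),
     module.smult = (\<lambda>c. Poly_Mapping.map ((*) c))\<rparr>"

section \<open>Modules, bimodules and tensor products\<close>

text \<open>
  The library's \<^locale>\<open>module\<close> needs a commutative ring of scalars. In all
  \<^typ>\<open>('a, 'm) module\<close> records below the fields \<^const>\<open>monoid.mult\<close> and \<^const>\<open>monoid.one\<close> play no role unless
  the record is an algebra.
\<close>

locale left_module = R?: ring R + M?: abelian_group M
  for R :: "('a, 'r) ring_scheme" (structure) and M :: "('a, 'm, 'z) module_scheme" (structure) +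
  assumes smult_closed: "\<lbrakk>a \<in> carrier R; x \<in> carrier M\<rbrakk> \<Longrightarrow> a \<odot>\<^bsub>M\<^esub> x \<in> carrier M"
    and smult_l_distr: "\<lbrakk>a \<in> carrier R; b \<in> carrier R; x \<in> carrier M\<rbrakk> \<Longrightarrow>
      (a \<oplus> b) \<odot>\<^bsub>M\<^esub> x = a \<odot>\<^bsub>M\<^esub> x \<oplus>\<^bsub>M\<^esub> b \<odot>\<^bsub>M\<^esub> x"
    and smult_r_distr: "\<lbrakk>a \<in> carrier R; x \<in> carrier M; y \<in> carrier M\<rbrakk> \<Longrightarrow>
      a \<odot>\<^bsub>M\<^esub> (x \<oplus>\<^bsub>M\<^esub> y) = a \<odot>\<^bsub>M\<^esub> x \<oplus>\<^bsub>M\<^esub> a \<odot>\<^bsub>M\<^esub> y"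
    and smult_assoc1: "\<lbrakk>a \<in> carrier R; b \<in> carrier R; x \<in> carrier M\<rbrakk> \<Longrightarrow>
      (a \<otimes> b) \<odot>\<^bsub>M\<^esub> x = a \<odot>\<^bsub>M\<^esub> (b \<odot>\<^bsub>M\<^esub> x)"
    and smult_one: "x \<in> carrier M \<Longrightarrow> \<one> \<odot>\<^bsub>M\<^esub> x = x"

definition finitely_generated ::
    "('a, 'r) ring_scheme \<Rightarrow> ('a, 'm, 'z) module_scheme \<Rightarrow> bool" where
  "finitely_generated R M \<longleftrightarrow>
    (\<exists>S. finite S \<and> S \<subseteq> carrier M \<and> (\<forall>N. submodule N R M \<and> S \<subseteq> N \<longrightarrow> N = carrier M))"

definition mod_hom ::
    "('a, 'r) ring_scheme \<Rightarrow> ('a, 'm, 'y) module_scheme \<Rightarrow> ('a, 'n, 'z) module_scheme \<Rightarrow>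
     ('m \<Rightarrow> 'n) set" where
  "mod_hom R M N = {f \<in> carrier M \<rightarrow>\<^sub>E carrier N.
     (\<forall>x\<in>carrier M. \<forall>y\<in>carrier M. f (x \<oplus>\<^bsub>M\<^esub> y) = f x \<oplus>\<^bsub>N\<^esub> f y) \<and>
     (\<forall>a\<in>carrier R. \<forall>x\<in>carrier M. f (a \<odot>\<^bsub>M\<^esub> x) = a \<odot>\<^bsub>N\<^esub> f x)}"

definition mod_iso ::
    "('a, 'r) ring_scheme \<Rightarrow> ('a, 'm, 'y) module_scheme \<Rightarrow> ('a, 'n, 'z) module_scheme \<Rightarrow>
     ('m \<Rightarrow> 'n) set" where
  "mod_iso R M N = {f \<in> mod_hom R M N. bij_betw f (carrier M) (carrier N)}"

text \<open>In \<open>('s, 'r, 'b) bimodule\<close>, scalars from \<open>'s\<close> act from the left and those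
  from \<open>'r\<close> from the right.\<close>

record ('s, 'r, 'b) bimodule = "('s, 'b) module" +
  rsmult :: "'b \<Rightarrow> 'r \<Rightarrow> 'b"

text \<open>
  The tensor product over \<open>R\<close> is the quotient of the free abelian group on
  \<^term>\<open>carrier B \<times> carrier M\<close> by the usual relations; its elements are cosets.
\<close>

definition tensor_relators ::
    "('r, 'c) ring_scheme \<Rightarrow> ('s, 'r, 'b, 'y) bimodule_scheme \<Rightarrow> ('r, 'm, 'z) module_scheme \<Rightarrow>
     ('b \<times> 'm \<Rightarrow>\<^sub>0 int) set" where
  "tensor_relators R B M =
     {frag_of (b \<oplus>\<^bsub>B\<^esub> b', m) - frag_of (b, m) - frag_of (b', m) | b b' m.
        b \<in> carrier B \<and> b' \<in> carrier B \<and> m \<in> carrier M} \<union>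
     {frag_of (b, m \<oplus>\<^bsub>M\<^esub> m') - frag_of (b, m) - frag_of (b, m') | b m m'.
        b \<in> carrier B \<and> m \<in> carrier M \<and> m' \<in> carrier M} \<union>
     {frag_of (rsmult B b r, m) - frag_of (b, r \<odot>\<^bsub>M\<^esub> m) | b r m.
        b \<in> carrier B \<and> r \<in> carrier R \<and> m \<in> carrier M}"

abbreviation tensor_free ::
    "('s, 'r, 'b, 'y) bimodule_scheme \<Rightarrow> ('r, 'm, 'z) module_scheme \<Rightarrow>
     ('b \<times> 'm \<Rightarrow>\<^sub>0 int) monoid" where
  "tensor_free B M \<equiv> free_Abelian_group (carrier B \<times> carrier M)"

definition tensor_null ::
    "('r, 'c) ring_scheme \<Rightarrow> ('s, 'r, 'b, 'y) bimodule_scheme \<Rightarrow> ('r, 'm, 'z) module_scheme \<Rightarrow>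
     ('b \<times> 'm \<Rightarrow>\<^sub>0 int) set" where
  "tensor_null R B M = generate (tensor_free B M) (tensor_relators R B M)"

text \<open>
  The map \<open>f \<otimes> g\<close> from \<open>B \<otimes> M\<close> to \<open>B' \<otimes> M'\<close>, evaluated at the coset \<open>K\<close>: all elements of \<open>K\<close>
  are sent to the same coset.
\<close>

definition tensor_map ::
    "('r, 'c) ring_scheme \<Rightarrow> ('s, 'r, 'b, 'y) bimodule_scheme \<Rightarrow> ('r, 'm, 'z) module_scheme \<Rightarrow>
     ('b1 \<Rightarrow> 'b) \<Rightarrow> ('m1 \<Rightarrow> 'm) \<Rightarrow> ('b1 \<times> 'm1 \<Rightarrow>\<^sub>0 int) set \<Rightarrow> ('b \<times> 'm \<Rightarrow>\<^sub>0 int) set" where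
  "tensor_map R B' M' f g K = the_elem
     ((\<lambda>x. tensor_null R B' M' #>\<^bsub>tensor_free B' M'\<^esub>
             frag_extend (\<lambda>(b, m). frag_of (f b, g m)) x) ` K)"

definition tensor ::
    "('r, 'c) ring_scheme \<Rightarrow> ('s, 'r, 'b, 'y) bimodule_scheme \<Rightarrow> ('r, 'm, 'z) module_scheme \<Rightarrow>
     ('s, ('b \<times> 'm \<Rightarrow>\<^sub>0 int) set) module" where
  "tensor R B M =
    (let T = tensor_free B M Mod tensor_null R B M in
     \<lparr>carrier = carrier T, monoid.mult = undefined, monoid.one = undefined,
      ring.zero = monoid.one T, add = monoid.mult T,
      module.smult = (\<lambda>s. tensor_map R B M (\<lambda>b. s \<odot>\<^bsub>B\<^esub> b) (\<lambda>m. m))\<rparr>)"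

definition tensor_bimodule ::
    "('r, 'c) ring_scheme \<Rightarrow> ('s, 'r, 'b, 'y) bimodule_scheme \<Rightarrow>
     ('r, 't, 'm, 'z) bimodule_scheme \<Rightarrow> ('s, 't, ('b \<times> 'm \<Rightarrow>\<^sub>0 int) set) bimodule" where
  "tensor_bimodule R B N = module.extend (tensor R B N)
     (bimodule.fields (\<lambda>K t. tensor_map R B N (\<lambda>b. b) (\<lambda>n. rsmult N n t) K))"

text \<open>
  An algebra over the field \<^typ>\<open>'k\<close> is a \<^typ>\<open>('k, 'a) module\<close> record that is also a ring, as in
  the library. The field itself is \<^const>\<open>ring_of_type_algebra\<close>.
\<close>

definition sub_bimodule ::
    "('k, 'a) module \<Rightarrow> 'a set \<Rightarrow> ('s \<Rightarrow> 'a \<Rightarrow> 'a) \<Rightarrow> ('a \<Rightarrow> 'r \<Rightarrow> 'a) \<Rightarrow>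
     ('s, 'r, 'a) bimodule" where
  "sub_bimodule A I l r = \<lparr>carrier = I, monoid.mult = undefined, monoid.one = undefined,
     ring.zero = \<zero>\<^bsub>A\<^esub>, add = add A, module.smult = l, rsmult = r\<rparr>"

definition ideal_bimodule :: "('k, 'a) module \<Rightarrow> 'a set \<Rightarrow> ('a, 'a, 'a) bimodule" where
  "ideal_bimodule A I = sub_bimodule A I (monoid.mult A) (monoid.mult A)"

definition free_bimodule ::
    "('k::field, 'a) module \<Rightarrow> ('a, 'a, ('a \<times> 'a \<Rightarrow>\<^sub>0 int) set) bimodule" where
  "free_bimodule A = tensor_bimodule (ring_of_type_algebra :: 'k ring)
     (sub_bimodule A (carrier A) (monoid.mult A) (\<lambda>a c. c \<odot>\<^bsub>A\<^esub> a))
     (sub_bimodule A (carrier A) (module.smult A) (monoid.mult A))"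

section \<open>Linear categories\<close>

text \<open>
  A morphism does not determine its source and target; therefore \<open>Comp K a b c g f\<close>, the composite
  of \<open>f : a \<rightarrow> b\<close> and \<open>g : b \<rightarrow> c\<close>, mentions the objects.
\<close>

record ('k, 'o, 'h) lincat =
  Obj :: "'o set"
  Hom :: "'o \<Rightarrow> 'o \<Rightarrow> ('k, 'h) module"
  Comp :: "'o \<Rightarrow> 'o \<Rightarrow> 'o \<Rightarrow> 'h \<Rightarrow> 'h \<Rightarrow> 'h"
  Id :: "'o \<Rightarrow> 'h"

abbreviation Mor :: "('k, 'o, 'h) lincat \<Rightarrow> 'o \<Rightarrow> 'o \<Rightarrow> 'h set" where
  "Mor K a b \<equiv> carrier (Hom K a b)"

locale category =
  fixes K :: "('k, 'o, 'h) lincat"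
  assumes Id_closed: "a \<in> Obj K \<Longrightarrow> Id K a \<in> Mor K a a"
    and Comp_closed: "\<lbrakk>a \<in> Obj K; b \<in> Obj K; c \<in> Obj K; f \<in> Mor K a b; g \<in> Mor K b c\<rbrakk> \<Longrightarrow>
      Comp K a b c g f \<in> Mor K a c"
    and Comp_Id_right: "\<lbrakk>a \<in> Obj K; b \<in> Obj K; f \<in> Mor K a b\<rbrakk> \<Longrightarrow> Comp K a a b f (Id K a) = f"
    and Comp_Id_left: "\<lbrakk>a \<in> Obj K; b \<in> Obj K; f \<in> Mor K a b\<rbrakk> \<Longrightarrow> Comp K a b b (Id K b) f = f"
    and Comp_assoc: "\<lbrakk>a \<in> Obj K; b \<in> Obj K; c \<in> Obj K; d \<in> Obj K;
        f \<in> Mor K a b; g \<in> Mor K b c; h \<in> Mor K c d\<rbrakk> \<Longrightarrow>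
      Comp K a c d h (Comp K a b c g f) = Comp K a b d (Comp K b c d h g) f"

definition bilinear_map ::
    "('k, 'u) module \<Rightarrow> ('k, 'v) module \<Rightarrow> ('k, 'w) module \<Rightarrow> ('u \<Rightarrow> 'v \<Rightarrow> 'w) \<Rightarrow> bool" where
  "bilinear_map U V W \<beta> \<longleftrightarrow>
    (\<forall>u\<in>carrier U. \<forall>u'\<in>carrier U. \<forall>v\<in>carrier V. \<beta> (u \<oplus>\<^bsub>U\<^esub> u') v = \<beta> u v \<oplus>\<^bsub>W\<^esub> \<beta> u' v) \<and>
    (\<forall>u\<in>carrier U. \<forall>v\<in>carrier V. \<forall>v'\<in>carrier V. \<beta> u (v \<oplus>\<^bsub>V\<^esub> v') = \<beta> u v \<oplus>\<^bsub>W\<^esub> \<beta> u v') \<and>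
    (\<forall>c. \<forall>u\<in>carrier U. \<forall>v\<in>carrier V. \<beta> (c \<odot>\<^bsub>U\<^esub> u) v = c \<odot>\<^bsub>W\<^esub> \<beta> u v \<and>
                                    \<beta> u (c \<odot>\<^bsub>V\<^esub> v) = c \<odot>\<^bsub>W\<^esub> \<beta> u v)"

locale linear_category = category K for K :: "('k::field, 'o, 'h) lincat" +
  assumes Hom_module: "\<lbrakk>a \<in> Obj K; b \<in> Obj K\<rbrakk> \<Longrightarrow>
      Module.module (ring_of_type_algebra :: 'k ring) (Hom K a b)"
    and Comp_bilinear: "\<lbrakk>a \<in> Obj K; b \<in> Obj K; c \<in> Obj K\<rbrakk> \<Longrightarrow>
      bilinear_map (Hom K b c) (Hom K a b) (Hom K a c) (Comp K a b c)"

definition isomorphic :: "('k, 'o, 'h) lincat \<Rightarrow> 'o \<Rightarrow> 'o \<Rightarrow> bool" where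
  "isomorphic K a b \<longleftrightarrow> a \<in> Obj K \<and> b \<in> Obj K \<and> (\<exists>f\<in>Mor K a b. \<exists>g\<in>Mor K b a.
     Comp K a b a g f = Id K a \<and> Comp K b a b f g = Id K b)"

definition zero_object :: "('k, 'o, 'h) lincat \<Rightarrow> 'o \<Rightarrow> bool" where
  "zero_object K a \<longleftrightarrow> a \<in> Obj K \<and>
     (\<forall>b\<in>Obj K. (\<exists>!f. f \<in> Mor K a b) \<and> (\<exists>!f. f \<in> Mor K b a))"

definition direct_sum :: "('k, 'o, 'h) lincat \<Rightarrow> 'o \<Rightarrow> 'o list \<Rightarrow> bool" where
  "direct_sum K x ys \<longleftrightarrow> x \<in> Obj K \<and> set ys \<subseteq> Obj K \<and>
    (\<exists>\<iota> \<pi>.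
      (\<forall>i<length ys. \<iota> i \<in> Mor K (ys ! i) x \<and> \<pi> i \<in> Mor K x (ys ! i)) \<and>
      (\<forall>i<length ys. \<forall>j<length ys. Comp K (ys ! i) x (ys ! j) (\<pi> j) (\<iota> i) =
         (if i = j then Id K (ys ! i) else \<zero>\<^bsub>Hom K (ys ! i) (ys ! j)\<^esub>)) \<and>
      (\<Oplus>\<^bsub>Hom K x x\<^esub> i\<in>{..<length ys}. Comp K x (ys ! i) x (\<iota> i) (\<pi> i)) = Id K x)"

definition indecomposable :: "('k, 'o, 'h) lincat \<Rightarrow> 'o \<Rightarrow> bool" where
  "indecomposable K x \<longleftrightarrow> x \<in> Obj K \<and> \<not> zero_object K x \<and>
     (\<forall>y z. direct_sum K x [y, z] \<longrightarrow> zero_object K y \<or> zero_object K z)"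

definition idempotent_split :: "('k, 'o, 'h) lincat \<Rightarrow> bool" where
  "idempotent_split K \<longleftrightarrow> (\<forall>x\<in>Obj K. \<forall>e\<in>Mor K x x. Comp K x x x e e = e \<longrightarrow>
     (\<exists>y\<in>Obj K. \<exists>r\<in>Mor K x y. \<exists>s\<in>Mor K y x.
        Comp K x y x s r = e \<and> Comp K y x y r s = Id K y))"

definition additive_closure :: "('k, 'o, 'h) lincat \<Rightarrow> 'o set \<Rightarrow> 'o set" where
  "additive_closure K S = {x \<in> Obj K. \<exists>s ys z.
     set ys \<subseteq> S \<and> direct_sum K s ys \<and> direct_sum K s [x, z]}"

definition full_subcategory :: "('k, 'o, 'h) lincat \<Rightarrow> 'o set \<Rightarrow> ('k, 'o, 'h) lincat" where
  "full_subcategory K S = K\<lparr>Obj := S\<rparr>"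

section \<open>Functors and natural transformations\<close>

record ('o, 'h, 'p, 'g) cfunctor =
  fobj :: "'o \<Rightarrow> 'p"
  fmor :: "'o \<Rightarrow> 'o \<Rightarrow> 'h \<Rightarrow> 'g"

text \<open>
  Functors and natural transformations are undefined outside their domains, so that equality of
  functors and of natural transformations is the usual one.
\<close>

locale linear_functor =
  fixes C :: "('k, 'o, 'h) lincat" and D :: "('k, 'p, 'g) lincat"
    and F :: "('o, 'h, 'p, 'g) cfunctor"
  assumes fobj_closed: "fobj F \<in> Obj C \<rightarrow>\<^sub>E Obj D"
    and fmor_closed: "\<lbrakk>a \<in> Obj C; b \<in> Obj C\<rbrakk> \<Longrightarrow>
      fmor F a b \<in> Mor C a b \<rightarrow>\<^sub>E Mor D (fobj F a) (fobj F b)"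
    and fmor_undefined: "a \<notin> Obj C \<or> b \<notin> Obj C \<Longrightarrow> fmor F a b = (\<lambda>_. undefined)"
    and fmor_Id: "a \<in> Obj C \<Longrightarrow> fmor F a a (Id C a) = Id D (fobj F a)"
    and fmor_Comp: "\<lbrakk>a \<in> Obj C; b \<in> Obj C; c \<in> Obj C; f \<in> Mor C a b; g \<in> Mor C b c\<rbrakk> \<Longrightarrow>
      fmor F a c (Comp C a b c g f) =
      Comp D (fobj F a) (fobj F b) (fobj F c) (fmor F b c g) (fmor F a b f)"
    and fmor_add: "\<lbrakk>a \<in> Obj C; b \<in> Obj C; f \<in> Mor C a b; g \<in> Mor C a b\<rbrakk> \<Longrightarrow>
      fmor F a b (f \<oplus>\<^bsub>Hom C a b\<^esub> g) =
      fmor F a b f \<oplus>\<^bsub>Hom D (fobj F a) (fobj F b)\<^esub> fmor F a b g"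
    and fmor_smult: "\<lbrakk>a \<in> Obj C; b \<in> Obj C; f \<in> Mor C a b\<rbrakk> \<Longrightarrow>
      fmor F a b (r \<odot>\<^bsub>Hom C a b\<^esub> f) = r \<odot>\<^bsub>Hom D (fobj F a) (fobj F b)\<^esub> fmor F a b f"

definition identity_functor :: "('k, 'o, 'h) lincat \<Rightarrow> ('o, 'h, 'o, 'h) cfunctor" where
  "identity_functor C =
    \<lparr>fobj = (\<lambda>a\<in>Obj C. a),
     fmor = (\<lambda>a b f. if a \<in> Obj C \<and> b \<in> Obj C \<and> f \<in> Mor C a b then f else undefined)\<rparr>"

definition compose_functors ::
    "('k, 'o, 'h) lincat \<Rightarrow> ('p, 'g, 'q, 'j) cfunctor \<Rightarrow> ('o, 'h, 'p, 'g) cfunctor \<Rightarrow>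
     ('o, 'h, 'q, 'j) cfunctor" where
  "compose_functors C G F =
    \<lparr>fobj = (\<lambda>a\<in>Obj C. fobj G (fobj F a)),
     fmor = (\<lambda>a b f. if a \<in> Obj C \<and> b \<in> Obj C \<and> f \<in> Mor C a b
                      then fmor G (fobj F a) (fobj F b) (fmor F a b f) else undefined)\<rparr>"

definition natural_transformations ::
    "('k, 'o, 'h) lincat \<Rightarrow> ('k, 'p, 'g) lincat \<Rightarrow>
     ('o, 'h, 'p, 'g) cfunctor \<Rightarrow> ('o, 'h, 'p, 'g) cfunctor \<Rightarrow> ('o \<Rightarrow> 'g) set" where
  "natural_transformations C D F G =
    {\<eta> \<in> (\<Pi>\<^sub>E a\<in>Obj C. Mor D (fobj F a) (fobj G a)).
      \<forall>a\<in>Obj C. \<forall>b\<in>Obj C. \<forall>f\<in>Mor C a b.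
        Comp D (fobj F a) (fobj F b) (fobj G b) (\<eta> b) (fmor F a b f) =
        Comp D (fobj F a) (fobj G a) (fobj G b) (fmor G a b f) (\<eta> a)}"

definition functor_category ::
    "('k, 'o, 'h) lincat \<Rightarrow> ('k, 'p, 'g) lincat \<Rightarrow>
     ('k, ('o, 'h, 'p, 'g) cfunctor, 'o \<Rightarrow> 'g) lincat" where
  "functor_category C D =
    \<lparr>Obj = {F. linear_functor C D F},
     Hom = (\<lambda>F G.
       \<lparr>carrier = natural_transformations C D F G, monoid.mult = undefined, monoid.one = undefined,
        ring.zero = (\<lambda>a\<in>Obj C. \<zero>\<^bsub>Hom D (fobj F a) (fobj G a)\<^esub>),
        add = (\<lambda>\<eta> \<zeta>. \<lambda>a\<in>Obj C. \<eta> a \<oplus>\<^bsub>Hom D (fobj F a) (fobj G a)\<^esub> \<zeta> a),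
        module.smult = (\<lambda>c \<eta>. \<lambda>a\<in>Obj C. c \<odot>\<^bsub>Hom D (fobj F a) (fobj G a)\<^esub> \<eta> a)\<rparr>),
     Comp = (\<lambda>F G H \<zeta> \<eta>. \<lambda>a\<in>Obj C. Comp D (fobj F a) (fobj G a) (fobj H a) (\<zeta> a) (\<eta> a)),
     Id = (\<lambda>F. \<lambda>a\<in>Obj C. Id D (fobj F a))\<rparr>"

text \<open>For \<open>\<alpha> : F \<rightarrow> F'\<close> and \<open>\<beta> : G \<rightarrow> G'\<close>, the transformation from \<open>G F\<close> to \<open>G' F'\<close>.\<close>

definition horizontal_composite ::
    "('k, 'o, 'h) lincat \<Rightarrow> ('k, 'p, 'g) lincat \<Rightarrow> ('k, 'q, 'j) lincat \<Rightarrow>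
     ('o, 'h, 'p, 'g) cfunctor \<Rightarrow> ('o, 'h, 'p, 'g) cfunctor \<Rightarrow>
     ('p, 'g, 'q, 'j) cfunctor \<Rightarrow> ('p, 'g, 'q, 'j) cfunctor \<Rightarrow>
     ('p \<Rightarrow> 'j) \<Rightarrow> ('o \<Rightarrow> 'g) \<Rightarrow> ('o \<Rightarrow> 'j)" where
  "horizontal_composite C D E F F' G G' \<beta> \<alpha> =
    (\<lambda>a\<in>Obj C. Comp E (fobj G (fobj F a)) (fobj G (fobj F' a)) (fobj G' (fobj F' a))
                 (\<beta> (fobj F' a)) (fmor G (fobj F a) (fobj F' a) (\<alpha> a)))"

section \<open>Finitary 2-categories\<close>

text \<open>
  \<open>HComp1 D i j k G F\<close> is the composite of \<open>F : i \<rightarrow> j\<close> and \<open>G : j \<rightarrow> k\<close>;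
  \<open>HComp2 D i j k F F' G G' \<beta> \<alpha>\<close> is the horizontal composite of \<open>\<alpha> : F \<rightarrow> F'\<close> and \<open>\<beta> : G \<rightarrow> G'\<close>.
\<close>

record ('k, 'i, 'o, 'h) two_cat =
  Ob2 :: "'i set"
  HomCat :: "'i \<Rightarrow> 'i \<Rightarrow> ('k, 'o, 'h) lincat"
  HComp1 :: "'i \<Rightarrow> 'i \<Rightarrow> 'i \<Rightarrow> 'o \<Rightarrow> 'o \<Rightarrow> 'o"
  HComp2 :: "'i \<Rightarrow> 'i \<Rightarrow> 'i \<Rightarrow> 'o \<Rightarrow> 'o \<Rightarrow> 'o \<Rightarrow> 'o \<Rightarrow> 'h \<Rightarrow> 'h \<Rightarrow> 'h"
  Id1 :: "'i \<Rightarrow> 'o"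

abbreviation Mor1 :: "('k, 'i, 'o, 'h) two_cat \<Rightarrow> 'i \<Rightarrow> 'i \<Rightarrow> 'o set" where
  "Mor1 D i j \<equiv> Obj (HomCat D i j)"

abbreviation Mor2 :: "('k, 'i, 'o, 'h) two_cat \<Rightarrow> 'i \<Rightarrow> 'i \<Rightarrow> 'o \<Rightarrow> 'o \<Rightarrow> 'h set" where
  "Mor2 D i j F G \<equiv> Mor (HomCat D i j) F G"

locale two_category =
  fixes D :: "('k, 'i, 'o, 'h) two_cat"
  assumes HomCat_category: "\<lbrakk>i \<in> Ob2 D; j \<in> Ob2 D\<rbrakk> \<Longrightarrow> category (HomCat D i j)"
    and Id1_closed: "i \<in> Ob2 D \<Longrightarrow> Id1 D i \<in> Mor1 D i i"
    and HComp1_closed: "\<lbrakk>i \<in> Ob2 D; j \<in> Ob2 D; k \<in> Ob2 D; F \<in> Mor1 D i j; G \<in> Mor1 D j k\<rbrakk> \<Longrightarrow>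
      HComp1 D i j k G F \<in> Mor1 D i k"
    and HComp2_closed: "\<lbrakk>i \<in> Ob2 D; j \<in> Ob2 D; k \<in> Ob2 D;
        F \<in> Mor1 D i j; F' \<in> Mor1 D i j; G \<in> Mor1 D j k; G' \<in> Mor1 D j k;
        \<alpha> \<in> Mor2 D i j F F'; \<beta> \<in> Mor2 D j k G G'\<rbrakk> \<Longrightarrow>
      HComp2 D i j k F F' G G' \<beta> \<alpha> \<in> Mor2 D i k (HComp1 D i j k G F) (HComp1 D i j k G' F')"
    and HComp2_Id: "\<lbrakk>i \<in> Ob2 D; j \<in> Ob2 D; k \<in> Ob2 D; F \<in> Mor1 D i j; G \<in> Mor1 D j k\<rbrakk> \<Longrightarrow>
      HComp2 D i j k F F G G (Id (HomCat D j k) G) (Id (HomCat D i j) F) =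
      Id (HomCat D i k) (HComp1 D i j k G F)"
    and interchange: "\<lbrakk>i \<in> Ob2 D; j \<in> Ob2 D; k \<in> Ob2 D;
        F \<in> Mor1 D i j; F' \<in> Mor1 D i j; F'' \<in> Mor1 D i j;
        G \<in> Mor1 D j k; G' \<in> Mor1 D j k; G'' \<in> Mor1 D j k;
        \<alpha> \<in> Mor2 D i j F F'; \<alpha>' \<in> Mor2 D i j F' F'';
        \<beta> \<in> Mor2 D j k G G'; \<beta>' \<in> Mor2 D j k G' G''\<rbrakk> \<Longrightarrow>
      HComp2 D i j k F F'' G G''
        (Comp (HomCat D j k) G G' G'' \<beta>' \<beta>) (Comp (HomCat D i j) F F' F'' \<alpha>' \<alpha>) =
      Comp (HomCat D i k) (HComp1 D i j k G F) (HComp1 D i j k G' F') (HComp1 D i j k G'' F'')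
        (HComp2 D i j k F' F'' G' G'' \<beta>' \<alpha>') (HComp2 D i j k F F' G G' \<beta> \<alpha>)"
    and HComp1_assoc: "\<lbrakk>i \<in> Ob2 D; j \<in> Ob2 D; k \<in> Ob2 D; l \<in> Ob2 D;
        F \<in> Mor1 D i j; G \<in> Mor1 D j k; H \<in> Mor1 D k l\<rbrakk> \<Longrightarrow>
      HComp1 D i k l H (HComp1 D i j k G F) = HComp1 D i j l (HComp1 D j k l H G) F"
    and HComp2_assoc: "\<lbrakk>i \<in> Ob2 D; j \<in> Ob2 D; k \<in> Ob2 D; l \<in> Ob2 D;
        F \<in> Mor1 D i j; F' \<in> Mor1 D i j; G \<in> Mor1 D j k; G' \<in> Mor1 D j k;
        H \<in> Mor1 D k l; H' \<in> Mor1 D k l;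
        \<alpha> \<in> Mor2 D i j F F'; \<beta> \<in> Mor2 D j k G G'; \<gamma> \<in> Mor2 D k l H H'\<rbrakk> \<Longrightarrow>
      HComp2 D i k l (HComp1 D i j k G F) (HComp1 D i j k G' F') H H' \<gamma>
        (HComp2 D i j k F F' G G' \<beta> \<alpha>) =
      HComp2 D i j l F F' (HComp1 D j k l H G) (HComp1 D j k l H' G')
        (HComp2 D j k l G G' H H' \<gamma> \<beta>) \<alpha>"
    and HComp1_Id_right: "\<lbrakk>i \<in> Ob2 D; j \<in> Ob2 D; F \<in> Mor1 D i j\<rbrakk> \<Longrightarrow>
      HComp1 D i i j F (Id1 D i) = F"
    and HComp1_Id_left: "\<lbrakk>i \<in> Ob2 D; j \<in> Ob2 D; F \<in> Mor1 D i j\<rbrakk> \<Longrightarrow>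
      HComp1 D i j j (Id1 D j) F = F"
    and HComp2_Id_right: "\<lbrakk>i \<in> Ob2 D; j \<in> Ob2 D; F \<in> Mor1 D i j; F' \<in> Mor1 D i j;
        \<alpha> \<in> Mor2 D i j F F'\<rbrakk> \<Longrightarrow>
      HComp2 D i i j (Id1 D i) (Id1 D i) F F' \<alpha> (Id (HomCat D i i) (Id1 D i)) = \<alpha>"
    and HComp2_Id_left: "\<lbrakk>i \<in> Ob2 D; j \<in> Ob2 D; F \<in> Mor1 D i j; F' \<in> Mor1 D i j;
        \<alpha> \<in> Mor2 D i j F F'\<rbrakk> \<Longrightarrow>
      HComp2 D i j j F F' (Id1 D j) (Id1 D j) (Id (HomCat D j j) (Id1 D j)) \<alpha> = \<alpha>"

text \<open>Bilinearity of vertical composition is part of \<^locale>\<open>linear_category\<close>.\<close>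

locale finitary_two_category = two_category D for D :: "('k::field, 'i, 'o, 'h) two_cat" +
  assumes finite_Ob2: "finite (Ob2 D)"
    and HomCat_linear: "\<lbrakk>i \<in> Ob2 D; j \<in> Ob2 D\<rbrakk> \<Longrightarrow> linear_category (HomCat D i j)"
    and HomCat_split: "\<lbrakk>i \<in> Ob2 D; j \<in> Ob2 D\<rbrakk> \<Longrightarrow> idempotent_split (HomCat D i j)"
    and finitely_many_indecomposables: "\<lbrakk>i \<in> Ob2 D; j \<in> Ob2 D\<rbrakk> \<Longrightarrow>
      finite ({F. indecomposable (HomCat D i j) F} // {(F, G). isomorphic (HomCat D i j) F G})"
    and Mor2_finite_dimensional: "\<lbrakk>i \<in> Ob2 D; j \<in> Ob2 D; F \<in> Mor1 D i j; G \<in> Mor1 D i j\<rbrakk> \<Longrightarrow>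
      finitely_generated (ring_of_type_algebra :: 'k ring) (Hom (HomCat D i j) F G)"
    and HComp2_bilinear: "\<lbrakk>i \<in> Ob2 D; j \<in> Ob2 D; k \<in> Ob2 D;
        F \<in> Mor1 D i j; F' \<in> Mor1 D i j; G \<in> Mor1 D j k; G' \<in> Mor1 D j k\<rbrakk> \<Longrightarrow>
      bilinear_map (Hom (HomCat D j k) G G') (Hom (HomCat D i j) F F')
        (Hom (HomCat D i k) (HComp1 D i j k G F) (HComp1 D i j k G' F'))
        (HComp2 D i j k F F' G G')"
    and Id1_indecomposable: "i \<in> Ob2 D \<Longrightarrow> indecomposable (HomCat D i i) (Id1 D i)"

section \<open>The 2-category of an algebra\<close>

text \<open>The field acts on an \<open>A\<close>-module through multiples of the unit of \<open>A\<close>.\<close>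

definition mod_category :: "('k, 'a) module \<Rightarrow> ('k, ('a, 'm) module, 'm \<Rightarrow> 'm) lincat" where
  "mod_category A =
    \<lparr>Obj = {M. left_module A M \<and> finitely_generated A M},
     Hom = (\<lambda>M N.
       \<lparr>carrier = mod_hom A M N, monoid.mult = undefined, monoid.one = undefined,
        ring.zero = (\<lambda>x\<in>carrier M. \<zero>\<^bsub>N\<^esub>),
        add = (\<lambda>f g. \<lambda>x\<in>carrier M. f x \<oplus>\<^bsub>N\<^esub> g x),
        module.smult = (\<lambda>c f. \<lambda>x\<in>carrier M. (c \<odot>\<^bsub>A\<^esub> \<one>\<^bsub>A\<^esub>) \<odot>\<^bsub>N\<^esub> f x)\<rparr>),
     Comp = (\<lambda>L M N g f. compose (carrier L) g f),
     Id = (\<lambda>M. \<lambda>x\<in>carrier M. x)\<rparr>"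

text \<open>
  A small category equivalent to \<open>A\<close>-mod is obtained by bounding the universe in which the carriers
  live. Every finitely generated \<open>A\<close>-module is isomorphic to a quotient of some \<open>A\<^sup>n\<close>, whose
  elements are sets of sequences in \<open>A\<close>.
\<close>

type_synonym 'a small_carrier = "(nat \<Rightarrow> 'a) set"
type_synonym 'a small_module = "('a, 'a small_carrier) module"
type_synonym 'a small_hom = "'a small_carrier \<Rightarrow> 'a small_carrier"
type_synonym 'a small_functor =
  "('a small_module, 'a small_hom, 'a small_module, 'a small_hom) cfunctor"

definition small_mod :: "('k, 'a) module \<Rightarrow> ('k, 'a small_module, 'a small_hom) lincat" where
  "small_mod A = mod_category A"

text \<open>
  The endofunctors of \<^const>\<open>small_mod\<close> that correspond to \<open>B \<otimes>\<^sub>A _\<close>, i.e. that are isomorphic to it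
  as functors from \<^const>\<open>small_mod\<close> to \<open>A\<close>-modules.
\<close>

definition tensor_functors ::
    "('k, 'a) module \<Rightarrow> ('a, 'a, 'b) bimodule \<Rightarrow> 'a small_functor set" where
  "tensor_functors A B = {F. linear_functor (small_mod A) (small_mod A) F \<and>
    (\<exists>\<theta>. (\<forall>M\<in>Obj (small_mod A). \<theta> M \<in> mod_iso A (tensor A B M) (fobj F M)) \<and>
         (\<forall>M\<in>Obj (small_mod A). \<forall>N\<in>Obj (small_mod A). \<forall>f\<in>Mor (small_mod A) M N.
            \<forall>x\<in>carrier (tensor A B M).
              fmor F M N f (\<theta> M x) = \<theta> N (tensor_map A B N (\<lambda>b. b) f x)))}"

abbreviation Dp :: "('k, 'a) module \<Rightarrow> 'a set \<Rightarrow> 'a small_functor set" where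
  "Dp A I \<equiv> tensor_functors A (ideal_bimodule A I)"

definition D'_functors :: "('k::field, 'a) module \<Rightarrow> 'a small_functor set" where
  "D'_functors A = additive_closure (functor_category (small_mod A) (small_mod A))
     (tensor_functors A (free_bimodule A) \<union> (\<Union>I\<in>{I. ideal I A}. Dp A I))"

definition D'_two_category ::
    "('k::field, 'a) module \<Rightarrow>
     ('k, ('k, 'a small_module, 'a small_hom) lincat,
      'a small_functor, 'a small_module \<Rightarrow> 'a small_hom) two_cat" where
  "D'_two_category A =
    \<lparr>Ob2 = {small_mod A},
     HomCat = (\<lambda>C D. full_subcategory (functor_category C D) (D'_functors A)),
     HComp1 = (\<lambda>C D E. compose_functors C),
     HComp2 = (\<lambda>C D E. horizontal_composite C D E),
     Id1 = identity_functor\<rparr>"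

end

theory Submission
  imports Defs
begin

text \<open>
  Two vertices of a tree quiver are joined by at most one path, so sandwiching an element between
  two vertex idempotents isolates a single coefficient. Hence every ideal of \<open>A\<close> is spanned by the
  paths in it and there are only finitely many ideals. Moreover, every ideal is projective on either
  side, with a dual basis given by its minimal paths.

  It follows that \<open>I \<otimes>\<^sub>A J = I J\<close>; that \<open>A \<otimes>\<^sub>k J \<otimes>\<^sub>A M\<close> is naturally a summand of \<open>A \<otimes>\<^sub>k M\<^sup>n\<close>, since
  \<open>J\<close> is projective on the right; and that \<open>I \<otimes>\<^sub>k M\<close> is naturally a summand of \<open>A\<^sup>n \<otimes>\<^sub>k M\<close>, since \<open>I\<close>
  is projective on the left. So the additive closure is closed under composition. A natural
  transformation from one of the generating functors is determined by the images of finitely many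
  elements at the regular module. This makes the spaces of 2-morphisms finite-dimensional, and
  splitting idempotents then leaves finitely many indecomposables. Finally, the natural endomorphisms
  of the identity functor form the centre of \<open>A\<close>, which is \<open>k\<close> because the quiver is connected.
\<close>

section \<open>Finite-dimensional vector spaces\<close>

text \<open>Dimension is replaced by a bound on the number of separating linear forms: such a bound
  passes to subspaces, drops on proper ones and needs no bases. Likewise, membership in an additive
  closure is tested by whether the identity is a sum of composites through generators; these sums
  form an ideal of morphisms, so they survive composition of every kind. The obstacle with the
  1-morphisms is that they are given only up to isomorphism with a tensor functor. Each of them is
  therefore handled through elements \<open>t M x m\<close> that correspond to pure tensors,
  together with the universal property that these inherit; natural transformations are built and
  compared on such elements. Smallness adds the task of realising products and the regular module by
  sets of sequences. Projectivity is used as a dual basis, which yields the required maps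
  explicitly, one basis element at a time. The quiver enters through uniqueness of paths, finiteness
  and connectedness.\<close>

abbreviation base_field :: "'k::field ring" where
  "base_field \<equiv> ring_of_type_algebra"

lemma base_field_simps [simp]:
  "carrier (base_field :: 'k::field ring) = UNIV"
  "\<zero>\<^bsub>(base_field :: 'k ring)\<^esub> = 0" "\<one>\<^bsub>(base_field :: 'k ring)\<^esub> = 1"
  "x \<oplus>\<^bsub>base_field\<^esub> y = x + (y :: 'k)" "x \<otimes>\<^bsub>base_field\<^esub> y = x * (y :: 'k)"
  by (simp_all add: ring_of_type_algebra_def)

lemma cring_base_field: "cring (base_field :: 'k::field ring)"
  by (rule cring_from_type_algebra)

definition linear_form :: "('k::field, 'v) module \<Rightarrow> 'v set \<Rightarrow> ('v \<Rightarrow> 'k) \<Rightarrow> bool" where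
  "linear_form V W l \<longleftrightarrow> (\<forall>u\<in>W. \<forall>v\<in>W. l (u \<oplus>\<^bsub>V\<^esub> v) = l u + l v) \<and> (\<forall>c. \<forall>u\<in>W. l (c \<odot>\<^bsub>V\<^esub> u) = c * l u)"

text \<open>At most \<open>n\<close> linear forms separate the points of \<open>W\<close>, that is, \<open>dim W \<le> n\<close>.\<close>

definition separated :: "('k::field, 'v) module \<Rightarrow> 'v set \<Rightarrow> nat \<Rightarrow> bool" where
  "separated V W n \<longleftrightarrow> (\<exists>\<Lambda>. finite \<Lambda> \<and> card \<Lambda> \<le> n \<and> (\<forall>l\<in>\<Lambda>. linear_form V W l) \<and>
     (\<forall>w\<in>W. (\<forall>l\<in>\<Lambda>. l w = 0) \<longrightarrow> w = \<zero>\<^bsub>V\<^esub>))"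

lemma linear_form_pullback:
  assumes "linear_form V W l" and "\<And>u. u \<in> W' \<Longrightarrow> f u \<in> W"
    and "\<And>u v. u \<in> W' \<Longrightarrow> v \<in> W' \<Longrightarrow> f (u \<oplus>\<^bsub>V'\<^esub> v) = f u \<oplus>\<^bsub>V\<^esub> f v"
    and "\<And>c u. u \<in> W' \<Longrightarrow> f (c \<odot>\<^bsub>V'\<^esub> u) = c \<odot>\<^bsub>V\<^esub> f u"
  shows "linear_form V' W' (\<lambda>u. l (f u))"
  using assms unfolding linear_form_def by simp

text \<open>The forms on the target are composed with \<open>f\<close>; the trivial kernel of
  \<open>f\<close> keeps the composites separating. This is the way to compare the endomorphism
  spaces of an object and of a retract.\<close>

lemma separated_pullback:
  assumes "separated V W n" and "\<And>u. u \<in> W' \<Longrightarrow> f u \<in> W"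
    and "\<And>u v. u \<in> W' \<Longrightarrow> v \<in> W' \<Longrightarrow> f (u \<oplus>\<^bsub>V'\<^esub> v) = f u \<oplus>\<^bsub>V\<^esub> f v"
    and "\<And>c u. u \<in> W' \<Longrightarrow> f (c \<odot>\<^bsub>V'\<^esub> u) = c \<odot>\<^bsub>V\<^esub> f u"
    and "\<And>u. u \<in> W' \<Longrightarrow> f u = \<zero>\<^bsub>V\<^esub> \<Longrightarrow> u = \<zero>\<^bsub>V'\<^esub>"
  shows "separated V' W' n"
proof -
  obtain \<Lambda> where \<Lambda>: "finite \<Lambda>" "card \<Lambda> \<le> n" "\<And>l. l \<in> \<Lambda> \<Longrightarrow> linear_form V W l"
    "\<And>w. w \<in> W \<Longrightarrow> (\<forall>l\<in>\<Lambda>. l w = 0) \<Longrightarrow> w = \<zero>\<^bsub>V\<^esub>"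
    using assms(1) unfolding separated_def by auto
  let ?\<Lambda> = "(\<lambda>l u. l (f u)) ` \<Lambda>"
  have "finite ?\<Lambda>" "card ?\<Lambda> \<le> n"
    using \<Lambda>(1,2) card_image_le[OF \<Lambda>(1), of "\<lambda>l u. l (f u)"] by auto
  moreover have "linear_form V' W' l" if "l \<in> ?\<Lambda>" for l
    using that linear_form_pullback[OF \<Lambda>(3) assms(2-4)] by auto
  moreover have "w = \<zero>\<^bsub>V'\<^esub>" if "w \<in> W'" "\<forall>l\<in>?\<Lambda>. l w = 0" for w
    using that \<Lambda>(4)[of "f w"] assms(2,5) by auto
  ultimately show ?thesis unfolding separated_def by blast
qed

text \<open>The library's modules over a commutative ring, specialised to a field whose carrier is a
  whole type. The derived laws lose their carrier conditions on scalars, and subtraction is written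
  as scaling by \<open>-1\<close>.\<close>

locale vspace = Module.module "base_field :: 'k ring" V for V :: "('k::field, 'v) module" (structure)
begin

lemma vs_smult_closed [simp]: "x \<in> carrier V \<Longrightarrow> c \<odot> x \<in> carrier V"
  using smult_closed[of c x] by simp

lemma vs_smult_zero [simp]: "x \<in> carrier V \<Longrightarrow> 0 \<odot> x = \<zero>\<^bsub>V\<^esub>"
  using smult_l_null[of x] by simp

lemma vs_smult_one [simp]: "x \<in> carrier V \<Longrightarrow> 1 \<odot> x = x"
  using smult_one[of x] by simp

lemma vs_smult_smult: "x \<in> carrier V \<Longrightarrow> c \<odot> (d \<odot> x) = (c * d) \<odot> x"
  using smult_assoc1[of c d x] by simp

lemma vs_add_smult: "x \<in> carrier V \<Longrightarrow> c \<odot> x \<oplus>\<^bsub>V\<^esub> d \<odot> x = (c + d) \<odot> x"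
  using smult_l_distr[of c d x] by simp

lemma vs_smult_add: "x \<in> carrier V \<Longrightarrow> y \<in> carrier V \<Longrightarrow> c \<odot> (x \<oplus>\<^bsub>V\<^esub> y) = c \<odot> x \<oplus>\<^bsub>V\<^esub> c \<odot> y"
  using smult_r_distr[of c x y] by simp

lemma vs_smult_right_zero [simp]: "c \<odot> \<zero>\<^bsub>V\<^esub> = \<zero>\<^bsub>V\<^esub>"
  using smult_r_null[of c] by simp

lemma vs_add_neg: "x \<in> carrier V \<Longrightarrow> x \<oplus>\<^bsub>V\<^esub> (-1) \<odot> x = \<zero>\<^bsub>V\<^esub>"
  using vs_add_smult[of x 1 "-1"] by simp

lemma vs_neg: "x \<in> carrier V \<Longrightarrow> \<ominus>\<^bsub>V\<^esub> x = (-1) \<odot> x"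
  using vs_add_neg by (metis M.minus_equality M.add.m_comm vs_smult_closed)

definition subspace :: "'v set \<Rightarrow> bool" where
  "subspace W \<longleftrightarrow> W \<subseteq> carrier V \<and> \<zero>\<^bsub>V\<^esub> \<in> W \<and> (\<forall>u\<in>W. \<forall>v\<in>W. u \<oplus>\<^bsub>V\<^esub> v \<in> W) \<and> (\<forall>c. \<forall>u\<in>W. c \<odot> u \<in> W)"

lemma subspace_iff_submodule: "subspace W \<longleftrightarrow> submodule W base_field V"
proof
  assume "subspace W"
  then show "submodule W base_field V"
    by (intro submoduleI) (auto simp: subspace_def vs_neg subset_iff)
next
  assume W: "submodule W base_field V"
  then show "subspace W"
    using submoduleE[OF W] submodule.axioms(1)[OF W, THEN subgroup.one_closed]
    by (auto simp: subspace_def)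
qed

lemma subspace_carrier: "subspace (carrier V)"
  by (auto simp: subspace_def)

lemma subspace_image:
  assumes "\<And>u. u \<in> carrier V \<Longrightarrow> f u \<in> carrier V"
    and "\<And>u v. u \<in> carrier V \<Longrightarrow> v \<in> carrier V \<Longrightarrow> f (u \<oplus>\<^bsub>V\<^esub> v) = f u \<oplus>\<^bsub>V\<^esub> f v"
    and "\<And>c u. u \<in> carrier V \<Longrightarrow> f (c \<odot> u) = c \<odot> f u"
  shows "subspace (f ` carrier V)"
proof -
  have "f \<zero>\<^bsub>V\<^esub> = \<zero>\<^bsub>V\<^esub>"
    using assms(3)[of "\<zero>\<^bsub>V\<^esub>" 0] assms(1)[of "\<zero>\<^bsub>V\<^esub>"] by simp
  then have "\<zero>\<^bsub>V\<^esub> \<in> f ` carrier V" by (metis M.zero_closed imageI)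
  then show ?thesis
    unfolding subspace_def using assms(1)
    by (auto simp: assms(2,3)[symmetric])
qed

text \<open>A form that does not vanish at some \<open>w\<close> outside \<open>W'\<close> can be
  spent to make all other forms vanish at \<open>w\<close>. A vector of \<open>W'\<close> killed by
  the modified forms differs from a multiple of \<open>w\<close> by a vector killed by all original
  ones, so it is itself a multiple of \<open>w\<close>, and it is zero because \<open>w\<close> is
  not in \<open>W'\<close>.\<close>

lemma separated_drop:
  assumes sep: "separated V W n" and W: "subspace W" and W': "subspace W'" and sub: "W' \<subset> W"
  shows "\<exists>m<n. separated V W' m"
proof -
  obtain \<Lambda> where \<Lambda>: "finite \<Lambda>" "card \<Lambda> \<le> n" "\<And>l. l \<in> \<Lambda> \<Longrightarrow> linear_form V W l"
    "\<And>w. w \<in> W \<Longrightarrow> (\<forall>l\<in>\<Lambda>. l w = 0) \<Longrightarrow> w = \<zero>\<^bsub>V\<^esub>"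
    using sep unfolding separated_def by auto
  obtain w where w: "w \<in> W" "w \<notin> W'" using sub by auto
  then obtain l0 where l0: "l0 \<in> \<Lambda>" "l0 w \<noteq> 0"
    using \<Lambda>(4)[of w] W' by (auto simp: subspace_def)
  \<comment> \<open>The multiple of \<open>l0\<close> is chosen so that \<open>\<mu> l\<close>
    vanishes at \<open>w\<close>. For \<open>l0\<close> itself the result would be zero, so it is
    omitted, and this gains the one form.\<close>
  define \<mu> where "\<mu> l = (\<lambda>v. l v - (l w / l0 w) * l0 v)" for l
  let ?\<Lambda> = "\<mu> ` (\<Lambda> - {l0})"
  have "card ?\<Lambda> \<le> card (\<Lambda> - {l0})" using \<Lambda>(1) by (simp add: card_image_le)
  then have "card ?\<Lambda> < n"
    using \<Lambda>(1,2) l0(1) by (metis card_Diff1_less le_less_trans less_le_trans)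
  moreover have "linear_form V W' l" if "l \<in> ?\<Lambda>" for l
  proof -
    obtain l1 where l1: "l1 \<in> \<Lambda>" "l = \<mu> l1" using \<open>l \<in> ?\<Lambda>\<close> by auto
    have "W' \<subseteq> W" using sub by auto
    with \<Lambda>(3)[OF l1(1)] \<Lambda>(3)[OF l0(1)] show ?thesis
      unfolding linear_form_def l1(2) \<mu>_def by (simp add: subset_iff field_simps add_divide_distrib)
  qed
  moreover have "v = \<zero>\<^bsub>V\<^esub>" if v: "v \<in> W'" "\<forall>l\<in>?\<Lambda>. l v = 0" for v
  proof -
    \<comment> \<open>With this coefficient \<open>v - c w\<close> is killed by \<open>l0\<close>,
      and \<open>\<mu> l v = 0\<close> says exactly that it is killed by every other
      \<open>l\<close>.\<close>
    define c where "c = l0 v / l0 w"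
    let ?u = "v \<oplus>\<^bsub>V\<^esub> (- c) \<odot> w"
    have vW: "v \<in> W" "v \<in> carrier V" "w \<in> carrier V" using v sub w W by (auto simp: subspace_def)
    have "?u \<in> W" using vW w W by (auto simp: subspace_def)
    moreover have "l ?u = 0" if l: "l \<in> \<Lambda>" for l
    proof -
      have lin: "l ?u = l v - c * l w"
        using \<Lambda>(3)[OF l] vW w W by (simp add: linear_form_def subspace_def)
      show ?thesis
      proof (cases "l = l0")
        case True then show ?thesis using lin l0 by (simp add: c_def)
      next
        case False
        then have "\<mu> l v = 0" using v(2) l by auto
        then show ?thesis using lin by (simp add: \<mu>_def c_def field_simps)
      qed
    qed
    ultimately have u0: "?u = \<zero>\<^bsub>V\<^esub>" using \<Lambda>(4) by blast
    have "v = ?u \<oplus>\<^bsub>V\<^esub> c \<odot> w"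
      using vW by (simp add: M.add.m_assoc vs_add_smult)
    then have vcw: "v = c \<odot> w" using u0 vW by simp
    show ?thesis
    proof (cases "c = 0")
      case True then show ?thesis using vcw vW by simp
    next
      case False
      then have "w = (1 / c) \<odot> v" using vcw vW by (simp add: vs_smult_smult)
      then have "w \<in> W'" using v W' by (auto simp: subspace_def)
      then show ?thesis using w by simp
    qed
  qed
  ultimately show ?thesis
    unfolding separated_def using \<Lambda>(1) by (intro exI[of _ "card ?\<Lambda>"]) (auto intro!: exI[of _ ?\<Lambda>])
qed

text \<open>A proper inclusion at the start of the chain lowers the bound, so the induction applies
  to the chain shifted by one. A single coincidence of neighbours is enough later, because the
  chains come from the powers of one endomorphism.\<close>

lemma descending_chain_stabilizes:
  assumes "separated V (W 0) n" and W: "\<And>i::nat. subspace (W i)" and "\<And>i. W (Suc i) \<subseteq> W i"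
  shows "\<exists>i. W (Suc i) = W i"
  using assms
proof (induction n arbitrary: W rule: less_induct)
  case (less n)
  show ?case
  proof (cases "W (Suc 0) = W 0")
    case False
    then obtain m where "m < n" "separated V (W (Suc 0)) m"
      using separated_drop[OF less.prems(1) less.prems(2)[of 0] less.prems(2)[of "Suc 0"]] less.prems(3)[of 0] by auto
    then have "\<exists>i. W (Suc (Suc i)) = W (Suc i)"
      using less.IH[of m "\<lambda>i. W (Suc i)"] less.prems by auto
    then show ?thesis by auto
  qed auto
qed

text \<open>A nonzero \<open>w\<close> and a form with \<open>l w \<noteq> 0\<close> split
  \<open>W\<close> into the kernel of \<open>l\<close>, which has a smaller bound, and the line
  through \<open>w\<close>. Generators of the kernel together with \<open>w\<close> generate
  \<open>W\<close>.\<close>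

lemma separated_imp_finite_generators:
  assumes "separated V W n" "subspace W"
  shows "\<exists>S. finite S \<and> S \<subseteq> W \<and> (\<forall>N. subspace N \<and> S \<subseteq> N \<longrightarrow> W \<subseteq> N)"
  using assms
proof (induction n arbitrary: W rule: less_induct)
  case (less n)
  obtain \<Lambda> where \<Lambda>: "finite \<Lambda>" "card \<Lambda> \<le> n" "\<And>l. l \<in> \<Lambda> \<Longrightarrow> linear_form V W l"
    "\<And>w. w \<in> W \<Longrightarrow> (\<forall>l\<in>\<Lambda>. l w = 0) \<Longrightarrow> w = \<zero>\<^bsub>V\<^esub>"
    using less.prems(1) unfolding separated_def by auto
  show ?case
  proof (cases "W = {\<zero>\<^bsub>V\<^esub>}")
    case True
    then show ?thesis by (intro exI[of _ "{}"]) (auto simp: subspace_def)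
  next
    case False
    then obtain w where w: "w \<in> W" "w \<noteq> \<zero>\<^bsub>V\<^esub>"
      using less.prems(2) by (auto simp: subspace_def)
    then obtain l where l: "l \<in> \<Lambda>" "l w \<noteq> 0" using \<Lambda>(4) by auto
    define W' where "W' = {v \<in> W. l v = 0}"
    have ll: "linear_form V W l" using \<Lambda>(3) l by auto
    have l00: "l \<zero>\<^bsub>V\<^esub> = 0"
    proof -
      have "w \<in> carrier V" using w less.prems(2) by (auto simp: subspace_def)
      then show ?thesis using ll w vs_smult_zero[of w] unfolding linear_form_def by (metis mult_zero_left)
    qed
    have W': "subspace W'"
      using less.prems(2) ll l00 by (auto simp: W'_def subspace_def linear_form_def)
    moreover have "W' \<subset> W" using w l by (auto simp: W'_def)
    ultimately obtain m where "m < n" "separated V W' m"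
      using separated_drop[OF less.prems(1,2)] by blast
    then obtain S where S: "finite S" "S \<subseteq> W'" "\<And>N. subspace N \<Longrightarrow> S \<subseteq> N \<Longrightarrow> W' \<subseteq> N"
      using less.IH W' by meson
    have "W \<subseteq> N" if N: "subspace N" "insert w S \<subseteq> N" for N
    proof
      fix v assume v: "v \<in> W"
      define c where "c = l v / l w"
      have vc: "v \<in> carrier V" "w \<in> carrier V" using v w less.prems(2) by (auto simp: subspace_def)
      have "v \<oplus>\<^bsub>V\<^esub> (- c) \<odot> w \<in> W'"
        using v w l ll less.prems(2) by (auto simp: W'_def subspace_def linear_form_def c_def)
      then have "v \<oplus>\<^bsub>V\<^esub> (- c) \<odot> w \<in> N" using S(3) N by auto
      moreover have "v = (v \<oplus>\<^bsub>V\<^esub> (- c) \<odot> w) \<oplus>\<^bsub>V\<^esub> c \<odot> w"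
        using vc by (simp add: M.add.m_assoc vs_add_smult)
      ultimately show "v \<in> N" using N by (metis subspace_def insert_subset)
    qed
    then show ?thesis using S w by (intro exI[of _ "insert w S"]) (auto simp: W'_def)
  qed
qed

lemma separated_finitely_generated:
  assumes "separated V (carrier V) n" shows "finitely_generated base_field V"
  using separated_imp_finite_generators[OF assms subspace_carrier]
  unfolding finitely_generated_def subspace_iff_submodule
  by (metis subset_antisym submoduleE(1))

text \<open>Linear combinations grow by one scaled generator at a time, so that properties of a span
  are proved by induction without finite sums of vectors.\<close>

inductive_set vspan :: "'v set \<Rightarrow> 'v set" for T where
  zero: "\<zero>\<^bsub>V\<^esub> \<in> vspan T"
| add: "u \<in> vspan T \<Longrightarrow> t \<in> T \<Longrightarrow> u \<oplus>\<^bsub>V\<^esub> c \<odot> t \<in> vspan T"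

lemma vspan_closed:
  assumes "T \<subseteq> carrier V" "u \<in> vspan T" shows "u \<in> carrier V"
  using assms(2,1) by induction auto

lemma vspan_subspace:
  assumes T: "T \<subseteq> carrier V" shows "subspace (vspan T)"
proof -
  have "u \<oplus>\<^bsub>V\<^esub> v \<in> vspan T" if "v \<in> vspan T" "u \<in> vspan T" for u v
    using that
  proof induction
    case zero then show ?case using vspan_closed[OF T] by simp
  next
    case (add v t c)
    then have "u \<oplus>\<^bsub>V\<^esub> (v \<oplus>\<^bsub>V\<^esub> c \<odot> t) = (u \<oplus>\<^bsub>V\<^esub> v) \<oplus>\<^bsub>V\<^esub> c \<odot> t"
      using vspan_closed[OF T] T by (simp add: M.add.m_assoc subset_iff)
    then show ?case using add vspan.add by simp
  qed
  moreover have "d \<odot> v \<in> vspan T" if "v \<in> vspan T" for d v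
    using that
  proof induction
    case (add v t c)
    then have "d \<odot> (v \<oplus>\<^bsub>V\<^esub> c \<odot> t) = d \<odot> v \<oplus>\<^bsub>V\<^esub> (d * c) \<odot> t"
      using vspan_closed[OF T] T by (simp add: vs_smult_add vs_smult_smult subset_iff)
    then show ?case using add vspan.add by simp
  qed (simp add: vspan.zero)
  ultimately show ?thesis
    using vspan_closed[OF T] vspan.zero by (auto simp: subspace_def)
qed

lemma vspan_mono:
  assumes "T \<subseteq> T'" "u \<in> vspan T" shows "u \<in> vspan T'"
  using assms(2) by induction (use assms(1) in \<open>auto intro: vspan.intros\<close>)

lemma vspan_insert:
  assumes T: "insert t T \<subseteq> carrier V" and u: "u \<in> vspan (insert t T)"
  shows "\<exists>v\<in>vspan T. \<exists>c. u = v \<oplus>\<^bsub>V\<^esub> c \<odot> t"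
  using u
proof induction
  case zero
  then show ?case using T by (intro bexI[OF _ vspan.zero] exI[of _ 0]) auto
next
  case (add u s d)
  then obtain v c where v: "v \<in> vspan T" "u = v \<oplus>\<^bsub>V\<^esub> c \<odot> t" by auto
  have vc: "v \<in> carrier V" "t \<in> carrier V" "s \<in> carrier V" using v add T vspan_closed[of T] by auto
  show ?case
  proof (cases "s = t")
    case True
    then have "u \<oplus>\<^bsub>V\<^esub> d \<odot> s = v \<oplus>\<^bsub>V\<^esub> (c + d) \<odot> t"
      using v vc by (simp add: M.add.m_assoc vs_add_smult)
    then show ?thesis using v by auto
  next
    case False
    then have "v \<oplus>\<^bsub>V\<^esub> d \<odot> s \<in> vspan T" using v add by (auto intro: vspan.add)
    moreover have "u \<oplus>\<^bsub>V\<^esub> d \<odot> s = (v \<oplus>\<^bsub>V\<^esub> d \<odot> s) \<oplus>\<^bsub>V\<^esub> c \<odot> t"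
      using v vc by (simp add: M.add.m_ac)
    ultimately show ?thesis by blast
  qed
qed

text \<open>Induction on the generators. If \<open>t\<close> is new, every vector is uniquely
  \<open>v + c t\<close> with \<open>v\<close> in the old span, so the coordinate \<open>c\<close>
  and the old forms applied to \<open>v\<close> separate.\<close>

lemma separated_vspan:
  assumes "finite T" "T \<subseteq> carrier V" shows "\<exists>n. separated V (vspan T) n"
  using assms
proof induction
  case empty
  have "u \<in> vspan {} \<Longrightarrow> u = \<zero>\<^bsub>V\<^esub>" for u
    by (induction rule: vspan.induct) auto
  then show ?case by (auto simp: separated_def)
next
  case (insert t T)
  then obtain n where n: "separated V (vspan T) n" by auto
  have tT: "t \<in> carrier V" "T \<subseteq> carrier V" using insert by auto
  have sub: "subspace (vspan T)" and sub': "subspace (vspan (insert t T))"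
    using vspan_subspace tT by auto
  show ?case
  proof (cases "t \<in> vspan T")
    case True
    have "vspan (insert t T) = vspan T"
    proof
      show "vspan (insert t T) \<subseteq> vspan T"
      proof
        fix u assume "u \<in> vspan (insert t T)"
        then obtain v c where "v \<in> vspan T" "u = v \<oplus>\<^bsub>V\<^esub> c \<odot> t"
          using vspan_insert[OF insert.prems] by blast
        then show "u \<in> vspan T" using True sub by (simp add: subspace_def)
      qed
    qed (auto intro: vspan_mono[rotated])
    then show ?thesis using n by auto
  next
    case False
    \<comment> \<open>Two different coefficients of \<open>t\<close> would put \<open>t\<close> into
      the old span. Pairs are used so that a single \<open>THE\<close> yields both coordinate
      functions.\<close>
    have dec: "\<exists>!vc. fst vc \<in> vspan T \<and> u = fst vc \<oplus>\<^bsub>V\<^esub> snd vc \<odot> t" if "u \<in> vspan (insert t T)" for u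
    proof (rule ex_ex1I)
      show "\<exists>vc. fst vc \<in> vspan T \<and> u = fst vc \<oplus>\<^bsub>V\<^esub> snd vc \<odot> t"
        using vspan_insert[OF insert.prems that] by auto
      fix x y assume "fst x \<in> vspan T \<and> u = fst x \<oplus>\<^bsub>V\<^esub> snd x \<odot> t"
        and "fst y \<in> vspan T \<and> u = fst y \<oplus>\<^bsub>V\<^esub> snd y \<odot> t"
      moreover obtain v c v' c' where xy: "x = (v, c)" "y = (v', c')" by (metis surj_pair)
      ultimately have v: "v \<in> vspan T" "v' \<in> vspan T" and eq: "v \<oplus>\<^bsub>V\<^esub> c \<odot> t = v' \<oplus>\<^bsub>V\<^esub> c' \<odot> t" by auto
      have vc: "v \<in> carrier V" "v' \<in> carrier V" using v vspan_closed tT by auto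
      have "v' = (v' \<oplus>\<^bsub>V\<^esub> c' \<odot> t) \<oplus>\<^bsub>V\<^esub> (- c') \<odot> t"
        using vc tT by (simp add: M.add.m_assoc vs_add_smult)
      also have "\<dots> = v \<oplus>\<^bsub>V\<^esub> (c - c') \<odot> t"
        using vc tT eq[symmetric] by (simp add: M.add.m_assoc vs_add_smult)
      finally have v': "v' = v \<oplus>\<^bsub>V\<^esub> (c - c') \<odot> t" .
      then have "v' \<oplus>\<^bsub>V\<^esub> (-1) \<odot> v = (v \<oplus>\<^bsub>V\<^esub> (-1) \<odot> v) \<oplus>\<^bsub>V\<^esub> (c - c') \<odot> t"
        using vc tT by (simp add: M.add.m_ac)
      then have e: "(c - c') \<odot> t = v' \<oplus>\<^bsub>V\<^esub> (-1) \<odot> v" using vc tT by (simp add: vs_add_neg)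
      have "c = c'"
      proof (rule ccontr)
        assume c: "c \<noteq> c'"
        have "t = (1 / (c - c')) \<odot> ((c - c') \<odot> t)" using c tT by (simp add: vs_smult_smult)
        also have "\<dots> \<in> vspan T" unfolding e using v sub by (simp add: subspace_def)
        finally show False using False by simp
      qed
      then show "x = y" using xy v' vc tT by simp
    qed
    define d where "d u = (THE vc. fst vc \<in> vspan T \<and> u = fst vc \<oplus>\<^bsub>V\<^esub> snd vc \<odot> t)" for u
    have d: "fst (d u) \<in> vspan T" "u = fst (d u) \<oplus>\<^bsub>V\<^esub> snd (d u) \<odot> t" if "u \<in> vspan (insert t T)" for u
      using theI'[OF dec[OF that]] unfolding d_def by auto
    have d_eq: "d u = (v, c)" if "v \<in> vspan T" "u = v \<oplus>\<^bsub>V\<^esub> c \<odot> t" "u \<in> vspan (insert t T)" for u v c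
      unfolding d_def by (rule the1_equality[OF dec[OF that(3)]]) (use that in auto)
    have d_add: "d (u \<oplus>\<^bsub>V\<^esub> v) = (fst (d u) \<oplus>\<^bsub>V\<^esub> fst (d v), snd (d u) + snd (d v))"
      if "u \<in> vspan (insert t T)" "v \<in> vspan (insert t T)" for u v
    proof (rule d_eq)
      have c: "fst (d u) \<in> carrier V" "fst (d v) \<in> carrier V"
        using d that vspan_closed[OF tT(2)] by auto
      have "u \<oplus>\<^bsub>V\<^esub> v = (fst (d u) \<oplus>\<^bsub>V\<^esub> snd (d u) \<odot> t) \<oplus>\<^bsub>V\<^esub> (fst (d v) \<oplus>\<^bsub>V\<^esub> snd (d v) \<odot> t)"
        using d(2) that by simp
      also have "\<dots> = fst (d u) \<oplus>\<^bsub>V\<^esub> fst (d v) \<oplus>\<^bsub>V\<^esub> (snd (d u) \<odot> t \<oplus>\<^bsub>V\<^esub> snd (d v) \<odot> t)"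
        using c tT by (simp add: M.add.m_ac)
      finally show "u \<oplus>\<^bsub>V\<^esub> v = fst (d u) \<oplus>\<^bsub>V\<^esub> fst (d v) \<oplus>\<^bsub>V\<^esub> (snd (d u) + snd (d v)) \<odot> t"
        using tT by (simp add: vs_add_smult)
    qed (use d that sub sub' in \<open>auto simp: subspace_def\<close>)
    have d_smult: "d (c \<odot> u) = (c \<odot> fst (d u), c * snd (d u))" if "u \<in> vspan (insert t T)" for u c
    proof (rule d_eq)
      have cc: "fst (d u) \<in> carrier V" using d that vspan_closed[OF tT(2)] by auto
      have "c \<odot> u = c \<odot> (fst (d u) \<oplus>\<^bsub>V\<^esub> snd (d u) \<odot> t)"
        using d(2) that by simp
      then show "c \<odot> u = c \<odot> fst (d u) \<oplus>\<^bsub>V\<^esub> (c * snd (d u)) \<odot> t"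
        using cc tT by (simp add: vs_smult_add vs_smult_smult)
    qed (use d that sub sub' in \<open>auto simp: subspace_def\<close>)
    obtain \<Lambda> where \<Lambda>: "finite \<Lambda>" "card \<Lambda> \<le> n" "\<And>l. l \<in> \<Lambda> \<Longrightarrow> linear_form V (vspan T) l"
      "\<And>w. w \<in> vspan T \<Longrightarrow> (\<forall>l\<in>\<Lambda>. l w = 0) \<Longrightarrow> w = \<zero>\<^bsub>V\<^esub>"
      using n unfolding separated_def by auto
    let ?\<Lambda> = "insert (\<lambda>u. snd (d u)) ((\<lambda>l u. l (fst (d u))) ` \<Lambda>)"
    have "\<forall>l\<in>?\<Lambda>. linear_form V (vspan (insert t T)) l"
      using d d_add d_smult \<Lambda>(3) by (auto simp: linear_form_def)
    moreover have "w = \<zero>\<^bsub>V\<^esub>" if "w \<in> vspan (insert t T)" "\<forall>l\<in>?\<Lambda>. l w = 0" for w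
      using that d[OF that(1)] \<Lambda>(4)[of "fst (d w)"] tT by auto
    ultimately show ?thesis
      unfolding separated_def using \<Lambda>(1)
      by (intro exI[of _ "card ?\<Lambda>"] exI[of _ ?\<Lambda>]) auto
  qed
qed

end

section \<open>Linear categories\<close>

lemma vspaceI: "Module.module base_field V \<Longrightarrow> vspace V"
  by (simp add: vspace_def)

text \<open>Repackages one endomorphism space as a ring record, so that powers, Fitting's lemma and
  the geometric series can be taken from ring theory.\<close>

definition endo_ring :: "('k, 'o, 'h) lincat \<Rightarrow> 'o \<Rightarrow> 'h ring" where
  "endo_ring K x = \<lparr>carrier = Mor K x x, monoid.mult = Comp K x x x, monoid.one = Id K x,
     ring.zero = \<zero>\<^bsub>Hom K x x\<^esub>, add = add (Hom K x x)\<rparr>"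

lemma endo_ring_simps [simp]:
  "carrier (endo_ring K x) = Mor K x x" "\<one>\<^bsub>endo_ring K x\<^esub> = Id K x"
  "f \<otimes>\<^bsub>endo_ring K x\<^esub> g = Comp K x x x f g" "\<zero>\<^bsub>endo_ring K x\<^esub> = \<zero>\<^bsub>Hom K x x\<^esub>"
  "f \<oplus>\<^bsub>endo_ring K x\<^esub> g = f \<oplus>\<^bsub>Hom K x x\<^esub> g"
  by (simp_all add: endo_ring_def)

text \<open>The morphisms \<open>x \<rightarrow> y\<close> that factor through a finite direct sum of objects in \<open>S\<close>, written
  without direct sums.\<close>

inductive_set factoring :: "('k, 'o, 'h) lincat \<Rightarrow> 'o set \<Rightarrow> 'o \<Rightarrow> 'o \<Rightarrow> 'h set" for K S x y where
  zero: "\<zero>\<^bsub>Hom K x y\<^esub> \<in> factoring K S x y"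
| add: "f \<in> factoring K S x y \<Longrightarrow> g \<in> S \<Longrightarrow> s \<in> Mor K x g \<Longrightarrow> r \<in> Mor K g y \<Longrightarrow>
    f \<oplus>\<^bsub>Hom K x y\<^esub> Comp K x g y r s \<in> factoring K S x y"

definition biproduct :: "('k, 'o, 'h) lincat \<Rightarrow> 'o \<Rightarrow> 'o \<Rightarrow> 'o \<Rightarrow> 'h \<Rightarrow> 'h \<Rightarrow> 'h \<Rightarrow> 'h \<Rightarrow> bool" where
  "biproduct K x y s i j p q \<longleftrightarrow> x \<in> Obj K \<and> y \<in> Obj K \<and> s \<in> Obj K \<and>
     i \<in> Mor K x s \<and> j \<in> Mor K y s \<and> p \<in> Mor K s x \<and> q \<in> Mor K s y \<and>
     Comp K x s x p i = Id K x \<and> Comp K y s y q j = Id K y \<and>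
     Comp K y s x p j = \<zero>\<^bsub>Hom K y x\<^esub> \<and> Comp K x s y q i = \<zero>\<^bsub>Hom K x y\<^esub> \<and>
     Comp K s x s i p \<oplus>\<^bsub>Hom K s s\<^esub> Comp K s y s j q = Id K s"

definition has_biproducts :: "('k, 'o, 'h) lincat \<Rightarrow> bool" where
  "has_biproducts K \<longleftrightarrow> (\<exists>z\<in>Obj K. Id K z = \<zero>\<^bsub>Hom K z z\<^esub>) \<and>
     (\<forall>x\<in>Obj K. \<forall>y\<in>Obj K. \<exists>s i j p q. biproduct K x y s i j p q)"

text \<open>Locality is expressed as nilpotent-or-invertible, because Fitting's lemma delivers it in
  this form and the exchange argument in \<open>local_summand\<close> consumes it in this form. Zero
  objects qualify, with exponent 0.\<close>

definition local_object :: "('k, 'o, 'h) lincat \<Rightarrow> 'o \<Rightarrow> bool" where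
  "local_object K x \<longleftrightarrow> x \<in> Obj K \<and> (\<forall>f\<in>Mor K x x.
     (\<exists>n::nat. f [^]\<^bsub>endo_ring K x\<^esub> n = \<zero>\<^bsub>Hom K x x\<^esub>) \<or>
     (\<exists>h\<in>Mor K x x. Comp K x x x f h = Id K x \<and> Comp K x x x h f = Id K x))"

section \<open>Sums of factorings and the additive closure\<close>

context linear_category
begin

lemma Hom_vspace: "a \<in> Obj K \<Longrightarrow> b \<in> Obj K \<Longrightarrow> vspace (Hom K a b)"
  using Hom_module by (rule vspaceI)

lemma Hom_closed [simp]:
  assumes "a \<in> Obj K" "b \<in> Obj K"
  shows "\<zero>\<^bsub>Hom K a b\<^esub> \<in> Mor K a b"
    "f \<in> Mor K a b \<Longrightarrow> g \<in> Mor K a b \<Longrightarrow> f \<oplus>\<^bsub>Hom K a b\<^esub> g \<in> Mor K a b"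
    "f \<in> Mor K a b \<Longrightarrow> c \<odot>\<^bsub>Hom K a b\<^esub> f \<in> Mor K a b"
proof -
  interpret vspace "Hom K a b" using assms by (rule Hom_vspace)
  show "\<zero>\<^bsub>Hom K a b\<^esub> \<in> Mor K a b"
    "f \<in> Mor K a b \<Longrightarrow> g \<in> Mor K a b \<Longrightarrow> f \<oplus>\<^bsub>Hom K a b\<^esub> g \<in> Mor K a b"
    "f \<in> Mor K a b \<Longrightarrow> c \<odot>\<^bsub>Hom K a b\<^esub> f \<in> Mor K a b" by auto
qed

lemma Hom_zero [simp]:
  assumes "a \<in> Obj K" "b \<in> Obj K" "f \<in> Mor K a b"
  shows "f \<oplus>\<^bsub>Hom K a b\<^esub> \<zero>\<^bsub>Hom K a b\<^esub> = f" "\<zero>\<^bsub>Hom K a b\<^esub> \<oplus>\<^bsub>Hom K a b\<^esub> f = f"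
proof -
  interpret vspace "Hom K a b" using assms by (intro Hom_vspace)
  show "f \<oplus>\<^bsub>Hom K a b\<^esub> \<zero>\<^bsub>Hom K a b\<^esub> = f" "\<zero>\<^bsub>Hom K a b\<^esub> \<oplus>\<^bsub>Hom K a b\<^esub> f = f"
    using assms by auto
qed

lemma Hom_assoc:
  assumes "a \<in> Obj K" "b \<in> Obj K" "f \<in> Mor K a b" "g \<in> Mor K a b" "h \<in> Mor K a b"
  shows "(f \<oplus>\<^bsub>Hom K a b\<^esub> g) \<oplus>\<^bsub>Hom K a b\<^esub> h = f \<oplus>\<^bsub>Hom K a b\<^esub> (g \<oplus>\<^bsub>Hom K a b\<^esub> h)"
proof -
  interpret vspace "Hom K a b" using assms by (intro Hom_vspace)
  show ?thesis using assms by (simp add: M.add.m_assoc)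
qed

lemma Hom_commute:
  assumes "a \<in> Obj K" "b \<in> Obj K" "f \<in> Mor K a b" "g \<in> Mor K a b"
  shows "f \<oplus>\<^bsub>Hom K a b\<^esub> g = g \<oplus>\<^bsub>Hom K a b\<^esub> f"
proof -
  interpret vspace "Hom K a b" using assms by (intro Hom_vspace)
  show ?thesis using assms by (simp add: M.add.m_comm)
qed

lemma Hom_neg:
  assumes "a \<in> Obj K" "b \<in> Obj K" "f \<in> Mor K a b"
  shows "f \<oplus>\<^bsub>Hom K a b\<^esub> (-1) \<odot>\<^bsub>Hom K a b\<^esub> f = \<zero>\<^bsub>Hom K a b\<^esub>"
proof -
  interpret vspace "Hom K a b" using assms by (intro Hom_vspace)
  show ?thesis using assms by (simp add: vs_add_neg)
qed

lemma Hom_smult_one [simp]: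
  assumes "a \<in> Obj K" "b \<in> Obj K" "f \<in> Mor K a b"
  shows "1 \<odot>\<^bsub>Hom K a b\<^esub> f = f" "0 \<odot>\<^bsub>Hom K a b\<^esub> f = \<zero>\<^bsub>Hom K a b\<^esub>"
proof -
  interpret vspace "Hom K a b" using assms by (intro Hom_vspace)
  show "1 \<odot>\<^bsub>Hom K a b\<^esub> f = f" "0 \<odot>\<^bsub>Hom K a b\<^esub> f = \<zero>\<^bsub>Hom K a b\<^esub>" using assms by auto
qed

declare Id_closed [simp] Comp_closed [simp] Comp_Id_left [simp] Comp_Id_right [simp]

lemma Comp_add_left:
  assumes "a \<in> Obj K" "b \<in> Obj K" "c \<in> Obj K" "f \<in> Mor K a b" "g \<in> Mor K b c" "g' \<in> Mor K b c"
  shows "Comp K a b c (g \<oplus>\<^bsub>Hom K b c\<^esub> g') f = Comp K a b c g f \<oplus>\<^bsub>Hom K a c\<^esub> Comp K a b c g' f"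
  using Comp_bilinear[OF assms(1-3)] assms by (simp add: bilinear_map_def)

lemma Comp_add_right:
  assumes "a \<in> Obj K" "b \<in> Obj K" "c \<in> Obj K" "f \<in> Mor K a b" "f' \<in> Mor K a b" "g \<in> Mor K b c"
  shows "Comp K a b c g (f \<oplus>\<^bsub>Hom K a b\<^esub> f') = Comp K a b c g f \<oplus>\<^bsub>Hom K a c\<^esub> Comp K a b c g f'"
  using Comp_bilinear[OF assms(1-3)] assms by (simp add: bilinear_map_def)

lemma Comp_smult:
  assumes "a \<in> Obj K" "b \<in> Obj K" "c \<in> Obj K" "f \<in> Mor K a b" "g \<in> Mor K b c"
  shows "Comp K a b c (k \<odot>\<^bsub>Hom K b c\<^esub> g) f = k \<odot>\<^bsub>Hom K a c\<^esub> Comp K a b c g f"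
    "Comp K a b c g (k \<odot>\<^bsub>Hom K a b\<^esub> f) = k \<odot>\<^bsub>Hom K a c\<^esub> Comp K a b c g f"
  using Comp_bilinear[OF assms(1-3)] assms by (simp_all add: bilinear_map_def)

lemma Comp_zero_left [simp]:
  assumes "a \<in> Obj K" "b \<in> Obj K" "c \<in> Obj K" "f \<in> Mor K a b"
  shows "Comp K a b c \<zero>\<^bsub>Hom K b c\<^esub> f = \<zero>\<^bsub>Hom K a c\<^esub>"
proof -
  have "Comp K a b c (0 \<odot>\<^bsub>Hom K b c\<^esub> \<zero>\<^bsub>Hom K b c\<^esub>) f = \<zero>\<^bsub>Hom K a c\<^esub>"
    using assms by (subst Comp_smult) auto
  then show ?thesis using assms by simp
qed

lemma Comp_zero_right [simp]:
  assumes "a \<in> Obj K" "b \<in> Obj K" "c \<in> Obj K" "g \<in> Mor K b c"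
  shows "Comp K a b c g \<zero>\<^bsub>Hom K a b\<^esub> = \<zero>\<^bsub>Hom K a c\<^esub>"
proof -
  have "Comp K a b c g (0 \<odot>\<^bsub>Hom K a b\<^esub> \<zero>\<^bsub>Hom K a b\<^esub>) = \<zero>\<^bsub>Hom K a c\<^esub>"
    using assms by (subst Comp_smult) auto
  then show ?thesis using assms by simp
qed

lemma ring_endo:
  assumes x: "x \<in> Obj K" shows "ring (endo_ring K x)"
proof (rule ringI)
  interpret vspace "Hom K x x" using x by (intro Hom_vspace)
  show "abelian_group (endo_ring K x)"
  proof (rule abelian_groupI)
    fix f assume "f \<in> carrier (endo_ring K x)"
    then show "\<exists>g\<in>carrier (endo_ring K x). g \<oplus>\<^bsub>endo_ring K x\<^esub> f = \<zero>\<^bsub>endo_ring K x\<^esub>"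
      by (intro bexI[of _ "\<ominus>\<^bsub>Hom K x x\<^esub> f"]) (auto simp: M.l_neg)
  qed (auto simp: M.add.m_ac)
  show "monoid (endo_ring K x)"
    by (rule monoidI) (use x in \<open>auto simp: Comp_assoc\<close>)
qed (use x in \<open>auto simp: Comp_add_left Comp_add_right\<close>)

lemma factoring_closed:
  assumes "x \<in> Obj K" "y \<in> Obj K" "S \<subseteq> Obj K" "f \<in> factoring K S x y"
  shows "f \<in> Mor K x y"
  using assms(4) by induction (use assms in auto)

lemma factoring_add:
  assumes "x \<in> Obj K" "y \<in> Obj K" "S \<subseteq> Obj K" "f' \<in> factoring K S x y" "f \<in> factoring K S x y"
  shows "f \<oplus>\<^bsub>Hom K x y\<^esub> f' \<in> factoring K S x y"
  using assms(4)
proof induction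
  case zero
  then show ?case using assms factoring_closed by simp
next
  case (add f' g s r)
  then have "g \<in> Obj K" "f' \<in> Mor K x y" "f \<in> Mor K x y" using assms factoring_closed by auto
  then have "f \<oplus>\<^bsub>Hom K x y\<^esub> (f' \<oplus>\<^bsub>Hom K x y\<^esub> Comp K x g y r s)
     = (f \<oplus>\<^bsub>Hom K x y\<^esub> f') \<oplus>\<^bsub>Hom K x y\<^esub> Comp K x g y r s"
    using assms add by (simp add: Hom_assoc)
  then show ?case using add factoring.add by metis
qed

lemma factoring_single:
  assumes "x \<in> Obj K" "y \<in> Obj K" "g \<in> Obj K" "g \<in> S" "s \<in> Mor K x g" "r \<in> Mor K g y"
  shows "Comp K x g y r s \<in> factoring K S x y"
  using factoring.add[OF factoring.zero assms(4-6)] assms by simp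

lemma factoring_Id:
  assumes "x \<in> S" "x \<in> Obj K" shows "Id K x \<in> factoring K S x x"
  using factoring_single[of x x x S "Id K x" "Id K x"] assms by simp

lemma factoring_mono:
  assumes "f \<in> factoring K S x y" "S \<subseteq> S'" shows "f \<in> factoring K S' x y"
  using assms(1) by induction (use assms(2) in \<open>auto intro: factoring.intros\<close>)

lemma factoring_comp_left:
  assumes "x \<in> Obj K" "y \<in> Obj K" "z \<in> Obj K" "S \<subseteq> Obj K" "f \<in> factoring K S x y" "h \<in> Mor K y z"
  shows "Comp K x y z h f \<in> factoring K S x z"
  using assms(5)
proof induction
  case zero
  then show ?case using assms by (simp add: factoring.zero)
next
  case (add f g s r)
  then have "g \<in> Obj K" "f \<in> Mor K x y" using assms factoring_closed by auto
  then have "Comp K x y z h (f \<oplus>\<^bsub>Hom K x y\<^esub> Comp K x g y r s)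
     = Comp K x y z h f \<oplus>\<^bsub>Hom K x z\<^esub> Comp K x g z (Comp K g y z h r) s"
    using assms add by (simp add: Comp_add_right Comp_assoc)
  moreover have "Comp K g y z h r \<in> Mor K g z" using add assms \<open>g \<in> Obj K\<close> by simp
  ultimately show ?case using add factoring.add by metis
qed

lemma factoring_comp_right:
  assumes "x \<in> Obj K" "y \<in> Obj K" "z \<in> Obj K" "S \<subseteq> Obj K" "f \<in> factoring K S y z" "h \<in> Mor K x y"
  shows "Comp K x y z f h \<in> factoring K S x z"
  using assms(5)
proof induction
  case zero
  then show ?case using assms by (simp add: factoring.zero)
next
  case (add f g s r)
  then have "g \<in> Obj K" "f \<in> Mor K y z" using assms factoring_closed by auto
  then have "Comp K x y z (f \<oplus>\<^bsub>Hom K y z\<^esub> Comp K y g z r s) h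
     = Comp K x y z f h \<oplus>\<^bsub>Hom K x z\<^esub> Comp K x g z r (Comp K x y g s h)"
    using assms add by (simp add: Comp_add_left Comp_assoc)
  moreover have "Comp K x y g s h \<in> Mor K x g" using add assms \<open>g \<in> Obj K\<close> by simp
  ultimately show ?case using add factoring.add by metis
qed

text \<open>Each summand \<open>r s\<close> through \<open>g\<close> is rewritten as
  \<open>r Id s\<close>, and the identity of \<open>g\<close> is replaced by its own sum of
  factorings through \<open>S\<close>.\<close>

lemma factoring_trans:
  assumes "x \<in> Obj K" "y \<in> Obj K" "S \<subseteq> Obj K" "S' \<subseteq> Obj K" "f \<in> factoring K S' x y"
    and S': "\<And>g. g \<in> S' \<Longrightarrow> Id K g \<in> factoring K S g g"
  shows "f \<in> factoring K S x y"
  using assms(5)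
proof induction
  case zero
  then show ?case by (rule factoring.zero)
next
  case (add f g s r)
  have g: "g \<in> Obj K" using add assms by auto
  have "Comp K x g y (Comp K g g y r (Id K g)) s \<in> factoring K S x y"
    using add assms g S'[of g] by (intro factoring_comp_right[of x g y] factoring_comp_left[of g g y]) auto
  then have "Comp K x g y r s \<in> factoring K S x y" using add assms g by simp
  then show ?case using add assms by (intro factoring_add) auto
qed

lemma factoring_iso:
  assumes "isomorphic K x g" "g \<in> S" shows "Id K x \<in> factoring K S x x"
  using assms unfolding isomorphic_def by (metis factoring_single)

lemma zero_object_iff:
  assumes "x \<in> Obj K" shows "zero_object K x \<longleftrightarrow> Id K x = \<zero>\<^bsub>Hom K x x\<^esub>"
proof
  assume "zero_object K x"
  then have "\<exists>!f. f \<in> Mor K x x" using assms by (auto simp: zero_object_def)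
  then show "Id K x = \<zero>\<^bsub>Hom K x x\<^esub>" using assms by (metis Hom_closed(1) Id_closed)
next
  assume z: "Id K x = \<zero>\<^bsub>Hom K x x\<^esub>"
  have "f = \<zero>\<^bsub>Hom K x b\<^esub>" if "b \<in> Obj K" "f \<in> Mor K x b" for b f
    using Comp_Id_right[of x b f] Comp_zero_right[of x x b f] that assms z by simp
  moreover have "f = \<zero>\<^bsub>Hom K b x\<^esub>" if "b \<in> Obj K" "f \<in> Mor K b x" for b f
    using Comp_Id_left[of b x f] Comp_zero_left[of b x x f] that assms z by simp
  ultimately show "zero_object K x" unfolding zero_object_def using assms by (metis Hom_closed(1))
qed

lemma isomorphic_sym: "isomorphic K x y \<Longrightarrow> isomorphic K y x"
  unfolding isomorphic_def by blast

lemma isomorphic_trans: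
  assumes "isomorphic K x y" "isomorphic K y z" shows "isomorphic K x z"
proof -
  obtain f g where f: "f \<in> Mor K x y" "g \<in> Mor K y x" "Comp K x y x g f = Id K x" "Comp K y x y f g = Id K y"
    and xy: "x \<in> Obj K" "y \<in> Obj K"
    using assms(1) by (auto simp: isomorphic_def)
  obtain f' g' where f': "f' \<in> Mor K y z" "g' \<in> Mor K z y" "Comp K y z y g' f' = Id K y"
      "Comp K z y z f' g' = Id K z" and z: "z \<in> Obj K"
    using assms(2) by (auto simp: isomorphic_def)
  have "Comp K x z x (Comp K z y x g g') (Comp K x y z f' f) = Comp K x y x (Comp K y y x g (Comp K y z y g' f')) f"
    using f(1,2) f'(1,2) xy z by (simp add: Comp_assoc)
  moreover have "Comp K z x z (Comp K x y z f' f) (Comp K z y x g g') = Comp K z y z (Comp K y y z f' (Comp K y x y f g)) g'"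
    using f(1,2) f'(1,2) xy z by (simp add: Comp_assoc)
  ultimately show ?thesis unfolding isomorphic_def
    using f f' xy z by (intro conjI bexI[of _ "Comp K x y z f' f"] bexI[of _ "Comp K z y x g g'"]) auto
qed

text \<open>Passes from families indexed by \<open>0\<close> and \<open>1\<close> to four named
  morphisms, the form in which two-term sums are used from here on.\<close>

lemma direct_sum_pair_iff:
  "direct_sum K x [y, z] \<longleftrightarrow> (\<exists>i j p q. biproduct K y z x i j p q)"
proof
  assume "direct_sum K x [y, z]"
  then obtain \<iota> \<pi> where x: "x \<in> Obj K" "set [y, z] \<subseteq> Obj K"
    and 1: "\<forall>i<length [y, z]. \<iota> i \<in> Mor K ([y, z] ! i) x \<and> \<pi> i \<in> Mor K x ([y, z] ! i)"
    and 2: "\<forall>i<length [y, z]. \<forall>j<length [y, z]. Comp K ([y, z] ! i) x ([y, z] ! j) (\<pi> j) (\<iota> i) =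
         (if i = j then Id K ([y, z] ! i) else \<zero>\<^bsub>Hom K ([y, z] ! i) ([y, z] ! j)\<^esub>)"
    and 3: "(\<Oplus>\<^bsub>Hom K x x\<^esub> i\<in>{..<length [y, z]}. Comp K x ([y, z] ! i) x (\<iota> i) (\<pi> i)) = Id K x"
    unfolding direct_sum_def by blast
  have x: "x \<in> Obj K" "y \<in> Obj K" "z \<in> Obj K" using x by auto
  interpret vspace "Hom K x x" using x by (intro Hom_vspace)
  have m: "\<iota> 0 \<in> Mor K y x" "\<iota> 1 \<in> Mor K z x" "\<pi> 0 \<in> Mor K x y" "\<pi> 1 \<in> Mor K x z"
    using 1[rule_format, of 0] 1[rule_format, of 1] by auto
  have "{..<length [y, z]} = {0, 1}" by auto
  then have "Comp K x y x (\<iota> 0) (\<pi> 0) \<oplus>\<^bsub>Hom K x x\<^esub> Comp K x z x (\<iota> 1) (\<pi> 1) = Id K x"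
    using 3 m x by (simp add: M.finsum_insert)
  then have "biproduct K y z x (\<iota> 0) (\<iota> 1) (\<pi> 0) (\<pi> 1)"
    unfolding biproduct_def using x m 2[rule_format, of 0 0] 2[rule_format, of 1 1] 2[rule_format, of 0 1] 2[rule_format, of 1 0] by simp
  then show "\<exists>i j p q. biproduct K y z x i j p q" by blast
next
  assume "\<exists>i j p q. biproduct K y z x i j p q"
  then obtain i j p q where b: "biproduct K y z x i j p q" by blast
  have x: "x \<in> Obj K" "y \<in> Obj K" "z \<in> Obj K" using b by (auto simp: biproduct_def)
  interpret vspace "Hom K x x" using x by (intro Hom_vspace)
  let ?\<iota> = "\<lambda>n::nat. if n = 0 then i else j" and ?\<pi> = "\<lambda>n::nat. if n = 0 then p else q"
  have s: "{..<Suc (Suc 0)} = {0, 1}" by auto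
  have "\<forall>n<length [y, z]. ?\<iota> n \<in> Mor K ([y, z] ! n) x \<and> ?\<pi> n \<in> Mor K x ([y, z] ! n)"
    using b by (auto simp: biproduct_def less_Suc_eq)
  moreover have "\<forall>n<length [y, z]. \<forall>m<length [y, z]. Comp K ([y, z] ! n) x ([y, z] ! m) (?\<pi> m) (?\<iota> n) =
         (if n = m then Id K ([y, z] ! n) else \<zero>\<^bsub>Hom K ([y, z] ! n) ([y, z] ! m)\<^esub>)"
    using b by (auto simp: biproduct_def less_Suc_eq)
  moreover have "(\<Oplus>\<^bsub>Hom K x x\<^esub> n\<in>{..<length [y, z]}. Comp K x ([y, z] ! n) x (?\<iota> n) (?\<pi> n)) = Id K x"
    using b x by (simp add: biproduct_def s M.finsum_insert)
  ultimately show "direct_sum K x [y, z]"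
    unfolding direct_sum_def using x by (intro conjI exI[of _ ?\<iota>] exI[of _ ?\<pi>]) auto
qed

lemma Comp_finsum:
  assumes "finite I" "s \<in> Obj K" "t \<in> Obj K" "i \<in> Mor K s t" "p \<in> Mor K t s"
    and "\<And>k. k \<in> I \<Longrightarrow> F k \<in> Mor K s s"
  shows "Comp K t s t i (Comp K t s s (\<Oplus>\<^bsub>Hom K s s\<^esub> k\<in>I. F k) p)
    = (\<Oplus>\<^bsub>Hom K t t\<^esub> k\<in>I. Comp K t s t i (Comp K t s s (F k) p))"
proof -
  interpret s: vspace "Hom K s s" using assms by (intro Hom_vspace)
  interpret t: vspace "Hom K t t" using assms by (intro Hom_vspace)
  show ?thesis using assms(1,6)
  proof induction
    case empty
    then show ?case using assms by simp
  next
    case (insert k I)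
    have F: "F \<in> I \<rightarrow> Mor K s s" using insert by auto
    have "(\<lambda>k. Comp K t s t i (Comp K t s s (F k) p)) \<in> I \<rightarrow> Mor K t t" using insert assms by auto
    then show ?case using insert assms F s.M.finsum_closed[OF F]
      by (simp add: s.M.finsum_insert t.M.finsum_insert Comp_add_left Comp_add_right)
  qed
qed

text \<open>The injections and projections of the old list are composed with those of the old sum
  inside the biproduct, and index \<open>length ys\<close> receives the new ones.\<close>

lemma direct_sum_snoc:
  assumes s: "direct_sum K s ys" and b: "biproduct K s g t i j p q"
  shows "direct_sum K t (ys @ [g])"
proof -
  define n where "n = length ys"
  obtain \<iota> \<pi> where ys: "s \<in> Obj K" "set ys \<subseteq> Obj K"
    and 11: "\<forall>i<n. \<iota> i \<in> Mor K (ys ! i) s \<and> \<pi> i \<in> Mor K s (ys ! i)"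
    and 22: "\<forall>i<n. \<forall>j<n. Comp K (ys ! i) s (ys ! j) (\<pi> j) (\<iota> i) =
         (if i = j then Id K (ys ! i) else \<zero>\<^bsub>Hom K (ys ! i) (ys ! j)\<^esub>)"
    and 3: "(\<Oplus>\<^bsub>Hom K s s\<^esub> i\<in>{..<n}. Comp K s (ys ! i) s (\<iota> i) (\<pi> i)) = Id K s"
    using s unfolding direct_sum_def n_def by blast
  note 1 = 11[rule_format] and 2 = 22[rule_format]
  have ysO: "ys ! k \<in> Obj K" if "k < n" for k using ys that by (auto simp: n_def)
  have bp: "g \<in> Obj K" "t \<in> Obj K" "i \<in> Mor K s t" "j \<in> Mor K g t" "p \<in> Mor K t s" "q \<in> Mor K t g"
    "Comp K s t s p i = Id K s" "Comp K g t g q j = Id K g" "Comp K g t s p j = \<zero>\<^bsub>Hom K g s\<^esub>"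
    "Comp K s t g q i = \<zero>\<^bsub>Hom K s g\<^esub>" "Comp K t s t i p \<oplus>\<^bsub>Hom K t t\<^esub> Comp K t g t j q = Id K t"
    using b by (auto simp: biproduct_def)
  interpret t: vspace "Hom K t t" using bp by (intro Hom_vspace)
  define \<iota>' where "\<iota>' k = (if k < n then Comp K (ys ! k) s t i (\<iota> k) else j)" for k
  define \<pi>' where "\<pi>' k = (if k < n then Comp K t s (ys ! k) (\<pi> k) p else q)" for k
  have len: "length (ys @ [g]) = Suc n" by (simp add: n_def)
  have nth: "(ys @ [g]) ! k = (if k < n then ys ! k else g)" if "k < Suc n" for k
    using that by (auto simp: nth_append n_def)
  have "\<iota>' k \<in> Mor K ((ys @ [g]) ! k) t \<and> \<pi>' k \<in> Mor K t ((ys @ [g]) ! k)" if "k < Suc n" for k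
    using that 1 ysO ys bp by (simp add: nth \<iota>'_def \<pi>'_def)
  moreover have "Comp K ((ys @ [g]) ! k) t ((ys @ [g]) ! l) (\<pi>' l) (\<iota>' k) =
      (if k = l then Id K ((ys @ [g]) ! k) else \<zero>\<^bsub>Hom K ((ys @ [g]) ! k) ((ys @ [g]) ! l)\<^esub>)"
    if kl: "k < Suc n" "l < Suc n" for k l
  proof -
    have a: "Comp K (ys ! k) t (ys ! l) (Comp K t s (ys ! l) (\<pi> l) p) (Comp K (ys ! k) s t i (\<iota> k))
        = Comp K (ys ! k) s (ys ! l) (\<pi> l) (\<iota> k)" if "k < n" "l < n"
    proof -
      have "Comp K (ys ! k) t (ys ! l) (Comp K t s (ys ! l) (\<pi> l) p) (Comp K (ys ! k) s t i (\<iota> k))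
        = Comp K (ys ! k) s (ys ! l) (Comp K s s (ys ! l) (\<pi> l) (Comp K s t s p i)) (\<iota> k)"
        using that 1 ysO ys bp(1-6) by (simp add: Comp_assoc)
      then show ?thesis using that 1 ysO ys bp by simp
    qed
    have b: "Comp K g t (ys ! l) (Comp K t s (ys ! l) (\<pi> l) p) j = \<zero>\<^bsub>Hom K g (ys ! l)\<^esub>" if "l < n"
    proof -
      have "Comp K g t (ys ! l) (Comp K t s (ys ! l) (\<pi> l) p) j = Comp K g s (ys ! l) (\<pi> l) (Comp K g t s p j)"
        using that 1 ysO ys bp(1-6) by (simp add: Comp_assoc)
      then show ?thesis using that 1 ysO ys bp by simp
    qed
    have c: "Comp K (ys ! k) t g q (Comp K (ys ! k) s t i (\<iota> k)) = \<zero>\<^bsub>Hom K (ys ! k) g\<^esub>" if "k < n"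
    proof -
      have "Comp K (ys ! k) t g q (Comp K (ys ! k) s t i (\<iota> k)) = Comp K (ys ! k) s g (Comp K s t g q i) (\<iota> k)"
        using that 1 ysO ys bp(1-6) by (simp add: Comp_assoc)
      then show ?thesis using that 1 ysO ys bp by simp
    qed
    show ?thesis
      using a b c 2 kl bp(8) by (auto simp: nth \<iota>'_def \<pi>'_def)
  qed
  moreover have "(\<Oplus>\<^bsub>Hom K t t\<^esub> k\<in>{..<Suc n}. Comp K t ((ys @ [g]) ! k) t (\<iota>' k) (\<pi>' k)) = Id K t"
  proof -
    have cl: "Comp K t (ys ! k) t (Comp K (ys ! k) s t i (\<iota> k)) (Comp K t s (ys ! k) (\<pi> k) p) \<in> Mor K t t" if "k < n" for k
      using that 1 ysO ys bp by simp
    have "(\<Oplus>\<^bsub>Hom K t t\<^esub> k\<in>{..<Suc n}. Comp K t ((ys @ [g]) ! k) t (\<iota>' k) (\<pi>' k))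
      = Comp K t g t j q \<oplus>\<^bsub>Hom K t t\<^esub> (\<Oplus>\<^bsub>Hom K t t\<^esub> k\<in>{..<n}. Comp K t ((ys @ [g]) ! k) t (\<iota>' k) (\<pi>' k))"
      unfolding lessThan_Suc using bp cl by (subst t.M.finsum_insert) (auto simp: nth \<iota>'_def \<pi>'_def)
    also have "(\<Oplus>\<^bsub>Hom K t t\<^esub> k\<in>{..<n}. Comp K t ((ys @ [g]) ! k) t (\<iota>' k) (\<pi>' k))
      = (\<Oplus>\<^bsub>Hom K t t\<^esub> k\<in>{..<n}. Comp K t s t i (Comp K t s s (Comp K s (ys ! k) s (\<iota> k) (\<pi> k)) p))"
      using 1 ysO ys bp by (intro t.M.finsum_cong') (auto simp: nth \<iota>'_def \<pi>'_def Comp_assoc)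
    also have "\<dots> = Comp K t s t i p"
      using 1 ysO ys bp 3 by (subst Comp_finsum[symmetric]) auto
    finally show ?thesis using bp ys by (simp add: Hom_commute)
  qed
  ultimately show ?thesis unfolding direct_sum_def len
    using bp ys by (intro conjI exI[of _ \<iota>'] exI[of _ \<pi>']) auto
qed

text \<open>Each new summand enlarges the intermediate object by one biproduct. The zero morphism
  factors through a zero object, which is the direct sum of the empty list.\<close>

lemma factoring_through_direct_sum:
  assumes "has_biproducts K" "x \<in> Obj K" "y \<in> Obj K" "S \<subseteq> Obj K" "f \<in> factoring K S x y"
  shows "\<exists>ys t u v. set ys \<subseteq> S \<and> direct_sum K t ys \<and> u \<in> Mor K x t \<and> v \<in> Mor K t y \<and> f = Comp K x t y v u"
  using assms(5)
proof induction
  case zero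
  obtain z where z: "z \<in> Obj K" "Id K z = \<zero>\<^bsub>Hom K z z\<^esub>" using assms(1) by (auto simp: has_biproducts_def)
  interpret vspace "Hom K z z" using z by (intro Hom_vspace)
  have "direct_sum K z []" using z by (simp add: direct_sum_def)
  then show ?case using z assms
    by (intro exI[of _ "[]"] exI[of _ z] exI[of _ "\<zero>\<^bsub>Hom K x z\<^esub>"] exI[of _ "\<zero>\<^bsub>Hom K z y\<^esub>"]) auto
next
  case (add f g s r)
  then obtain ys t u v where IH: "set ys \<subseteq> S" "direct_sum K t ys" "u \<in> Mor K x t" "v \<in> Mor K t y"
    "f = Comp K x t y v u" by blast
  have t: "t \<in> Obj K" "g \<in> Obj K" using IH(2) add assms by (auto simp: direct_sum_def)
  then obtain t' i j p q where b: "biproduct K t g t' i j p q"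
    using assms(1) unfolding has_biproducts_def by blast
  then have bp: "t' \<in> Obj K" "i \<in> Mor K t t'" "j \<in> Mor K g t'" "p \<in> Mor K t' t" "q \<in> Mor K t' g"
    "Comp K t t' t p i = Id K t" "Comp K g t' g q j = Id K g" "Comp K g t' t p j = \<zero>\<^bsub>Hom K g t\<^esub>"
    "Comp K t t' g q i = \<zero>\<^bsub>Hom K t g\<^esub>"
    by (auto simp: biproduct_def)
  \<comment> \<open>The column \<open>(u, s)\<close> and the row \<open>(v, r)\<close> of matrices
    into and out of the biproduct; their product is \<open>v u + r s\<close>.\<close>
  let ?u = "Comp K x t t' i u \<oplus>\<^bsub>Hom K x t'\<^esub> Comp K x g t' j s"
  let ?v = "Comp K t' t y v p \<oplus>\<^bsub>Hom K t' y\<^esub> Comp K t' g y r q"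
  have pu: "Comp K x t' t p ?u = u"
    using bp t IH(3) add assms by (simp add: Comp_add_right Comp_assoc)
  have qu: "Comp K x t' g q ?u = s"
    using bp t IH(3) add assms by (simp add: Comp_add_right Comp_assoc)
  have uM: "?u \<in> Mor K x t'" using bp t IH(3) add assms by simp
  have "Comp K x t' y ?v ?u = Comp K x t' y (Comp K t' t y v p) ?u \<oplus>\<^bsub>Hom K x y\<^esub> Comp K x t' y (Comp K t' g y r q) ?u"
    using bp t IH(3,4) add assms uM by (intro Comp_add_left) auto
  also have "\<dots> = Comp K x t y v (Comp K x t' t p ?u) \<oplus>\<^bsub>Hom K x y\<^esub> Comp K x g y r (Comp K x t' g q ?u)"
    using bp(1-5) t IH(4) add assms uM by (simp only: Comp_assoc)
  finally have eq: "Comp K x t' y ?v ?u = f \<oplus>\<^bsub>Hom K x y\<^esub> Comp K x g y r s" unfolding pu qu IH(5) .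
  have "direct_sum K t' (ys @ [g])" using direct_sum_snoc[OF IH(2) b] .
  moreover have "?v \<in> Mor K t' y" using bp t IH(4) add assms by simp
  moreover have "set (ys @ [g]) \<subseteq> S" using IH add by simp
  ultimately show ?case using uM eq by metis
qed

text \<open>The complement of a retract arises by splitting the complementary idempotent
  \<open>1 - s r\<close>; the orthogonality relations come from
  \<open>e d = d e = 0\<close>.\<close>

lemma idempotent_split_complement:
  assumes "idempotent_split K" "x \<in> Obj K" "y \<in> Obj K" "s \<in> Mor K y x" "r \<in> Mor K x y"
    and rs: "Comp K y x y r s = Id K y"
  shows "\<exists>z s' r'. biproduct K y z x s s' r r'"
proof -
  define e where "e = Comp K x y x s r"
  define d where "d = Id K x \<oplus>\<^bsub>Hom K x x\<^esub> (-1) \<odot>\<^bsub>Hom K x x\<^esub> e"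
  have e: "e \<in> Mor K x x" "d \<in> Mor K x x" using assms by (auto simp: e_def d_def)
  have "Comp K x x x e e = Comp K x y x (Comp K y y x s (Comp K y x y r s)) r"
    unfolding e_def using assms(2-5) by (simp only: Comp_assoc Comp_closed)
  then have ee: "Comp K x x x e e = e" using assms by (simp add: e_def)
  have "Comp K x x x e d = \<zero>\<^bsub>Hom K x x\<^esub>" unfolding d_def
    using e ee assms by (simp add: Comp_add_right Comp_smult Hom_neg)
  moreover have "Comp K x x x d e = \<zero>\<^bsub>Hom K x x\<^esub>" unfolding d_def
    using e ee assms by (simp add: Comp_add_left Comp_smult Hom_neg)
  ultimately have ed: "Comp K x x x e d = \<zero>\<^bsub>Hom K x x\<^esub>" "Comp K x x x d e = \<zero>\<^bsub>Hom K x x\<^esub>" by auto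
  have "Comp K x x x d d = Comp K x x x (Id K x \<oplus>\<^bsub>Hom K x x\<^esub> (-1) \<odot>\<^bsub>Hom K x x\<^esub> e) d" by (simp add: d_def)
  also have "\<dots> = d \<oplus>\<^bsub>Hom K x x\<^esub> (-1) \<odot>\<^bsub>Hom K x x\<^esub> Comp K x x x e d"
    using e assms by (subst Comp_add_left) (auto simp: Comp_smult)
  finally have dd: "Comp K x x x d d = d"
    using ed e assms vspace.vs_smult_right_zero[OF Hom_vspace, of x x] by simp
  obtain z r' s' where z: "z \<in> Obj K" "r' \<in> Mor K x z" "s' \<in> Mor K z x" "Comp K x z x s' r' = d"
    "Comp K z x z r' s' = Id K z"
    using assms(1,2) e dd unfolding idempotent_split_def by metis
  \<comment> \<open>The mixed composite \<open>r s'\<close> vanishes because \<open>r = r e\<close>,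
    \<open>s' = d s'\<close> and \<open>e d = 0\<close>. The same argument with the roles of
    \<open>e\<close> and \<open>d\<close> exchanged gives \<open>r' s = 0\<close>.\<close>
  have "r = Comp K x x y r e"
    unfolding e_def using assms by (simp add: Comp_assoc)
  then have rd: "Comp K x x y r d = \<zero>\<^bsub>Hom K x y\<^esub>"
    using ed e assms by (metis Comp_assoc Comp_zero_right)
  have "s' = Comp K z x x d s'"
    using z assms by (metis Comp_assoc Comp_Id_right)
  then have rs': "Comp K z x y r s' = \<zero>\<^bsub>Hom K z y\<^esub>"
    using rd e assms z by (metis Comp_assoc Comp_zero_left)
  have "s = Comp K y x x e s"
    unfolding e_def using assms by (metis Comp_assoc Comp_Id_right)
  then have ds: "Comp K y x x d s = \<zero>\<^bsub>Hom K y x\<^esub>"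
    using ed e assms by (metis Comp_assoc Comp_zero_left)
  have "r' = Comp K x x z r' d"
    using z assms by (metis Comp_assoc Comp_Id_left)
  then have r's: "Comp K y x z r' s = \<zero>\<^bsub>Hom K y z\<^esub>"
    using ds e assms z by (metis Comp_assoc Comp_zero_right)
  have "e \<oplus>\<^bsub>Hom K x x\<^esub> d = Id K x"
  proof -
    interpret vspace "Hom K x x" using assms by (intro Hom_vspace)
    have "e \<oplus>\<^bsub>Hom K x x\<^esub> d = Id K x \<oplus>\<^bsub>Hom K x x\<^esub> (e \<oplus>\<^bsub>Hom K x x\<^esub> (-1) \<odot>\<^bsub>Hom K x x\<^esub> e)"
      unfolding d_def using e assms by (simp add: M.add.m_lcomm)
    then show ?thesis using e assms by (simp add: vs_add_neg)
  qed
  then have "biproduct K y z x s s' r r'"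
    unfolding biproduct_def using assms z rs' r's by (simp add: e_def)
  then show ?thesis by blast
qed

text \<open>The identity of a direct sum is the sum of the composites \<open>\<iota> \<pi>\<close>,
  and injection and projection carry it to any summand \<open>x\<close>. Conversely, a factoring of
  \<open>Id x\<close> through a direct sum makes \<open>x\<close> a retract of it, and split
  idempotents turn retracts into direct summands.\<close>

lemma additive_closure_iff:
  assumes "idempotent_split K" "has_biproducts K" "S \<subseteq> Obj K"
  shows "additive_closure K S = {x \<in> Obj K. Id K x \<in> factoring K S x x}"
proof (intro subset_antisym subsetI)
  fix x assume "x \<in> additive_closure K S"
  then obtain s ys z where x: "x \<in> Obj K" and ys: "set ys \<subseteq> S" "direct_sum K s ys" "direct_sum K s [x, z]"
    by (auto simp: additive_closure_def)
  obtain \<iota> \<pi> where s: "s \<in> Obj K"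
    and 11: "\<forall>i<length ys. \<iota> i \<in> Mor K (ys ! i) s \<and> \<pi> i \<in> Mor K s (ys ! i)"
    and 3: "(\<Oplus>\<^bsub>Hom K s s\<^esub> i\<in>{..<length ys}. Comp K s (ys ! i) s (\<iota> i) (\<pi> i)) = Id K s"
    using ys(2) unfolding direct_sum_def by blast
  note 1 = 11[rule_format]
  interpret vspace "Hom K s s" using s by (intro Hom_vspace)
  have "(\<Oplus>\<^bsub>Hom K s s\<^esub> i\<in>I. Comp K s (ys ! i) s (\<iota> i) (\<pi> i)) \<in> factoring K S s s"
    if "finite I" "I \<subseteq> {..<length ys}" for I
    using that
  proof induction
    case empty then show ?case by (simp add: factoring.zero)
  next
    case (insert k I)
    have o: "ys ! i \<in> Obj K" "ys ! i \<in> S" if "i < length ys" for i using that ys assms by (auto simp: subset_iff)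
    have "(\<lambda>i. Comp K s (ys ! i) s (\<iota> i) (\<pi> i)) \<in> insert k I \<rightarrow> Mor K s s"
      using insert o 1 s by (auto simp: Pi_def)
    then have "(\<Oplus>\<^bsub>Hom K s s\<^esub> i\<in>insert k I. Comp K s (ys ! i) s (\<iota> i) (\<pi> i)) =
       Comp K s (ys ! k) s (\<iota> k) (\<pi> k) \<oplus>\<^bsub>Hom K s s\<^esub> (\<Oplus>\<^bsub>Hom K s s\<^esub> i\<in>I. Comp K s (ys ! i) s (\<iota> i) (\<pi> i))"
      using insert by (intro M.finsum_insert) auto
    moreover have "Comp K s (ys ! k) s (\<iota> k) (\<pi> k) \<in> factoring K S s s"
      using insert o 1 s by (intro factoring_single) auto
    ultimately show ?case using insert s assms by (auto intro: factoring_add)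
  qed
  then have "Id K s \<in> factoring K S s s" using 3 by (metis finite_lessThan subset_refl)
  moreover obtain i j p q where "biproduct K x z s i j p q" using ys(3) direct_sum_pair_iff by blast
  then have ip: "i \<in> Mor K x s" "p \<in> Mor K s x" "Comp K x s x p i = Id K x" by (auto simp: biproduct_def)
  ultimately have "Comp K x s x p (Comp K x s s (Id K s) i) \<in> factoring K S x x"
    using s x assms by (intro factoring_comp_left factoring_comp_right) auto
  then show "x \<in> {x \<in> Obj K. Id K x \<in> factoring K S x x}" using ip s x by simp
next
  fix x assume "x \<in> {x \<in> Obj K. Id K x \<in> factoring K S x x}"
  then have x: "x \<in> Obj K" "Id K x \<in> factoring K S x x" by auto
  then obtain ys t u v where t: "set ys \<subseteq> S" "direct_sum K t ys" "u \<in> Mor K x t" "v \<in> Mor K t x"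
    "Id K x = Comp K x t x v u"
    using factoring_through_direct_sum[OF assms(2) x(1,1) assms(3)] by blast
  moreover have "t \<in> Obj K" using t(2) by (auto simp: direct_sum_def)
  ultimately obtain z s' r' where "biproduct K x z t u s' v r'"
    using idempotent_split_complement[OF assms(1), of t x u v] x by auto
  then have "direct_sum K t [x, z]" using direct_sum_pair_iff by blast
  then show "x \<in> additive_closure K S" using x t by (auto simp: additive_closure_def)
qed

end

text \<open>The relation \<open>f^i = f^i f h\<close> can be substituted into itself any number of
  times, and multiplying by further powers of \<open>f\<close> on the left preserves the outcome. So
  one repetition in the chain of right ideals gives absorption at every later exponent.\<close>

lemma (in monoid) nat_pow_absorb_right:
  assumes f: "f \<in> carrier G" and h: "h \<in> carrier G"
    and eq: "f [^] (i::nat) = f [^] i \<otimes> f \<otimes> h"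
  shows "\<exists>a\<in>carrier G. f [^] (i + k) = f [^] (i + k + l) \<otimes> a"
proof -
  have "\<exists>a\<in>carrier G. f [^] i = f [^] (i + l) \<otimes> a"
  proof (induction l)
    case 0 then show ?case using f by (intro bexI[of _ \<one>]) auto
  next
    case (Suc l)
    then obtain a where a: "a \<in> carrier G" "f [^] i = f [^] (i + l) \<otimes> a" by blast
    have "f [^] (i + l) = f [^] l \<otimes> f [^] i" using f by (simp add: nat_pow_mult add.commute)
    also have "\<dots> = f [^] l \<otimes> (f [^] i \<otimes> f \<otimes> h)" using eq by simp
    also have "\<dots> = f [^] l \<otimes> f [^] i \<otimes> (f \<otimes> h)" using f h by (simp add: m_assoc)
    also have "f [^] l \<otimes> f [^] i = f [^] (i + l)" using f by (simp add: nat_pow_mult add.commute)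
    finally have "f [^] i = f [^] (i + l) \<otimes> (f \<otimes> h) \<otimes> a" using a(2) by simp
    also have "\<dots> = f [^] (i + Suc l) \<otimes> (h \<otimes> a)" using a(1) f h by (simp add: m_assoc)
    finally have "f [^] i = f [^] (i + Suc l) \<otimes> (h \<otimes> a)" .
    then show ?case using a h by (intro bexI[of _ "h \<otimes> a"]) auto
  qed
  then obtain a where a: "a \<in> carrier G" "f [^] i = f [^] (i + l) \<otimes> a" by blast
  have "f [^] (i + k) = f [^] k \<otimes> (f [^] (i + l) \<otimes> a)" using f a(2) by (metis nat_pow_mult add.commute)
  also have "\<dots> = f [^] (i + k + l) \<otimes> a" using f a(1)
    by (simp add: m_assoc[symmetric] nat_pow_mult add_ac)
  finally show ?thesis using a by blast
qed

lemma (in monoid) nat_pow_absorb_left: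
  assumes f: "f \<in> carrier G" and h: "h \<in> carrier G"
    and eq: "f [^] (i::nat) = h \<otimes> (f [^] i \<otimes> f)"
  shows "\<exists>a\<in>carrier G. f [^] (i + k) = a \<otimes> f [^] (i + k + l)"
proof -
  have "\<exists>a\<in>carrier G. f [^] i = a \<otimes> f [^] (i + l)"
  proof (induction l)
    case 0 then show ?case using f by (intro bexI[of _ \<one>]) auto
  next
    case (Suc l)
    then obtain a where a: "a \<in> carrier G" "f [^] i = a \<otimes> f [^] (i + l)" by blast
    have "f [^] (i + l) = f [^] i \<otimes> f [^] l" using f by (simp add: nat_pow_mult)
    also have "\<dots> = h \<otimes> (f [^] i \<otimes> f) \<otimes> f [^] l" using eq by simp
    also have "\<dots> = h \<otimes> (f [^] i \<otimes> (f \<otimes> f [^] l))" using f h by (simp add: m_assoc)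
    also have "f \<otimes> f [^] l = f [^] l \<otimes> f" using f by (metis nat_pow_Suc nat_pow_Suc2)
    also have "f [^] i \<otimes> (f [^] l \<otimes> f) = f [^] (i + l) \<otimes> f" using f by (simp add: m_assoc[symmetric] nat_pow_mult)
    finally have "f [^] i = a \<otimes> (h \<otimes> (f [^] (i + l) \<otimes> f))" using a(2) by simp
    also have "\<dots> = (a \<otimes> h) \<otimes> f [^] (i + Suc l)" using a(1) f h by (simp add: m_assoc)
    finally have "f [^] i = (a \<otimes> h) \<otimes> f [^] (i + Suc l)" .
    then show ?case using a h by (intro bexI[of _ "a \<otimes> h"]) auto
  qed
  then obtain a where a: "a \<in> carrier G" "f [^] i = a \<otimes> f [^] (i + l)" by blast
  have "f [^] (i + k) = (a \<otimes> f [^] (i + l)) \<otimes> f [^] k" using f a(2) by (metis nat_pow_mult)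
  also have "\<dots> = a \<otimes> f [^] (i + k + l)" using f a(1)
    by (simp add: m_assoc nat_pow_mult add_ac)
  finally show ?thesis using a by blast
qed

text \<open>Fitting's lemma, for a power \<open>f\<^sup>m\<close> that generates the same left and the same right ideal as \<open>f\<^sup>2\<^sup>m\<close>.\<close>

lemma (in ring) nilpotent_or_invertible:
  assumes f: "f \<in> carrier R" and m: "m > (0::nat)" and ab: "a \<in> carrier R" "b \<in> carrier R"
    and a: "f [^] m = f [^] (m + m) \<otimes> a" and b: "f [^] m = b \<otimes> f [^] (m + m)"
    and idem: "\<And>e. e \<in> carrier R \<Longrightarrow> e \<otimes> e = e \<Longrightarrow> e = \<zero> \<or> e = \<one>"
  shows "f [^] m = \<zero> \<or> (\<exists>h\<in>carrier R. f \<otimes> h = \<one> \<and> h \<otimes> f = \<one>)"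
proof -
  define g where "g = f [^] m"
  have gg: "g \<otimes> g = f [^] (m + m)" using f by (simp add: g_def nat_pow_mult)
  have g: "g \<in> carrier R" "g = g \<otimes> g \<otimes> a" "g = b \<otimes> (g \<otimes> g)"
    unfolding gg unfolding g_def by (rule nat_pow_closed[OF f], rule a, rule b)
  \<comment> \<open>The idempotent that projects onto the part where \<open>g\<close> is invertible;
    it also equals \<open>b g\<close>. If it is zero then \<open>g = g e = 0\<close>, and if it is
    one then \<open>f\<close> has inverses on both sides built from \<open>a\<close> and
    \<open>b\<close>.\<close>
  define e where "e = g \<otimes> a"
  have e: "e \<in> carrier R" using g ab by (simp add: e_def)
  have eb: "e = b \<otimes> g"
  proof -
    have "e = b \<otimes> (g \<otimes> g) \<otimes> a" using g(3) by (simp add: e_def)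
    also have "\<dots> = b \<otimes> (g \<otimes> g \<otimes> a)" using g(1) ab by (simp add: m_assoc)
    finally show ?thesis using g(2) by simp
  qed
  have "e \<otimes> e = b \<otimes> (g \<otimes> g \<otimes> a)" using eb g(1) ab by (subst (1) eb) (simp add: e_def m_assoc)
  then have "e \<otimes> e = e" using g(2) eb by simp
  then consider "e = \<zero>" | "e = \<one>" using idem e by blast
  then show ?thesis
  proof cases
    case 1
    have "g = g \<otimes> e" using g ab by (simp add: e_def m_assoc)
    then show ?thesis using 1 g by (simp add: g_def)
  next
    case 2
    obtain k where k: "m = Suc k" using m by (cases m) auto
    have fg: "g = f \<otimes> f [^] k" "g = f [^] k \<otimes> f"
      using f nat_pow_Suc2[of f k] by (auto simp: g_def k)
    have "f \<otimes> (f [^] k \<otimes> a) = \<one>" using 2 f ab fg(1) by (simp add: e_def m_assoc)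
    moreover have "(b \<otimes> f [^] k) \<otimes> f = \<one>" using 2 eb f ab fg(2) by (simp add: m_assoc)
    ultimately have "f [^] k \<otimes> a = b \<otimes> f [^] k"
      using f ab by (metis inv_unique m_closed nat_pow_closed)
    then show ?thesis
      using \<open>f \<otimes> (f [^] k \<otimes> a) = \<one>\<close> \<open>(b \<otimes> f [^] k) \<otimes> f = \<one>\<close> f ab
      by (intro disjI2 bexI[of _ "f [^] k \<otimes> a"]) auto
  qed
qed

text \<open>The geometric series: with \<open>M = 1 - N\<close>, a partial sum \<open>v\<close>
  satisfies \<open>M v + N^k = 1\<close>, and the next partial sum is
  \<open>v + N^k\<close>.\<close>

lemma (in ring) right_inverse_one_minus_nilpotent:
  assumes N: "N \<in> carrier R" "N [^] (n::nat) = \<zero>"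
  shows "\<exists>v\<in>carrier R. (\<one> \<ominus> N) \<otimes> v = \<one>"
proof -
  define M where "M = \<one> \<ominus> N"
  have M: "M \<in> carrier R" "M \<oplus> N = \<one>" using N(1) by (auto simp: M_def minus_eq a_assoc l_neg)
  have "\<exists>v\<in>carrier R. M \<otimes> v \<oplus> N [^] k = \<one>" for k :: nat
  proof (induction k)
    case 0 then show ?case by (intro bexI[of _ \<zero>]) (use M in auto)
  next
    case (Suc k)
    then obtain v where v: "v \<in> carrier R" "M \<otimes> v \<oplus> N [^] k = \<one>" by blast
    have "M \<otimes> (v \<oplus> N [^] k) \<oplus> N [^] Suc k = M \<otimes> v \<oplus> (M \<otimes> N [^] k \<oplus> N \<otimes> N [^] k)"
      unfolding nat_pow_Suc2[OF N(1)] using v(1) N(1) M(1) by (simp add: r_distr a_assoc)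
    also have "M \<otimes> N [^] k \<oplus> N \<otimes> N [^] k = (M \<oplus> N) \<otimes> N [^] k" using N(1) M(1) by (simp add: l_distr)
    finally have "M \<otimes> (v \<oplus> N [^] k) \<oplus> N [^] Suc k = \<one>" using M v N(1) by simp
    then show ?case using v N by (intro bexI[of _ "v \<oplus> N [^] k"]) auto
  qed
  from this[of n] show ?thesis using N M(1) by (auto simp: M_def)
qed

section \<open>Decomposition into local objects\<close>

context linear_category
begin

text \<open>The right ideals and the left ideals generated by the powers of \<open>f\<close> are
  descending chains of subspaces, so each chain repeats once. The absorption lemmas then give a
  common exponent to which the version for rings applies.\<close>

lemma nilpotent_or_invertible:
  assumes x: "x \<in> Obj K" and sep: "separated (Hom K x x) (Mor K x x) n" and f: "f \<in> Mor K x x"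
    and idem: "\<And>e. e \<in> Mor K x x \<Longrightarrow> Comp K x x x e e = e \<Longrightarrow> e = \<zero>\<^bsub>Hom K x x\<^esub> \<or> e = Id K x"
  shows "(\<exists>m::nat. f [^]\<^bsub>endo_ring K x\<^esub> m = \<zero>\<^bsub>Hom K x x\<^esub>) \<or>
     (\<exists>h\<in>Mor K x x. Comp K x x x f h = Id K x \<and> Comp K x x x h f = Id K x)"
proof -
  interpret E: ring "endo_ring K x" using x by (rule ring_endo)
  interpret vspace "Hom K x x" using x by (intro Hom_vspace)
  define p where "p i = f [^]\<^bsub>endo_ring K x\<^esub> (i::nat)" for i
  have p: "p i \<in> Mor K x x" for i unfolding p_def using E.nat_pow_closed[of f i] f by simp
  have pS: "p (Suc i) = Comp K x x x (p i) f" "p (Suc i) = Comp K x x x f (p i)" for i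
    using E.nat_pow_Suc[of f i] E.nat_pow_Suc2[of f i] f by (simp_all add: p_def)
  have p0: "p 0 = Id K x" by (simp add: p_def)
  define W where "W i = (\<lambda>h. Comp K x x x (p i) h) ` Mor K x x" for i
  have W: "subspace (W i)" for i
    unfolding W_def using x p[of i] by (intro subspace_image) (auto simp: Comp_add_right Comp_smult)
  have "W (Suc i) \<subseteq> W i" for i
    using x p[of i] f unfolding W_def by (auto simp: pS(1) Comp_assoc[symmetric])
  moreover have "W 0 = Mor K x x" using x by (auto simp: W_def p0 image_iff)
  ultimately obtain i where i: "W (Suc i) = W i"
    using descending_chain_stabilizes[of W n] sep W by auto
  have "p i \<in> W i" unfolding W_def using x p[of i] by (intro image_eqI[of _ _ "Id K x"]) auto
  then obtain a where a: "a \<in> Mor K x x" "p i = Comp K x x x (p (Suc i)) a" unfolding i[symmetric] by (auto simp: W_def)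
  define W' where "W' i = (\<lambda>h. Comp K x x x h (p i)) ` Mor K x x" for i
  have W': "subspace (W' i)" for i
    unfolding W'_def using x p[of i] by (intro subspace_image) (auto simp: Comp_add_left Comp_smult)
  have "W' (Suc i) \<subseteq> W' i" for i
    using x p[of i] f unfolding W'_def by (auto simp: pS(2) Comp_assoc)
  moreover have "W' 0 = Mor K x x" using x by (auto simp: W'_def p0 image_iff)
  ultimately obtain j where j: "W' (Suc j) = W' j"
    using descending_chain_stabilizes[of W' n] sep W' by auto
  have "p j \<in> W' j" unfolding W'_def using x p[of j] by (intro image_eqI[of _ _ "Id K x"]) auto
  then obtain b where b: "b \<in> Mor K x x" "p j = Comp K x x x b (p (Suc j))" unfolding j[symmetric] by (auto simp: W'_def)
  \<comment> \<open>The exponent must be at least both indices of repetition, and positive so that a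
    factor \<open>f\<close> can be split off the power.\<close>
  define m where "m = Suc (i + j)"
  obtain a' where a': "a' \<in> Mor K x x" "p m = Comp K x x x (p (m + m)) a'"
    using E.nat_pow_absorb_right[of f a i "Suc j" m] f a by (auto simp: p_def m_def)
  obtain b' where b': "b' \<in> Mor K x x" "p m = Comp K x x x b' (p (m + m))"
    using E.nat_pow_absorb_left[of f b j "Suc i" m] f b by (auto simp: p_def m_def add_ac)
  have "m > 0" by (simp add: m_def)
  then have "p m = \<zero>\<^bsub>Hom K x x\<^esub> \<or> (\<exists>h\<in>Mor K x x. Comp K x x x f h = Id K x \<and> Comp K x x x h f = Id K x)"
    using E.nilpotent_or_invertible[of f m a' b'] f a' b' idem by (simp add: p_def)
  then show ?thesis by (auto simp: p_def)
qed

text \<open>As long as \<open>x\<close> is not local, Fitting's lemma provides an idempotent other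
  than zero and the identity. Both of its summands have a strictly smaller bound, so the recursion
  ends in local objects, and the identity of \<open>x\<close> is collected from the two
  factorings.\<close>

lemma local_decomposition:
  assumes split: "idempotent_split K" and x: "x \<in> Obj K" and sep: "separated (Hom K x x) (Mor K x x) n"
  shows "\<exists>L. finite L \<and> (\<forall>g\<in>L. local_object K g) \<and> Id K x \<in> factoring K L x x"
  using x sep
proof (induction n arbitrary: x rule: less_induct)
  case (less n)
  show ?case
  proof (cases "local_object K x")
    case True
    then show ?thesis using less.prems by (intro exI[of _ "{x}"]) (auto intro: factoring_Id)
  next
    case False
    then obtain e where e: "e \<in> Mor K x x" "Comp K x x x e e = e" "e \<noteq> \<zero>\<^bsub>Hom K x x\<^esub>" "e \<noteq> Id K x"
      using nilpotent_or_invertible[OF less.prems] less.prems(1) unfolding local_object_def by blast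
    obtain y r s where y: "y \<in> Obj K" "r \<in> Mor K x y" "s \<in> Mor K y x" "Comp K x y x s r = e"
      "Comp K y x y r s = Id K y"
      using split less.prems(1) e(1,2) unfolding idempotent_split_def by metis
    obtain z s' r' where b: "biproduct K y z x s s' r r'"
      using idempotent_split_complement[OF split less.prems(1) y(1,3,2,5)] by blast
    then have z: "z \<in> Obj K" "r' \<in> Mor K x z" "s' \<in> Mor K z x" "Comp K z x z r' s' = Id K z"
      "e \<oplus>\<^bsub>Hom K x x\<^esub> Comp K x z x s' r' = Id K x"
      using y(4) by (auto simp: biproduct_def)
    \<comment> \<open>For a retract \<open>y\<close> with \<open>s r\<close> not the identity,
      \<open>h\<close> is sent to \<open>s h r\<close>. This embeds the endomorphisms of
      \<open>y\<close> into the \<open>h\<close> with \<open>(s r) h = h\<close>, a proper subspace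
      because the identity is not in it.\<close>
    have smaller: "\<exists>m<n. separated (Hom K y y) (Mor K y y) m"
      if y: "y \<in> Obj K" "r \<in> Mor K x y" "s \<in> Mor K y x" "Comp K y x y r s = Id K y"
        "Comp K x y x s r \<noteq> Id K x" for y r s
    proof -
      interpret vspace "Hom K x x" using less.prems by (intro Hom_vspace)
      let ?e = "Comp K x y x s r"
      define W where "W = {h \<in> Mor K x x. Comp K x x x ?e h = h}"
      have "Comp K x x x ?e ?e = Comp K x y x (Comp K y y x s (Comp K y x y r s)) r"
        using y(1-3) less.prems(1) by (simp only: Comp_assoc Comp_closed)
      then have ee: "?e \<in> Mor K x x" "Comp K x x x ?e ?e = ?e" using y less.prems(1) by auto
      have "subspace W" unfolding subspace_def W_def
        using less.prems(1) ee by (auto simp: Comp_add_right Comp_smult)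
      moreover have "W \<subset> Mor K x x"
      proof -
        have "Id K x \<notin> W" using less.prems(1) ee y(5) by (simp add: W_def)
        moreover have "Id K x \<in> Mor K x x" using less.prems(1) by simp
        ultimately show ?thesis by (auto simp: W_def)
      qed
      ultimately obtain m where m: "m < n" "separated (Hom K x x) W m"
        using separated_drop[OF less.prems(2) subspace_carrier] by blast
      have "separated (Hom K y y) (Mor K y y) m"
      proof (rule separated_pullback[OF m(2)])
        fix h assume h: "h \<in> Mor K y y"
        have "Comp K x x x ?e (Comp K x y x s (Comp K x y y h r))
           = Comp K x y x (Comp K y y x s (Comp K y x y r s)) (Comp K x y y h r)"
          using h y(1-3) less.prems(1) by (simp only: Comp_assoc Comp_closed)
        then show "Comp K x y x s (Comp K x y y h r) \<in> W"
          unfolding W_def using h y less.prems(1) by simp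
        show "Comp K x y x s (Comp K x y y (c \<odot>\<^bsub>Hom K y y\<^esub> h) r)
          = c \<odot>\<^bsub>Hom K x x\<^esub> Comp K x y x s (Comp K x y y h r)" for c
          using h y less.prems(1) by (simp add: Comp_smult)
        { fix h' assume h': "h' \<in> Mor K y y"
          show "Comp K x y x s (Comp K x y y (h \<oplus>\<^bsub>Hom K y y\<^esub> h') r)
          = Comp K x y x s (Comp K x y y h r) \<oplus>\<^bsub>Hom K x x\<^esub> Comp K x y x s (Comp K x y y h' r)"
            using h h' y less.prems(1) by (simp add: Comp_add_left Comp_add_right) }
        assume 0: "Comp K x y x s (Comp K x y y h r) = \<zero>\<^bsub>Hom K x x\<^esub>"
        have "Comp K y x y r (Comp K y x x (Comp K x y x s (Comp K x y y h r)) s)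
          = Comp K y y y (Comp K y x y r s) (Comp K y y y h (Comp K y x y r s))"
          using h y(1-3) less.prems(1) by (simp add: Comp_assoc)
        then show "h = \<zero>\<^bsub>Hom K y y\<^esub>" using 0 h y less.prems(1) by simp
      qed
      then show ?thesis using m by blast
    qed
    \<comment> \<open>Otherwise the complementary idempotent \<open>e\<close> would vanish. This
      makes the bound drop for the second summand as well.\<close>
    have "Comp K x z x s' r' \<noteq> Id K x"
    proof
      assume i: "Comp K x z x s' r' = Id K x"
      interpret vspace "Hom K x x" using less.prems by (intro Hom_vspace)
      have "e \<oplus>\<^bsub>Hom K x x\<^esub> Id K x = Id K x" using z(5) i by simp
      then have "e = \<zero>\<^bsub>Hom K x x\<^esub>" using e(1) less.prems(1) by simp
      then show False using e by simp
    qed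
    then obtain m1 m2 where "m1 < n" "separated (Hom K y y) (Mor K y y) m1"
        "m2 < n" "separated (Hom K z z) (Mor K z z) m2"
      using smaller[OF y(1,2,3,5)] smaller[OF z(1-4)] y(4) e(4) by metis
    then obtain L1 L2 where L: "finite L1" "\<forall>g\<in>L1. local_object K g" "Id K y \<in> factoring K L1 y y"
      "finite L2" "\<forall>g\<in>L2. local_object K g" "Id K z \<in> factoring K L2 z z"
      using less.IH[of m1 y] less.IH[of m2 z] y z by metis
    have LO: "L1 \<union> L2 \<subseteq> Obj K" using L by (auto simp: local_object_def)
    have "Comp K x y x s (Comp K x y y (Id K y) r) \<in> factoring K (L1 \<union> L2) x x"
      using y less.prems(1) LO factoring_mono[OF L(3), of "L1 \<union> L2"]
      by (intro factoring_comp_left[of x y x] factoring_comp_right[of x y y]) auto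
    moreover have "Comp K x z x s' (Comp K x z z (Id K z) r') \<in> factoring K (L1 \<union> L2) x x"
      using z less.prems(1) LO factoring_mono[OF L(6), of "L1 \<union> L2"]
      by (intro factoring_comp_left[of x z x] factoring_comp_right[of x z z]) auto
    ultimately have "e \<oplus>\<^bsub>Hom K x x\<^esub> Comp K x z x s' r' \<in> factoring K (L1 \<union> L2) x x"
      using y z less.prems(1) LO by (intro factoring_add) auto
    then show ?thesis using L z(5) by (intro exI[of _ "L1 \<union> L2"]) auto
  qed
qed

text \<open>An exchange argument that peels off the last summand \<open>r s\<close>. If
  \<open>s w r\<close> is nilpotent, then \<open>1 - r s w\<close> has a right inverse, and so has
  the remaining sum \<open>f\<close>; otherwise locality makes \<open>s w r\<close> invertible, and
  \<open>g\<close> is a retract of \<open>x\<close>. The right inverse \<open>w\<close> is arbitrary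
  because the induction changes it.\<close>

lemma local_summand:
  assumes x: "x \<in> Obj K" and L: "\<And>g. g \<in> L \<Longrightarrow> local_object K g"
    and f: "f \<in> factoring K L x x" and w: "w \<in> Mor K x x" "Comp K x x x f w = Id K x"
  shows "Id K x = \<zero>\<^bsub>Hom K x x\<^esub> \<or> (\<exists>g\<in>L. Id K g \<noteq> \<zero>\<^bsub>Hom K g g\<^esub> \<and>
    (\<exists>s\<in>Mor K x g. \<exists>r\<in>Mor K g x. Comp K g x g s r = Id K g))"
  using f w
proof (induction arbitrary: w)
  case zero
  then show ?case using x by simp
next
  case (add f g s r)
  have LO: "L \<subseteq> Obj K" using L by (auto simp: local_object_def)
  then have g: "g \<in> Obj K" "f \<in> Mor K x x" using add factoring_closed[OF x x] by auto
  let ?t = "Comp K g x g s (Comp K g x x w r)"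
  have t: "?t \<in> Mor K g g" using g add x by simp
  interpret Rg: ring "endo_ring K g" using g by (intro ring_endo)
  interpret Rx: ring "endo_ring K x" using x by (intro ring_endo)
  show ?case
  proof (cases "\<exists>n::nat. ?t [^]\<^bsub>endo_ring K g\<^esub> n = \<zero>\<^bsub>Hom K g g\<^esub>")
    case True
    then obtain n :: nat where n: "?t [^]\<^bsub>endo_ring K g\<^esub> n = \<zero>\<^bsub>Hom K g g\<^esub>" by blast
    let ?u = "Comp K x x g s w"
    \<comment> \<open>\<open>N\<close> is \<open>r s w\<close>, an endomorphism of \<open>x\<close>,
      whereas the nilpotent \<open>s w r\<close> lives on \<open>g\<close>. Shifting the factors
      gives \<open>N^(k+1) = r (s w r)^k s w\<close>, so \<open>N\<close> is nilpotent with one more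
      power.\<close>
    define N where "N = Comp K x g x r ?u"
    have N: "N \<in> Mor K x x" using g add x by (simp add: N_def)
    have pt: "?t [^]\<^bsub>endo_ring K g\<^esub> (k::nat) \<in> Mor K g g" for k
      using Rg.nat_pow_closed[of ?t k] t by simp
    have "N [^]\<^bsub>endo_ring K x\<^esub> Suc k = Comp K x g x r (Comp K x g g (?t [^]\<^bsub>endo_ring K g\<^esub> k) ?u)" for k
    proof (induction k)
      case 0 then show ?case using g add x by (simp add: N_def)
    next
      case (Suc k)
      have "N [^]\<^bsub>endo_ring K x\<^esub> Suc (Suc k) = Comp K x x x (Comp K x g x r (Comp K x g g (?t [^]\<^bsub>endo_ring K g\<^esub> k) ?u)) N"
        using Suc by simp
      also have "\<dots> = Comp K x g x r (Comp K x g g (Comp K g g g (?t [^]\<^bsub>endo_ring K g\<^esub> k) ?t) ?u)"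
        unfolding N_def using g add.hyps add.prems(1) x pt[of k] by (simp add: Comp_assoc)
      finally show ?case by simp
    qed
    then have "N [^]\<^bsub>endo_ring K x\<^esub> Suc n = \<zero>\<^bsub>Hom K x x\<^esub>" using n g add x by simp
    then obtain v where v: "v \<in> Mor K x x" "Comp K x x x (Id K x \<ominus>\<^bsub>endo_ring K x\<^esub> N) v = Id K x"
      using Rx.right_inverse_one_minus_nilpotent[of N "Suc n"] N by auto
    have fw: "Comp K x x x f w \<in> Mor K x x" using g add x by simp
    have "Comp K x x x f w \<oplus>\<^bsub>Hom K x x\<^esub> N = Id K x"
      using add g x by (simp add: N_def Comp_add_left Comp_assoc)
    then have "Comp K x x x f w = Id K x \<ominus>\<^bsub>endo_ring K x\<^esub> N"
      using Rx.add.inv_solve_right[of "Comp K x x x f w" "Id K x" N] fw N x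
      by (simp add: a_minus_def a_inv_def)
    then have "Comp K x x x f (Comp K x x x w v) = Id K x"
      using v g add x by (simp add: Comp_assoc)
    then show ?thesis using add.IH[of "Comp K x x x w v"] add.prems v x by simp
  next
    case False
    then have ng: "Id K g \<noteq> \<zero>\<^bsub>Hom K g g\<^esub>" by (metis Rg.nat_pow_0 endo_ring_simps(2))
    obtain h where h: "h \<in> Mor K g g" "Comp K g g g ?t h = Id K g"
      using False L[OF \<open>g \<in> L\<close>] t unfolding local_object_def by blast
    have "Comp K g x g s (Comp K g g x (Comp K g x x w r) h) = Id K g"
      using h g add x by (simp add: Comp_assoc)
    moreover have "Comp K g g x (Comp K g x x w r) h \<in> Mor K g x" using h g add x by simp
    ultimately show ?thesis using ng add by blast
  qed
qed

text \<open>The local retract \<open>g\<close> of \<open>x\<close> has a complement. Since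
  \<open>g\<close> is not zero, indecomposability makes the complement zero, and then
  \<open>r s\<close> is the identity of \<open>x\<close>.\<close>

lemma indecomposable_isomorphic_local:
  assumes split: "idempotent_split K" and x: "indecomposable K x"
    and L: "\<And>g. g \<in> L \<Longrightarrow> local_object K g" and f: "Id K x \<in> factoring K L x x"
  shows "\<exists>g\<in>L. isomorphic K x g"
proof -
  have xO: "x \<in> Obj K" "Id K x \<noteq> \<zero>\<^bsub>Hom K x x\<^esub>"
    using x zero_object_iff by (auto simp: indecomposable_def)
  then obtain g s r where g: "g \<in> L" "Id K g \<noteq> \<zero>\<^bsub>Hom K g g\<^esub>" "s \<in> Mor K x g" "r \<in> Mor K g x"
    "Comp K g x g s r = Id K g"
    using local_summand[OF xO(1) L f, of "Id K x"] by auto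
  have gO: "g \<in> Obj K" using L g by (auto simp: local_object_def)
  obtain z s' r' where b: "biproduct K g z x r s' s r'"
    using idempotent_split_complement[OF split xO(1) gO g(4,3,5)] by blast
  then have z: "z \<in> Obj K" "r' \<in> Mor K x z" "s' \<in> Mor K z x"
      "Comp K x g x r s \<oplus>\<^bsub>Hom K x x\<^esub> Comp K x z x s' r' = Id K x"
    by (auto simp: biproduct_def)
  have "direct_sum K x [g, z]" using b direct_sum_pair_iff by blast
  then have "zero_object K z" using x g(2) gO zero_object_iff by (auto simp: indecomposable_def)
  then have "Id K z = \<zero>\<^bsub>Hom K z z\<^esub>" using z zero_object_iff by blast
  then have "s' = \<zero>\<^bsub>Hom K z x\<^esub>" using Comp_Id_right[of z x s'] z xO by simp
  then have "Comp K x g x r s = Id K x" using z g xO gO by simp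
  then show ?thesis using g xO gO unfolding isomorphic_def by blast
qed

text \<open>Isomorphic objects have equal classes, so the classes of the representatives in
  \<open>L\<close> cover the quotient; the representatives may lie outside \<open>T\<close>.\<close>

lemma finite_quotientI:
  assumes L: "finite L" and T: "\<And>x. x \<in> T \<Longrightarrow> \<exists>g\<in>L. isomorphic K x g"
  shows "finite (T // {(F, G). isomorphic K F G})"
proof -
  let ?r = "{(F, G). isomorphic K F G}"
  have "?r `` {x} \<in> (\<lambda>g. ?r `` {g}) ` L" if "x \<in> T" for x
  proof -
    obtain g where g: "g \<in> L" "isomorphic K x g" using T[OF \<open>x \<in> T\<close>] by auto
    have "isomorphic K x y \<longleftrightarrow> isomorphic K g y" for y
      using g(2) isomorphic_sym isomorphic_trans by metis
    then have "?r `` {x} = ?r `` {g}" by auto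
    then show ?thesis using g by blast
  qed
  then have "T // ?r \<subseteq> (\<lambda>g. ?r `` {g}) ` L" by (auto simp: quotient_def)
  then show ?thesis using L finite_surj by blast
qed

text \<open>A morphism \<open>h\<close> out of \<open>x\<close> is detected by its composites with
  the maps \<open>r\<close> from the generators. The claim concerns \<open>h f\<close> for an
  arbitrary sum of factorings \<open>f\<close>, so that the induction can add one summand;
  \<open>f = Id\<close> gives the bound for the whole morphism space.\<close>

lemma separated_factoring:
  assumes "x \<in> Obj K" "y \<in> Obj K" "S \<subseteq> Obj K" and f: "f \<in> factoring K S x x"
    and sep: "\<And>g. g \<in> S \<Longrightarrow> \<exists>n. separated (Hom K g y) (Mor K g y) n"
  shows "\<exists>\<Lambda>. finite \<Lambda> \<and> (\<forall>l\<in>\<Lambda>. linear_form (Hom K x y) (Mor K x y) l) \<and>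
    (\<forall>h\<in>Mor K x y. (\<forall>l\<in>\<Lambda>. l h = 0) \<longrightarrow> Comp K x x y h f = \<zero>\<^bsub>Hom K x y\<^esub>)"
  using f
proof induction
  case zero
  then show ?case using assms by (intro exI[of _ "{}"]) auto
next
  case (add f g s r)
  then obtain \<Lambda> where \<Lambda>: "finite \<Lambda>" "\<And>l. l \<in> \<Lambda> \<Longrightarrow> linear_form (Hom K x y) (Mor K x y) l"
    "\<And>h. h \<in> Mor K x y \<Longrightarrow> \<forall>l\<in>\<Lambda>. l h = 0 \<Longrightarrow> Comp K x x y h f = \<zero>\<^bsub>Hom K x y\<^esub>" by blast
  have g: "g \<in> Obj K" "f \<in> Mor K x x" using add assms factoring_closed[of x x S f] by auto
  obtain \<Lambda>' where \<Lambda>': "finite \<Lambda>'" "\<And>l. l \<in> \<Lambda>' \<Longrightarrow> linear_form (Hom K g y) (Mor K g y) l"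
    "\<And>h. h \<in> Mor K g y \<Longrightarrow> \<forall>l\<in>\<Lambda>'. l h = 0 \<Longrightarrow> h = \<zero>\<^bsub>Hom K g y\<^esub>"
    using sep[OF add(2)] unfolding separated_def by blast
  let ?\<Lambda> = "\<Lambda> \<union> (\<lambda>l h. l (Comp K g x y h r)) ` \<Lambda>'"
  have "linear_form (Hom K x y) (Mor K x y) l" if "l \<in> ?\<Lambda>" for l
    using that \<Lambda>(2)
  proof
    assume "l \<in> (\<lambda>l h. l (Comp K g x y h r)) ` \<Lambda>'"
    then obtain l' where l': "l' \<in> \<Lambda>'" "l = (\<lambda>h. l' (Comp K g x y h r))" by auto
    show ?thesis unfolding l'(2)
      by (rule linear_form_pullback[OF \<Lambda>'(2)[OF l'(1)]])
        (use g add.hyps assms(1,2) in \<open>simp_all add: Comp_add_left Comp_smult\<close>)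
  qed
  moreover have "Comp K x x y h (f \<oplus>\<^bsub>Hom K x x\<^esub> Comp K x g x r s) = \<zero>\<^bsub>Hom K x y\<^esub>"
    if h: "h \<in> Mor K x y" "\<forall>l\<in>?\<Lambda>. l h = 0" for h
  proof -
    have "Comp K x x y h f = \<zero>\<^bsub>Hom K x y\<^esub>" using h \<Lambda>(3) by blast
    moreover have "\<forall>l\<in>\<Lambda>'. l (Comp K g x y h r) = 0" using h(2) by auto
    then have "Comp K g x y h r = \<zero>\<^bsub>Hom K g y\<^esub>" using \<Lambda>'(3) h(1) g add.hyps assms(1,2) by simp
    ultimately show ?thesis using h g add assms by (simp add: Comp_add_right Comp_assoc)
  qed
  ultimately show ?case using \<Lambda>(1) \<Lambda>'(1) by (intro exI[of _ ?\<Lambda>]) blast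
qed

lemma separated_Hom:
  assumes "x \<in> Obj K" "y \<in> Obj K" "S \<subseteq> Obj K" "Id K x \<in> factoring K S x x"
    and sep: "\<And>g. g \<in> S \<Longrightarrow> \<exists>n. separated (Hom K g y) (Mor K g y) n"
  shows "\<exists>n. separated (Hom K x y) (Mor K x y) n"
proof -
  obtain \<Lambda> where "finite \<Lambda>" "\<forall>l\<in>\<Lambda>. linear_form (Hom K x y) (Mor K x y) l"
    "\<forall>h\<in>Mor K x y. (\<forall>l\<in>\<Lambda>. l h = 0) \<longrightarrow> Comp K x x y h (Id K x) = \<zero>\<^bsub>Hom K x y\<^esub>"
    using separated_factoring[OF assms] by auto
  then show ?thesis unfolding separated_def using assms
    by (intro exI[of _ "card \<Lambda>"] exI[of _ \<Lambda>]) auto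
qed

text \<open>In a decomposition the idempotent \<open>i p\<close> is a scalar \<open>c\<close>. If
  \<open>c = 0\<close>, then \<open>(p i) (p i) = p (i p) i\<close> shows that the first summand is
  zero; otherwise \<open>q i = 0\<close> gives \<open>c q = 0\<close>, and the second summand is
  zero.\<close>

lemma indecomposableI:
  assumes x: "x \<in> Obj K" "Id K x \<noteq> \<zero>\<^bsub>Hom K x x\<^esub>"
    and scalar: "\<And>f. f \<in> Mor K x x \<Longrightarrow> \<exists>c. f = c \<odot>\<^bsub>Hom K x x\<^esub> Id K x"
  shows "indecomposable K x"
proof -
  have "zero_object K y \<or> zero_object K z" if yz: "direct_sum K x [y, z]" for y z
  proof -
    obtain i j p q where "biproduct K y z x i j p q" using yz direct_sum_pair_iff by blast
    then have b: "y \<in> Obj K" "z \<in> Obj K" "i \<in> Mor K y x" "p \<in> Mor K x y" "j \<in> Mor K z x" "q \<in> Mor K x z"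
      "Comp K y x y p i = Id K y" "Comp K z x z q j = Id K z" "Comp K y x z q i = \<zero>\<^bsub>Hom K y z\<^esub>"
      by (auto simp: biproduct_def)
    obtain c where c: "Comp K x y x i p = c \<odot>\<^bsub>Hom K x x\<^esub> Id K x" using scalar[of "Comp K x y x i p"] b x by auto
    show ?thesis
    proof (cases "c = 0")
      case True
      have "Comp K y y y (Comp K y x y p i) (Comp K y x y p i)
         = Comp K y x y p (Comp K y x x (Comp K x y x i p) i)"
        using b(1-6) x by (simp add: Comp_assoc)
      then have "Id K y = \<zero>\<^bsub>Hom K y y\<^esub>" using True c b x by simp
      then show ?thesis using b zero_object_iff by blast
    next
      case False
      interpret vspace "Hom K x z" using x b by (intro Hom_vspace)
      have "Comp K x x z q (Comp K x y x i p) = Comp K x y z (Comp K y x z q i) p"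
        using b(1-6) x by (simp add: Comp_assoc)
      then have "c \<odot>\<^bsub>Hom K x z\<^esub> q = \<zero>\<^bsub>Hom K x z\<^esub>" using c b x by (simp add: Comp_smult)
      then have "(1 / c) \<odot>\<^bsub>Hom K x z\<^esub> (c \<odot>\<^bsub>Hom K x z\<^esub> q) = \<zero>\<^bsub>Hom K x z\<^esub>" by simp
      then have "q = \<zero>\<^bsub>Hom K x z\<^esub>" using False b x by (simp add: vs_smult_smult)
      then have "Id K z = \<zero>\<^bsub>Hom K z z\<^esub>" using b x by (metis Comp_zero_left)
      then show ?thesis using b zero_object_iff by blast
    qed
  qed
  then show ?thesis using x zero_object_iff by (auto simp: indecomposable_def)
qed

end

section \<open>Full subcategories and the finiteness criterion for additive closures\<close>

lemma full_subcategory_simps [simp]: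
  "Obj (full_subcategory K S) = S" "Hom (full_subcategory K S) = Hom K"
  "Comp (full_subcategory K S) = Comp K" "Id (full_subcategory K S) = Id K"
  by (simp_all add: full_subcategory_def)

text \<open>\<open>factoring\<close> refers to morphism spaces and composition but never to the set
  of objects, so it does not see the passage to a full subcategory.\<close>

lemma factoring_full_subcategory [simp]:
  "factoring (full_subcategory K S) T x y = factoring K T x y"
proof (intro subset_antisym subsetI)
  show "f \<in> factoring (full_subcategory K S) T x y \<Longrightarrow> f \<in> factoring K T x y" for f
    by (induction rule: factoring.induct) (auto intro: factoring.intros)
  show "f \<in> factoring K T x y \<Longrightarrow> f \<in> factoring (full_subcategory K S) T x y" for f
  proof (induction rule: factoring.induct)
    case zero then show ?case using factoring.zero[of "full_subcategory K S"] by simp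
  next
    case (add f g s r) then show ?case using factoring.add[of f "full_subcategory K S"] by simp
  qed
qed

context linear_category
begin

lemma linear_full_subcategory:
  assumes "S \<subseteq> Obj K" shows "linear_category (full_subcategory K S)"
  by (intro linear_category.intro category.intro linear_category_axioms.intro)
    (use assms in \<open>simp_all add: subset_iff Comp_assoc Hom_module Comp_bilinear\<close>)

text \<open>Splitting an idempotent of \<open>x\<close> in the ambient category gives a retract of
  \<open>x\<close>. Its identity is \<open>r Id s\<close>, which inherits a factoring through
  \<open>T\<close>.\<close>

lemma idempotent_split_retracts:
  assumes split: "idempotent_split K" and T: "T \<subseteq> Obj K"
  shows "idempotent_split (full_subcategory K {x \<in> Obj K. Id K x \<in> factoring K T x x})"
  unfolding idempotent_split_def full_subcategory_simps
proof (intro ballI impI)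
  fix x e assume x: "x \<in> {x \<in> Obj K. Id K x \<in> factoring K T x x}"
    and e: "e \<in> Mor K x x" "Comp K x x x e e = e"
  then have x: "x \<in> Obj K" "Id K x \<in> factoring K T x x" by auto
  then obtain y r s where y: "y \<in> Obj K" "r \<in> Mor K x y" "s \<in> Mor K y x" "Comp K x y x s r = e"
      "Comp K y x y r s = Id K y"
    using split x e unfolding idempotent_split_def by metis
  have "Comp K y x y r (Comp K y x x (Id K x) s) \<in> factoring K T y y"
    using x y T by (intro factoring_comp_left[of y x y] factoring_comp_right[of y x x]) auto
  then show "\<exists>y\<in>{x \<in> Obj K. Id K x \<in> factoring K T x x}. \<exists>r\<in>Mor K x y. \<exists>s\<in>Mor K y x.
         Comp K x y x s r = e \<and> Comp K y x y r s = Id K y"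
    using x y by auto
qed

text \<open>Reduces finiteness to the generators: finitely many up to isomorphism, with
  finite-dimensional morphism spaces out of them. All other objects are reached by sums of
  factorings, and every indecomposable is isomorphic to one of the local parts of the
  generators.\<close>

theorem finitary_additive_closure:
  assumes split: "idempotent_split K" and bi: "has_biproducts K" and S: "S \<subseteq> Obj K"
    and fin: "finite S'" "S' \<subseteq> S" "\<And>g. g \<in> S \<Longrightarrow> \<exists>g'\<in>S'. isomorphic K g g'"
    and sep: "\<And>g h. g \<in> S \<Longrightarrow> h \<in> Obj K \<Longrightarrow> \<exists>n. separated (Hom K g h) (Mor K g h) n"
  defines "K' \<equiv> full_subcategory K (additive_closure K S)"
  shows "linear_category K'" and "idempotent_split K'"
    and "finite ({F. indecomposable K' F} // {(F, G). isomorphic K' F G})"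
    and "F \<in> Obj K' \<Longrightarrow> G \<in> Obj K' \<Longrightarrow> finitely_generated base_field (Hom K' F G)"
proof -
  have ac: "additive_closure K S = {x \<in> Obj K. Id K x \<in> factoring K S x x}"
    by (rule additive_closure_iff[OF split bi S])
  show lin: "linear_category K'" unfolding K'_def by (rule linear_full_subcategory) (auto simp: ac)
  then interpret K': linear_category K' .
  show split': "idempotent_split K'" unfolding K'_def ac by (rule idempotent_split_retracts[OF split S])
  have SK': "S \<subseteq> Obj K'" unfolding K'_def ac using S by (auto intro: factoring_Id)
  have "\<exists>L. finite L \<and> (\<forall>l\<in>L. local_object K' l) \<and> Id K g \<in> factoring K L g g" if "g \<in> S" for g
  proof -
    obtain n where "separated (Hom K' g g) (Mor K' g g) n" using sep[of g g] \<open>g \<in> S\<close> S by (auto simp: K'_def)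
    then have "\<exists>L. finite L \<and> (\<forall>l\<in>L. local_object K' l) \<and> Id K' g \<in> factoring K' L g g"
      using K'.local_decomposition[OF split', of g n] that SK' by blast
    then show ?thesis by (simp add: K'_def)
  qed
  then obtain L where L: "\<And>g. g \<in> S \<Longrightarrow> finite (L g) \<and> (\<forall>l\<in>L g. local_object K' l) \<and> Id K g \<in> factoring K (L g) g g"
    by metis
  \<comment> \<open>Only the representatives contribute, so \<open>LL\<close> is finite although
    \<open>S\<close> itself may be infinite; the other generators reach \<open>LL\<close> through an
    isomorphism.\<close>
  define LL where "LL = (\<Union>g\<in>S'. L g)"
  have LL: "finite LL" "\<And>l. l \<in> LL \<Longrightarrow> local_object K' l" using fin L by (auto simp: LL_def)
  have LLO: "LL \<subseteq> Obj K" using LL(2) by (auto simp: local_object_def K'_def ac)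
  have IdS: "Id K g \<in> factoring K LL g g" if g: "g \<in> S" for g
  proof -
    obtain g' where g': "g' \<in> S'" "isomorphic K g g'" using fin(3) g by blast
    have "Id K g \<in> factoring K S' g g" using factoring_iso[OF g'(2,1)] .
    then show ?thesis
    proof (rule factoring_trans[rotated 4])
      fix h assume h: "h \<in> S'"
      then have "L h \<subseteq> LL" by (auto simp: LL_def)
      then show "Id K h \<in> factoring K LL h h" using L[of h] fin(2) h factoring_mono by blast
    qed (use g S fin(2) LLO in auto)
  qed
  show "finite ({F. indecomposable K' F} // {(F, G). isomorphic K' F G})"
  proof (rule K'.finite_quotientI[OF LL(1)])
    fix x assume x: "x \<in> {F. indecomposable K' F}"
    then have xx: "x \<in> Obj K" "Id K x \<in> factoring K S x x" by (auto simp: indecomposable_def K'_def ac)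
    then have "Id K x \<in> factoring K LL x x" using factoring_trans[OF xx(1,1) LLO S xx(2) IdS] by blast
    then show "\<exists>g\<in>LL. isomorphic K' x g"
      using K'.indecomposable_isomorphic_local[OF split' _ LL(2)] x by (auto simp: K'_def)
  qed
  assume "F \<in> Obj K'" "G \<in> Obj K'"
  then have FG: "F \<in> Obj K" "G \<in> Obj K" "Id K F \<in> factoring K S F F" by (auto simp: K'_def ac)
  then obtain n where n: "separated (Hom K F G) (Mor K F G) n" using separated_Hom[OF FG(1,2) S] sep by blast
  interpret vspace "Hom K F G" using FG by (intro Hom_vspace)
  show "finitely_generated base_field (Hom K' F G)"
    unfolding K'_def using separated_finitely_generated[OF n] by simp
qed

end

section \<open>Functor categories\<close>

lemma functor_category_simps [simp]:
  "Obj (functor_category C D) = {F. linear_functor C D F}"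
  "Mor (functor_category C D) F G = natural_transformations C D F G"
  "\<zero>\<^bsub>Hom (functor_category C D) F G\<^esub> = (\<lambda>a\<in>Obj C. \<zero>\<^bsub>Hom D (fobj F a) (fobj G a)\<^esub>)"
  "\<eta> \<oplus>\<^bsub>Hom (functor_category C D) F G\<^esub> \<zeta> = (\<lambda>a\<in>Obj C. \<eta> a \<oplus>\<^bsub>Hom D (fobj F a) (fobj G a)\<^esub> \<zeta> a)"
  "c \<odot>\<^bsub>Hom (functor_category C D) F G\<^esub> \<eta> = (\<lambda>a\<in>Obj C. c \<odot>\<^bsub>Hom D (fobj F a) (fobj G a)\<^esub> \<eta> a)"
  "Comp (functor_category C D) F G H \<zeta> \<eta> =
    (\<lambda>a\<in>Obj C. Comp D (fobj F a) (fobj G a) (fobj H a) (\<zeta> a) (\<eta> a))"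
  "Id (functor_category C D) F = (\<lambda>a\<in>Obj C. Id D (fobj F a))"
  by (simp_all add: functor_category_def)

lemma natural_transformations_iff:
  "\<eta> \<in> natural_transformations C D F G \<longleftrightarrow> \<eta> \<in> extensional (Obj C) \<and>
    (\<forall>a\<in>Obj C. \<eta> a \<in> Mor D (fobj F a) (fobj G a)) \<and>
    (\<forall>a\<in>Obj C. \<forall>b\<in>Obj C. \<forall>f\<in>Mor C a b.
        Comp D (fobj F a) (fobj F b) (fobj G b) (\<eta> b) (fmor F a b f) =
        Comp D (fobj F a) (fobj G a) (fobj G b) (fmor G a b f) (\<eta> a))"
  by (auto simp: natural_transformations_def PiE_def)

lemma natural_transformation_closed:
  "\<eta> \<in> natural_transformations C D F G \<Longrightarrow> a \<in> Obj C \<Longrightarrow> \<eta> a \<in> Mor D (fobj F a) (fobj G a)"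
  by (auto simp: natural_transformations_iff)

lemma natural_transformation_natural:
  "\<eta> \<in> natural_transformations C D F G \<Longrightarrow> a \<in> Obj C \<Longrightarrow> b \<in> Obj C \<Longrightarrow> f \<in> Mor C a b \<Longrightarrow>
    Comp D (fobj F a) (fobj F b) (fobj G b) (\<eta> b) (fmor F a b f) =
    Comp D (fobj F a) (fobj G a) (fobj G b) (fmor G a b f) (\<eta> a)"
  by (auto simp: natural_transformations_iff)

lemma natural_transformation_ext:
  assumes "\<eta> \<in> natural_transformations C D F G" "\<zeta> \<in> natural_transformations C D F' G'"
    and "\<And>a. a \<in> Obj C \<Longrightarrow> \<eta> a = \<zeta> a"
  shows "\<eta> = \<zeta>"
  using assms by (auto simp: natural_transformations_iff intro: extensionalityI)

lemma linear_functor_obj: "linear_functor C D F \<Longrightarrow> a \<in> Obj C \<Longrightarrow> fobj F a \<in> Obj D"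
  using linear_functor.fobj_closed by (fastforce simp: PiE_def)

lemma linear_functor_mor:
  "linear_functor C D F \<Longrightarrow> a \<in> Obj C \<Longrightarrow> b \<in> Obj C \<Longrightarrow> f \<in> Mor C a b \<Longrightarrow>
    fmor F a b f \<in> Mor D (fobj F a) (fobj F b)"
  using linear_functor.fmor_closed by (fastforce simp: PiE_def)

lemma linear_functor_undefined:
  assumes "linear_functor C D F" "\<not> (a \<in> Obj C \<and> b \<in> Obj C \<and> f \<in> Mor C a b)"
  shows "fmor F a b f = undefined"
proof (cases "a \<in> Obj C \<and> b \<in> Obj C")
  case True
  then have "fmor F a b \<in> extensional (Mor C a b)" using linear_functor.fmor_closed[OF assms(1)] by (auto simp: PiE_def)
  then show ?thesis using True assms(2) by (auto simp: extensional_def)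
next
  case False
  then show ?thesis using linear_functor.fmor_undefined[OF assms(1), of a b] by auto
qed

text \<open>The record tests membership explicitly so that it is extensional. Evaluating it at an
  identity, a composite, a sum or a multiple therefore uses closure of the source category under
  these operations, which the last four assumptions provide.\<close>

lemma linear_functorI:
  fixes C :: "('k, 'o, 'h) lincat" and D :: "('k, 'p, 'g) lincat"
  assumes "\<And>a. a \<in> Obj C \<Longrightarrow> Fo a \<in> Obj D"
    and "\<And>a b f. a \<in> Obj C \<Longrightarrow> b \<in> Obj C \<Longrightarrow> f \<in> Mor C a b \<Longrightarrow> Fm a b f \<in> Mor D (Fo a) (Fo b)"
    and "\<And>a. a \<in> Obj C \<Longrightarrow> Fm a a (Id C a) = Id D (Fo a)"
    and "\<And>a b c f g. a \<in> Obj C \<Longrightarrow> b \<in> Obj C \<Longrightarrow> c \<in> Obj C \<Longrightarrow> f \<in> Mor C a b \<Longrightarrow> g \<in> Mor C b c \<Longrightarrow>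
      Fm a c (Comp C a b c g f) = Comp D (Fo a) (Fo b) (Fo c) (Fm b c g) (Fm a b f)"
    and "\<And>a b f g. a \<in> Obj C \<Longrightarrow> b \<in> Obj C \<Longrightarrow> f \<in> Mor C a b \<Longrightarrow> g \<in> Mor C a b \<Longrightarrow>
      Fm a b (f \<oplus>\<^bsub>Hom C a b\<^esub> g) = Fm a b f \<oplus>\<^bsub>Hom D (Fo a) (Fo b)\<^esub> Fm a b g"
    and "\<And>a b f r. a \<in> Obj C \<Longrightarrow> b \<in> Obj C \<Longrightarrow> f \<in> Mor C a b \<Longrightarrow>
      Fm a b (r \<odot>\<^bsub>Hom C a b\<^esub> f) = r \<odot>\<^bsub>Hom D (Fo a) (Fo b)\<^esub> Fm a b f"
    and Id: "\<And>a. a \<in> Obj C \<Longrightarrow> Id C a \<in> Mor C a a"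
    and Comp: "\<And>a b c f g. a \<in> Obj C \<Longrightarrow> b \<in> Obj C \<Longrightarrow> c \<in> Obj C \<Longrightarrow> f \<in> Mor C a b \<Longrightarrow> g \<in> Mor C b c \<Longrightarrow>
      Comp C a b c g f \<in> Mor C a c"
    and add: "\<And>a b f g. a \<in> Obj C \<Longrightarrow> b \<in> Obj C \<Longrightarrow> f \<in> Mor C a b \<Longrightarrow> g \<in> Mor C a b \<Longrightarrow>
      f \<oplus>\<^bsub>Hom C a b\<^esub> g \<in> Mor C a b"
    and smult: "\<And>a b f r. a \<in> Obj C \<Longrightarrow> b \<in> Obj C \<Longrightarrow> f \<in> Mor C a b \<Longrightarrow> r \<odot>\<^bsub>Hom C a b\<^esub> f \<in> Mor C a b"
  shows "linear_functor C D \<lparr>fobj = (\<lambda>a\<in>Obj C. Fo a),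
     fmor = (\<lambda>a b f. if a \<in> Obj C \<and> b \<in> Obj C \<and> f \<in> Mor C a b then Fm a b f else undefined)\<rparr>"
  by (intro linear_functor.intro) (use assms in \<open>auto simp: PiE_def extensional_def\<close>)

locale linear_categories = C: linear_category C + D: linear_category D
  for C :: "('k::field, 'o, 'h) lincat" and D :: "('k, 'p, 'g) lincat"
begin

lemmas lf_simps [simp] = linear_functor_obj[of C D] linear_functor_mor[of C D]
  natural_transformation_closed[of _ C D]

text \<open>All structure is componentwise, and extensionality on \<open>Obj C\<close> turns
  equality of components into equality of transformations. Naturality of sums and multiples comes
  from bilinearity of composition in \<open>D\<close>.\<close>

lemma linear_functor_category: "linear_category (functor_category C D)"
proof (intro linear_category.intro category.intro linear_category_axioms.intro)
  fix F G H I \<eta> \<zeta> \<xi>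
  assume "F \<in> Obj (functor_category C D)" "G \<in> Obj (functor_category C D)"
  then have F: "linear_functor C D F" "linear_functor C D G" by auto
  show "Id (functor_category C D) F \<in> Mor (functor_category C D) F F"
    using F by (auto simp: natural_transformations_iff)
  show "Module.module base_field (Hom (functor_category C D) F G)"
  proof (rule moduleI[OF cring_base_field])
    show "abelian_group (Hom (functor_category C D) F G)"
    proof (rule abelian_groupI)
      fix \<eta> assume "\<eta> \<in> carrier (Hom (functor_category C D) F G)"
      then have \<eta>: "\<eta> \<in> natural_transformations C D F G" by simp
      then show "\<exists>\<zeta>\<in>carrier (Hom (functor_category C D) F G). \<zeta> \<oplus>\<^bsub>Hom (functor_category C D) F G\<^esub> \<eta> =
          \<zero>\<^bsub>Hom (functor_category C D) F G\<^esub>"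
        using F by (intro bexI[of _ "\<lambda>a\<in>Obj C. (-1) \<odot>\<^bsub>Hom D (fobj F a) (fobj G a)\<^esub> \<eta> a"])
          (auto simp: natural_transformations_iff D.Comp_smult D.Hom_commute[of _ _ "_ \<odot>\<^bsub>_\<^esub> _"] D.Hom_neg
            intro!: restrict_ext)
    qed (use F in \<open>auto simp: natural_transformations_iff D.Comp_add_left D.Comp_add_right D.Hom_assoc
        intro!: restrict_ext extensionalityI[of _ "Obj C"] intro: D.Hom_commute\<close>)
  next
    fix c d :: 'k and \<eta> \<zeta>
    have v: "vspace (Hom D (fobj F a) (fobj G a))" if "a \<in> Obj C" for a
      using F that by (intro D.Hom_vspace) auto
    { assume "\<eta> \<in> carrier (Hom (functor_category C D) F G)"
      then have \<eta>: "\<eta> \<in> natural_transformations C D F G" by simp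
      show "c \<odot>\<^bsub>Hom (functor_category C D) F G\<^esub> \<eta> \<in> carrier (Hom (functor_category C D) F G)"
        using \<eta> F by (auto simp: natural_transformations_iff D.Comp_smult)
      show "(c \<oplus>\<^bsub>base_field\<^esub> d) \<odot>\<^bsub>Hom (functor_category C D) F G\<^esub> \<eta> =
          c \<odot>\<^bsub>Hom (functor_category C D) F G\<^esub> \<eta> \<oplus>\<^bsub>Hom (functor_category C D) F G\<^esub> d \<odot>\<^bsub>Hom (functor_category C D) F G\<^esub> \<eta>"
        using \<eta> F by (auto simp: vspace.vs_add_smult[OF v] intro!: restrict_ext)
      show "(c \<otimes>\<^bsub>base_field\<^esub> d) \<odot>\<^bsub>Hom (functor_category C D) F G\<^esub> \<eta> =
          c \<odot>\<^bsub>Hom (functor_category C D) F G\<^esub> (d \<odot>\<^bsub>Hom (functor_category C D) F G\<^esub> \<eta>)"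
        using \<eta> F by (auto simp: vspace.vs_smult_smult[OF v] intro!: restrict_ext)
      show "\<one>\<^bsub>base_field\<^esub> \<odot>\<^bsub>Hom (functor_category C D) F G\<^esub> \<eta> = \<eta>"
        using \<eta> F by (auto simp: natural_transformations_iff intro!: extensionalityI[of _ "Obj C"])
      assume "\<zeta> \<in> carrier (Hom (functor_category C D) F G)"
      then have \<zeta>: "\<zeta> \<in> natural_transformations C D F G" by simp
      show "c \<odot>\<^bsub>Hom (functor_category C D) F G\<^esub> (\<eta> \<oplus>\<^bsub>Hom (functor_category C D) F G\<^esub> \<zeta>) =
        c \<odot>\<^bsub>Hom (functor_category C D) F G\<^esub> \<eta> \<oplus>\<^bsub>Hom (functor_category C D) F G\<^esub> c \<odot>\<^bsub>Hom (functor_category C D) F G\<^esub> \<zeta>"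
        using \<eta> \<zeta> F by (auto simp: vspace.vs_smult_add[OF v] intro!: restrict_ext) }
  qed
  { assume "\<eta> \<in> Mor (functor_category C D) F G"
    then have \<eta>: "\<eta> \<in> natural_transformations C D F G" by simp
    show "Comp (functor_category C D) F F G \<eta> (Id (functor_category C D) F) = \<eta>"
      using F \<eta> by (auto simp: natural_transformations_iff intro!: extensionalityI[of _ "Obj C"])
    show "Comp (functor_category C D) F G G (Id (functor_category C D) G) \<eta> = \<eta>"
      using F \<eta> by (auto simp: natural_transformations_iff intro!: extensionalityI[of _ "Obj C"])
    assume "H \<in> Obj (functor_category C D)" "\<zeta> \<in> Mor (functor_category C D) G H"
    then have H: "linear_functor C D H" "\<zeta> \<in> natural_transformations C D G H" by auto
    show "Comp (functor_category C D) F G H \<zeta> \<eta> \<in> Mor (functor_category C D) F H"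
    proof -
      have "Comp D (fobj F a) (fobj F b) (fobj H b) (Comp D (fobj F b) (fobj G b) (fobj H b) (\<zeta> b) (\<eta> b)) (fmor F a b f) =
         Comp D (fobj F a) (fobj H a) (fobj H b) (fmor H a b f) (Comp D (fobj F a) (fobj G a) (fobj H a) (\<zeta> a) (\<eta> a))"
        if ab: "a \<in> Obj C" "b \<in> Obj C" "f \<in> Mor C a b" for a b f
      proof -
        have "Comp D (fobj F a) (fobj F b) (fobj H b) (Comp D (fobj F b) (fobj G b) (fobj H b) (\<zeta> b) (\<eta> b)) (fmor F a b f)
          = Comp D (fobj F a) (fobj G b) (fobj H b) (\<zeta> b) (Comp D (fobj F a) (fobj F b) (fobj G b) (\<eta> b) (fmor F a b f))"
          using ab F H \<eta> by (simp add: D.Comp_assoc)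
        also have "\<dots> = Comp D (fobj F a) (fobj G a) (fobj H b) (Comp D (fobj G a) (fobj G b) (fobj H b) (\<zeta> b) (fmor G a b f)) (\<eta> a)"
          using ab F H \<eta> by (simp add: D.Comp_assoc natural_transformation_natural[OF \<eta>])
        finally show ?thesis using ab F H \<eta> by (simp add: D.Comp_assoc natural_transformation_natural[OF H(2)])
      qed
      then show ?thesis using F H \<eta> by (auto simp: natural_transformations_iff[of _ C D F H])
    qed
    assume "I \<in> Obj (functor_category C D)" "\<xi> \<in> Mor (functor_category C D) H I"
    then have I: "linear_functor C D I" "\<xi> \<in> natural_transformations C D H I" by auto
    show "Comp (functor_category C D) F H I \<xi> (Comp (functor_category C D) F G H \<zeta> \<eta>) =
      Comp (functor_category C D) F G I (Comp (functor_category C D) G H I \<xi> \<zeta>) \<eta>"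
      using F H I \<eta> by (auto simp: D.Comp_assoc intro!: restrict_ext) }
  assume "H \<in> Obj (functor_category C D)"
  then have H: "linear_functor C D H" by simp
  then show "bilinear_map (Hom (functor_category C D) G H) (Hom (functor_category C D) F G)
       (Hom (functor_category C D) F H) (Comp (functor_category C D) F G H)"
    unfolding bilinear_map_def using F
    by (auto simp: D.Comp_add_left D.Comp_add_right D.Comp_smult intro!: restrict_ext)
qed

text \<open>A splitting is chosen for each component separately. \<open>F\<close> conjugated by the
  chosen maps acts on the chosen objects, and naturality of \<open>e\<close> makes this action
  functorial and the choices natural.\<close>

lemma functor_category_split:
  assumes split: "idempotent_split D" shows "idempotent_split (functor_category C D)"
  unfolding idempotent_split_def
proof (intro ballI impI)
  fix F e assume "F \<in> Obj (functor_category C D)" "e \<in> Mor (functor_category C D) F F"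
    and ee: "Comp (functor_category C D) F F F e e = e"
  then have F: "linear_functor C D F" and e: "e \<in> natural_transformations C D F F" by auto
  have "\<exists>yrs. fst yrs \<in> Obj D \<and> fst (snd yrs) \<in> Mor D (fobj F a) (fst yrs) \<and> snd (snd yrs) \<in> Mor D (fst yrs) (fobj F a) \<and>
     Comp D (fobj F a) (fst yrs) (fobj F a) (snd (snd yrs)) (fst (snd yrs)) = e a \<and>
     Comp D (fst yrs) (fobj F a) (fst yrs) (fst (snd yrs)) (snd (snd yrs)) = Id D (fst yrs)" if a: "a \<in> Obj C" for a
  proof -
    have "Comp D (fobj F a) (fobj F a) (fobj F a) (e a) (e a) = e a"
      using fun_cong[OF ee, of a] a by simp
    then obtain y r s where "y \<in> Obj D" "r \<in> Mor D (fobj F a) y" "s \<in> Mor D y (fobj F a)"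
      "Comp D (fobj F a) y (fobj F a) s r = e a" "Comp D y (fobj F a) y r s = Id D y"
      using split F e a unfolding idempotent_split_def by (meson lf_simps)
    then show ?thesis by (intro exI[of _ "(y, r, s)"]) simp
  qed
  then obtain yrs where yrs: "\<And>a. a \<in> Obj C \<Longrightarrow> fst (yrs a) \<in> Obj D \<and> fst (snd (yrs a)) \<in> Mor D (fobj F a) (fst (yrs a)) \<and> snd (snd (yrs a)) \<in> Mor D (fst (yrs a)) (fobj F a) \<and>
     Comp D (fobj F a) (fst (yrs a)) (fobj F a) (snd (snd (yrs a))) (fst (snd (yrs a))) = e a \<and>
     Comp D (fst (yrs a)) (fobj F a) (fst (yrs a)) (fst (snd (yrs a))) (snd (snd (yrs a))) = Id D (fst (yrs a))"
    by metis
  define y r s where "y a = fst (yrs a)" and "r a = fst (snd (yrs a))" and "s a = snd (snd (yrs a))" for a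
  have y [simp]: "y a \<in> Obj D" "r a \<in> Mor D (fobj F a) (y a)" "s a \<in> Mor D (y a) (fobj F a)" if "a \<in> Obj C" for a
    using yrs[OF that] by (auto simp: y_def r_def s_def)
  have sr: "Comp D (fobj F a) (y a) (fobj F a) (s a) (r a) = e a"
    and rs: "Comp D (y a) (fobj F a) (y a) (r a) (s a) = Id D (y a)" if "a \<in> Obj C" for a
    using yrs[OF that] by (auto simp: y_def r_def s_def)
  have re: "Comp D (fobj F a) (fobj F a) (y a) (r a) (e a) = r a"
    and es: "Comp D (y a) (fobj F a) (fobj F a) (e a) (s a) = s a" if a: "a \<in> Obj C" for a
    using a F e by (simp_all add: sr[symmetric] D.Comp_assoc rs) (simp add: D.Comp_assoc[symmetric] rs)
  \<comment> \<open>\<open>F f\<close> is restricted along \<open>s\<close> and projected along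
    \<open>r\<close>. Since \<open>s r = e\<close> commutes with \<open>F f\<close> and is absorbed
    by \<open>r\<close> and \<open>s\<close>, inserting it between two such maps changes
    nothing.\<close>
  define Gm where "Gm a b f = Comp D (y a) (fobj F b) (y b) (r b) (Comp D (y a) (fobj F a) (fobj F b) (fmor F a b f) (s a))" for a b f
  define G where "G = \<lparr>fobj = (\<lambda>a\<in>Obj C. y a),
     fmor = (\<lambda>a b f. if a \<in> Obj C \<and> b \<in> Obj C \<and> f \<in> Mor C a b then Gm a b f else undefined)\<rparr>"
  have rnat: "Comp D (fobj F a) (fobj F b) (y b) (r b) (fmor F a b f) = Comp D (fobj F a) (y a) (y b) (Gm a b f) (r a)"
    if ab: "a \<in> Obj C" "b \<in> Obj C" "f \<in> Mor C a b" for a b f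
  proof -
    have "Comp D (fobj F a) (y a) (y b) (Gm a b f) (r a)
      = Comp D (fobj F a) (fobj F b) (y b) (r b) (Comp D (fobj F a) (fobj F a) (fobj F b) (fmor F a b f) (Comp D (fobj F a) (y a) (fobj F a) (s a) (r a)))"
      using ab F by (simp add: Gm_def D.Comp_assoc)
    also have "\<dots> = Comp D (fobj F a) (fobj F b) (y b) (r b) (Comp D (fobj F a) (fobj F b) (fobj F b) (e b) (fmor F a b f))"
      using ab by (simp add: sr natural_transformation_natural[OF e])
    also have "\<dots> = Comp D (fobj F a) (fobj F b) (y b) (Comp D (fobj F b) (fobj F b) (y b) (r b) (e b)) (fmor F a b f)"
      using ab F e by (simp add: D.Comp_assoc)
    finally show ?thesis using ab by (simp add: re)
  qed
  have snat: "Comp D (y a) (y b) (fobj F b) (s b) (Gm a b f) = Comp D (y a) (fobj F a) (fobj F b) (fmor F a b f) (s a)"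
    if ab: "a \<in> Obj C" "b \<in> Obj C" "f \<in> Mor C a b" for a b f
  proof -
    have "Comp D (y a) (y b) (fobj F b) (s b) (Gm a b f)
      = Comp D (y a) (fobj F a) (fobj F b) (Comp D (fobj F a) (fobj F b) (fobj F b) (Comp D (fobj F b) (y b) (fobj F b) (s b) (r b)) (fmor F a b f)) (s a)"
      using ab F by (simp add: Gm_def D.Comp_assoc)
    also have "\<dots> = Comp D (y a) (fobj F a) (fobj F b) (Comp D (fobj F a) (fobj F a) (fobj F b) (fmor F a b f) (e a)) (s a)"
      using ab by (simp add: sr natural_transformation_natural[OF e])
    also have "\<dots> = Comp D (y a) (fobj F a) (fobj F b) (fmor F a b f) (Comp D (y a) (fobj F a) (fobj F a) (e a) (s a))"
      using ab F e by (simp add: D.Comp_assoc)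
    finally show ?thesis using ab by (simp add: es)
  qed
  have G: "linear_functor C D G"
    unfolding G_def
  proof (rule linear_functorI)
    fix a b c f g assume ab: "a \<in> Obj C" "b \<in> Obj C" "c \<in> Obj C" "f \<in> Mor C a b" "g \<in> Mor C b c"
    have "Comp D (y a) (y b) (y c) (Gm b c g) (Gm a b f) =
      Comp D (y a) (fobj F c) (y c) (r c) (Comp D (y a) (fobj F b) (fobj F c) (fmor F b c g) (Comp D (y a) (y b) (fobj F b) (s b) (Gm a b f)))"
      unfolding Gm_def[of b c] using ab F by (simp add: D.Comp_assoc Gm_def)
    also have "\<dots> = Comp D (y a) (fobj F c) (y c) (r c) (Comp D (y a) (fobj F b) (fobj F c) (fmor F b c g)
        (Comp D (y a) (fobj F a) (fobj F b) (fmor F a b f) (s a)))"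
      using ab by (simp only: snat)
    also have "\<dots> = Gm a c (Comp C a b c g f)"
      using ab F by (simp add: Gm_def linear_functor.fmor_Comp[OF F] D.Comp_assoc)
    finally show "Gm a c (Comp C a b c g f) = Comp D (y a) (y b) (y c) (Gm b c g) (Gm a b f)" by simp
  qed (use F in \<open>auto simp: Gm_def linear_functor.fmor_add[OF F] linear_functor.fmor_smult[OF F]
      linear_functor.fmor_Id[OF F] D.Comp_add_left D.Comp_add_right D.Comp_smult rs\<close>)
  have GO: "fobj G a = y a" if "a \<in> Obj C" for a using that by (simp add: G_def)
  have GM: "fmor G a b f = Gm a b f" if "a \<in> Obj C" "b \<in> Obj C" "f \<in> Mor C a b" for a b f using that by (simp add: G_def)
  have "(\<lambda>a\<in>Obj C. r a) \<in> natural_transformations C D F G" "(\<lambda>a\<in>Obj C. s a) \<in> natural_transformations C D G F"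
    unfolding natural_transformations_iff using rnat snat by (auto simp: GO GM)
  moreover have "(\<lambda>a\<in>Obj C. Comp D (fobj F a) (fobj G a) (fobj F a) (s a) (r a)) = e"
    using e by (auto simp: GO sr natural_transformations_iff intro!: extensionalityI[of _ "Obj C"])
  moreover have "(\<lambda>a\<in>Obj C. Comp D (fobj G a) (fobj F a) (fobj G a) (r a) (s a)) = (\<lambda>a\<in>Obj C. Id D (fobj G a))"
    by (auto simp: GO rs intro!: restrict_ext)
  ultimately show "\<exists>y\<in>Obj (functor_category C D). \<exists>r\<in>Mor (functor_category C D) F y. \<exists>s\<in>Mor (functor_category C D) y F.
            Comp (functor_category C D) F y F s r = e \<and> Comp (functor_category C D) y F y r s = Id (functor_category C D) y"
    using G by (intro bexI[of _ G] bexI[of _ "\<lambda>a\<in>Obj C. r a"] bexI[of _ "\<lambda>a\<in>Obj C. s a"])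
      (auto simp: cong: restrict_cong)
qed

text \<open>Biproducts of the values are chosen object by object. The sum functor acts by the
  block-diagonal matrix with entries \<open>F f\<close> and \<open>G f\<close>, which makes the
  chosen injections and projections natural.\<close>

lemma functor_category_biproducts:
  assumes bi: "has_biproducts D" shows "has_biproducts (functor_category C D)"
proof -
  obtain z where z: "z \<in> Obj D" "Id D z = \<zero>\<^bsub>Hom D z z\<^esub>" using bi by (auto simp: has_biproducts_def)
  define Z where "Z = \<lparr>fobj = (\<lambda>a\<in>Obj C. z),
     fmor = (\<lambda>a b f. if a \<in> Obj C \<and> b \<in> Obj C \<and> f \<in> Mor C a b then \<zero>\<^bsub>Hom D z z\<^esub> else undefined)\<rparr>"
  have "linear_functor C D Z"
    unfolding Z_def by (rule linear_functorI)
      (use z vspace.vs_smult_right_zero[OF D.Hom_vspace[OF z(1,1)]] in auto)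
  moreover have "Id (functor_category C D) Z = \<zero>\<^bsub>Hom (functor_category C D) Z Z\<^esub>"
    using z by (auto simp: Z_def intro!: restrict_ext)
  moreover have "\<exists>s i j p q. biproduct (functor_category C D) F G s i j p q"
    if "linear_functor C D F" "linear_functor C D G" for F G
  proof -
    note FG = that
    have "\<forall>a\<in>Obj C. \<exists>s i j p q. biproduct D (fobj F a) (fobj G a) s i j p q"
      using FG bi by (auto simp: has_biproducts_def)
    then obtain t i j p q where "\<forall>a\<in>Obj C. biproduct D (fobj F a) (fobj G a) (t a) (i a) (j a) (p a) (q a)"
      by metis
    then have t [simp]: "t a \<in> Obj D" "i a \<in> Mor D (fobj F a) (t a)" "j a \<in> Mor D (fobj G a) (t a)"
        "p a \<in> Mor D (t a) (fobj F a)" "q a \<in> Mor D (t a) (fobj G a)"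
      and pi: "Comp D (fobj F a) (t a) (fobj F a) (p a) (i a) = Id D (fobj F a)"
      and qj: "Comp D (fobj G a) (t a) (fobj G a) (q a) (j a) = Id D (fobj G a)"
      and pj: "Comp D (fobj G a) (t a) (fobj F a) (p a) (j a) = \<zero>\<^bsub>Hom D (fobj G a) (fobj F a)\<^esub>"
      and qi: "Comp D (fobj F a) (t a) (fobj G a) (q a) (i a) = \<zero>\<^bsub>Hom D (fobj F a) (fobj G a)\<^esub>"
      and ip: "Comp D (t a) (fobj F a) (t a) (i a) (p a) \<oplus>\<^bsub>Hom D (t a) (t a)\<^esub> Comp D (t a) (fobj G a) (t a) (j a) (q a) = Id D (t a)"
      if "a \<in> Obj C" for a
      using that by (simp_all add: biproduct_def)
    \<comment> \<open>The two diagonal blocks are kept apart so that functoriality and linearity can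
      be verified for each of them before adding.\<close>
    define H1 H2 where "H1 a b f = Comp D (t a) (fobj F b) (t b) (i b) (Comp D (t a) (fobj F a) (fobj F b) (fmor F a b f) (p a))"
      and "H2 a b f = Comp D (t a) (fobj G b) (t b) (j b) (Comp D (t a) (fobj G a) (fobj G b) (fmor G a b f) (q a))" for a b f
    define Hm where "Hm a b f = H1 a b f \<oplus>\<^bsub>Hom D (t a) (t b)\<^esub> H2 a b f" for a b f
    define H where "H = \<lparr>fobj = (\<lambda>a\<in>Obj C. t a),
     fmor = (\<lambda>a b f. if a \<in> Obj C \<and> b \<in> Obj C \<and> f \<in> Mor C a b then Hm a b f else undefined)\<rparr>"
    have H12 [simp]: "H1 a b f \<in> Mor D (t a) (t b)" "H2 a b f \<in> Mor D (t a) (t b)"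
      if "a \<in> Obj C" "b \<in> Obj C" "f \<in> Mor C a b" for a b f
      using that FG by (simp_all add: H1_def H2_def)
    have pH: "Comp D (t a) (t b) (fobj F b) (p b) (Hm a b f) = Comp D (t a) (fobj F a) (fobj F b) (fmor F a b f) (p a)"
      if ab: "a \<in> Obj C" "b \<in> Obj C" "f \<in> Mor C a b" for a b f
      unfolding Hm_def using ab FG
      by (simp add: D.Comp_add_right) (simp add: H1_def H2_def D.Comp_assoc pi pj)
    have qH: "Comp D (t a) (t b) (fobj G b) (q b) (Hm a b f) = Comp D (t a) (fobj G a) (fobj G b) (fmor G a b f) (q a)"
      if ab: "a \<in> Obj C" "b \<in> Obj C" "f \<in> Mor C a b" for a b f
      unfolding Hm_def using ab FG
      by (simp add: D.Comp_add_right) (simp add: H1_def H2_def D.Comp_assoc qi qj)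
    have H1i: "Comp D (fobj F a) (t a) (t b) (H1 a b f) (i a) = Comp D (fobj F a) (fobj F b) (t b) (i b) (fmor F a b f)"
      and H2i: "Comp D (fobj F a) (t a) (t b) (H2 a b f) (i a) = \<zero>\<^bsub>Hom D (fobj F a) (t b)\<^esub>"
      and H1j: "Comp D (fobj G a) (t a) (t b) (H1 a b f) (j a) = \<zero>\<^bsub>Hom D (fobj G a) (t b)\<^esub>"
      and H2j: "Comp D (fobj G a) (t a) (t b) (H2 a b f) (j a) = Comp D (fobj G a) (fobj G b) (t b) (j b) (fmor G a b f)"
      if ab: "a \<in> Obj C" "b \<in> Obj C" "f \<in> Mor C a b" for a b f
      unfolding H1_def H2_def using ab FG
      by (simp_all add: D.Comp_assoc[symmetric] pi pj qi qj)
    have Hmi: "Comp D (fobj F a) (t a) (t b) (Hm a b f) (i a) = Comp D (fobj F a) (fobj F b) (t b) (i b) (fmor F a b f)"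
      if ab: "a \<in> Obj C" "b \<in> Obj C" "f \<in> Mor C a b" for a b f
      unfolding Hm_def using ab FG by (simp add: D.Comp_add_left H1i H2i)
    have Hmj: "Comp D (fobj G a) (t a) (t b) (Hm a b f) (j a) = Comp D (fobj G a) (fobj G b) (t b) (j b) (fmor G a b f)"
      if ab: "a \<in> Obj C" "b \<in> Obj C" "f \<in> Mor C a b" for a b f
      unfolding Hm_def using ab FG by (simp add: D.Comp_add_left H1j H2j)
    have H: "linear_functor C D H"
      unfolding H_def
    proof (rule linear_functorI)
      show "Hm a b f \<in> Mor D (t a) (t b)" if "a \<in> Obj C" "b \<in> Obj C" "f \<in> Mor C a b" for a b f
        using that by (simp add: Hm_def)
      show "Hm a a (Id C a) = Id D (t a)" if "a \<in> Obj C" for a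
        using that FG ip by (simp add: Hm_def H1_def H2_def linear_functor.fmor_Id)
      show "Hm a c (Comp C a b c g f) = Comp D (t a) (t b) (t c) (Hm b c g) (Hm a b f)"
        if ab: "a \<in> Obj C" "b \<in> Obj C" "c \<in> Obj C" "f \<in> Mor C a b" "g \<in> Mor C b c" for a b c f g
      proof -
        have HM: "Hm a b f \<in> Mor D (t a) (t b)" using ab by (simp add: Hm_def)
        have 1: "Comp D (t a) (t b) (t c) (H1 b c g) (Hm a b f) = H1 a c (Comp C a b c g f)"
        proof -
          have "Comp D (t a) (t b) (t c) (H1 b c g) (Hm a b f) =
            Comp D (t a) (fobj F c) (t c) (i c) (Comp D (t a) (fobj F b) (fobj F c) (fmor F b c g) (Comp D (t a) (t b) (fobj F b) (p b) (Hm a b f)))"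
            using ab FG HM by (simp add: H1_def D.Comp_assoc)
          also have "\<dots> = H1 a c (Comp C a b c g f)"
            using ab FG by (simp add: pH H1_def linear_functor.fmor_Comp[OF FG(1)] D.Comp_assoc)
          finally show ?thesis .
        qed
        have 2: "Comp D (t a) (t b) (t c) (H2 b c g) (Hm a b f) = H2 a c (Comp C a b c g f)"
        proof -
          have "Comp D (t a) (t b) (t c) (H2 b c g) (Hm a b f) =
            Comp D (t a) (fobj G c) (t c) (j c) (Comp D (t a) (fobj G b) (fobj G c) (fmor G b c g) (Comp D (t a) (t b) (fobj G b) (q b) (Hm a b f)))"
            using ab FG HM by (simp add: H2_def D.Comp_assoc)
          also have "\<dots> = H2 a c (Comp C a b c g f)"
            using ab FG by (simp add: qH H2_def linear_functor.fmor_Comp[OF FG(2)] D.Comp_assoc)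
          finally show ?thesis .
        qed
        show ?thesis unfolding Hm_def[of b c] Hm_def[of a c]
          using ab HM 1 2 by (simp add: D.Comp_add_left)
      qed
      show "Hm a b (f \<oplus>\<^bsub>Hom C a b\<^esub> g) = Hm a b f \<oplus>\<^bsub>Hom D (t a) (t b)\<^esub> Hm a b g"
        if ab: "a \<in> Obj C" "b \<in> Obj C" "f \<in> Mor C a b" "g \<in> Mor C a b" for a b f g
      proof -
        interpret vspace "Hom D (t a) (t b)" using ab by (intro D.Hom_vspace) auto
        have "H1 a b (f \<oplus>\<^bsub>Hom C a b\<^esub> g) = H1 a b f \<oplus>\<^bsub>Hom D (t a) (t b)\<^esub> H1 a b g"
          "H2 a b (f \<oplus>\<^bsub>Hom C a b\<^esub> g) = H2 a b f \<oplus>\<^bsub>Hom D (t a) (t b)\<^esub> H2 a b g"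
          using ab FG by (simp_all add: H1_def H2_def linear_functor.fmor_add[OF FG(1)] linear_functor.fmor_add[OF FG(2)]
              D.Comp_add_left D.Comp_add_right)
        then show ?thesis using ab by (simp add: Hm_def M.add.m_ac)
      qed
      show "Hm a b (c \<odot>\<^bsub>Hom C a b\<^esub> f) = c \<odot>\<^bsub>Hom D (t a) (t b)\<^esub> Hm a b f"
        if ab: "a \<in> Obj C" "b \<in> Obj C" "f \<in> Mor C a b" for a b f c
      proof -
        interpret vspace "Hom D (t a) (t b)" using ab by (intro D.Hom_vspace) auto
        have "H1 a b (c \<odot>\<^bsub>Hom C a b\<^esub> f) = c \<odot>\<^bsub>Hom D (t a) (t b)\<^esub> H1 a b f"
          "H2 a b (c \<odot>\<^bsub>Hom C a b\<^esub> f) = c \<odot>\<^bsub>Hom D (t a) (t b)\<^esub> H2 a b f"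
          using ab FG by (simp_all add: H1_def H2_def linear_functor.fmor_smult[OF FG(1)] linear_functor.fmor_smult[OF FG(2)]
              D.Comp_smult)
        then show ?thesis using ab by (simp add: Hm_def vs_smult_add)
      qed
    qed auto
    have HO: "fobj H a = t a" if "a \<in> Obj C" for a using that by (simp add: H_def)
    have HM: "fmor H a b f = Hm a b f" if "a \<in> Obj C" "b \<in> Obj C" "f \<in> Mor C a b" for a b f using that by (simp add: H_def)
    have "biproduct (functor_category C D) F G H (\<lambda>a\<in>Obj C. i a) (\<lambda>a\<in>Obj C. j a) (\<lambda>a\<in>Obj C. p a) (\<lambda>a\<in>Obj C. q a)"
      unfolding biproduct_def using FG H
      by (auto simp: natural_transformations_iff HO HM pH qH Hmi Hmj pi pj qi qj ip intro!: restrict_ext)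
    then show ?thesis by blast
  qed
  ultimately show ?thesis unfolding has_biproducts_def by auto
qed

end

section \<open>The 2-category of endofunctors\<close>

lemma compose_functors_simps [simp]:
  "a \<in> Obj C \<Longrightarrow> fobj (compose_functors C G F) a = fobj G (fobj F a)"
  "a \<in> Obj C \<Longrightarrow> b \<in> Obj C \<Longrightarrow> f \<in> Mor C a b \<Longrightarrow>
    fmor (compose_functors C G F) a b f = fmor G (fobj F a) (fobj F b) (fmor F a b f)"
  "a \<in> Obj C \<Longrightarrow> fobj (identity_functor C) a = a"
  "a \<in> Obj C \<Longrightarrow> b \<in> Obj C \<Longrightarrow> f \<in> Mor C a b \<Longrightarrow> fmor (identity_functor C) a b f = f"
  by (simp_all add: compose_functors_def identity_functor_def)

context linear_category
begin

interpretation KK: linear_categories K K ..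

lemma linear_compose_functors:
  assumes F: "linear_functor K K F" and G: "linear_functor K K G"
  shows "linear_functor K K (compose_functors K G F)"
  unfolding compose_functors_def
  by (rule linear_functorI)
    (use F G in \<open>auto simp: linear_functor.fmor_add linear_functor.fmor_smult linear_functor.fmor_Id linear_functor.fmor_Comp\<close>)

lemma linear_identity_functor: "linear_functor K K (identity_functor K)"
  unfolding identity_functor_def by (rule linear_functorI) auto

lemma compose_functors_assoc:
  assumes F: "linear_functor K K F" and G: "linear_functor K K G"
  shows "compose_functors K H (compose_functors K G F) = compose_functors K (compose_functors K H G) F"
  by (rule cfunctor.equality) (use F G in \<open>auto simp: compose_functors_def fun_eq_iff\<close>)

text \<open>The unit laws hold as equalities of records and not merely up to isomorphism, because
  functors are \<open>undefined\<close> outside their domain and composition restores exactly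
  that.\<close>

lemma compose_identity_functor:
  assumes F: "linear_functor K K F"
  shows "compose_functors K F (identity_functor K) = F" "compose_functors K (identity_functor K) F = F"
proof -
  have "fobj F a = undefined" if "a \<notin> Obj K" for a
    using linear_functor.fobj_closed[OF F] that by (auto simp: PiE_def extensional_def)
  moreover have "fmor F a b f = undefined" if "\<not> (a \<in> Obj K \<and> b \<in> Obj K \<and> f \<in> Mor K a b)" for a b f
    using linear_functor_undefined[OF F that] .
  ultimately have
    "fobj (compose_functors K F (identity_functor K)) = fobj F" "fmor (compose_functors K F (identity_functor K)) = fmor F"
    "fobj (compose_functors K (identity_functor K) F) = fobj F" "fmor (compose_functors K (identity_functor K) F) = fmor F"
    using F by (auto simp: compose_functors_def identity_functor_def fun_eq_iff)
  then show "compose_functors K F (identity_functor K) = F" "compose_functors K (identity_functor K) F = F"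
    by (auto intro: cfunctor.equality)
qed

text \<open>Naturality of \<open>\<alpha>\<close> is applied inside \<open>G\<close>, and naturality
  of \<open>\<beta>\<close> at the morphism \<open>F' f\<close>.\<close>

lemma horizontal_composite_natural:
  assumes F: "linear_functor K K F" "linear_functor K K F'" "linear_functor K K G" "linear_functor K K G'"
    and \<alpha>: "\<alpha> \<in> natural_transformations K K F F'" and \<beta>: "\<beta> \<in> natural_transformations K K G G'"
  shows "horizontal_composite K K K F F' G G' \<beta> \<alpha> \<in>
    natural_transformations K K (compose_functors K G F) (compose_functors K G' F')"
proof -
  have "Comp K (fobj G (fobj F a)) (fobj G (fobj F b)) (fobj G' (fobj F' b))
      (Comp K (fobj G (fobj F b)) (fobj G (fobj F' b)) (fobj G' (fobj F' b)) (\<beta> (fobj F' b)) (fmor G (fobj F b) (fobj F' b) (\<alpha> b)))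
      (fmor G (fobj F a) (fobj F b) (fmor F a b f))
    = Comp K (fobj G (fobj F a)) (fobj G' (fobj F' a)) (fobj G' (fobj F' b)) (fmor G' (fobj F' a) (fobj F' b) (fmor F' a b f))
      (Comp K (fobj G (fobj F a)) (fobj G (fobj F' a)) (fobj G' (fobj F' a)) (\<beta> (fobj F' a)) (fmor G (fobj F a) (fobj F' a) (\<alpha> a)))"
    if ab: "a \<in> Obj K" "b \<in> Obj K" "f \<in> Mor K a b" for a b f
  proof -
    have "Comp K (fobj G (fobj F a)) (fobj G (fobj F b)) (fobj G' (fobj F' b))
      (Comp K (fobj G (fobj F b)) (fobj G (fobj F' b)) (fobj G' (fobj F' b)) (\<beta> (fobj F' b)) (fmor G (fobj F b) (fobj F' b) (\<alpha> b)))
      (fmor G (fobj F a) (fobj F b) (fmor F a b f))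
      = Comp K (fobj G (fobj F a)) (fobj G (fobj F' b)) (fobj G' (fobj F' b)) (\<beta> (fobj F' b))
         (fmor G (fobj F a) (fobj F' b) (Comp K (fobj F a) (fobj F b) (fobj F' b) (\<alpha> b) (fmor F a b f)))"
      using ab F \<alpha> \<beta> by (simp add: linear_functor.fmor_Comp[OF F(3)] Comp_assoc)
    also have "\<dots> = Comp K (fobj G (fobj F a)) (fobj G (fobj F' a)) (fobj G' (fobj F' b))
        (Comp K (fobj G (fobj F' a)) (fobj G (fobj F' b)) (fobj G' (fobj F' b)) (\<beta> (fobj F' b)) (fmor G (fobj F' a) (fobj F' b) (fmor F' a b f)))
        (fmor G (fobj F a) (fobj F' a) (\<alpha> a))"
      using ab F \<alpha> \<beta> by (simp add: natural_transformation_natural[OF \<alpha>] linear_functor.fmor_Comp[OF F(3)] Comp_assoc)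
    finally show ?thesis
      using ab F \<alpha> \<beta>
      by (simp add: natural_transformation_natural[OF \<beta>, of "fobj F' a" "fobj F' b" "fmor F' a b f"] Comp_assoc)
  qed
  then show ?thesis
    using F \<alpha> \<beta> by (auto simp: natural_transformations_iff[of _ K K "compose_functors K G F"] horizontal_composite_def)
qed

text \<open>The point is to exchange \<open>\<beta>\<close> with the image of
  \<open>\<alpha>'\<close>, which is naturality of \<open>\<beta>\<close> at the component of
  \<open>\<alpha>'\<close>; the rest is functoriality and associativity.\<close>

lemma horizontal_composite_interchange:
  assumes F: "linear_functor K K F" "linear_functor K K F'" "linear_functor K K F''"
      "linear_functor K K G" "linear_functor K K G'" "linear_functor K K G''"
    and \<alpha>: "\<alpha> \<in> natural_transformations K K F F'" "\<alpha>' \<in> natural_transformations K K F' F''"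
    and \<beta>: "\<beta> \<in> natural_transformations K K G G'" "\<beta>' \<in> natural_transformations K K G' G''"
  shows "horizontal_composite K K K F F'' G G''
      (Comp (functor_category K K) G G' G'' \<beta>' \<beta>) (Comp (functor_category K K) F F' F'' \<alpha>' \<alpha>) =
    Comp (functor_category K K) (compose_functors K G F) (compose_functors K G' F') (compose_functors K G'' F'')
      (horizontal_composite K K K F' F'' G' G'' \<beta>' \<alpha>') (horizontal_composite K K K F F' G G' \<beta> \<alpha>)"
proof -
  have "Comp K (fobj G (fobj F a)) (fobj G (fobj F'' a)) (fobj G'' (fobj F'' a))
      (Comp K (fobj G (fobj F'' a)) (fobj G' (fobj F'' a)) (fobj G'' (fobj F'' a)) (\<beta>' (fobj F'' a)) (\<beta> (fobj F'' a)))
      (fmor G (fobj F a) (fobj F'' a) (Comp K (fobj F a) (fobj F' a) (fobj F'' a) (\<alpha>' a) (\<alpha> a)))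
    = Comp K (fobj G (fobj F a)) (fobj G' (fobj F' a)) (fobj G'' (fobj F'' a))
      (Comp K (fobj G' (fobj F' a)) (fobj G' (fobj F'' a)) (fobj G'' (fobj F'' a)) (\<beta>' (fobj F'' a)) (fmor G' (fobj F' a) (fobj F'' a) (\<alpha>' a)))
      (Comp K (fobj G (fobj F a)) (fobj G (fobj F' a)) (fobj G' (fobj F' a)) (\<beta> (fobj F' a)) (fmor G (fobj F a) (fobj F' a) (\<alpha> a)))"
    if a: "a \<in> Obj K" for a
  proof -
    have "Comp K (fobj G (fobj F a)) (fobj G (fobj F'' a)) (fobj G'' (fobj F'' a))
      (Comp K (fobj G (fobj F'' a)) (fobj G' (fobj F'' a)) (fobj G'' (fobj F'' a)) (\<beta>' (fobj F'' a)) (\<beta> (fobj F'' a)))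
      (fmor G (fobj F a) (fobj F'' a) (Comp K (fobj F a) (fobj F' a) (fobj F'' a) (\<alpha>' a) (\<alpha> a)))
      = Comp K (fobj G (fobj F a)) (fobj G (fobj F' a)) (fobj G'' (fobj F'' a))
        (Comp K (fobj G (fobj F' a)) (fobj G' (fobj F'' a)) (fobj G'' (fobj F'' a)) (\<beta>' (fobj F'' a))
          (Comp K (fobj G (fobj F' a)) (fobj G (fobj F'' a)) (fobj G' (fobj F'' a)) (\<beta> (fobj F'' a)) (fmor G (fobj F' a) (fobj F'' a) (\<alpha>' a))))
        (fmor G (fobj F a) (fobj F' a) (\<alpha> a))"
      using a F \<alpha> \<beta> by (simp add: linear_functor.fmor_Comp[OF F(4)] Comp_assoc)
    then show ?thesis
      using a F \<alpha> \<beta>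
      by (simp add: natural_transformation_natural[OF \<beta>(1), of "fobj F' a" "fobj F'' a" "\<alpha>' a"] Comp_assoc)
  qed
  then show ?thesis
    using F by (auto simp: horizontal_composite_def intro!: restrict_ext)
qed

lemma horizontal_composite_assoc:
  assumes F: "linear_functor K K F" "linear_functor K K F'" "linear_functor K K G" "linear_functor K K G'"
      "linear_functor K K H" "linear_functor K K H'"
    and \<alpha>: "\<alpha> \<in> natural_transformations K K F F'" and \<beta>: "\<beta> \<in> natural_transformations K K G G'"
    and \<gamma>: "\<gamma> \<in> natural_transformations K K H H'"
  shows "horizontal_composite K K K (compose_functors K G F) (compose_functors K G' F') H H' \<gamma>
        (horizontal_composite K K K F F' G G' \<beta> \<alpha>) =
      horizontal_composite K K K F F' (compose_functors K H G) (compose_functors K H' G')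
        (horizontal_composite K K K G G' H H' \<gamma> \<beta>) \<alpha>"
  using F \<alpha> \<beta> \<gamma>
  by (auto simp: horizontal_composite_def linear_functor.fmor_Comp[OF F(5)] Comp_assoc intro!: restrict_ext)

lemma horizontal_composite_bilinear:
  assumes F: "linear_functor K K F" "linear_functor K K F'" "linear_functor K K G" "linear_functor K K G'"
  shows "bilinear_map (Hom (functor_category K K) G G') (Hom (functor_category K K) F F')
        (Hom (functor_category K K) (compose_functors K G F) (compose_functors K G' F'))
        (horizontal_composite K K K F F' G G')"
  unfolding bilinear_map_def using F
  by (auto simp: horizontal_composite_def linear_functor.fmor_add[OF F(3)] linear_functor.fmor_smult[OF F(3)]
      Comp_add_left Comp_add_right Comp_smult intro!: restrict_ext)

lemma horizontal_composite_Id: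
  assumes F: "linear_functor K K F" "linear_functor K K F'" and \<alpha>: "\<alpha> \<in> natural_transformations K K F F'"
  shows "horizontal_composite K K K (identity_functor K) (identity_functor K) F F' \<alpha>
      (\<lambda>a\<in>Obj K. Id K (fobj (identity_functor K) a)) = \<alpha>"
    "horizontal_composite K K K F F' (identity_functor K) (identity_functor K)
      (\<lambda>a\<in>Obj K. Id K (fobj (identity_functor K) a)) \<alpha> = \<alpha>"
proof -
  have "\<alpha> \<in> extensional (Obj K)" using \<alpha> by (simp add: natural_transformations_iff)
  then show "horizontal_composite K K K (identity_functor K) (identity_functor K) F F' \<alpha>
      (\<lambda>a\<in>Obj K. Id K (fobj (identity_functor K) a)) = \<alpha>"
    "horizontal_composite K K K F F' (identity_functor K) (identity_functor K)
      (\<lambda>a\<in>Obj K. Id K (fobj (identity_functor K) a)) \<alpha> = \<alpha>"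
    using F \<alpha> by (auto simp: horizontal_composite_def linear_functor.fmor_Id[OF F(1)]
        linear_functor.fmor_Id[OF F(2)] intro!: extensionalityI[of _ "Obj K"])
qed

lemma horizontal_composite_Id_Id:
  assumes F: "linear_functor K K F" "linear_functor K K G"
  shows "horizontal_composite K K K F F G G (\<lambda>a\<in>Obj K. Id K (fobj G a)) (\<lambda>a\<in>Obj K. Id K (fobj F a)) =
      (\<lambda>a\<in>Obj K. Id K (fobj (compose_functors K G F) a))"
  using F by (auto simp: horizontal_composite_def linear_functor.fmor_Id[OF F(2)] intro!: restrict_ext)

text \<open>Since all natural transformations are taken as 2-morphisms, a set of 1-morphisms only
  has to contain the identity and be closed under composition. The equations are inherited from the
  endofunctors of \<open>K\<close>, where they are strict.\<close>

lemma two_category_endofunctors: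
  assumes S: "\<And>F. F \<in> S \<Longrightarrow> linear_functor K K F" and Id: "identity_functor K \<in> S"
    and comp: "\<And>F G. F \<in> S \<Longrightarrow> G \<in> S \<Longrightarrow> compose_functors K G F \<in> S"
  shows "two_category \<lparr>Ob2 = {K},
     HomCat = (\<lambda>C D. full_subcategory (functor_category C D) S),
     HComp1 = (\<lambda>C D E. compose_functors C),
     HComp2 = (\<lambda>C D E. horizontal_composite C D E),
     Id1 = identity_functor\<rparr>"
proof -
  interpret FK: linear_category "functor_category K K" by (rule KK.linear_functor_category)
  have "S \<subseteq> Obj (functor_category K K)" using S by auto
  then interpret S: linear_category "full_subcategory (functor_category K K) S"
    by (rule FK.linear_full_subcategory)
  have "category (full_subcategory (functor_category K K) S)" ..
  then show ?thesis
    apply (intro two_category.intro)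
    using S Id comp
    by (auto simp: horizontal_composite_natural horizontal_composite_interchange[simplified]
        compose_functors_assoc horizontal_composite_assoc compose_identity_functor horizontal_composite_Id
        horizontal_composite_Id_Id)
qed

end

section \<open>Modules over an algebra\<close>

locale kalgebra = ring A for A :: "('k::field, 'a) module" (structure) +
  assumes vspace_A: "vspace A"
    and smult_mult_left: "a \<in> carrier A \<Longrightarrow> b \<in> carrier A \<Longrightarrow> (c \<odot> a) \<otimes> b = c \<odot> (a \<otimes> b)"
    and smult_mult_right: "a \<in> carrier A \<Longrightarrow> b \<in> carrier A \<Longrightarrow> a \<otimes> (c \<odot> b) = c \<odot> (a \<otimes> b)"

lemma left_moduleI:
  assumes "ring R" "abelian_group M"
    and "\<And>a x. a \<in> carrier R \<Longrightarrow> x \<in> carrier M \<Longrightarrow> a \<odot>\<^bsub>M\<^esub> x \<in> carrier M"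
    and "\<And>a b x. a \<in> carrier R \<Longrightarrow> b \<in> carrier R \<Longrightarrow> x \<in> carrier M \<Longrightarrow>
      (a \<oplus>\<^bsub>R\<^esub> b) \<odot>\<^bsub>M\<^esub> x = a \<odot>\<^bsub>M\<^esub> x \<oplus>\<^bsub>M\<^esub> b \<odot>\<^bsub>M\<^esub> x"
    and "\<And>a x y. a \<in> carrier R \<Longrightarrow> x \<in> carrier M \<Longrightarrow> y \<in> carrier M \<Longrightarrow>
      a \<odot>\<^bsub>M\<^esub> (x \<oplus>\<^bsub>M\<^esub> y) = a \<odot>\<^bsub>M\<^esub> x \<oplus>\<^bsub>M\<^esub> a \<odot>\<^bsub>M\<^esub> y"
    and "\<And>a b x. a \<in> carrier R \<Longrightarrow> b \<in> carrier R \<Longrightarrow> x \<in> carrier M \<Longrightarrow>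
      (a \<otimes>\<^bsub>R\<^esub> b) \<odot>\<^bsub>M\<^esub> x = a \<odot>\<^bsub>M\<^esub> (b \<odot>\<^bsub>M\<^esub> x)"
    and "\<And>x. x \<in> carrier M \<Longrightarrow> \<one>\<^bsub>R\<^esub> \<odot>\<^bsub>M\<^esub> x = x"
  shows "left_module R M"
  by (intro left_module.intro left_module_axioms.intro assms)

context
  fixes R :: "('a, 'r) ring_scheme" and M :: "('a, 'm, 'z) module_scheme"
  assumes M: "left_module R M"
begin

interpretation left_module R M by (rule M)

lemma lm_abelian_group: "abelian_group M" ..

text \<open>The module laws are restated with \<open>left_module R M\<close> as an explicit premise,
  so that proofs can handle several modules, or families of them, without interpreting the locale
  for each.\<close>

lemma lm_closed [simp]:
  "a \<in> carrier R \<Longrightarrow> x \<in> carrier M \<Longrightarrow> a \<odot>\<^bsub>M\<^esub> x \<in> carrier M"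
  "x \<in> carrier M \<Longrightarrow> y \<in> carrier M \<Longrightarrow> x \<oplus>\<^bsub>M\<^esub> y \<in> carrier M"
  "\<zero>\<^bsub>M\<^esub> \<in> carrier M"
  by (auto intro: smult_closed)

lemma lm_zero [simp]:
  "x \<in> carrier M \<Longrightarrow> x \<oplus>\<^bsub>M\<^esub> \<zero>\<^bsub>M\<^esub> = x" "x \<in> carrier M \<Longrightarrow> \<zero>\<^bsub>M\<^esub> \<oplus>\<^bsub>M\<^esub> x = x"
  "x \<in> carrier M \<Longrightarrow> \<one>\<^bsub>R\<^esub> \<odot>\<^bsub>M\<^esub> x = x"
  by (auto intro: smult_one)

lemma lm_assoc:
  "x \<in> carrier M \<Longrightarrow> y \<in> carrier M \<Longrightarrow> z \<in> carrier M \<Longrightarrow> x \<oplus>\<^bsub>M\<^esub> y \<oplus>\<^bsub>M\<^esub> z = x \<oplus>\<^bsub>M\<^esub> (y \<oplus>\<^bsub>M\<^esub> z)"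
  by (rule M.a_assoc)

lemma lm_commute: "x \<in> carrier M \<Longrightarrow> y \<in> carrier M \<Longrightarrow> x \<oplus>\<^bsub>M\<^esub> y = y \<oplus>\<^bsub>M\<^esub> x"
  by (rule M.a_comm)

lemma lm_left_commute:
  "x \<in> carrier M \<Longrightarrow> y \<in> carrier M \<Longrightarrow> z \<in> carrier M \<Longrightarrow> x \<oplus>\<^bsub>M\<^esub> (y \<oplus>\<^bsub>M\<^esub> z) = y \<oplus>\<^bsub>M\<^esub> (x \<oplus>\<^bsub>M\<^esub> z)"
  by (rule M.add.m_lcomm)

lemma lm_smult_add_left: "a \<in> carrier R \<Longrightarrow> b \<in> carrier R \<Longrightarrow> x \<in> carrier M \<Longrightarrow>
    (a \<oplus>\<^bsub>R\<^esub> b) \<odot>\<^bsub>M\<^esub> x = a \<odot>\<^bsub>M\<^esub> x \<oplus>\<^bsub>M\<^esub> b \<odot>\<^bsub>M\<^esub> x"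
  by (rule smult_l_distr)

lemma lm_smult_add_right: "a \<in> carrier R \<Longrightarrow> x \<in> carrier M \<Longrightarrow> y \<in> carrier M \<Longrightarrow>
    a \<odot>\<^bsub>M\<^esub> (x \<oplus>\<^bsub>M\<^esub> y) = a \<odot>\<^bsub>M\<^esub> x \<oplus>\<^bsub>M\<^esub> a \<odot>\<^bsub>M\<^esub> y"
  by (rule smult_r_distr)

lemma lm_smult_smult: "a \<in> carrier R \<Longrightarrow> b \<in> carrier R \<Longrightarrow> x \<in> carrier M \<Longrightarrow>
    a \<odot>\<^bsub>M\<^esub> (b \<odot>\<^bsub>M\<^esub> x) = (a \<otimes>\<^bsub>R\<^esub> b) \<odot>\<^bsub>M\<^esub> x"
  by (rule smult_assoc1[symmetric])

lemma lm_smult_zero [simp]: "a \<in> carrier R \<Longrightarrow> a \<odot>\<^bsub>M\<^esub> \<zero>\<^bsub>M\<^esub> = \<zero>\<^bsub>M\<^esub>"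
proof -
  assume a: "a \<in> carrier R"
  have "a \<odot>\<^bsub>M\<^esub> \<zero>\<^bsub>M\<^esub> \<oplus>\<^bsub>M\<^esub> a \<odot>\<^bsub>M\<^esub> \<zero>\<^bsub>M\<^esub> = a \<odot>\<^bsub>M\<^esub> \<zero>\<^bsub>M\<^esub>" using a by (simp add: lm_smult_add_right[symmetric])
  then show ?thesis using a by (metis M.add.r_cancel_one' lm_closed(1,3))
qed

lemma lm_zero_smult [simp]: "x \<in> carrier M \<Longrightarrow> \<zero>\<^bsub>R\<^esub> \<odot>\<^bsub>M\<^esub> x = \<zero>\<^bsub>M\<^esub>"
proof -
  assume x: "x \<in> carrier M"
  have "\<zero>\<^bsub>R\<^esub> \<odot>\<^bsub>M\<^esub> x \<oplus>\<^bsub>M\<^esub> \<zero>\<^bsub>R\<^esub> \<odot>\<^bsub>M\<^esub> x = \<zero>\<^bsub>R\<^esub> \<odot>\<^bsub>M\<^esub> x" using x by (simp add: lm_smult_add_left[symmetric])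
  then show ?thesis using x by (metis M.add.r_cancel_one' R.zero_closed lm_closed(1))
qed

lemma lm_neg: "x \<in> carrier M \<Longrightarrow> \<ominus>\<^bsub>M\<^esub> x = (\<ominus>\<^bsub>R\<^esub> \<one>\<^bsub>R\<^esub>) \<odot>\<^bsub>M\<^esub> x"
proof -
  assume x: "x \<in> carrier M"
  have "(\<ominus>\<^bsub>R\<^esub> \<one>\<^bsub>R\<^esub>) \<odot>\<^bsub>M\<^esub> x \<oplus>\<^bsub>M\<^esub> x = (\<ominus>\<^bsub>R\<^esub> \<one>\<^bsub>R\<^esub> \<oplus>\<^bsub>R\<^esub> \<one>\<^bsub>R\<^esub>) \<odot>\<^bsub>M\<^esub> x"
    using x by (simp add: lm_smult_add_left)
  then have "(\<ominus>\<^bsub>R\<^esub> \<one>\<^bsub>R\<^esub>) \<odot>\<^bsub>M\<^esub> x \<oplus>\<^bsub>M\<^esub> x = \<zero>\<^bsub>M\<^esub>" using x by (simp add: R.l_neg)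
  then show ?thesis using x by (simp add: M.minus_equality)
qed

text \<open>Negation is scaling by \<open>-1\<close>, so the closure under negation that a library
  submodule demands follows from closure under scaling.\<close>

lemma lm_submodule_iff: "submodule N R M \<longleftrightarrow> N \<subseteq> carrier M \<and> \<zero>\<^bsub>M\<^esub> \<in> N \<and>
    (\<forall>x\<in>N. \<forall>y\<in>N. x \<oplus>\<^bsub>M\<^esub> y \<in> N) \<and> (\<forall>a\<in>carrier R. \<forall>x\<in>N. a \<odot>\<^bsub>M\<^esub> x \<in> N)"
proof
  assume "submodule N R M"
  then interpret N: submodule N R M .
  show "N \<subseteq> carrier M \<and> \<zero>\<^bsub>M\<^esub> \<in> N \<and>
    (\<forall>x\<in>N. \<forall>y\<in>N. x \<oplus>\<^bsub>M\<^esub> y \<in> N) \<and> (\<forall>a\<in>carrier R. \<forall>x\<in>N. a \<odot>\<^bsub>M\<^esub> x \<in> N)"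
    using N.subset N.one_closed N.m_closed N.smult_closed by auto
next
  assume N: "N \<subseteq> carrier M \<and> \<zero>\<^bsub>M\<^esub> \<in> N \<and>
    (\<forall>x\<in>N. \<forall>y\<in>N. x \<oplus>\<^bsub>M\<^esub> y \<in> N) \<and> (\<forall>a\<in>carrier R. \<forall>x\<in>N. a \<odot>\<^bsub>M\<^esub> x \<in> N)"
  have "inv\<^bsub>add_monoid M\<^esub> x \<in> N" if "x \<in> N" for x
    using that N lm_neg[of x] by (auto simp: a_inv_def[symmetric])
  then show "submodule N R M"
    using N by (intro submodule.intro subgroup.intro submodule_axioms.intro) auto
qed

end

lemma mod_hom_iff: "f \<in> mod_hom R M N \<longleftrightarrow> f \<in> extensional (carrier M) \<and>
    (\<forall>x\<in>carrier M. f x \<in> carrier N) \<and>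
    (\<forall>x\<in>carrier M. \<forall>y\<in>carrier M. f (x \<oplus>\<^bsub>M\<^esub> y) = f x \<oplus>\<^bsub>N\<^esub> f y) \<and>
    (\<forall>a\<in>carrier R. \<forall>x\<in>carrier M. f (a \<odot>\<^bsub>M\<^esub> x) = a \<odot>\<^bsub>N\<^esub> f x)"
  by (auto simp: mod_hom_def PiE_def)

lemma mod_homD:
  assumes "f \<in> mod_hom R M N"
  shows "x \<in> carrier M \<Longrightarrow> f x \<in> carrier N"
    and "x \<in> carrier M \<Longrightarrow> y \<in> carrier M \<Longrightarrow> f (x \<oplus>\<^bsub>M\<^esub> y) = f x \<oplus>\<^bsub>N\<^esub> f y"
    and "a \<in> carrier R \<Longrightarrow> x \<in> carrier M \<Longrightarrow> f (a \<odot>\<^bsub>M\<^esub> x) = a \<odot>\<^bsub>N\<^esub> f x"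
    and "f \<in> extensional (carrier M)"
  using assms by (auto simp: mod_hom_iff)

lemma mod_hom_zero:
  assumes M: "left_module R M" and N: "left_module R N" and f: "f \<in> mod_hom R M N"
  shows "f \<zero>\<^bsub>M\<^esub> = \<zero>\<^bsub>N\<^esub>"
proof -
  interpret M: left_module R M by (rule M)
  have "f (\<zero>\<^bsub>R\<^esub> \<odot>\<^bsub>M\<^esub> \<zero>\<^bsub>M\<^esub>) = \<zero>\<^bsub>R\<^esub> \<odot>\<^bsub>N\<^esub> f \<zero>\<^bsub>M\<^esub>" using f M by (intro mod_homD(3)) auto
  then show ?thesis using M N f mod_homD(1)[OF f, of "\<zero>\<^bsub>M\<^esub>"] by simp
qed

lemma finitely_generatedE:
  assumes "finitely_generated R M"
  obtains S where "finite S" "S \<subseteq> carrier M" "\<And>L. submodule L R M \<Longrightarrow> S \<subseteq> L \<Longrightarrow> L = carrier M"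
  using assms unfolding finitely_generated_def by blast

text \<open>A submodule of the target that contains the images of the generators has a preimage that
  is a submodule containing the generators, hence everything.\<close>

lemma finitely_generated_surj:
  assumes M: "left_module R M" and N: "left_module R N" and f: "f \<in> mod_hom R M N"
    and surj: "f ` carrier M = carrier N" and fg: "finitely_generated R M"
  shows "finitely_generated R N"
proof -
  obtain S where S: "finite S" "S \<subseteq> carrier M" "\<And>L. submodule L R M \<Longrightarrow> S \<subseteq> L \<Longrightarrow> L = carrier M"
    by (rule finitely_generatedE[OF fg]) (rule that)
  have "L = carrier N" if L: "submodule L R N" "f ` S \<subseteq> L" for L
  proof -
    let ?L = "{x \<in> carrier M. f x \<in> L}"
    have "submodule ?L R M"
      using L(1) f M N by (auto simp: lm_submodule_iff[OF M] lm_submodule_iff[OF N] mod_homD[OF f] mod_hom_zero[OF M N f])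
    then have "?L = carrier M" using S L by (intro S(3)) auto
    then have "f ` carrier M \<subseteq> L" by blast
    then show ?thesis using surj L(1) by (auto simp: lm_submodule_iff[OF N])
  qed
  then show ?thesis unfolding finitely_generated_def
    using S mod_homD(1)[OF f] by (intro exI[of _ "f ` S"]) auto
qed

text \<open>Carries a module structure along an injection. It serves to move products and the
  regular module into the fixed type of small carriers.\<close>

definition transport :: "('m \<Rightarrow> 'n) \<Rightarrow> ('a, 'm) module \<Rightarrow> ('a, 'n) module" where
  "transport f M = \<lparr>carrier = f ` carrier M, monoid.mult = undefined, monoid.one = undefined,
     ring.zero = f \<zero>\<^bsub>M\<^esub>,
     add = (\<lambda>x y. f (inv_into (carrier M) f x \<oplus>\<^bsub>M\<^esub> inv_into (carrier M) f y)),
     module.smult = (\<lambda>a x. f (a \<odot>\<^bsub>M\<^esub> inv_into (carrier M) f x))\<rparr>"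

lemma transport_simps [simp]:
  "carrier (transport f M) = f ` carrier M" "\<zero>\<^bsub>transport f M\<^esub> = f \<zero>\<^bsub>M\<^esub>"
  "inj_on f (carrier M) \<Longrightarrow> x \<in> carrier M \<Longrightarrow> y \<in> carrier M \<Longrightarrow> f x \<oplus>\<^bsub>transport f M\<^esub> f y = f (x \<oplus>\<^bsub>M\<^esub> y)"
  "inj_on f (carrier M) \<Longrightarrow> x \<in> carrier M \<Longrightarrow> a \<odot>\<^bsub>transport f M\<^esub> f x = f (a \<odot>\<^bsub>M\<^esub> x)"
  by (simp_all add: transport_def)

lemma transport_module:
  assumes M: "left_module R M" and inj: "inj_on f (carrier M)"
  shows "left_module R (transport f M)"
proof (rule left_moduleI)
  show "ring R" using M by (simp add: left_module_def)
  show "abelian_group (transport f M)"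
  proof (rule abelian_groupI)
    fix x assume "x \<in> carrier (transport f M)"
    then obtain y where y: "x = f y" "y \<in> carrier M" by auto
    interpret M: abelian_group M using M by (rule lm_abelian_group)
    show "\<exists>y\<in>carrier (transport f M). y \<oplus>\<^bsub>transport f M\<^esub> x = \<zero>\<^bsub>transport f M\<^esub>"
      using y inj by (intro bexI[of _ "f (\<ominus>\<^bsub>M\<^esub> y)"]) (auto simp: M.l_neg)
  qed (use M inj in \<open>auto simp: lm_assoc[OF M] lm_commute[OF M] lm_left_commute[OF M]\<close>)
qed (use M inj in \<open>auto simp: lm_smult_add_left[OF M] lm_smult_add_right[OF M] lm_smult_smult[OF M]\<close>)

lemma transport_hom:
  assumes M: "left_module R M" and inj: "inj_on f (carrier M)"
  shows "restrict f (carrier M) \<in> mod_hom R M (transport f M)"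
  using M inj by (auto simp: mod_hom_iff)

lemma transport_finitely_generated:
  assumes M: "left_module R M" and inj: "inj_on f (carrier M)" and fg: "finitely_generated R M"
  shows "finitely_generated R (transport f M)"
  by (rule finitely_generated_surj[OF M transport_module[OF M inj] transport_hom[OF M inj] _ fg]) auto

section \<open>The linear category of modules and its small version\<close>

lemma mod_category_simps [simp]:
  "Obj (mod_category A) = {M. left_module A M \<and> finitely_generated A M}"
  "Mor (mod_category A) M N = mod_hom A M N"
  "\<zero>\<^bsub>Hom (mod_category A) M N\<^esub> = (\<lambda>x\<in>carrier M. \<zero>\<^bsub>N\<^esub>)"
  "f \<oplus>\<^bsub>Hom (mod_category A) M N\<^esub> g = (\<lambda>x\<in>carrier M. f x \<oplus>\<^bsub>N\<^esub> g x)"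
  "c \<odot>\<^bsub>Hom (mod_category A) M N\<^esub> f = (\<lambda>x\<in>carrier M. (c \<odot>\<^bsub>A\<^esub> \<one>\<^bsub>A\<^esub>) \<odot>\<^bsub>N\<^esub> f x)"
  "Comp (mod_category A) L M N g f = compose (carrier L) g f"
  "Id (mod_category A) M = (\<lambda>x\<in>carrier M. x)"
  by (simp_all add: mod_category_def)

context kalgebra
begin

sublocale V: vspace A by (rule vspace_A)

abbreviation scalar :: "'k \<Rightarrow> 'a" where "scalar c \<equiv> c \<odot> \<one>"

lemma scalar_closed: "scalar c \<in> carrier A"
  by simp

lemma scalar_mult: "a \<in> carrier A \<Longrightarrow> scalar c \<otimes> a = c \<odot> a" "a \<in> carrier A \<Longrightarrow> a \<otimes> scalar c = c \<odot> a"
  by (simp_all add: smult_mult_left smult_mult_right)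

text \<open>The vector space underlying an \<open>A\<close>-module, with the same action of the
  field as in \<open>mod_category\<close>.\<close>

definition restrict_scalars :: "('a, 'm) module \<Rightarrow> ('k, 'm) module" where
  "restrict_scalars M = \<lparr>carrier = carrier M, monoid.mult = undefined, monoid.one = undefined,
     ring.zero = \<zero>\<^bsub>M\<^esub>, add = add M, module.smult = (\<lambda>c x. scalar c \<odot>\<^bsub>M\<^esub> x)\<rparr>"

lemma restrict_scalars_simps [simp]:
  "carrier (restrict_scalars M) = carrier M" "\<zero>\<^bsub>restrict_scalars M\<^esub> = \<zero>\<^bsub>M\<^esub>"
  "x \<oplus>\<^bsub>restrict_scalars M\<^esub> y = x \<oplus>\<^bsub>M\<^esub> y" "c \<odot>\<^bsub>restrict_scalars M\<^esub> x = scalar c \<odot>\<^bsub>M\<^esub> x"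
  by (simp_all add: restrict_scalars_def)

lemma vspace_restrict_scalars:
  assumes M: "left_module A M" shows "vspace (restrict_scalars M)"
proof (rule vspaceI, rule moduleI[OF cring_base_field])
  interpret M: abelian_group M using M by (rule lm_abelian_group)
  show "abelian_group (restrict_scalars M)"
  proof (rule abelian_groupI)
    fix x assume "x \<in> carrier (restrict_scalars M)"
    then show "\<exists>y\<in>carrier (restrict_scalars M). y \<oplus>\<^bsub>restrict_scalars M\<^esub> x = \<zero>\<^bsub>restrict_scalars M\<^esub>"
      by (intro bexI[of _ "\<ominus>\<^bsub>M\<^esub> x"]) (auto simp: M.l_neg)
  qed (auto simp: M.a_assoc intro: M.a_comm)
  fix c d :: 'k and x assume "x \<in> carrier (restrict_scalars M)"
  then have x: "x \<in> carrier M" by simp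
  show "(c \<oplus>\<^bsub>base_field\<^esub> d) \<odot>\<^bsub>restrict_scalars M\<^esub> x =
      c \<odot>\<^bsub>restrict_scalars M\<^esub> x \<oplus>\<^bsub>restrict_scalars M\<^esub> d \<odot>\<^bsub>restrict_scalars M\<^esub> x"
    using x M by (simp add: V.vs_add_smult[symmetric] lm_smult_add_left[OF M])
  show "(c \<otimes>\<^bsub>base_field\<^esub> d) \<odot>\<^bsub>restrict_scalars M\<^esub> x = c \<odot>\<^bsub>restrict_scalars M\<^esub> (d \<odot>\<^bsub>restrict_scalars M\<^esub> x)"
    using x M by (simp add: lm_smult_smult[OF M] scalar_mult V.vs_smult_smult mult.commute)
qed (use M in \<open>auto simp: lm_smult_add_right[OF M]\<close>)

lemma mod_hom_add:
  assumes "left_module A M" "left_module A N" "f \<in> mod_hom A M N" "g \<in> mod_hom A M N"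
  shows "(\<lambda>x\<in>carrier M. f x \<oplus>\<^bsub>N\<^esub> g x) \<in> mod_hom A M N"
  using assms by (auto simp: mod_hom_iff lm_smult_add_right[OF assms(2)] lm_assoc[OF assms(2)] lm_left_commute[OF assms(2)])

lemma mod_hom_smult:
  assumes "left_module A M" "left_module A N" "f \<in> mod_hom A M N"
  shows "(\<lambda>x\<in>carrier M. scalar c \<odot>\<^bsub>N\<^esub> f x) \<in> mod_hom A M N"
  using assms by (auto simp: mod_hom_iff lm_smult_add_right[OF assms(2)] lm_smult_smult[OF assms(2)] scalar_mult)

lemma linear_mod_category: "linear_category (mod_category A :: ('k, ('a, 'm) module, 'm \<Rightarrow> 'm) lincat)"
proof (intro linear_category.intro category.intro linear_category_axioms.intro)
  fix M N L P :: "('a, 'm) module" and f g h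
  assume "M \<in> Obj (mod_category A)" "N \<in> Obj (mod_category A)"
  then have M: "left_module A M" and N: "left_module A N" by auto
  show "Id (mod_category A) M \<in> Mor (mod_category A) M M" using M by (auto simp: mod_hom_iff)
  interpret N: vspace "restrict_scalars N" using N by (rule vspace_restrict_scalars)
  show "Module.module base_field (Hom (mod_category A) M N)"
  proof (rule moduleI[OF cring_base_field])
    show "abelian_group (Hom (mod_category A) M N)"
    proof (rule abelian_groupI)
      show "\<zero>\<^bsub>Hom (mod_category A) M N\<^esub> \<in> Mor (mod_category A) M N"
        using M N by (auto simp: mod_hom_iff)
      fix f assume "f \<in> Mor (mod_category A) M N"
      then have f: "f \<in> mod_hom A M N" by simp
      show "\<zero>\<^bsub>Hom (mod_category A) M N\<^esub> \<oplus>\<^bsub>Hom (mod_category A) M N\<^esub> f = f"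
        using M N mod_homD[OF f] by (auto intro!: extensionalityI[of _ "carrier M"])
      show "\<exists>g\<in>Mor (mod_category A) M N. g \<oplus>\<^bsub>Hom (mod_category A) M N\<^esub> f = \<zero>\<^bsub>Hom (mod_category A) M N\<^esub>"
        using mod_hom_smult[OF M N f, of "-1"] mod_homD[OF f] N.vs_add_neg lm_commute[OF N] N
        by (intro bexI[of _ "\<lambda>x\<in>carrier M. scalar (-1) \<odot>\<^bsub>N\<^esub> f x"]) (auto intro!: restrict_ext)
      fix g assume "g \<in> Mor (mod_category A) M N"
      then have g: "g \<in> mod_hom A M N" by simp
      show "f \<oplus>\<^bsub>Hom (mod_category A) M N\<^esub> g \<in> Mor (mod_category A) M N"
        using mod_hom_add[OF M N f g] by simp
      show "f \<oplus>\<^bsub>Hom (mod_category A) M N\<^esub> g = g \<oplus>\<^bsub>Hom (mod_category A) M N\<^esub> f"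
        using mod_homD[OF f] mod_homD[OF g] lm_commute[OF N] by (auto intro!: restrict_ext)
      fix h assume "h \<in> Mor (mod_category A) M N"
      then have h: "h \<in> mod_hom A M N" by simp
      show "f \<oplus>\<^bsub>Hom (mod_category A) M N\<^esub> g \<oplus>\<^bsub>Hom (mod_category A) M N\<^esub> h =
          f \<oplus>\<^bsub>Hom (mod_category A) M N\<^esub> (g \<oplus>\<^bsub>Hom (mod_category A) M N\<^esub> h)"
        using mod_homD[OF f] mod_homD[OF g] mod_homD[OF h] by (auto simp: lm_assoc[OF N] intro!: restrict_ext)
    qed
  next
    fix c d :: 'k and f g
    { assume "f \<in> Mor (mod_category A) M N"
      then have f: "f \<in> mod_hom A M N" by simp
      show "c \<odot>\<^bsub>Hom (mod_category A) M N\<^esub> f \<in> Mor (mod_category A) M N"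
        using mod_hom_smult[OF M N f] by simp
      show "(c \<oplus>\<^bsub>base_field\<^esub> d) \<odot>\<^bsub>Hom (mod_category A) M N\<^esub> f =
          c \<odot>\<^bsub>Hom (mod_category A) M N\<^esub> f \<oplus>\<^bsub>Hom (mod_category A) M N\<^esub> d \<odot>\<^bsub>Hom (mod_category A) M N\<^esub> f"
        using mod_homD[OF f] N.vs_add_smult by (auto intro!: restrict_ext)
      show "(c \<otimes>\<^bsub>base_field\<^esub> d) \<odot>\<^bsub>Hom (mod_category A) M N\<^esub> f =
          c \<odot>\<^bsub>Hom (mod_category A) M N\<^esub> (d \<odot>\<^bsub>Hom (mod_category A) M N\<^esub> f)"
        using mod_homD[OF f] N.vs_smult_smult by (auto intro!: restrict_ext)
      show "\<one>\<^bsub>base_field\<^esub> \<odot>\<^bsub>Hom (mod_category A) M N\<^esub> f = f"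
        using mod_homD[OF f] N by (auto intro!: extensionalityI[of _ "carrier M"])
      assume "g \<in> Mor (mod_category A) M N"
      then have g: "g \<in> mod_hom A M N" by simp
      show "c \<odot>\<^bsub>Hom (mod_category A) M N\<^esub> (f \<oplus>\<^bsub>Hom (mod_category A) M N\<^esub> g) =
        c \<odot>\<^bsub>Hom (mod_category A) M N\<^esub> f \<oplus>\<^bsub>Hom (mod_category A) M N\<^esub> c \<odot>\<^bsub>Hom (mod_category A) M N\<^esub> g"
        using mod_homD[OF f] mod_homD[OF g] by (auto simp: lm_smult_add_right[OF N] intro!: restrict_ext) }
  qed
  { assume "f \<in> Mor (mod_category A) M N"
    then have f: "f \<in> mod_hom A M N" by simp
    show "Comp (mod_category A) M M N f (Id (mod_category A) M) = f"
      "Comp (mod_category A) M N N (Id (mod_category A) N) f = f"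
      using mod_homD[OF f] by (auto simp: compose_def intro!: extensionalityI[of _ "carrier M"])
    assume "L \<in> Obj (mod_category A)" "g \<in> Mor (mod_category A) N L"
    then have L: "left_module A L" "g \<in> mod_hom A N L" by auto
    show "Comp (mod_category A) M N L g f \<in> Mor (mod_category A) M L"
      using f L(2) M N by (simp add: mod_hom_iff compose_def)
    show "Comp (mod_category A) M L P h (Comp (mod_category A) M N L g f) =
      Comp (mod_category A) M N P (Comp (mod_category A) N L P h g) f"
      using mod_homD[OF f] by (auto simp: compose_def intro!: restrict_ext) }
  assume "L \<in> Obj (mod_category A)"
  then have L: "left_module A L" by simp
  show "bilinear_map (Hom (mod_category A) N L) (Hom (mod_category A) M N)
       (Hom (mod_category A) M L) (Comp (mod_category A) M N L)"
    unfolding bilinear_map_def using N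
    by (auto simp: compose_def mod_homD intro!: restrict_ext)
qed

text \<open>The image of the idempotent is a submodule, finitely generated as a quotient; inclusion
  and corestriction split the idempotent. The carrier type does not change, so the result applies to
  the small category as it stands.\<close>

lemma mod_category_split: "idempotent_split (mod_category A)"
  unfolding idempotent_split_def
proof (intro ballI impI)
  fix M e assume "M \<in> Obj (mod_category A)" "e \<in> Mor (mod_category A) M M"
    and "Comp (mod_category A) M M M e e = e"
  then have M: "left_module A M" "finitely_generated A M" and e: "e \<in> mod_hom A M M"
    and ce: "compose (carrier M) e e = e" by auto
  have ee: "e (e x) = e x" if "x \<in> carrier M" for x using fun_cong[OF ce, of x] that by (simp add: compose_def)
  define N where "N = M\<lparr>carrier := e ` carrier M\<rparr>"
  have N_simps [simp]: "carrier N = e ` carrier M" "\<zero>\<^bsub>N\<^esub> = \<zero>\<^bsub>M\<^esub>" "add N = add M" "module.smult N = module.smult M"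
    by (simp_all add: N_def)
  have sub: "submodule (e ` carrier M) A M"
    unfolding lm_submodule_iff[OF M(1)]
    using M(1) mod_homD[OF e] mod_hom_zero[OF M(1) M(1) e]
    by (auto simp: mod_homD(2,3)[OF e, symmetric] intro: image_eqI[of _ _ "\<zero>\<^bsub>M\<^esub>"])
  note subD = sub[unfolded lm_submodule_iff[OF M(1)]]
  have NM: "x \<in> carrier M" if "x \<in> e ` carrier M" for x using subD that by blast
  note N_closed = subD[THEN conjunct2, THEN conjunct1]
    subD[THEN conjunct2, THEN conjunct2, THEN conjunct1, THEN bspec, THEN bspec]
    subD[THEN conjunct2, THEN conjunct2, THEN conjunct2, THEN bspec, THEN bspec]
  have N: "left_module A N"
  proof (rule left_moduleI)
    show "abelian_group N"
    proof (rule abelian_groupI)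
      fix x assume "x \<in> carrier N"
      then have x: "x \<in> e ` carrier M" "x \<in> carrier M" using NM by auto
      have "\<ominus>\<^bsub>M\<^esub> x \<in> carrier N" using N_closed(3)[of "\<ominus> \<one>" x] lm_neg[OF M(1) x(2)] x(1) by simp
      moreover interpret M: abelian_group M using M(1) by (rule lm_abelian_group)
      have "\<ominus>\<^bsub>M\<^esub> x \<oplus>\<^bsub>N\<^esub> x = \<zero>\<^bsub>N\<^esub>" using x by (simp add: M.l_neg)
      ultimately show "\<exists>y\<in>carrier N. y \<oplus>\<^bsub>N\<^esub> x = \<zero>\<^bsub>N\<^esub>" by blast
    qed (simp_all add: N_closed NM M(1) lm_zero[OF M(1)] lm_assoc[OF M(1)] lm_commute[OF M(1)] lm_left_commute[OF M(1)])
  qed (simp_all add: N_closed NM M(1) ring_axioms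
      lm_smult_add_left[OF M(1)] lm_smult_add_right[OF M(1)] lm_smult_smult[OF M(1)])
  have eN: "e \<in> mod_hom A M N" using e by (auto simp: mod_hom_iff)
  have iN: "(\<lambda>x\<in>carrier N. x) \<in> mod_hom A N M"
    using sub by (auto simp: mod_hom_iff lm_submodule_iff[OF M(1)])
  have "finitely_generated A N"
    by (rule finitely_generated_surj[OF M(1) N eN _ M(2)]) simp
  moreover have "compose (carrier M) (\<lambda>x\<in>carrier N. x) e = e"
    using mod_homD[OF e] by (auto simp: compose_def intro!: extensionalityI[of _ "carrier M"])
  moreover have "compose (carrier N) e (\<lambda>x\<in>carrier N. x) = (\<lambda>x\<in>carrier N. x)"
    using ee by (auto simp: compose_def intro!: restrict_ext)
  ultimately show "\<exists>y\<in>Obj (mod_category A). \<exists>r\<in>Mor (mod_category A) M y. \<exists>s\<in>Mor (mod_category A) y M.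
            Comp (mod_category A) M y M s r = e \<and> Comp (mod_category A) y M y r s = Id (mod_category A) y"
    using N eN iN by (intro bexI[of _ N] bexI[of _ e] bexI[of _ "\<lambda>x\<in>carrier N. x"]) simp_all
qed

definition product_module :: "('a, 'm) module \<Rightarrow> ('a, 'n) module \<Rightarrow> ('a, 'm \<times> 'n) module" where
  "product_module M N = \<lparr>carrier = carrier M \<times> carrier N, monoid.mult = undefined, monoid.one = undefined,
     ring.zero = (\<zero>\<^bsub>M\<^esub>, \<zero>\<^bsub>N\<^esub>), add = (\<lambda>x y. (fst x \<oplus>\<^bsub>M\<^esub> fst y, snd x \<oplus>\<^bsub>N\<^esub> snd y)),
     module.smult = (\<lambda>a x. (a \<odot>\<^bsub>M\<^esub> fst x, a \<odot>\<^bsub>N\<^esub> snd x))\<rparr>"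

lemma product_module_simps [simp]:
  "carrier (product_module M N) = carrier M \<times> carrier N" "\<zero>\<^bsub>product_module M N\<^esub> = (\<zero>\<^bsub>M\<^esub>, \<zero>\<^bsub>N\<^esub>)"
  "x \<oplus>\<^bsub>product_module M N\<^esub> y = (fst x \<oplus>\<^bsub>M\<^esub> fst y, snd x \<oplus>\<^bsub>N\<^esub> snd y)"
  "a \<odot>\<^bsub>product_module M N\<^esub> x = (a \<odot>\<^bsub>M\<^esub> fst x, a \<odot>\<^bsub>N\<^esub> snd x)"
  by (simp_all add: product_module_def)

lemma product_module:
  assumes M: "left_module A M" and N: "left_module A N"
  shows "left_module A (product_module M N)"
proof (rule left_moduleI)
  interpret M: abelian_group M using M by (rule lm_abelian_group)
  interpret N: abelian_group N using N by (rule lm_abelian_group)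
  show "abelian_group (product_module M N)"
  proof (rule abelian_groupI)
    fix x assume "x \<in> carrier (product_module M N)"
    then show "\<exists>y\<in>carrier (product_module M N). y \<oplus>\<^bsub>product_module M N\<^esub> x = \<zero>\<^bsub>product_module M N\<^esub>"
      by (intro bexI[of _ "(\<ominus>\<^bsub>M\<^esub> fst x, \<ominus>\<^bsub>N\<^esub> snd x)"]) (auto simp: M.l_neg N.l_neg)
  qed (auto simp: M.a_assoc N.a_assoc intro: M.a_comm N.a_comm)
qed (use M N in \<open>auto simp: lm_smult_add_left[OF M] lm_smult_add_right[OF M] lm_smult_smult[OF M]
   lm_smult_add_left[OF N] lm_smult_add_right[OF N] lm_smult_smult[OF N] intro: ring_axioms\<close>)

text \<open>For a submodule that contains both sets of generators, the \<open>x\<close> with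
  \<open>(x, \<zero>)\<close> in it form a submodule of \<open>M\<close> containing the generators
  of \<open>M\<close>, and likewise for \<open>N\<close>; sums of the two kinds give
  everything.\<close>

lemma product_module_finitely_generated:
  assumes M: "left_module A M" "finitely_generated A M" and N: "left_module A N" "finitely_generated A N"
  shows "finitely_generated A (product_module M N)"
proof -
  let ?P = "product_module M N"
  note P = product_module[OF M(1) N(1)]
  obtain S where S: "finite S" "S \<subseteq> carrier M" "\<And>L. submodule L A M \<Longrightarrow> S \<subseteq> L \<Longrightarrow> L = carrier M"
    by (rule finitely_generatedE[OF M(2)]) (rule that)
  obtain T where T: "finite T" "T \<subseteq> carrier N" "\<And>L. submodule L A N \<Longrightarrow> T \<subseteq> L \<Longrightarrow> L = carrier N"
    by (rule finitely_generatedE[OF N(2)]) (rule that)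
  let ?U = "(\<lambda>x. (x, \<zero>\<^bsub>N\<^esub>)) ` S \<union> (\<lambda>y. (\<zero>\<^bsub>M\<^esub>, y)) ` T"
  have "L = carrier ?P" if L: "submodule L A ?P" "?U \<subseteq> L" for L
  proof -
    note LL = L(1)[unfolded lm_submodule_iff[OF P]]
    have add: "(x \<oplus>\<^bsub>M\<^esub> x', y \<oplus>\<^bsub>N\<^esub> y') \<in> L" if "(x, y) \<in> L" "(x', y') \<in> L" for x y x' y'
      using LL that by (metis fst_conv snd_conv product_module_simps(3))
    have smult: "(a \<odot>\<^bsub>M\<^esub> x, a \<odot>\<^bsub>N\<^esub> y) \<in> L" if "(x, y) \<in> L" "a \<in> carrier A" for x y a
      using LL that by (metis fst_conv snd_conv product_module_simps(4))
    have zero: "(\<zero>\<^bsub>M\<^esub>, \<zero>\<^bsub>N\<^esub>) \<in> L" using LL by simp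
    have "submodule {x \<in> carrier M. (x, \<zero>\<^bsub>N\<^esub>) \<in> L} A M"
      unfolding lm_submodule_iff[OF M(1)]
    proof (intro conjI ballI)
      show "x \<oplus>\<^bsub>M\<^esub> y \<in> {x \<in> carrier M. (x, \<zero>\<^bsub>N\<^esub>) \<in> L}"
        if "x \<in> {x \<in> carrier M. (x, \<zero>\<^bsub>N\<^esub>) \<in> L}" "y \<in> {x \<in> carrier M. (x, \<zero>\<^bsub>N\<^esub>) \<in> L}" for x y
        using add[of x "\<zero>\<^bsub>N\<^esub>" y "\<zero>\<^bsub>N\<^esub>"] that M(1) N(1) by simp
      show "a \<odot>\<^bsub>M\<^esub> x \<in> {x \<in> carrier M. (x, \<zero>\<^bsub>N\<^esub>) \<in> L}"
        if "a \<in> carrier A" "x \<in> {x \<in> carrier M. (x, \<zero>\<^bsub>N\<^esub>) \<in> L}" for x a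
        using smult[of x "\<zero>\<^bsub>N\<^esub>" a] that M(1) N(1) by simp
    qed (use M(1) zero in auto)
    then have 1: "{x \<in> carrier M. (x, \<zero>\<^bsub>N\<^esub>) \<in> L} = carrier M" using S(2) L(2) by (intro S(3)) auto
    have "submodule {x \<in> carrier N. (\<zero>\<^bsub>M\<^esub>, x) \<in> L} A N"
      unfolding lm_submodule_iff[OF N(1)]
    proof (intro conjI ballI)
      show "x \<oplus>\<^bsub>N\<^esub> y \<in> {x \<in> carrier N. (\<zero>\<^bsub>M\<^esub>, x) \<in> L}"
        if "x \<in> {x \<in> carrier N. (\<zero>\<^bsub>M\<^esub>, x) \<in> L}" "y \<in> {x \<in> carrier N. (\<zero>\<^bsub>M\<^esub>, x) \<in> L}" for x y
        using add[of "\<zero>\<^bsub>M\<^esub>" x "\<zero>\<^bsub>M\<^esub>" y] that M(1) N(1) by simp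
      show "a \<odot>\<^bsub>N\<^esub> x \<in> {x \<in> carrier N. (\<zero>\<^bsub>M\<^esub>, x) \<in> L}"
        if "a \<in> carrier A" "x \<in> {x \<in> carrier N. (\<zero>\<^bsub>M\<^esub>, x) \<in> L}" for x a
        using smult[of "\<zero>\<^bsub>M\<^esub>" x a] that M(1) N(1) by simp
    qed (use N(1) zero in auto)
    then have 2: "{x \<in> carrier N. (\<zero>\<^bsub>M\<^esub>, x) \<in> L} = carrier N" using T(2) L(2) by (intro T(3)) auto
    have "(x, y) \<in> L" if "x \<in> carrier M" "y \<in> carrier N" for x y
    proof -
      have "(x, \<zero>\<^bsub>N\<^esub>) \<in> L" "(\<zero>\<^bsub>M\<^esub>, y) \<in> L" using that 1 2 by auto
      then show ?thesis using add[of x "\<zero>\<^bsub>N\<^esub>" "\<zero>\<^bsub>M\<^esub>" y] that M(1) N(1) by simp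
    qed
    then show ?thesis using LL by auto
  qed
  then show ?thesis unfolding finitely_generated_def
    using S(1,2) T(1,2) M(1) N(1) by (intro exI[of _ ?U]) auto
qed

text \<open>Stores two sets of sequences in one by prefixing a tag to every sequence, which keeps
  the product of two small modules in the same universe.\<close>

definition encode_pair :: "'a small_carrier \<times> 'a small_carrier \<Rightarrow> 'a small_carrier" where
  "encode_pair XY = case_nat \<zero> ` fst XY \<union> case_nat \<one> ` snd XY"

lemma inj_encode_pair:
  assumes "\<zero> \<noteq> \<one>" shows "inj encode_pair"
proof (rule inj_on_inverseI)
  fix XY :: "'a small_carrier \<times> 'a small_carrier"
  \<comment> \<open>Dropping the first entry undoes the prefix, so equality of two prefixed
    sequences gives equality of the originals; the tag shows which set they came from.\<close>
  have dec: "case_nat a f \<circ> Suc = f" for a :: 'a and f by auto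
  have "f \<in> fst XY \<longleftrightarrow> case_nat \<zero> f \<in> encode_pair XY" for f
  proof
    assume "case_nat \<zero> f \<in> encode_pair XY"
    then obtain g where "case_nat \<zero> f = case_nat \<zero> g \<and> g \<in> fst XY \<or> case_nat \<zero> f = case_nat \<one> g"
      by (auto simp: encode_pair_def)
    then show "f \<in> fst XY" using assms dec by (metis old.nat.simps(4))
  qed (auto simp: encode_pair_def)
  moreover have "f \<in> snd XY \<longleftrightarrow> case_nat \<one> f \<in> encode_pair XY" for f
  proof
    assume "case_nat \<one> f \<in> encode_pair XY"
    then obtain g where "case_nat \<one> f = case_nat \<one> g \<and> g \<in> snd XY \<or> case_nat \<one> f = case_nat \<zero> g"
      by (auto simp: encode_pair_def)
    then show "f \<in> snd XY" using assms dec by (metis old.nat.simps(4))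
  qed (auto simp: encode_pair_def)
  ultimately show "(\<lambda>Z. ({f. case_nat \<zero> f \<in> Z}, {f. case_nat \<one> f \<in> Z})) (encode_pair XY) = XY"
    by (auto simp: prod_eq_iff)
qed

text \<open>The product is transported along \<open>encode_pair\<close>, whose tags must differ,
  whence the assumption. The zero object is the module whose only element is the empty set of
  sequences.\<close>

lemma small_mod_biproducts:
  assumes nontrivial: "\<zero> \<noteq> \<one>" shows "has_biproducts (small_mod A)"
proof -
  define Z :: "'a small_module" where "Z = \<lparr>carrier = {{}}, monoid.mult = undefined, monoid.one = undefined,
     ring.zero = {}, add = (\<lambda>x y. {}), module.smult = (\<lambda>a x. {})\<rparr>"
  have Z: "left_module A Z"
    by (rule left_moduleI[OF ring_axioms abelian_groupI]) (auto simp: Z_def)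
  moreover have "finitely_generated A Z"
    unfolding finitely_generated_def lm_submodule_iff[OF Z]
    by (intro exI[of _ "{}"]) (auto simp: Z_def)
  moreover have "Id (mod_category A) Z = \<zero>\<^bsub>Hom (mod_category A) Z Z\<^esub>"
    by (auto simp: Z_def intro!: restrict_ext)
  moreover have "\<exists>s i j p q. biproduct (mod_category A) M N s i j p q"
    if "M \<in> Obj (mod_category A)" "N \<in> Obj (mod_category A)" for M N :: "'a small_module"
  proof -
    have M: "left_module A M" "finitely_generated A M" and N: "left_module A N" "finitely_generated A N"
      using that by auto
    have inj: "inj_on encode_pair (carrier (product_module M N))"
      using inj_encode_pair[OF nontrivial] by (rule inj_on_subset) simp
    have inv: "inv_into (carrier M \<times> carrier N) encode_pair (encode_pair xy) = xy" if "xy \<in> carrier M \<times> carrier N" for xy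
      using inv_into_f_f[OF inj] that by simp
    define P where "P = transport encode_pair (product_module M N)"
    note PM = product_module[OF M(1) N(1)]
    have P: "left_module A P" "finitely_generated A P"
      using transport_module[OF PM inj] transport_finitely_generated[OF PM inj]
        product_module_finitely_generated[OF M N] by (simp_all add: P_def)
    have P_simps: "carrier P = encode_pair ` (carrier M \<times> carrier N)"
      "\<And>x y x' y'. x \<in> carrier M \<Longrightarrow> y \<in> carrier N \<Longrightarrow> x' \<in> carrier M \<Longrightarrow> y' \<in> carrier N \<Longrightarrow>
        encode_pair (x, y) \<oplus>\<^bsub>P\<^esub> encode_pair (x', y') = encode_pair (x \<oplus>\<^bsub>M\<^esub> x', y \<oplus>\<^bsub>N\<^esub> y')"
      "\<And>x y a. x \<in> carrier M \<Longrightarrow> y \<in> carrier N \<Longrightarrow>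
        a \<odot>\<^bsub>P\<^esub> encode_pair (x, y) = encode_pair (a \<odot>\<^bsub>M\<^esub> x, a \<odot>\<^bsub>N\<^esub> y)"
      using inj by (simp_all add: P_def)
    define i j p q where "i = (\<lambda>x\<in>carrier M. encode_pair (x, \<zero>\<^bsub>N\<^esub>))" and "j = (\<lambda>y\<in>carrier N. encode_pair (\<zero>\<^bsub>M\<^esub>, y))"
      and "p = (\<lambda>z\<in>carrier P. fst (inv_into (carrier M \<times> carrier N) encode_pair z))"
      and "q = (\<lambda>z\<in>carrier P. snd (inv_into (carrier M \<times> carrier N) encode_pair z))"
    have p: "p (encode_pair (x, y)) = x" "q (encode_pair (x, y)) = y" if "x \<in> carrier M" "y \<in> carrier N" for x y
      using that inv[of "(x, y)"] by (auto simp: p_def q_def P_simps)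
    have ext: "p \<in> extensional (carrier P)" "q \<in> extensional (carrier P)" by (simp_all add: p_def q_def)
    have "i \<in> mod_hom A M P" "j \<in> mod_hom A N P" "p \<in> mod_hom A P M" "q \<in> mod_hom A P N"
      using M(1) N(1) ext by (auto simp: mod_hom_iff P_simps i_def j_def p)
    moreover have "compose (carrier M) p i = (\<lambda>x\<in>carrier M. x)" "compose (carrier N) q j = (\<lambda>x\<in>carrier N. x)"
      "compose (carrier N) p j = (\<lambda>x\<in>carrier N. \<zero>\<^bsub>M\<^esub>)" "compose (carrier M) q i = (\<lambda>x\<in>carrier M. \<zero>\<^bsub>N\<^esub>)"
      using M(1) N(1) by (auto simp: compose_def i_def j_def p intro!: restrict_ext)
    moreover have "(\<lambda>x\<in>carrier P. compose (carrier P) i p x \<oplus>\<^bsub>P\<^esub> compose (carrier P) j q x) = (\<lambda>x\<in>carrier P. x)"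
      using M(1) N(1) by (auto simp: compose_def i_def j_def p P_simps intro!: restrict_ext)
    ultimately have "biproduct (mod_category A) M N P i j p q"
      unfolding biproduct_def using M N P by simp
    then show ?thesis by blast
  qed
  ultimately show ?thesis unfolding has_biproducts_def small_mod_def by auto
qed

text \<open>A copy of the regular module, coded by singletons of constant sequences. Every element
  of a small module is the image of its generator under some homomorphism, which is how natural
  transformations will be tested.\<close>

definition small_regular :: "'a small_module" where
  "small_regular = transport (\<lambda>a. {\<lambda>_. a}) \<lparr>carrier = carrier A, monoid.mult = undefined, monoid.one = undefined,
     ring.zero = \<zero>, add = add A, module.smult = monoid.mult A\<rparr>"

definition to_regular :: "'a \<Rightarrow> 'a small_carrier" where "to_regular a = {\<lambda>_. a}"

lemma inj_to_regular: "to_regular a = to_regular b \<longleftrightarrow> a = b"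
  by (auto simp: to_regular_def fun_eq_iff)

lemma small_regular:
  shows "small_regular \<in> Obj (small_mod A)"
    and "carrier small_regular = to_regular ` carrier A"
    and "a \<in> carrier A \<Longrightarrow> b \<in> carrier A \<Longrightarrow> to_regular a \<oplus>\<^bsub>small_regular\<^esub> to_regular b = to_regular (a \<oplus> b)"
    and "b \<in> carrier A \<Longrightarrow> a \<odot>\<^bsub>small_regular\<^esub> to_regular b = to_regular (a \<otimes> b)"
    and "\<zero>\<^bsub>small_regular\<^esub> = to_regular \<zero>"
proof -
  define R :: "('a, 'a) module" where "R = \<lparr>carrier = carrier A, monoid.mult = undefined, monoid.one = undefined,
     ring.zero = \<zero>, add = add A, module.smult = monoid.mult A\<rparr>"
  have inj: "inj_on to_regular (carrier R)" by (auto simp: inj_on_def inj_to_regular)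
  have sr: "small_regular = transport to_regular R"
    by (simp add: small_regular_def R_def to_regular_def[abs_def])
  have R: "left_module A R"
  proof (rule left_moduleI)
    show "abelian_group R"
    proof (rule abelian_groupI)
      fix x assume "x \<in> carrier R"
      then show "\<exists>y\<in>carrier R. y \<oplus>\<^bsub>R\<^esub> x = \<zero>\<^bsub>R\<^esub>"
        by (intro bexI[of _ "\<ominus> x"]) (auto simp: R_def l_neg)
    qed (auto simp: R_def a_assoc intro: a_comm)
  qed (auto simp: R_def l_distr r_distr m_assoc intro: ring_axioms)
  have "finitely_generated A R"
    unfolding finitely_generated_def
  proof (intro exI[of _ "{\<one>}"] conjI allI impI)
    fix N assume "submodule N A R \<and> {\<one>} \<subseteq> N"
    then have N: "submodule N A R" "\<one> \<in> N" by auto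
    show "N = carrier R"
    proof
      show "N \<subseteq> carrier R" using N(1) by (simp add: lm_submodule_iff[OF R])
      show "carrier R \<subseteq> N"
      proof
        fix x assume "x \<in> carrier R"
        then have x: "x \<in> carrier A" by (simp add: R_def)
        have "x \<odot>\<^bsub>R\<^esub> \<one> \<in> N" using N(1)[unfolded lm_submodule_iff[OF R]] N(2) x by blast
        then show "x \<in> N" using x by (simp add: R_def)
      qed
    qed
  qed (auto simp: R_def)
  then show "small_regular \<in> Obj (small_mod A)"
    using transport_module[OF R inj] transport_finitely_generated[OF R inj] by (simp add: small_mod_def sr)
  show "carrier small_regular = to_regular ` carrier A" "\<zero>\<^bsub>small_regular\<^esub> = to_regular \<zero>"
    by (simp_all add: sr R_def)
  show "a \<in> carrier A \<Longrightarrow> b \<in> carrier A \<Longrightarrow> to_regular a \<oplus>\<^bsub>small_regular\<^esub> to_regular b = to_regular (a \<oplus> b)"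
    using transport_simps(3)[OF inj, of a b] by (simp add: sr) (simp add: R_def)
  show "b \<in> carrier A \<Longrightarrow> a \<odot>\<^bsub>small_regular\<^esub> to_regular b = to_regular (a \<otimes> b)"
    using transport_simps(4)[OF inj, of b a] by (simp add: sr) (simp add: R_def)
qed

text \<open>The homomorphism that sends the generator of the regular module to \<open>x\<close>; the
  description operator decodes the singleton.\<close>

definition regular_hom :: "'a small_module \<Rightarrow> 'a small_carrier \<Rightarrow> 'a small_hom" where
  "regular_hom M x = (\<lambda>r\<in>carrier small_regular. (THE a. r = to_regular a) \<odot>\<^bsub>M\<^esub> x)"

lemma regular_hom:
  assumes M: "left_module A M" and x: "x \<in> carrier M"
  shows "regular_hom M x \<in> mod_hom A small_regular M"
    and "a \<in> carrier A \<Longrightarrow> regular_hom M x (to_regular a) = a \<odot>\<^bsub>M\<^esub> x"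
proof -
  show eq: "regular_hom M x (to_regular a) = a \<odot>\<^bsub>M\<^esub> x" if "a \<in> carrier A" for a
    using that by (simp add: regular_hom_def small_regular inj_to_regular)
  have "regular_hom M x \<in> extensional (carrier small_regular)" by (simp add: regular_hom_def)
  then show "regular_hom M x \<in> mod_hom A small_regular M"
    using x M by (auto simp: mod_hom_iff small_regular eq lm_smult_add_left[OF M] lm_smult_smult[OF M])
qed

text \<open>The products of the spanning elements of \<open>A\<close> with the module generators
  span a subspace that is stable under \<open>A\<close>. It is a submodule containing the generators
  and hence all of \<open>M\<close>.\<close>

lemma separated_module:
  assumes P: "finite P" "P \<subseteq> carrier A" "carrier A = V.vspan P"
    and M: "left_module A M" "finitely_generated A M"
  shows "\<exists>n. separated (restrict_scalars M) (carrier M) n"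
proof -
  interpret MV: vspace "restrict_scalars M" using M(1) by (rule vspace_restrict_scalars)
  obtain S where S: "finite S" "S \<subseteq> carrier M" "\<And>L. submodule L A M \<Longrightarrow> S \<subseteq> L \<Longrightarrow> L = carrier M"
    by (rule finitely_generatedE[OF M(2)]) (rule that)
  let ?T = "(\<lambda>(p, s). p \<odot>\<^bsub>M\<^esub> s) ` (P \<times> S)"
  have T: "finite ?T" "?T \<subseteq> carrier (restrict_scalars M)" using P S M by (auto simp: subset_iff)
  have sub: "MV.subspace (MV.vspan ?T)" by (rule MV.vspan_subspace[OF T(2)])
  have W: "a \<odot>\<^bsub>M\<^esub> s \<in> MV.vspan ?T" if "a \<in> carrier A" "s \<in> S" for a s
  proof -
    have s: "s \<in> carrier M" using that S by auto
    have "a \<in> V.vspan P" using that P by simp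
    then show ?thesis
    proof induction
      case zero
      then show ?case using s M(1) sub by (simp add: MV.subspace_def)
    next
      case (add u t c)
      have c: "u \<in> carrier A" "t \<in> carrier A" using add P(2) V.vspan_closed[OF P(2)] by auto
      have "(u \<oplus> c \<odot> t) \<odot>\<^bsub>M\<^esub> s = u \<odot>\<^bsub>M\<^esub> s \<oplus>\<^bsub>M\<^esub> scalar c \<odot>\<^bsub>M\<^esub> (t \<odot>\<^bsub>M\<^esub> s)"
        using c s M(1) by (simp add: lm_smult_add_left[OF M(1)] lm_smult_smult[OF M(1)] scalar_mult)
      moreover have "t \<odot>\<^bsub>M\<^esub> s \<in> ?T" using add that by auto
      ultimately show ?case using MV.vspan.add[OF add.IH, of "t \<odot>\<^bsub>M\<^esub> s" c] by simp
    qed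
  qed
  have "a \<odot>\<^bsub>M\<^esub> x \<in> MV.vspan ?T" if a: "a \<in> carrier A" and x: "x \<in> MV.vspan ?T" for a x
    using x
  proof induction
    case zero
    then show ?case using a M(1) sub by (simp add: MV.subspace_def)
  next
    case (add u t c)
    then obtain p s where t: "t = p \<odot>\<^bsub>M\<^esub> s" "p \<in> P" "s \<in> S" by auto
    have cl: "u \<in> carrier M" "p \<in> carrier A" "s \<in> carrier M"
      using add t P(2) S(2) MV.vspan_closed[OF T(2)] by auto
    have "a \<odot>\<^bsub>M\<^esub> (u \<oplus>\<^bsub>M\<^esub> scalar c \<odot>\<^bsub>M\<^esub> t) = a \<odot>\<^bsub>M\<^esub> u \<oplus>\<^bsub>M\<^esub> scalar c \<odot>\<^bsub>M\<^esub> ((a \<otimes> p) \<odot>\<^bsub>M\<^esub> s)"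
      using cl a M(1) by (simp add: t lm_smult_add_right[OF M(1)] lm_smult_smult[OF M(1)] scalar_mult smult_mult_right)
    moreover have "(a \<otimes> p) \<odot>\<^bsub>M\<^esub> s \<in> MV.vspan ?T" using W cl a t by simp
    ultimately show ?case using add.IH sub by (simp add: MV.subspace_def)
  qed
  then have "submodule (MV.vspan ?T) A M"
    using sub by (auto simp: lm_submodule_iff[OF M(1)] MV.subspace_def)
  moreover have "S \<subseteq> MV.vspan ?T" using W[OF one_closed] S(2) M(1) by (auto simp: subset_iff)
  ultimately have "MV.vspan ?T = carrier M" using S(3) by blast
  then show ?thesis using MV.separated_vspan[OF T] by simp
qed

end

section \<open>Tensor products\<close>

text \<open>Unlike \<open>mod_hom\<close> this is not extensional, so composites and sums need no
  restriction to the carrier. It is typed for ring records, which all module and tensor records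
  extend.\<close>

definition additive_map :: "('a, 'c) ring_scheme \<Rightarrow> ('b, 'd) ring_scheme \<Rightarrow> ('a \<Rightarrow> 'b) \<Rightarrow> bool" where
  "additive_map V W h \<longleftrightarrow> (\<forall>x\<in>carrier V. h x \<in> carrier W) \<and>
     (\<forall>x\<in>carrier V. \<forall>y\<in>carrier V. h (x \<oplus>\<^bsub>V\<^esub> y) = h x \<oplus>\<^bsub>W\<^esub> h y)"

lemma additive_mapI:
  "(\<And>x. x \<in> carrier V \<Longrightarrow> h x \<in> carrier W) \<Longrightarrow>
   (\<And>x y. x \<in> carrier V \<Longrightarrow> y \<in> carrier V \<Longrightarrow> h (x \<oplus>\<^bsub>V\<^esub> y) = h x \<oplus>\<^bsub>W\<^esub> h y) \<Longrightarrow> additive_map V W h"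
  by (simp add: additive_map_def)

lemma additive_mapD:
  assumes "additive_map V W h"
  shows "x \<in> carrier V \<Longrightarrow> h x \<in> carrier W"
    and "x \<in> carrier V \<Longrightarrow> y \<in> carrier V \<Longrightarrow> h (x \<oplus>\<^bsub>V\<^esub> y) = h x \<oplus>\<^bsub>W\<^esub> h y"
  using assms by (auto simp: additive_map_def)

lemma additive_map_compose:
  "additive_map U V f \<Longrightarrow> additive_map V W g \<Longrightarrow> additive_map U W (\<lambda>x. g (f x))"
  by (simp add: additive_map_def)

lemma additive_map_zero:
  assumes "additive_map V W h" "abelian_group V" "abelian_group W"
  shows "h \<zero>\<^bsub>V\<^esub> = \<zero>\<^bsub>W\<^esub>"
proof -
  interpret V: abelian_group V by fact
  interpret W: abelian_group W by fact
  have "h \<zero>\<^bsub>V\<^esub> \<oplus>\<^bsub>W\<^esub> h \<zero>\<^bsub>V\<^esub> = h \<zero>\<^bsub>V\<^esub>" using additive_mapD(2)[OF assms(1), of "\<zero>\<^bsub>V\<^esub>" "\<zero>\<^bsub>V\<^esub>"] by simp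
  then show ?thesis using additive_mapD(1)[OF assms(1), of "\<zero>\<^bsub>V\<^esub>"] by (metis V.zero_closed W.add.r_cancel_one')
qed

lemma additive_map_sum:
  assumes "abelian_group W" "additive_map V W f" "additive_map V W g"
  shows "additive_map V W (\<lambda>x. f x \<oplus>\<^bsub>W\<^esub> g x)"
proof -
  interpret W: abelian_group W by fact
  show ?thesis using assms(2,3) by (auto simp: additive_map_def W.add.m_ac)
qed

lemma mod_hom_additive: "f \<in> mod_hom R M N \<Longrightarrow> additive_map M N f"
  by (auto simp: mod_hom_iff additive_map_def)

definition balanced_map ::
    "('r, 'c) ring_scheme \<Rightarrow> ('s, 'r, 'b, 'y) bimodule_scheme \<Rightarrow> ('r, 'm, 'z) module_scheme \<Rightarrow>
     ('h, 'd) ring_scheme \<Rightarrow> ('b \<Rightarrow> 'm \<Rightarrow> 'h) \<Rightarrow> bool" where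
  "balanced_map R B M H \<beta> \<longleftrightarrow>
    (\<forall>m\<in>carrier M. additive_map B H (\<lambda>b. \<beta> b m)) \<and> (\<forall>b\<in>carrier B. additive_map M H (\<beta> b)) \<and>
    (\<forall>b\<in>carrier B. \<forall>r\<in>carrier R. \<forall>m\<in>carrier M. \<beta> (rsmult B b r) m = \<beta> b (r \<odot>\<^bsub>M\<^esub> m))"

lemma balanced_mapD:
  assumes "balanced_map R B M H \<beta>"
  shows "b \<in> carrier B \<Longrightarrow> m \<in> carrier M \<Longrightarrow> \<beta> b m \<in> carrier H"
    and "b \<in> carrier B \<Longrightarrow> b' \<in> carrier B \<Longrightarrow> m \<in> carrier M \<Longrightarrow> \<beta> (b \<oplus>\<^bsub>B\<^esub> b') m = \<beta> b m \<oplus>\<^bsub>H\<^esub> \<beta> b' m"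
    and "b \<in> carrier B \<Longrightarrow> m \<in> carrier M \<Longrightarrow> m' \<in> carrier M \<Longrightarrow> \<beta> b (m \<oplus>\<^bsub>M\<^esub> m') = \<beta> b m \<oplus>\<^bsub>H\<^esub> \<beta> b m'"
    and "b \<in> carrier B \<Longrightarrow> r \<in> carrier R \<Longrightarrow> m \<in> carrier M \<Longrightarrow> \<beta> (rsmult B b r) m = \<beta> b (r \<odot>\<^bsub>M\<^esub> m)"
  using assms by (auto simp: balanced_map_def additive_map_def)

definition tensor_pure ::
    "('r, 'c) ring_scheme \<Rightarrow> ('s, 'r, 'b, 'y) bimodule_scheme \<Rightarrow> ('r, 'm, 'z) module_scheme \<Rightarrow>
     'b \<Rightarrow> 'm \<Rightarrow> ('b \<times> 'm \<Rightarrow>\<^sub>0 int) set" where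
  "tensor_pure R B M b m = tensor_null R B M #>\<^bsub>tensor_free B M\<^esub> frag_of (b, m)"

lemma tensor_simps:
  "carrier (tensor R B M) = carrier (tensor_free B M Mod tensor_null R B M)"
  "\<zero>\<^bsub>tensor R B M\<^esub> = \<one>\<^bsub>tensor_free B M Mod tensor_null R B M\<^esub>"
  "x \<oplus>\<^bsub>tensor R B M\<^esub> y = x \<otimes>\<^bsub>tensor_free B M Mod tensor_null R B M\<^esub> y"
  "s \<odot>\<^bsub>tensor R B M\<^esub> x = tensor_map R B M (\<lambda>b. s \<odot>\<^bsub>B\<^esub> b) (\<lambda>m. m) x"
  by (simp_all add: tensor_def Let_def FactGroup_def)

text \<open>Closure of the carriers under the operations that occur in the relators makes the
  relators elements of the free group. The tensor product and its universal property are thus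
  available before any bimodule law is known.\<close>

locale tensor_data =
  fixes R :: "('r, 'c) ring_scheme" and B :: "('s, 'r, 'b, 'y) bimodule_scheme"
    and M :: "('r, 'm, 'z) module_scheme"
  assumes B_add: "b \<in> carrier B \<Longrightarrow> b' \<in> carrier B \<Longrightarrow> b \<oplus>\<^bsub>B\<^esub> b' \<in> carrier B"
    and B_smult: "b \<in> carrier B \<Longrightarrow> r \<in> carrier R \<Longrightarrow> rsmult B b r \<in> carrier B"
    and M_add: "m \<in> carrier M \<Longrightarrow> m' \<in> carrier M \<Longrightarrow> m \<oplus>\<^bsub>M\<^esub> m' \<in> carrier M"
    and M_smult: "m \<in> carrier M \<Longrightarrow> r \<in> carrier R \<Longrightarrow> r \<odot>\<^bsub>M\<^esub> m \<in> carrier M"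
begin

abbreviation "free \<equiv> tensor_free B M"
abbreviation "null \<equiv> tensor_null R B M"
abbreviation "T \<equiv> tensor R B M"
abbreviation "pure \<equiv> tensor_pure R B M"

lemma free_comm_group: "comm_group free"
  by (rule abelian_free_Abelian_group)

lemma tensor_relators_closed: "tensor_relators R B M \<subseteq> carrier free"
proof -
  have diff: "x - y \<in> carrier free" if "x \<in> carrier free" "y \<in> carrier free" for x y
    using that keys_diff[of x y] by auto
  show ?thesis unfolding tensor_relators_def
    by (auto intro!: diff simp: B_add B_smult M_add M_smult simp del: carrier_free_Abelian_group_iff)
qed

lemma null_subgroup: "subgroup null free"
  unfolding tensor_null_def
  by (rule group.generate_is_subgroup[OF group_free_Abelian_group tensor_relators_closed])

lemma null_normal: "null \<lhd> free"
  by (rule comm_group.subgroup_imp_normal[OF free_comm_group null_subgroup])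

lemma T_abelian_group: "abelian_group T"
proof -
  interpret Q: comm_group "free Mod null"
    by (rule comm_group.abelian_FactGroup[OF free_comm_group null_subgroup])
  show ?thesis
  proof (rule abelian_groupI)
    fix x assume "x \<in> carrier T"
    then show "\<exists>y\<in>carrier T. y \<oplus>\<^bsub>T\<^esub> x = \<zero>\<^bsub>T\<^esub>"
      using Q.l_inv_ex by (simp add: tensor_simps)
  qed (unfold tensor_simps, (rule Q.m_closed Q.one_closed Q.m_assoc Q.m_comm Q.l_one; assumption)+)
qed

lemma carrier_T: "carrier T = (\<lambda>c. null #>\<^bsub>free\<^esub> c) ` carrier free"
  by (auto simp: tensor_simps FactGroup_def RCOSETS_def)

lemma coset_closed: "c \<in> carrier free \<Longrightarrow> null #>\<^bsub>free\<^esub> c \<in> carrier T"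
  unfolding carrier_T by (rule imageI)

lemma carrier_TE:
  assumes "x \<in> carrier T" obtains c where "c \<in> carrier free" "x = null #>\<^bsub>free\<^esub> c"
  using assms unfolding carrier_T by (elim imageE) simp

lemma T_add: "x \<in> carrier free \<Longrightarrow> y \<in> carrier free \<Longrightarrow>
    (null #>\<^bsub>free\<^esub> x) \<oplus>\<^bsub>T\<^esub> (null #>\<^bsub>free\<^esub> y) = null #>\<^bsub>free\<^esub> (x + y)"
  using normal.rcos_sum[OF null_normal, of x y] by (simp add: tensor_simps FactGroup_def)

lemma pure_closed: "b \<in> carrier B \<Longrightarrow> m \<in> carrier M \<Longrightarrow> pure b m \<in> carrier T"
  unfolding carrier_T tensor_pure_def by (intro imageI) simp

lemma coset_eqI:
  assumes "x \<in> carrier free" "y \<in> carrier free" "x - y \<in> null"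
  shows "null #>\<^bsub>free\<^esub> x = null #>\<^bsub>free\<^esub> y"
proof -
  have "x \<in> null #>\<^bsub>free\<^esub> y"
    unfolding r_coset_def using assms(3) by (auto intro!: bexI[of _ "x - y"])
  then show ?thesis
    using group.repr_independence[OF group_free_Abelian_group _ assms(2) null_subgroup] by auto
qed

lemma relator_null: "x \<in> tensor_relators R B M \<Longrightarrow> x \<in> null"
  by (simp add: tensor_null_def generate.incl)

lemma balanced_pure: "balanced_map R B M T pure"
proof -
  have keys2: "Poly_Mapping.keys (frag_of x + frag_of y) \<subseteq> carrier B \<times> carrier M"
    if "x \<in> carrier B \<times> carrier M" "y \<in> carrier B \<times> carrier M" for x y :: "'b \<times> 'm"
    using that keys_add[of "frag_of x" "frag_of y"] by auto
  have "pure (b \<oplus>\<^bsub>B\<^esub> b') m = pure b m \<oplus>\<^bsub>T\<^esub> pure b' m"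
    if "b \<in> carrier B" "b' \<in> carrier B" "m \<in> carrier M" for b b' m
    unfolding tensor_pure_def using that
    by (subst T_add, simp, simp, intro coset_eqI relator_null)
      (auto simp: B_add keys2 tensor_relators_def diff_diff_eq[symmetric])
  moreover have "pure b (m \<oplus>\<^bsub>M\<^esub> m') = pure b m \<oplus>\<^bsub>T\<^esub> pure b m'"
    if "b \<in> carrier B" "m' \<in> carrier M" "m \<in> carrier M" for b m' m
    unfolding tensor_pure_def using that
    by (subst T_add, simp, simp, intro coset_eqI relator_null)
      (auto simp: M_add keys2 tensor_relators_def diff_diff_eq[symmetric])
  moreover have "pure (rsmult B b r) m = pure b (r \<odot>\<^bsub>M\<^esub> m)"
    if "b \<in> carrier B" "r \<in> carrier R" "m \<in> carrier M" for b r m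
    unfolding tensor_pure_def using that
    by (intro coset_eqI relator_null) (auto simp: B_smult M_smult tensor_relators_def)
  ultimately show ?thesis
    by (auto simp: balanced_map_def additive_map_def pure_closed)
qed

text \<open>Balancedness sends each of the three kinds of relators to zero; the kernel is a
  subgroup, so it contains all that the relators generate.\<close>

lemma hom_null:
  assumes H: "abelian_group H" and \<beta>: "balanced_map R B M H \<beta>"
    and h: "h \<in> hom free (add_monoid H)" "\<And>b m. b \<in> carrier B \<Longrightarrow> m \<in> carrier M \<Longrightarrow> h (frag_of (b, m)) = \<beta> b m"
    and x: "x \<in> null"
  shows "h x = \<zero>\<^bsub>H\<^esub>"
proof -
  interpret H: abelian_group H by (rule H)
  interpret gh: group_hom free "add_monoid H" h
    using h(1) H.a_comm_group by (intro group_hom.intro group_hom_axioms.intro) (auto simp: comm_group_def)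
  have hadd: "h (u + v) = h u \<oplus>\<^bsub>H\<^esub> h v" if "u \<in> carrier free" "v \<in> carrier free" for u v
    using gh.hom_mult[OF that] by simp
  have hdiff: "h (u - v) = h u \<ominus>\<^bsub>H\<^esub> h v" if "u \<in> carrier free" "v \<in> carrier free" for u v
  proof -
    have "u - v \<in> carrier free" using that keys_diff[of u v] by auto
    then have "h u = h (u - v) \<oplus>\<^bsub>H\<^esub> h v" using hadd[of "u - v" v] that by simp
    moreover have "h (u - v) \<in> carrier H" "h v \<in> carrier H" "h u \<in> carrier H"
      using gh.hom_closed that \<open>u - v \<in> carrier free\<close> by auto
    ultimately show ?thesis by (simp add: a_minus_def H.a_assoc H.r_neg)
  qed
  have H0: "p \<oplus>\<^bsub>H\<^esub> q \<ominus>\<^bsub>H\<^esub> p \<ominus>\<^bsub>H\<^esub> q = \<zero>\<^bsub>H\<^esub>" if "p \<in> carrier H" "q \<in> carrier H" for p q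
    using that by (simp add: a_minus_def H.a_comm[of p q] H.a_assoc H.r_neg)
  have H1: "p \<ominus>\<^bsub>H\<^esub> p = \<zero>\<^bsub>H\<^esub>" if "p \<in> carrier H" for p
    using that by (simp add: a_minus_def H.r_neg)
  have cl: "frag_of (b, m) \<in> carrier free" if "b \<in> carrier B" "m \<in> carrier M" for b m using that by simp
  have cl2: "frag_of (b, m) - frag_of (b', m') \<in> carrier free"
    if "b \<in> carrier B" "m \<in> carrier M" "b' \<in> carrier B" "m' \<in> carrier M" for b m b' m'
    using that keys_diff[of "frag_of (b, m)" "frag_of (b', m')"] by auto
  have "h y = \<zero>\<^bsub>H\<^esub>" if "y \<in> tensor_relators R B M" for y
    using that unfolding tensor_relators_def
    by (auto simp: hdiff cl cl2 h(2) B_add M_add B_smult M_smult balanced_mapD[OF \<beta>] H0 H1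
        simp del: carrier_free_Abelian_group_iff)
  then have "tensor_relators R B M \<subseteq> kernel free (add_monoid H) h"
    using tensor_relators_closed by (auto simp: kernel_def simp del: carrier_free_Abelian_group_iff)
  then have "null \<subseteq> kernel free (add_monoid H) h"
    unfolding tensor_null_def
    by (intro group.generate_subgroup_incl[OF group_free_Abelian_group] gh.subgroup_kernel)
  then show ?thesis using x by (auto simp: kernel_def)
qed

lemma hom_coset:
  assumes H: "abelian_group H" and \<beta>: "balanced_map R B M H \<beta>"
    and h: "h \<in> hom free (add_monoid H)" "\<And>b m. b \<in> carrier B \<Longrightarrow> m \<in> carrier M \<Longrightarrow> h (frag_of (b, m)) = \<beta> b m"
    and c: "c \<in> carrier free" and x: "x \<in> null #>\<^bsub>free\<^esub> c"
  shows "h x = h c"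
proof -
  interpret H: abelian_group H by (rule H)
  obtain n where n: "n \<in> null" "x = n + c" using x by (auto simp: r_coset_def)
  have "n \<in> carrier free" using n null_subgroup by (meson subgroup.mem_carrier)
  then have "h x = h n \<oplus>\<^bsub>H\<^esub> h c" using h(1) c n unfolding hom_def by fastforce
  moreover have "h c \<in> carrier H" using h(1) c unfolding hom_def by fastforce
  ultimately show ?thesis using hom_null[OF assms(1-4) n(1)] by simp
qed

lemma free_hom_exists:
  assumes H: "abelian_group H" and \<beta>: "balanced_map R B M H \<beta>"
  shows "\<exists>h\<in>hom free (add_monoid H). \<forall>b\<in>carrier B. \<forall>m\<in>carrier M. h (frag_of (b, m)) = \<beta> b m"
proof -
  have "comm_group (add_monoid H)" using H by (rule abelian_group.a_comm_group)
  moreover have "(\<lambda>(b, m). \<beta> b m) ` (carrier B \<times> carrier M) \<subseteq> carrier (add_monoid H)"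
    using balanced_mapD[OF \<beta>] by auto
  ultimately obtain h where h: "h \<in> hom free (add_monoid H)"
    "\<And>x. x \<in> carrier B \<times> carrier M \<Longrightarrow> h (frag_of x) = (\<lambda>(b, m). \<beta> b m) x"
    using comm_group.free_Abelian_group_universal by metis
  then show ?thesis by (intro bexI[OF _ h(1)]) auto
qed

lemma tensor_universal:
  assumes H: "abelian_group H" and \<beta>: "balanced_map R B M H \<beta>"
  shows "\<exists>h. additive_map T H h \<and> (\<forall>b\<in>carrier B. \<forall>m\<in>carrier M. h (pure b m) = \<beta> b m)"
proof -
  obtain h where h: "h \<in> hom free (add_monoid H)" "\<And>b m. b \<in> carrier B \<Longrightarrow> m \<in> carrier M \<Longrightarrow> h (frag_of (b, m)) = \<beta> b m"
    using free_hom_exists[OF assms] by blast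
  \<comment> \<open>Any representative of the coset will do, since \<open>h\<close> is constant on
    cosets.\<close>
  define g where "g K = h (SOME x. x \<in> K)" for K
  have g: "g (null #>\<^bsub>free\<^esub> c) = h c" if "c \<in> carrier free" for c
  proof -
    have "c \<in> null #>\<^bsub>free\<^esub> c" using that null_subgroup by (simp add: group.rcos_self)
    then have "(SOME x. x \<in> null #>\<^bsub>free\<^esub> c) \<in> null #>\<^bsub>free\<^esub> c" by (rule someI)
    then show ?thesis unfolding g_def using hom_coset[OF assms h that] by blast
  qed
  have "additive_map T H g"
  proof (rule additive_mapI)
    show "g x \<in> carrier H" if "x \<in> carrier T" for x
      using that h(1) g unfolding carrier_T by (auto simp: hom_def Pi_def simp del: carrier_free_Abelian_group_iff)
    show "g (x \<oplus>\<^bsub>T\<^esub> y) = g x \<oplus>\<^bsub>H\<^esub> g y" if "x \<in> carrier T" "y \<in> carrier T" for x y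
    proof -
      obtain c where c: "c \<in> carrier free" "x = null #>\<^bsub>free\<^esub> c"
        using \<open>x \<in> carrier T\<close> by (rule carrier_TE) (rule that)
      obtain d where d: "d \<in> carrier free" "y = null #>\<^bsub>free\<^esub> d"
        using \<open>y \<in> carrier T\<close> by (rule carrier_TE) (rule that)
      have "c + d \<in> carrier free" using c d keys_add[of c d] by auto
      then have "g (x \<oplus>\<^bsub>T\<^esub> y) = h (c + d)" using c d by (simp add: T_add g del: carrier_free_Abelian_group_iff)
      also have "\<dots> = h c \<oplus>\<^bsub>H\<^esub> h d" using h(1) c(1) d(1) unfolding hom_def by fastforce
      finally show ?thesis using c d by (simp add: g del: carrier_free_Abelian_group_iff)
    qed
  qed
  moreover have "g (pure b m) = \<beta> b m" if "b \<in> carrier B" "m \<in> carrier M" for b m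
    unfolding tensor_pure_def using that by (simp add: g h(2))
  ultimately show ?thesis by blast
qed

text \<open>Every coset comes from a finite integer combination of pairs. The induction over such
  combinations proceeds by differences, which additivity and cancellation in \<open>H\<close> take
  care of.\<close>

lemma tensor_hom_ext:
  assumes H: "abelian_group H" and f: "additive_map T H f" and g: "additive_map T H g"
    and eq: "\<And>b m. b \<in> carrier B \<Longrightarrow> m \<in> carrier M \<Longrightarrow> f (pure b m) = g (pure b m)"
    and x: "x \<in> carrier T"
  shows "f x = g x"
proof -
  interpret H: abelian_group H by (rule H)
  interpret T: abelian_group T by (rule T_abelian_group)
  obtain c where c: "c \<in> carrier free" "x = null #>\<^bsub>free\<^esub> c" using x by (rule carrier_TE) (rule that)
  have "c \<in> carrier free \<and> f (null #>\<^bsub>free\<^esub> c) = g (null #>\<^bsub>free\<^esub> c)"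
    using c(1)[unfolded carrier_free_Abelian_group_iff]
  proof (induction c rule: frag_induction)
    case zero
    have "null #>\<^bsub>free\<^esub> 0 = \<zero>\<^bsub>T\<^esub>"
      using null_subgroup by (simp add: tensor_simps FactGroup_def group.coset_mult_one[OF group_free_Abelian_group, of _ "carrier B \<times> carrier M", simplified] subgroup.subset)
    then show ?case using additive_map_zero[OF f T_abelian_group H] additive_map_zero[OF g T_abelian_group H] by simp
  next
    case (one bm)
    then show ?case using eq by (cases bm) (auto simp: tensor_pure_def)
  next
    case (diff a b)
    then have ab: "a \<in> carrier free" "b \<in> carrier free" by auto
    then have d: "a - b \<in> carrier free" using keys_diff[of a b] by auto
    note mem = coset_closed[OF ab(1)] coset_closed[OF ab(2)] coset_closed[OF d]
    have "null #>\<^bsub>free\<^esub> a = (null #>\<^bsub>free\<^esub> (a - b)) \<oplus>\<^bsub>T\<^esub> (null #>\<^bsub>free\<^esub> b)"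
      using T_add[OF d ab(2)] by simp
    then have "f (null #>\<^bsub>free\<^esub> (a - b)) \<oplus>\<^bsub>H\<^esub> f (null #>\<^bsub>free\<^esub> b) = g (null #>\<^bsub>free\<^esub> (a - b)) \<oplus>\<^bsub>H\<^esub> g (null #>\<^bsub>free\<^esub> b)"
      using diff additive_mapD(2)[OF f mem(3,2)] additive_mapD(2)[OF g mem(3,2)] by simp
    then show ?case
      using diff d additive_mapD(1)[OF f] additive_mapD(1)[OF g] mem by simp
  qed
  then show ?thesis using c by simp
qed

end

text \<open>\<open>tensor_map\<close> takes the only element of the image of a coset. This image is
  a singleton because the homomorphism from the free group comes from a balanced map and so kills
  the relators.\<close>

lemma tensor_map:
  assumes D1: "tensor_data R B M" and D2: "tensor_data R B' M'"
    and f: "additive_map B B' f" "\<And>b r. b \<in> carrier B \<Longrightarrow> r \<in> carrier R \<Longrightarrow> f (rsmult B b r) = rsmult B' (f b) r"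
    and g: "additive_map M M' g" "\<And>m r. m \<in> carrier M \<Longrightarrow> r \<in> carrier R \<Longrightarrow> g (r \<odot>\<^bsub>M\<^esub> m) = r \<odot>\<^bsub>M'\<^esub> g m"
  shows "additive_map (tensor R B M) (tensor R B' M') (tensor_map R B' M' f g)"
    and "b \<in> carrier B \<Longrightarrow> m \<in> carrier M \<Longrightarrow>
      tensor_map R B' M' f g (tensor_pure R B M b m) = tensor_pure R B' M' (f b) (g m)"
proof -
  interpret D1: tensor_data R B M by (rule D1)
  interpret D2: tensor_data R B' M' by (rule D2)
  define \<phi> where "\<phi> = frag_extend (\<lambda>(b, m). frag_of (f b, g m))"
  define \<psi> where "\<psi> x = D2.null #>\<^bsub>D2.free\<^esub> \<phi> x" for x
  have \<phi>: "\<phi> x \<in> carrier D2.free" if "x \<in> carrier D1.free" for x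
  proof -
    have x: "Poly_Mapping.keys x \<subseteq> carrier B \<times> carrier M" using that by simp
    have "Poly_Mapping.keys (\<phi> x) \<subseteq> (\<Union>z\<in>Poly_Mapping.keys x. Poly_Mapping.keys ((\<lambda>(b, m). frag_of (f b, g m)) z))"
      unfolding \<phi>_def by (rule keys_frag_extend)
    also have "\<dots> \<subseteq> carrier B' \<times> carrier M'"
      using x additive_mapD(1)[OF f(1)] additive_mapD(1)[OF g(1)] by (intro UN_least) (auto simp: subset_iff)
    finally show ?thesis by simp
  qed
  have \<psi>: "\<psi> \<in> hom D1.free (add_monoid D2.T)"
    unfolding hom_def
  proof (intro CollectI conjI ballI)
    show "\<psi> \<in> carrier D1.free \<rightarrow> carrier (add_monoid D2.T)"
      using \<phi> by (auto simp: \<psi>_def D2.carrier_T simp del: carrier_free_Abelian_group_iff)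
    show "\<psi> (x \<otimes>\<^bsub>D1.free\<^esub> y) = \<psi> x \<otimes>\<^bsub>add_monoid D2.T\<^esub> \<psi> y" if "x \<in> carrier D1.free" "y \<in> carrier D1.free" for x y
      using D2.T_add[OF \<phi>[OF that(1)] \<phi>[OF that(2)]] by (simp add: \<psi>_def \<phi>_def frag_extend_add)
  qed
  have \<psi>_pure: "\<psi> (frag_of (b, m)) = tensor_pure R B' M' (f b) (g m)" for b m
    by (simp add: \<psi>_def \<phi>_def tensor_pure_def)
  have bal: "balanced_map R B M D2.T (\<lambda>b m. tensor_pure R B' M' (f b) (g m))"
    using additive_mapD[OF f(1)] additive_mapD[OF g(1)] f(2) g(2) balanced_mapD[OF D2.balanced_pure]
    by (auto simp: balanced_map_def additive_map_def)
  have eq: "tensor_map R B' M' f g (D1.null #>\<^bsub>D1.free\<^esub> c) = \<psi> c" if c: "c \<in> carrier D1.free" for c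
  proof -
    have "\<psi> x = \<psi> c" if "x \<in> D1.null #>\<^bsub>D1.free\<^esub> c" for x
      by (rule D1.hom_coset[OF D2.T_abelian_group bal \<psi> \<psi>_pure c that])
    moreover have "c \<in> D1.null #>\<^bsub>D1.free\<^esub> c" using c D1.null_subgroup by (simp add: group.rcos_self)
    ultimately have "\<psi> ` (D1.null #>\<^bsub>D1.free\<^esub> c) = {\<psi> c}" by blast
    then show ?thesis by (simp add: tensor_map_def \<psi>_def[abs_def] \<phi>_def)
  qed
  show "additive_map (tensor R B M) (tensor R B' M') (tensor_map R B' M' f g)"
  proof (rule additive_mapI)
    show "tensor_map R B' M' f g x \<in> carrier D2.T" if x: "x \<in> carrier D1.T" for x
    proof -
      obtain c where c: "c \<in> carrier D1.free" "x = D1.null #>\<^bsub>D1.free\<^esub> c" using x by (rule D1.carrier_TE) (rule that)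
      then show ?thesis using \<psi> by (auto simp: eq hom_def Pi_def simp del: carrier_free_Abelian_group_iff)
    qed
    show "tensor_map R B' M' f g (x \<oplus>\<^bsub>D1.T\<^esub> y) = tensor_map R B' M' f g x \<oplus>\<^bsub>D2.T\<^esub> tensor_map R B' M' f g y"
      if xy: "x \<in> carrier D1.T" "y \<in> carrier D1.T" for x y
    proof -
      obtain c where c: "c \<in> carrier D1.free" "x = D1.null #>\<^bsub>D1.free\<^esub> c" using xy(1) by (rule D1.carrier_TE) (rule that)
      obtain d where d: "d \<in> carrier D1.free" "y = D1.null #>\<^bsub>D1.free\<^esub> d" using xy(2) by (rule D1.carrier_TE) (rule that)
      have cd: "c + d \<in> carrier D1.free" using c d keys_add[of c d] by auto
      have "\<psi> (c + d) = \<psi> c \<oplus>\<^bsub>D2.T\<^esub> \<psi> d" using \<psi> c(1) d(1) unfolding hom_def by fastforce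
      then show ?thesis using D1.T_add[OF c(1) d(1)] c d eq cd by simp
    qed
  qed
  show "tensor_map R B' M' f g (tensor_pure R B M b m) = tensor_pure R B' M' (f b) (g m)"
    if "b \<in> carrier B" "m \<in> carrier M"
    using that unfolding tensor_pure_def[of R B M] by (simp add: eq \<psi>_pure)
qed

section \<open>Functors given by tensoring with a bimodule\<close>

lemma sub_bimodule_simps [simp]:
  "carrier (sub_bimodule A I l r) = I" "add (sub_bimodule A I l r) = add A" "\<zero>\<^bsub>sub_bimodule A I l r\<^esub> = \<zero>\<^bsub>A\<^esub>"
  "module.smult (sub_bimodule A I l r) = l" "rsmult (sub_bimodule A I l r) = r"
  by (simp_all add: sub_bimodule_def)

lemma ideal_bimodule_simps [simp]:
  "carrier (ideal_bimodule A I) = I" "add (ideal_bimodule A I) = add A" "\<zero>\<^bsub>ideal_bimodule A I\<^esub> = \<zero>\<^bsub>A\<^esub>"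
  "module.smult (ideal_bimodule A I) = monoid.mult A" "rsmult (ideal_bimodule A I) = monoid.mult A"
  by (simp_all add: ideal_bimodule_def)

lemma tensor_bimodule_simps [simp]:
  "carrier (tensor_bimodule R B N) = carrier (tensor R B N)" "add (tensor_bimodule R B N) = add (tensor R B N)"
  "\<zero>\<^bsub>tensor_bimodule R B N\<^esub> = \<zero>\<^bsub>tensor R B N\<^esub>"
  "module.smult (tensor_bimodule R B N) = module.smult (tensor R B N)"
  "rsmult (tensor_bimodule R B N) x t = tensor_map R B N (\<lambda>b. b) (\<lambda>n. rsmult N n t) x"
  by (simp_all add: tensor_bimodule_def module.defs bimodule.defs)

lemma small_mod_simps [simp]:
  "Obj (small_mod A) = {M. left_module A M \<and> finitely_generated A M}"
  "Mor (small_mod A) M N = mod_hom A M N"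
  "\<zero>\<^bsub>Hom (small_mod A) M N\<^esub> = (\<lambda>x\<in>carrier M. \<zero>\<^bsub>N\<^esub>)"
  "f \<oplus>\<^bsub>Hom (small_mod A) M N\<^esub> g = (\<lambda>x\<in>carrier M. f x \<oplus>\<^bsub>N\<^esub> g x)"
  "c \<odot>\<^bsub>Hom (small_mod A) M N\<^esub> f = (\<lambda>x\<in>carrier M. (c \<odot>\<^bsub>A\<^esub> \<one>\<^bsub>A\<^esub>) \<odot>\<^bsub>N\<^esub> f x)"
  "Comp (small_mod A) L M N g f = compose (carrier L) g f"
  "Id (small_mod A) M = (\<lambda>x\<in>carrier M. x)"
  by (simp_all add: small_mod_def)

context kalgebra
begin

lemma linear_small_mod: "linear_category (small_mod A)"
  unfolding small_mod_def by (rule linear_mod_category)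

sublocale S: linear_category "small_mod A" by (rule linear_small_mod)

sublocale SS: linear_categories "small_mod A" "small_mod A" ..

lemma small_functor_module:
  assumes "linear_functor (small_mod A) (small_mod A) F" "M \<in> Obj (small_mod A)"
  shows "left_module A (fobj F M)" "fobj F M \<in> Obj (small_mod A)"
  using linear_functor_obj[OF assms] by simp_all

lemma small_functor_hom:
  assumes "linear_functor (small_mod A) (small_mod A) F" "M \<in> Obj (small_mod A)" "N \<in> Obj (small_mod A)"
    "f \<in> mod_hom A M N"
  shows "fmor F M N f \<in> mod_hom A (fobj F M) (fobj F N)"
  using linear_functor_mor[OF assms(1-3)] assms(4) by simp

text \<open>The element of \<open>F M\<close> that corresponds to a pure tensor. Membership in
  \<open>tensor_functors\<close> comes without a preferred isomorphism, so one is chosen; the choice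
  is made for all \<open>M\<close> at once, which keeps it natural.\<close>

definition pure_element :: "('a, 'a, 'b) bimodule \<Rightarrow> 'a small_functor \<Rightarrow>
    'a small_module \<Rightarrow> 'b \<Rightarrow> 'a small_carrier \<Rightarrow> 'a small_carrier" where
  "pure_element B F M b m = (SOME \<theta>. (\<forall>M\<in>Obj (small_mod A). \<theta> M \<in> mod_iso A (tensor A B M) (fobj F M)) \<and>
         (\<forall>M\<in>Obj (small_mod A). \<forall>N\<in>Obj (small_mod A). \<forall>f\<in>Mor (small_mod A) M N.
            \<forall>x\<in>carrier (tensor A B M).
              fmor F M N f (\<theta> M x) = \<theta> N (tensor_map A B N (\<lambda>b. b) f x))) M (tensor_pure A B M b m)"

end

locale kbimodule = kalgebra A for A :: "('k::field, 'a) module" (structure) +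
  fixes B :: "('a, 'a, 'b) bimodule"
  assumes add_closed: "b \<in> carrier B \<Longrightarrow> b' \<in> carrier B \<Longrightarrow> b \<oplus>\<^bsub>B\<^esub> b' \<in> carrier B"
    and rsmult_closed: "b \<in> carrier B \<Longrightarrow> a \<in> carrier A \<Longrightarrow> rsmult B b a \<in> carrier B"
    and lsmult_closed: "b \<in> carrier B \<Longrightarrow> a \<in> carrier A \<Longrightarrow> a \<odot>\<^bsub>B\<^esub> b \<in> carrier B"
    and lsmult_add: "b \<in> carrier B \<Longrightarrow> b' \<in> carrier B \<Longrightarrow> a \<in> carrier A \<Longrightarrow>
      a \<odot>\<^bsub>B\<^esub> (b \<oplus>\<^bsub>B\<^esub> b') = a \<odot>\<^bsub>B\<^esub> b \<oplus>\<^bsub>B\<^esub> a \<odot>\<^bsub>B\<^esub> b'"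
    and lsmult_rsmult: "b \<in> carrier B \<Longrightarrow> a \<in> carrier A \<Longrightarrow> c \<in> carrier A \<Longrightarrow>
      a \<odot>\<^bsub>B\<^esub> rsmult B b c = rsmult B (a \<odot>\<^bsub>B\<^esub> b) c"
begin

lemma tensor_data: "left_module A M \<Longrightarrow> tensor_data A B M"
  by unfold_locales (auto simp: add_closed rsmult_closed)

lemma smult_pure:
  assumes M: "left_module A M" and "a \<in> carrier A" "b \<in> carrier B" "m \<in> carrier M"
  shows "a \<odot>\<^bsub>tensor A B M\<^esub> tensor_pure A B M b m = tensor_pure A B M (a \<odot>\<^bsub>B\<^esub> b) m"
    and "additive_map (tensor A B M) (tensor A B M) (\<lambda>x. a \<odot>\<^bsub>tensor A B M\<^esub> x)"
proof -
  have f: "additive_map B B (\<lambda>b. a \<odot>\<^bsub>B\<^esub> b)"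
    by (rule additive_mapI) (use assms in \<open>auto simp: lsmult_closed lsmult_add\<close>)
  have g: "additive_map M M (\<lambda>m. m)" by (simp add: additive_map_def)
  note * = tensor_map[OF tensor_data[OF M] tensor_data[OF M] f _ g]
  show "a \<odot>\<^bsub>tensor A B M\<^esub> tensor_pure A B M b m = tensor_pure A B M (a \<odot>\<^bsub>B\<^esub> b) m"
    unfolding tensor_simps by (rule *(2)) (use assms in \<open>auto simp: lsmult_rsmult\<close>)
  show "additive_map (tensor A B M) (tensor A B M) (\<lambda>x. a \<odot>\<^bsub>tensor A B M\<^esub> x)"
    unfolding tensor_simps(4) by (rule *(1)) (use assms in \<open>auto simp: lsmult_rsmult\<close>)
qed

lemma tensor_map_hom:
  assumes M: "left_module A M" and N: "left_module A N" and f: "f \<in> mod_hom A M N"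
  shows "additive_map (tensor A B M) (tensor A B N) (tensor_map A B N (\<lambda>b. b) f)"
    and "b \<in> carrier B \<Longrightarrow> m \<in> carrier M \<Longrightarrow>
      tensor_map A B N (\<lambda>b. b) f (tensor_pure A B M b m) = tensor_pure A B N b (f m)"
proof -
  note * = tensor_map[OF tensor_data[OF M] tensor_data[OF N] _ _ mod_hom_additive[OF f] mod_homD(3)[OF f], of "\<lambda>b. b"]
  show "additive_map (tensor A B M) (tensor A B N) (tensor_map A B N (\<lambda>b. b) f)"
    by (rule *(1)) (auto simp: additive_map_def)
  show "b \<in> carrier B \<Longrightarrow> m \<in> carrier M \<Longrightarrow>
      tensor_map A B N (\<lambda>b. b) f (tensor_pure A B M b m) = tensor_pure A B N b (f m)"
    by (rule *(2)) (auto simp: additive_map_def)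
qed

context
  fixes F :: "'a small_functor"
  assumes F: "F \<in> tensor_functors A B"
begin

abbreviation "t \<equiv> pure_element B F"

lemma tensor_functor_linear: "linear_functor (small_mod A) (small_mod A) F"
  using F by (simp add: tensor_functors_def)

lemma tensor_functor_iso:
  "\<exists>\<theta>. (\<forall>M\<in>Obj (small_mod A). \<theta> M \<in> mod_iso A (tensor A B M) (fobj F M) \<and>
        (\<forall>b m. t M b m = \<theta> M (tensor_pure A B M b m))) \<and>
      (\<forall>M\<in>Obj (small_mod A). \<forall>N\<in>Obj (small_mod A). \<forall>f\<in>Mor (small_mod A) M N.
            \<forall>x\<in>carrier (tensor A B M).
              fmor F M N f (\<theta> M x) = \<theta> N (tensor_map A B N (\<lambda>b. b) f x))"
proof -
  let ?P = "\<lambda>\<theta>. (\<forall>M\<in>Obj (small_mod A). \<theta> M \<in> mod_iso A (tensor A B M) (fobj F M)) \<and>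
         (\<forall>M\<in>Obj (small_mod A). \<forall>N\<in>Obj (small_mod A). \<forall>f\<in>Mor (small_mod A) M N.
            \<forall>x\<in>carrier (tensor A B M).
              fmor F M N f (\<theta> M x) = \<theta> N (tensor_map A B N (\<lambda>b. b) f x))"
  have "\<exists>\<theta>. ?P \<theta>" using F unfolding tensor_functors_def by blast
  then have "?P (SOME \<theta>. ?P \<theta>)" by (rule someI_ex)
  moreover have "t M b m = (SOME \<theta>. ?P \<theta>) M (tensor_pure A B M b m)" for M b m
    by (simp add: pure_element_def)
  ultimately show ?thesis by blast
qed

lemma pure_element_balanced:
  assumes M: "M \<in> Obj (small_mod A)"
  shows "balanced_map A B M (fobj F M) (t M)"
    and "a \<in> carrier A \<Longrightarrow> b \<in> carrier B \<Longrightarrow> m \<in> carrier M \<Longrightarrow> a \<odot>\<^bsub>fobj F M\<^esub> t M b m = t M (a \<odot>\<^bsub>B\<^esub> b) m"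
    and "N \<in> Obj (small_mod A) \<Longrightarrow> f \<in> mod_hom A M N \<Longrightarrow> b \<in> carrier B \<Longrightarrow> m \<in> carrier M \<Longrightarrow>
      fmor F M N f (t M b m) = t N b (f m)"
proof -
  have lm: "left_module A M" using M by simp
  interpret tensor_data A B M by (rule tensor_data[OF lm])
  obtain \<theta> where \<theta>: "\<forall>M\<in>Obj (small_mod A). \<theta> M \<in> mod_iso A (tensor A B M) (fobj F M) \<and>
        (\<forall>b m. t M b m = \<theta> M (tensor_pure A B M b m))"
    and nat: "\<forall>M\<in>Obj (small_mod A). \<forall>N\<in>Obj (small_mod A). \<forall>f\<in>Mor (small_mod A) M N.
            \<forall>x\<in>carrier (tensor A B M). fmor F M N f (\<theta> M x) = \<theta> N (tensor_map A B N (\<lambda>b. b) f x)"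
    using tensor_functor_iso by blast
  have \<theta>M: "\<theta> M \<in> mod_hom A T (fobj F M)" and t: "\<And>b m. t M b m = \<theta> M (pure b m)"
    using \<theta> M unfolding mod_iso_def by auto
  show "balanced_map A B M (fobj F M) (t M)"
    using balanced_mapD[OF balanced_pure] pure_closed mod_homD(1,2)[OF \<theta>M]
    by (simp add: balanced_map_def additive_map_def t)
  show "a \<odot>\<^bsub>fobj F M\<^esub> t M b m = t M (a \<odot>\<^bsub>B\<^esub> b) m" if "a \<in> carrier A" "b \<in> carrier B" "m \<in> carrier M"
    using mod_homD(3)[OF \<theta>M, of a "pure b m"] smult_pure(1)[OF lm that] pure_closed that by (simp add: t)
  show "fmor F M N f (t M b m) = t N b (f m)"
    if N: "N \<in> Obj (small_mod A)" and f: "f \<in> mod_hom A M N" and "b \<in> carrier B" "m \<in> carrier M"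
  proof -
    have "f \<in> Mor (small_mod A) M N" using f by simp
    then have "fmor F M N f (\<theta> M (pure b m)) = \<theta> N (tensor_map A B N (\<lambda>b. b) f (pure b m))"
      using nat M N pure_closed[OF that(3,4)] by blast
    moreover have "left_module A N" using N by simp
    ultimately show ?thesis using \<theta> M N that tensor_map_hom(2)[OF lm _ f] by simp
  qed
qed

text \<open>The universal property is moved from the tensor product to \<open>F M\<close> along the
  inverse of the chosen isomorphism, so that functors known only up to isomorphism can be mapped out
  of directly.\<close>

lemma pure_element_universal:
  fixes H :: "('a, 'h) module"
  assumes M: "M \<in> Obj (small_mod A)" and H: "abelian_group H"
  shows "balanced_map A B M H \<beta> \<Longrightarrow>
      \<exists>h. additive_map (fobj F M) H h \<and> (\<forall>b\<in>carrier B. \<forall>m\<in>carrier M. h (t M b m) = \<beta> b m)"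
    and "additive_map (fobj F M) H f \<Longrightarrow> additive_map (fobj F M) H g \<Longrightarrow>
      (\<And>b m. b \<in> carrier B \<Longrightarrow> m \<in> carrier M \<Longrightarrow> f (t M b m) = g (t M b m)) \<Longrightarrow>
      x \<in> carrier (fobj F M) \<Longrightarrow> f x = g x"
proof -
  have lm: "left_module A M" using M by simp
  interpret tensor_data A B M by (rule tensor_data[OF lm])
  interpret T: abelian_group T by (rule T_abelian_group)
  obtain \<theta> where "\<forall>M\<in>Obj (small_mod A). \<theta> M \<in> mod_iso A (tensor A B M) (fobj F M) \<and>
        (\<forall>b m. t M b m = \<theta> M (tensor_pure A B M b m))"
    using tensor_functor_iso by blast
  then have \<theta>M: "\<theta> M \<in> mod_hom A T (fobj F M)" and bij: "bij_betw (\<theta> M) (carrier T) (carrier (fobj F M))"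
    and t: "\<And>b m. t M b m = \<theta> M (pure b m)"
    using M unfolding mod_iso_def by auto
  let ?i = "inv_into (carrier T) (\<theta> M)"
  have i: "?i (\<theta> M x) = x" if "x \<in> carrier T" for x using bij that by (simp add: bij_betw_inv_into_left)
  have surj: "\<exists>y\<in>carrier T. x = \<theta> M y" if "x \<in> carrier (fobj F M)" for x
    using bij that unfolding bij_betw_def by auto
  have iadd: "additive_map (fobj F M) T ?i"
  proof (rule additive_mapI)
    fix x assume "x \<in> carrier (fobj F M)"
    then obtain x' where x': "x' \<in> carrier T" "x = \<theta> M x'" using surj by blast
    then show "?i x \<in> carrier T" using i by simp
    fix y assume "y \<in> carrier (fobj F M)"
    then obtain y' where y': "y' \<in> carrier T" "y = \<theta> M y'" using surj by blast
    have "\<theta> M x' \<oplus>\<^bsub>fobj F M\<^esub> \<theta> M y' = \<theta> M (x' \<oplus>\<^bsub>T\<^esub> y')" using x' y' mod_homD(2)[OF \<theta>M] by simp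
    then show "?i (x \<oplus>\<^bsub>fobj F M\<^esub> y) = ?i x \<oplus>\<^bsub>T\<^esub> ?i y" using x' y' i by simp
  qed
  show "\<exists>h. additive_map (fobj F M) H h \<and> (\<forall>b\<in>carrier B. \<forall>m\<in>carrier M. h (t M b m) = \<beta> b m)"
    if \<beta>: "balanced_map A B M H \<beta>"
  proof -
    obtain h where h: "additive_map T H h" "\<forall>b\<in>carrier B. \<forall>m\<in>carrier M. h (pure b m) = \<beta> b m"
      using tensor_universal[OF H \<beta>] by blast
    have "additive_map (fobj F M) H (\<lambda>x. h (?i x))" by (rule additive_map_compose[OF iadd h(1)])
    then show ?thesis using h(2) i pure_closed by (intro exI[of _ "\<lambda>x. h (?i x)"]) (simp add: t)
  qed
  show "f x = g x" if f: "additive_map (fobj F M) H f" and g: "additive_map (fobj F M) H g"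
    and eq: "\<And>b m. b \<in> carrier B \<Longrightarrow> m \<in> carrier M \<Longrightarrow> f (t M b m) = g (t M b m)"
    and x: "x \<in> carrier (fobj F M)"
  proof -
    obtain y where y: "y \<in> carrier T" "x = \<theta> M y" using surj x by blast
    have "f (\<theta> M y) = g (\<theta> M y)"
      using tensor_hom_ext[OF H additive_map_compose[OF mod_hom_additive[OF \<theta>M] f]
          additive_map_compose[OF mod_hom_additive[OF \<theta>M] g]] eq y(1) by (simp add: t)
    then show ?thesis using y by simp
  qed
qed

end

end

section \<open>The generating bimodules: ideals and \<open>A \<otimes>\<^sub>k A\<close>\<close>

context kalgebra
begin

lemma kbimodule_ideal:
  assumes "ideal I A" shows "kbimodule A (ideal_bimodule A I)"
proof -
  interpret ideal I A by fact
  show ?thesis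
    by unfold_locales (auto simp: I_l_closed I_r_closed r_distr m_assoc a_subset[THEN subsetD])
qed

abbreviation left_factor :: "('a, 'k, 'a) bimodule" where
  "left_factor \<equiv> sub_bimodule A (carrier A) (monoid.mult A) (\<lambda>a c. c \<odot> a)"

abbreviation right_factor :: "('k, 'a, 'a) bimodule" where
  "right_factor \<equiv> sub_bimodule A (carrier A) (module.smult A) (monoid.mult A)"

abbreviation pure2 :: "'a \<Rightarrow> 'a \<Rightarrow> ('a \<times> 'a \<Rightarrow>\<^sub>0 int) set" where
  "pure2 \<equiv> tensor_pure base_field left_factor right_factor"

abbreviation tensor2 :: "('a, ('a \<times> 'a \<Rightarrow>\<^sub>0 int) set) module" where
  "tensor2 \<equiv> tensor base_field left_factor right_factor"

sublocale TT: tensor_data base_field left_factor right_factor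
  by unfold_locales auto

lemma free_bimodule_simps:
  "carrier (free_bimodule A) = carrier tensor2" "add (free_bimodule A) = add tensor2"
  "module.smult (free_bimodule A) = module.smult tensor2"
  "rsmult (free_bimodule A) x a = tensor_map base_field left_factor right_factor (\<lambda>b. b) (\<lambda>n. n \<otimes> a) x"
  by (simp_all add: free_bimodule_def)

lemma free_bimodule_lsmult:
  assumes "a \<in> carrier A"
  shows "additive_map tensor2 tensor2 (\<lambda>x. a \<odot>\<^bsub>free_bimodule A\<^esub> x)"
    and "b \<in> carrier A \<Longrightarrow> c \<in> carrier A \<Longrightarrow> a \<odot>\<^bsub>free_bimodule A\<^esub> pure2 b c = pure2 (a \<otimes> b) c"
proof -
  have f: "additive_map left_factor left_factor (\<lambda>b. a \<odot>\<^bsub>left_factor\<^esub> b)"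
    and g: "additive_map right_factor right_factor (\<lambda>b. b)"
    using assms by (auto simp: additive_map_def r_distr)
  note * = tensor_map[OF TT.tensor_data_axioms TT.tensor_data_axioms f _ g]
  show "additive_map tensor2 tensor2 (\<lambda>x. a \<odot>\<^bsub>free_bimodule A\<^esub> x)"
    unfolding free_bimodule_simps tensor_simps(4) by (rule *(1)) (use assms in \<open>simp_all add: smult_mult_right\<close>)
  show "a \<odot>\<^bsub>free_bimodule A\<^esub> pure2 b c = pure2 (a \<otimes> b) c" if "b \<in> carrier A" "c \<in> carrier A"
    using *(2)[of b c] assms that by (simp add: free_bimodule_simps tensor_simps(4) smult_mult_right)
qed

lemma free_bimodule_rsmult:
  assumes "a \<in> carrier A"
  shows "additive_map tensor2 tensor2 (\<lambda>x. rsmult (free_bimodule A) x a)"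
    and "b \<in> carrier A \<Longrightarrow> c \<in> carrier A \<Longrightarrow> rsmult (free_bimodule A) (pure2 b c) a = pure2 b (c \<otimes> a)"
proof -
  have f: "additive_map left_factor left_factor (\<lambda>b. b)"
    and g: "additive_map right_factor right_factor (\<lambda>b. b \<otimes> a)"
    using assms by (auto simp: additive_map_def l_distr)
  note * = tensor_map[OF TT.tensor_data_axioms TT.tensor_data_axioms f _ g]
  show "additive_map tensor2 tensor2 (\<lambda>x. rsmult (free_bimodule A) x a)"
    unfolding free_bimodule_simps by (rule *(1)) (use assms in \<open>simp_all add: smult_mult_left\<close>)
  show "rsmult (free_bimodule A) (pure2 b c) a = pure2 b (c \<otimes> a)" if "b \<in> carrier A" "c \<in> carrier A"
    using *(2)[of b c] assms that by (simp add: free_bimodule_simps smult_mult_left)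
qed

text \<open>The left action moves the first factor and the right action the second, so they commute
  on pure tensors. Both composites are additive, and the agreement extends to the whole tensor
  product.\<close>

lemma kbimodule_free: "kbimodule A (free_bimodule A)"
proof unfold_locales
  fix b b' a c
  interpret T2: abelian_group tensor2 by (rule TT.T_abelian_group)
  { assume "b \<in> carrier (free_bimodule A)" "b' \<in> carrier (free_bimodule A)"
    then show "b \<oplus>\<^bsub>free_bimodule A\<^esub> b' \<in> carrier (free_bimodule A)" by (simp add: free_bimodule_simps)
    assume "a \<in> carrier A"
    then show "a \<odot>\<^bsub>free_bimodule A\<^esub> (b \<oplus>\<^bsub>free_bimodule A\<^esub> b') =
        a \<odot>\<^bsub>free_bimodule A\<^esub> b \<oplus>\<^bsub>free_bimodule A\<^esub> a \<odot>\<^bsub>free_bimodule A\<^esub> b'"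
      using additive_mapD(2)[OF free_bimodule_lsmult(1)] \<open>b \<in> _\<close> \<open>b' \<in> _\<close> by (simp add: free_bimodule_simps(1,2)) }
  assume b: "b \<in> carrier (free_bimodule A)" and a: "a \<in> carrier A"
  then show "rsmult (free_bimodule A) b a \<in> carrier (free_bimodule A)"
    "a \<odot>\<^bsub>free_bimodule A\<^esub> b \<in> carrier (free_bimodule A)"
    using additive_mapD(1)[OF free_bimodule_rsmult(1)] additive_mapD(1)[OF free_bimodule_lsmult(1)]
    by (simp_all add: free_bimodule_simps(1))
  assume c: "c \<in> carrier A"
  show "a \<odot>\<^bsub>free_bimodule A\<^esub> rsmult (free_bimodule A) b c = rsmult (free_bimodule A) (a \<odot>\<^bsub>free_bimodule A\<^esub> b) c"
    by (rule TT.tensor_hom_ext[OF TT.T_abelian_group additive_map_compose[OF free_bimodule_rsmult(1)[OF c] free_bimodule_lsmult(1)[OF a]]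
        additive_map_compose[OF free_bimodule_lsmult(1)[OF a] free_bimodule_rsmult(1)[OF c]]])
      (use a b c in \<open>simp_all add: free_bimodule_lsmult(2) free_bimodule_rsmult(2) free_bimodule_simps(1)\<close>)
qed

text \<open>
  A functor \<open>F\<close> with elements \<open>t M x m\<close> of \<open>F M\<close> that behave like \<open>x \<otimes> m\<close> in \<open>I \<otimes>\<^sub>Z M\<close>. Taking \<open>Z\<close> to be
  the base field and \<open>I = A\<close> covers tensoring with \<open>A \<otimes>\<^sub>k A\<close>, and \<open>Z = A\<close> covers tensoring with an ideal.
\<close>

definition tensor_like :: "'a set \<Rightarrow> 'a set \<Rightarrow> 'a small_functor \<Rightarrow>
    ('a small_module \<Rightarrow> 'a \<Rightarrow> 'a small_carrier \<Rightarrow> 'a small_carrier) \<Rightarrow> bool" where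
  "tensor_like Z I F t \<longleftrightarrow> linear_functor (small_mod A) (small_mod A) F \<and>
    ideal I A \<and> Z \<subseteq> carrier A \<and> range scalar \<subseteq> Z \<and>
    (\<forall>M\<in>Obj (small_mod A). balanced_map (A\<lparr>carrier := Z\<rparr>) (ideal_bimodule A I) M (fobj F M) (t M) \<and>
      (\<forall>a\<in>carrier A. \<forall>x\<in>I. \<forall>m\<in>carrier M. a \<odot>\<^bsub>fobj F M\<^esub> t M x m = t M (a \<otimes> x) m) \<and>
      (\<forall>N\<in>Obj (small_mod A). \<forall>f\<in>mod_hom A M N. \<forall>x\<in>I. \<forall>m\<in>carrier M. fmor F M N f (t M x m) = t N x (f m)))"

text \<open>HOL cannot quantify over types, so the carrier type of the target groups is a parameter.\<close>

definition universal :: "'h itself \<Rightarrow> 'a set \<Rightarrow> 'a set \<Rightarrow> 'a small_functor \<Rightarrow>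
    ('a small_module \<Rightarrow> 'a \<Rightarrow> 'a small_carrier \<Rightarrow> 'a small_carrier) \<Rightarrow> bool" where
  "universal _ Z I F t \<longleftrightarrow> (\<forall>M\<in>Obj (small_mod A). \<forall>H :: ('a, 'h) module. abelian_group H \<longrightarrow>
    (\<forall>\<beta>. balanced_map (A\<lparr>carrier := Z\<rparr>) (ideal_bimodule A I) M H \<beta> \<longrightarrow>
       (\<exists>h. additive_map (fobj F M) H h \<and> (\<forall>x\<in>I. \<forall>m\<in>carrier M. h (t M x m) = \<beta> x m))) \<and>
    (\<forall>f g. additive_map (fobj F M) H f \<longrightarrow> additive_map (fobj F M) H g \<longrightarrow>
       (\<forall>x\<in>I. \<forall>m\<in>carrier M. f (t M x m) = g (t M x m)) \<longrightarrow> (\<forall>y\<in>carrier (fobj F M). f y = g y)))"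

lemma carrier_update_A: "A\<lparr>carrier := carrier A\<rparr> = A"
  by simp

lemma tensor_functor_ideal:
  assumes I: "ideal I A" and F: "F \<in> tensor_functors A (ideal_bimodule A I)"
  shows "tensor_like (carrier A) I F (pure_element (ideal_bimodule A I) F)"
    and "universal h (carrier A) I F (pure_element (ideal_bimodule A I) F)"
proof -
  interpret kbimodule A "ideal_bimodule A I" by (rule kbimodule_ideal[OF I])
  show "tensor_like (carrier A) I F (pure_element (ideal_bimodule A I) F)"
    unfolding tensor_like_def carrier_update_A
  proof (intro conjI ballI)
    fix M assume M: "M \<in> Obj (small_mod A)"
    show "balanced_map A (ideal_bimodule A I) M (fobj F M) (pure_element (ideal_bimodule A I) F M)"
      by (rule pure_element_balanced(1)[OF F M])
    show "a \<odot>\<^bsub>fobj F M\<^esub> pure_element (ideal_bimodule A I) F M x m = pure_element (ideal_bimodule A I) F M (a \<otimes> x) m"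
      if "a \<in> carrier A" "x \<in> I" "m \<in> carrier M" for a x m
      using pure_element_balanced(2)[OF F M that(1) _ that(3), of x] that by simp
    show "fmor F M N f (pure_element (ideal_bimodule A I) F M x m) = pure_element (ideal_bimodule A I) F N x (f m)"
      if "N \<in> Obj (small_mod A)" "f \<in> mod_hom A M N" "x \<in> I" "m \<in> carrier M" for N f x m
      using pure_element_balanced(3)[OF F M that(1,2) _ that(4), of x] that by simp
  qed (use tensor_functor_linear[OF F] I in auto)
  show "universal h (carrier A) I F (pure_element (ideal_bimodule A I) F)"
    unfolding universal_def carrier_update_A
  proof (intro ballI allI impI conjI)
    fix M and H :: "('a, 'b) module" assume M: "M \<in> Obj (small_mod A)" and H: "abelian_group H"
    show "\<exists>h. additive_map (fobj F M) H h \<and> (\<forall>x\<in>I. \<forall>m\<in>carrier M. h (pure_element (ideal_bimodule A I) F M x m) = \<beta> x m)"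
      if "balanced_map A (ideal_bimodule A I) M H \<beta>" for \<beta>
      using pure_element_universal(1)[OF F M H that] by simp
    show "f y = g y" if "additive_map (fobj F M) H f" "additive_map (fobj F M) H g"
      "\<forall>x\<in>I. \<forall>m\<in>carrier M. f (pure_element (ideal_bimodule A I) F M x m) = g (pure_element (ideal_bimodule A I) F M x m)"
      "y \<in> carrier (fobj F M)" for f g y
      using pure_element_universal(2)[OF F M H that(1,2) _ that(4)] that(3) by simp
  qed
qed

text \<open>Stands for \<open>(a \<otimes> 1) \<otimes> m\<close> in
  \<open>(A \<otimes>\<^sub>k A) \<otimes>\<^sub>A M\<close>. These elements play the part of
  \<open>a \<otimes> m\<close> in \<open>A \<otimes>\<^sub>k M\<close>.\<close>

definition free_element :: "'a small_functor \<Rightarrow> 'a small_module \<Rightarrow> 'a \<Rightarrow> 'a small_carrier \<Rightarrow> 'a small_carrier" where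
  "free_element F M a m = pure_element (free_bimodule A) F M (pure2 a \<one>) m"

text \<open>The isomorphism of \<open>(A \<otimes>\<^sub>k A) \<otimes>\<^sub>A M\<close> with
  \<open>A \<otimes>\<^sub>k M\<close> is not written down. Instead, the elements
  \<open>free_element F M a m\<close> are shown to have the universal property of the
  latter.\<close>

lemma tensor_functor_free:
  assumes F: "F \<in> tensor_functors A (free_bimodule A)"
  shows "tensor_like (range scalar) (carrier A) F (free_element F)"
    and "universal h (range scalar) (carrier A) F (free_element F)"
proof -
  interpret B: kbimodule A "free_bimodule A" by (rule kbimodule_free)
  let ?t = "pure_element (free_bimodule A) F"
  have p: "pure2 a b \<in> carrier (free_bimodule A)" if "a \<in> carrier A" "b \<in> carrier A" for a b
    using TT.pure_closed that by (simp add: free_bimodule_simps(1))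
  note b2 = balanced_mapD[OF TT.balanced_pure, simplified]
  \<comment> \<open>Moving \<open>b\<close> across the tensor sign over \<open>A\<close> brings
    every pure element into the form with second factor \<open>\<one>\<close>.\<close>
  have t2: "?t M (pure2 a b) m = free_element F M a (b \<odot>\<^bsub>M\<^esub> m)"
    if M: "M \<in> Obj (small_mod A)" and ab: "a \<in> carrier A" "b \<in> carrier A" "m \<in> carrier M" for M a b m
  proof -
    have "pure2 a b = rsmult (free_bimodule A) (pure2 a \<one>) b" using ab by (simp add: free_bimodule_rsmult(2))
    then show ?thesis
      using balanced_mapD(4)[OF B.pure_element_balanced(1)[OF F M] p[OF ab(1) one_closed] ab(2,3)]
      by (simp add: free_element_def)
  qed
  show "tensor_like (range scalar) (carrier A) F (free_element F)"
    unfolding tensor_like_def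
  proof (intro conjI ballI)
    fix M assume M: "M \<in> Obj (small_mod A)"
    then have lm: "left_module A M" by simp
    note t = balanced_mapD[OF B.pure_element_balanced(1)[OF F M]]
    have "free_element F M (a \<otimes> scalar c) m = free_element F M a (scalar c \<odot>\<^bsub>M\<^esub> m)"
      if "a \<in> carrier A" "m \<in> carrier M" for a c m
    proof -
      have "pure2 (a \<otimes> scalar c) \<one> = pure2 a (scalar c)" using that b2(4)[of a "\<one>" c] by (simp add: scalar_mult)
      then show ?thesis using t2[OF M, of a "scalar c" m] that by (simp add: free_element_def)
    qed
    moreover have "free_element F M (a \<oplus> b) m = free_element F M a m \<oplus>\<^bsub>fobj F M\<^esub> free_element F M b m"
      if "a \<in> carrier A" "b \<in> carrier A" "m \<in> carrier M" for a b m
    proof -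
      have "pure2 (a \<oplus> b) \<one> = pure2 a \<one> \<oplus>\<^bsub>free_bimodule A\<^esub> pure2 b \<one>"
        using that b2(2)[of a b "\<one>"] by (simp add: free_bimodule_simps(2))
      then show ?thesis using t(2) p that by (simp add: free_element_def)
    qed
    ultimately show "balanced_map (A\<lparr>carrier := range scalar\<rparr>) (ideal_bimodule A (carrier A)) M (fobj F M) (free_element F M)"
      using t(1,3) p by (auto simp: balanced_map_def additive_map_def) (simp_all add: free_element_def)
    show "a \<odot>\<^bsub>fobj F M\<^esub> free_element F M x m = free_element F M (a \<otimes> x) m"
      if "a \<in> carrier A" "x \<in> carrier A" "m \<in> carrier M" for a x m
      using B.pure_element_balanced(2)[OF F M that(1) p[OF that(2) one_closed] that(3)] that
      by (simp add: free_element_def free_bimodule_lsmult(2))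
    show "fmor F M N f (free_element F M x m) = free_element F N x (f m)"
      if "N \<in> Obj (small_mod A)" "f \<in> mod_hom A M N" "x \<in> carrier A" "m \<in> carrier M" for N f x m
      using B.pure_element_balanced(3)[OF F M that(1,2) p[OF that(3) one_closed] that(4)]
      by (simp add: free_element_def)
  qed (use B.tensor_functor_linear[OF F] oneideal in auto)
  show "universal h (range scalar) (carrier A) F (free_element F)"
    unfolding universal_def
  proof (intro ballI allI impI conjI)
    fix M and H :: "('a, 'b) module" assume M: "M \<in> Obj (small_mod A)" and H: "abelian_group H"
    have lm: "left_module A M" using M by simp
    note t = balanced_mapD[OF B.pure_element_balanced(1)[OF F M]]
    { fix \<beta> assume \<beta>: "balanced_map (A\<lparr>carrier := range scalar\<rparr>) (ideal_bimodule A (carrier A)) M H \<beta>"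
      note b = balanced_mapD[OF \<beta>, simplified]
      interpret H: abelian_group H by (rule H)
      \<comment> \<open>For fixed \<open>m\<close>, the map \<open>\<beta> a (b m)\<close> of
        \<open>a\<close> and \<open>b\<close> is balanced over the field and factors through
        \<open>A \<otimes>\<^sub>k A\<close>. The resulting maps \<open>h m\<close> are then shown
        to be balanced over \<open>A\<close> jointly with \<open>m\<close>.\<close>
      have "\<exists>h. additive_map tensor2 H h \<and> (\<forall>a\<in>carrier A. \<forall>b\<in>carrier A. h (pure2 a b) = \<beta> a (b \<odot>\<^bsub>M\<^esub> m))"
        if m: "m \<in> carrier M" for m
      proof -
        have "\<beta> (c \<odot> a) (b \<odot>\<^bsub>M\<^esub> m) = \<beta> a ((c \<odot> b) \<odot>\<^bsub>M\<^esub> m)" if "a \<in> carrier A" "b \<in> carrier A" for a b c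
          using b(4)[of a "scalar c" "b \<odot>\<^bsub>M\<^esub> m"] that m lm
          by (simp add: scalar_mult lm_smult_smult[OF lm])
        then have "balanced_map base_field left_factor right_factor H (\<lambda>a b. \<beta> a (b \<odot>\<^bsub>M\<^esub> m))"
          using b(1-3) m lm by (simp add: balanced_map_def additive_map_def lm_smult_add_left[OF lm])
        then show ?thesis using TT.tensor_universal[OF H] by simp
      qed
      then obtain h where h: "\<And>m. m \<in> carrier M \<Longrightarrow> additive_map tensor2 H (h m)"
        "\<And>m a b. m \<in> carrier M \<Longrightarrow> a \<in> carrier A \<Longrightarrow> b \<in> carrier A \<Longrightarrow> h m (pure2 a b) = \<beta> a (b \<odot>\<^bsub>M\<^esub> m)"
        by metis
      have ext: "f u = g u" if "additive_map tensor2 H f" "additive_map tensor2 H g"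
        "\<And>a b. a \<in> carrier A \<Longrightarrow> b \<in> carrier A \<Longrightarrow> f (pure2 a b) = g (pure2 a b)" "u \<in> carrier tensor2" for f g u
        by (rule TT.tensor_hom_ext[OF H that(1,2) _ that(4)]) (use that(3) in simp)
      have "h (m \<oplus>\<^bsub>M\<^esub> m') u = h m u \<oplus>\<^bsub>H\<^esub> h m' u"
        if "m \<in> carrier M" "m' \<in> carrier M" "u \<in> carrier tensor2" for m m' u
        by (rule ext[OF h(1) additive_map_sum[OF H h(1) h(1)] _ that(3)])
          (use that lm b(3) in \<open>simp_all add: h(2) lm_smult_add_right[OF lm]\<close>)
      moreover have "h m (rsmult (free_bimodule A) u a) = h (a \<odot>\<^bsub>M\<^esub> m) u"
        if "m \<in> carrier M" "a \<in> carrier A" "u \<in> carrier tensor2" for m a u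
        by (rule ext[OF additive_map_compose[OF free_bimodule_rsmult(1) h(1)] h(1) _ that(3)])
          (use that lm in \<open>simp_all add: h(2) free_bimodule_rsmult(2) lm_smult_smult[OF lm]\<close>)
      ultimately have "balanced_map A (free_bimodule A) M H (\<lambda>u m. h m u)"
        using h(1) by (simp add: balanced_map_def additive_map_def free_bimodule_simps(1,2))
      then obtain k where "additive_map (fobj F M) H k" "\<forall>u\<in>carrier (free_bimodule A). \<forall>m\<in>carrier M. k (?t M u m) = h m u"
        using B.pure_element_universal(1)[OF F M H] by blast
      then show "\<exists>h. additive_map (fobj F M) H h \<and> (\<forall>x\<in>carrier A. \<forall>m\<in>carrier M. h (free_element F M x m) = \<beta> x m)"
        using p h(2) lm by (intro exI[of _ k]) (simp add: free_element_def) }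
    fix f g y assume f: "additive_map (fobj F M) H f" and g: "additive_map (fobj F M) H g"
      and eq: "\<forall>x\<in>carrier A. \<forall>m\<in>carrier M. f (free_element F M x m) = g (free_element F M x m)"
      and y: "y \<in> carrier (fobj F M)"
    show "f y = g y"
    proof (rule B.pure_element_universal(2)[OF F M H f g _ y])
      fix u m assume u: "u \<in> carrier (free_bimodule A)" and m: "m \<in> carrier M"
      have tu: "additive_map tensor2 (fobj F M) (\<lambda>u. ?t M u m)"
        using t(1,2) m by (simp add: additive_map_def free_bimodule_simps(1,2))
      show "f (?t M u m) = g (?t M u m)"
        by (rule TT.tensor_hom_ext[OF H additive_map_compose[OF tu f] additive_map_compose[OF tu g]])
          (use u m eq t2[OF M] lm in \<open>simp_all add: free_bimodule_simps(1)\<close>)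
    qed
  qed
qed

end

section \<open>Composition of tensor functors\<close>

context kalgebra
begin

sublocale FC: linear_category "functor_category (small_mod A) (small_mod A)"
  by (rule SS.linear_functor_category)

abbreviation "FCat \<equiv> functor_category (small_mod A) (small_mod A)"

abbreviation comp_functor :: "'a small_functor \<Rightarrow> 'a small_functor \<Rightarrow> 'a small_functor" (infixr \<open>\<star>\<close> 75) where
  "F \<star> G \<equiv> compose_functors (small_mod A) F G"

lemma natural_component:
  assumes "\<eta> \<in> natural_transformations (small_mod A) (small_mod A) F G" "M \<in> Obj (small_mod A)"
  shows "\<eta> M \<in> mod_hom A (fobj F M) (fobj G M)"
  using natural_transformation_closed[OF assms] by simp

lemma natural_transformation_eval:
  assumes \<eta>: "\<eta> \<in> natural_transformations (small_mod A) (small_mod A) F G" and F: "linear_functor (small_mod A) (small_mod A) F"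
    and M: "M \<in> Obj (small_mod A)" "N \<in> Obj (small_mod A)" and f: "f \<in> mod_hom A M N" and x: "x \<in> carrier (fobj F M)"
  shows "\<eta> N (fmor F M N f x) = fmor G M N f (\<eta> M x)"
proof -
  have "Comp (small_mod A) (fobj F M) (fobj F N) (fobj G N) (\<eta> N) (fmor F M N f) =
    Comp (small_mod A) (fobj F M) (fobj G M) (fobj G N) (fmor G M N f) (\<eta> M)"
    by (rule natural_transformation_natural[OF \<eta> M]) (use f in simp)
  from fun_cong[OF this, of x] x show ?thesis by (simp add: compose_def)
qed

text \<open>The family \<open>h\<close> consists of plain functions. Restricting it twice makes both
  the transformation and its components extensional, as membership demands.\<close>

lemma natural_transformationI:
  assumes F: "linear_functor (small_mod A) (small_mod A) F" and G: "linear_functor (small_mod A) (small_mod A) G"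
    and h: "\<And>M. M \<in> Obj (small_mod A) \<Longrightarrow> additive_map (fobj F M) (fobj G M) (h M)"
    and lin: "\<And>M a x. M \<in> Obj (small_mod A) \<Longrightarrow> a \<in> carrier A \<Longrightarrow> x \<in> carrier (fobj F M) \<Longrightarrow>
      h M (a \<odot>\<^bsub>fobj F M\<^esub> x) = a \<odot>\<^bsub>fobj G M\<^esub> h M x"
    and nat: "\<And>M N f x. M \<in> Obj (small_mod A) \<Longrightarrow> N \<in> Obj (small_mod A) \<Longrightarrow> f \<in> mod_hom A M N \<Longrightarrow>
      x \<in> carrier (fobj F M) \<Longrightarrow> h N (fmor F M N f x) = fmor G M N f (h M x)"
  shows "(\<lambda>M\<in>Obj (small_mod A). \<lambda>x\<in>carrier (fobj F M). h M x) \<in> natural_transformations (small_mod A) (small_mod A) F G"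
  unfolding natural_transformations_iff
proof (intro conjI ballI)
  fix M assume M: "M \<in> Obj (small_mod A)"
  have lm: "left_module A (fobj F M)" by (rule small_functor_module(1)[OF F M])
  show "(\<lambda>M\<in>Obj (small_mod A). \<lambda>x\<in>carrier (fobj F M). h M x) M \<in> Mor (small_mod A) (fobj F M) (fobj G M)"
    using M additive_mapD[OF h[OF M]] lin[OF M] lm by (simp add: mod_hom_iff)
  fix N f assume N: "N \<in> Obj (small_mod A)" and f: "f \<in> Mor (small_mod A) M N"
  then have f: "f \<in> mod_hom A M N" by simp
  show "Comp (small_mod A) (fobj F M) (fobj F N) (fobj G N) ((\<lambda>M\<in>Obj (small_mod A). \<lambda>x\<in>carrier (fobj F M). h M x) N) (fmor F M N f) =
    Comp (small_mod A) (fobj F M) (fobj G M) (fobj G N) (fmor G M N f) ((\<lambda>M\<in>Obj (small_mod A). \<lambda>x\<in>carrier (fobj F M). h M x) M)"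
    using M N nat[OF M N f] mod_homD(1)[OF small_functor_hom[OF F M N f]] additive_mapD(1)[OF h[OF M]]
    by (auto simp: compose_def intro!: restrict_ext)
qed simp

lemma natural_transformation_eqI:
  assumes \<eta>: "\<eta> \<in> natural_transformations (small_mod A) (small_mod A) F G"
    and \<zeta>: "\<zeta> \<in> natural_transformations (small_mod A) (small_mod A) F G"
    and eq: "\<And>M x. M \<in> Obj (small_mod A) \<Longrightarrow> x \<in> carrier (fobj F M) \<Longrightarrow> \<eta> M x = \<zeta> M x"
  shows "\<eta> = \<zeta>"
proof (rule natural_transformation_ext[OF \<eta> \<zeta>])
  fix M assume M: "M \<in> Obj (small_mod A)"
  then show "\<eta> M = \<zeta> M"
    using mod_homD(4)[OF natural_component[OF \<eta> M]] mod_homD(4)[OF natural_component[OF \<zeta> M]] eq[OF M]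
    by (auto intro: extensionalityI)
qed

lemma additive_map_smult:
  "left_module A M \<Longrightarrow> a \<in> carrier A \<Longrightarrow> additive_map M M (\<lambda>x. a \<odot>\<^bsub>M\<^esub> x)"
  by (simp add: additive_map_def lm_smult_add_right)

section \<open>Maps out of tensor-like functors\<close>

context
  fixes Z I F t
  assumes tl: "tensor_like Z I F t"
begin

lemma tl_functor: "linear_functor (small_mod A) (small_mod A) F"
  and tl_ideal: "ideal I A" and tl_Z: "Z \<subseteq> carrier A" and tl_scalar: "scalar c \<in> Z"
  using tl by (auto simp: tensor_like_def)

lemma tl_sub: "x \<in> I \<Longrightarrow> x \<in> carrier A"
  using ideal.Icarr[OF tl_ideal] .

lemma tl_I [simp]: "x \<in> I \<Longrightarrow> a \<in> carrier A \<Longrightarrow> a \<otimes> x \<in> I" "x \<in> I \<Longrightarrow> a \<in> carrier A \<Longrightarrow> x \<otimes> a \<in> I" "\<zero> \<in> I"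
  "x \<in> I \<Longrightarrow> y \<in> I \<Longrightarrow> x \<oplus> y \<in> I"
  using ideal.I_l_closed[OF tl_ideal] ideal.I_r_closed[OF tl_ideal]
    additive_subgroup.zero_closed[OF ideal.axioms(1)[OF tl_ideal]]
    additive_subgroup.a_closed[OF ideal.axioms(1)[OF tl_ideal]] by auto

context
  fixes M
  assumes M: "M \<in> Obj (small_mod A)"
begin

lemma tl_balanced: "balanced_map (A\<lparr>carrier := Z\<rparr>) (ideal_bimodule A I) M (fobj F M) (t M)"
  using tl M by (simp add: tensor_like_def)

lemma tl_closed [simp]: "x \<in> I \<Longrightarrow> m \<in> carrier M \<Longrightarrow> t M x m \<in> carrier (fobj F M)"
  using balanced_mapD(1)[OF tl_balanced] by simp

lemma tl_add_left: "x \<in> I \<Longrightarrow> y \<in> I \<Longrightarrow> m \<in> carrier M \<Longrightarrow> t M (x \<oplus> y) m = t M x m \<oplus>\<^bsub>fobj F M\<^esub> t M y m"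
  using balanced_mapD(2)[OF tl_balanced] by simp

lemma tl_add_right: "x \<in> I \<Longrightarrow> m \<in> carrier M \<Longrightarrow> m' \<in> carrier M \<Longrightarrow>
    t M x (m \<oplus>\<^bsub>M\<^esub> m') = t M x m \<oplus>\<^bsub>fobj F M\<^esub> t M x m'"
  using balanced_mapD(3)[OF tl_balanced] by simp

lemma tl_balance: "x \<in> I \<Longrightarrow> z \<in> Z \<Longrightarrow> m \<in> carrier M \<Longrightarrow> t M (x \<otimes> z) m = t M x (z \<odot>\<^bsub>M\<^esub> m)"
  using balanced_mapD(4)[OF tl_balanced] by simp

lemma tl_smult: "a \<in> carrier A \<Longrightarrow> x \<in> I \<Longrightarrow> m \<in> carrier M \<Longrightarrow> a \<odot>\<^bsub>fobj F M\<^esub> t M x m = t M (a \<otimes> x) m"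
  using tl M by (simp add: tensor_like_def)

lemma tl_natural: "N \<in> Obj (small_mod A) \<Longrightarrow> f \<in> mod_hom A M N \<Longrightarrow> x \<in> I \<Longrightarrow> m \<in> carrier M \<Longrightarrow>
    fmor F M N f (t M x m) = t N x (f m)"
  using tl M by (simp add: tensor_like_def)

lemma tl_module: "left_module A M" "left_module A (fobj F M)" "abelian_group (fobj F M)"
  using M small_functor_module(1)[OF tl_functor M] lm_abelian_group by auto

text \<open>Scalars are central in \<open>A\<close> and lie in \<open>Z\<close>, so they pass from
  the left of \<open>x\<close> to its right and from there to \<open>m\<close>.\<close>

lemma tl_scalar_smult: "x \<in> I \<Longrightarrow> m \<in> carrier M \<Longrightarrow> scalar c \<odot>\<^bsub>fobj F M\<^esub> t M x m = t M x (scalar c \<odot>\<^bsub>M\<^esub> m)"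
  using tl_smult[of "scalar c" x m] tl_balance[of x "scalar c" m] tl_scalar[of c] tl_sub[of x]
  by (simp add: scalar_mult)

lemma tl_zero: "m \<in> carrier M \<Longrightarrow> t M \<zero> m = \<zero>\<^bsub>fobj F M\<^esub>" "x \<in> I \<Longrightarrow> t M x \<zero>\<^bsub>M\<^esub> = \<zero>\<^bsub>fobj F M\<^esub>"
proof -
  show "t M \<zero> m = \<zero>\<^bsub>fobj F M\<^esub>" if "m \<in> carrier M"
    using tl_smult[of \<zero> \<zero> m] that tl_module by simp
  show "t M x \<zero>\<^bsub>M\<^esub> = \<zero>\<^bsub>fobj F M\<^esub>" if "x \<in> I"
    using tl_scalar_smult[OF that, of "\<zero>\<^bsub>M\<^esub>" 0] that tl_module by simp
qed

lemma tl_additive: "x \<in> I \<Longrightarrow> additive_map M (fobj F M) (t M x)"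
  by (simp add: additive_map_def tl_add_right)

end

lemma universal_ext:
  fixes H :: "('a, 'h) module"
  assumes "universal TYPE('h) Z I F t" "M \<in> Obj (small_mod A)" "abelian_group H"
    "additive_map (fobj F M) H f" "additive_map (fobj F M) H g"
    "\<And>x m. x \<in> I \<Longrightarrow> m \<in> carrier M \<Longrightarrow> f (t M x m) = g (t M x m)" "y \<in> carrier (fobj F M)"
  shows "f y = g y"
  using assms unfolding universal_def by blast

lemma universal_exists:
  fixes H :: "('a, 'h) module"
  assumes "universal TYPE('h) Z I F t" "M \<in> Obj (small_mod A)" "abelian_group H"
    "balanced_map (A\<lparr>carrier := Z\<rparr>) (ideal_bimodule A I) M H \<beta>"
  shows "\<exists>h. additive_map (fobj F M) H h \<and> (\<forall>x\<in>I. \<forall>m\<in>carrier M. h (t M x m) = \<beta> x m)"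
  using assms unfolding universal_def by blast

text \<open>The universal property gives a component at each module. Linearity and naturality follow
  because both sides of each equation are additive and agree on the elements
  \<open>t (fobj G M) x g\<close>. The inner functor \<open>G\<close> is included so that maps out
  of composites are covered.\<close>

lemma natural_of_balanced:
  assumes un: "universal TYPE('a small_carrier) Z I F t"
    and G: "linear_functor (small_mod A) (small_mod A) G" and K: "linear_functor (small_mod A) (small_mod A) K"
    and \<beta>: "\<And>M. M \<in> Obj (small_mod A) \<Longrightarrow>
      balanced_map (A\<lparr>carrier := Z\<rparr>) (ideal_bimodule A I) (fobj G M) (fobj K M) (\<beta> M)"
    and lin: "\<And>M a x g. M \<in> Obj (small_mod A) \<Longrightarrow> a \<in> carrier A \<Longrightarrow> x \<in> I \<Longrightarrow> g \<in> carrier (fobj G M) \<Longrightarrow>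
      a \<odot>\<^bsub>fobj K M\<^esub> \<beta> M x g = \<beta> M (a \<otimes> x) g"
    and nat: "\<And>M N f x g. M \<in> Obj (small_mod A) \<Longrightarrow> N \<in> Obj (small_mod A) \<Longrightarrow> f \<in> mod_hom A M N \<Longrightarrow> x \<in> I \<Longrightarrow>
      g \<in> carrier (fobj G M) \<Longrightarrow> fmor K M N f (\<beta> M x g) = \<beta> N x (fmor G M N f g)"
  shows "\<exists>\<eta>\<in>natural_transformations (small_mod A) (small_mod A) (F \<star> G) K.
    \<forall>M\<in>Obj (small_mod A). \<forall>x\<in>I. \<forall>g\<in>carrier (fobj G M). \<eta> M (t (fobj G M) x g) = \<beta> M x g"
proof -
  note GO = small_functor_module[OF G] and KO = small_functor_module[OF K]
  have "\<exists>h. additive_map (fobj F (fobj G M)) (fobj K M) h \<and> (\<forall>x\<in>I. \<forall>g\<in>carrier (fobj G M). h (t (fobj G M) x g) = \<beta> M x g)"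
    if M: "M \<in> Obj (small_mod A)" for M
    by (rule universal_exists[OF un GO(2)[OF M] lm_abelian_group[OF KO(1)[OF M]] \<beta>[OF M]])
  then obtain h where h: "\<And>M. M \<in> Obj (small_mod A) \<Longrightarrow> additive_map (fobj F (fobj G M)) (fobj K M) (h M)"
    "\<And>M x g. M \<in> Obj (small_mod A) \<Longrightarrow> x \<in> I \<Longrightarrow> g \<in> carrier (fobj G M) \<Longrightarrow> h M (t (fobj G M) x g) = \<beta> M x g"
    by metis
  have FG: "linear_functor (small_mod A) (small_mod A) (F \<star> G)" by (rule S.linear_compose_functors[OF G tl_functor])
  have "(\<lambda>M\<in>Obj (small_mod A). \<lambda>x\<in>carrier (fobj (F \<star> G) M). h M x) \<in> natural_transformations (small_mod A) (small_mod A) (F \<star> G) K"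
  proof (rule natural_transformationI[OF FG K])
    fix M assume M: "M \<in> Obj (small_mod A)"
    note FGM = small_functor_module(1)[OF tl_functor GO(2)[OF M]]
    show hM: "additive_map (fobj (F \<star> G) M) (fobj K M) (h M)" using h(1)[OF M] M by simp
    { fix a x assume a: "a \<in> carrier A" and x: "x \<in> carrier (fobj (F \<star> G) M)"
      have "h M (a \<odot>\<^bsub>fobj F (fobj G M)\<^esub> x) = a \<odot>\<^bsub>fobj K M\<^esub> h M x"
        by (rule universal_ext[OF un GO(2)[OF M] lm_abelian_group[OF KO(1)[OF M]]
             additive_map_compose[OF additive_map_smult[OF FGM a] h(1)[OF M]]
             additive_map_compose[OF h(1)[OF M] additive_map_smult[OF KO(1)[OF M] a]]])
          (use a x M GO(2)[OF M] in \<open>simp_all add: tl_smult h(2) lin\<close>)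
      then show "h M (a \<odot>\<^bsub>fobj (F \<star> G) M\<^esub> x) = a \<odot>\<^bsub>fobj K M\<^esub> h M x" using M by simp }
    fix N f x assume N: "N \<in> Obj (small_mod A)" and f: "f \<in> mod_hom A M N" and x: "x \<in> carrier (fobj (F \<star> G) M)"
    have Gf: "fmor G M N f \<in> mod_hom A (fobj G M) (fobj G N)" by (rule small_functor_hom[OF G M N f])
    have FGf: "fmor F (fobj G M) (fobj G N) (fmor G M N f) \<in> mod_hom A (fobj F (fobj G M)) (fobj F (fobj G N))"
      by (rule small_functor_hom[OF tl_functor GO(2)[OF M] GO(2)[OF N] Gf])
    have "h N (fmor F (fobj G M) (fobj G N) (fmor G M N f) x) = fmor K M N f (h M x)"
      by (rule universal_ext[OF un GO(2)[OF M] lm_abelian_group[OF KO(1)[OF N]]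
             additive_map_compose[OF mod_hom_additive[OF FGf] h(1)[OF N]]
             additive_map_compose[OF h(1)[OF M] mod_hom_additive[OF small_functor_hom[OF K M N f]]]])
          (use x M N f GO(2)[OF M] GO(2)[OF N] Gf mod_homD(1)[OF Gf] in \<open>simp_all add: tl_natural h(2) nat\<close>)
    then show "h N (fmor (F \<star> G) M N f x) = fmor K M N f (h M x)" using M N f by simp
  qed
  moreover have "(\<lambda>M\<in>Obj (small_mod A). \<lambda>x\<in>carrier (fobj (F \<star> G) M). h M x) M (t (fobj G M) x g) = \<beta> M x g"
    if M: "M \<in> Obj (small_mod A)" and "x \<in> I" "g \<in> carrier (fobj G M)" for M x g
    using that GO(2)[OF M] h(2)[OF that] tl_closed[OF GO(2)[OF M] that(2,3)] by simp
  ultimately show ?thesis by blast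
qed

text \<open>The case where the inner functor is the identity, with which composition is strictly
  trivial.\<close>

lemma natural_of_balanced_single:
  assumes un: "universal TYPE('a small_carrier) Z I F t" and K: "linear_functor (small_mod A) (small_mod A) K"
    and \<beta>: "\<And>M. M \<in> Obj (small_mod A) \<Longrightarrow>
      balanced_map (A\<lparr>carrier := Z\<rparr>) (ideal_bimodule A I) M (fobj K M) (\<beta> M)"
    and lin: "\<And>M a x g. M \<in> Obj (small_mod A) \<Longrightarrow> a \<in> carrier A \<Longrightarrow> x \<in> I \<Longrightarrow> g \<in> carrier M \<Longrightarrow>
      a \<odot>\<^bsub>fobj K M\<^esub> \<beta> M x g = \<beta> M (a \<otimes> x) g"
    and nat: "\<And>M N f x g. M \<in> Obj (small_mod A) \<Longrightarrow> N \<in> Obj (small_mod A) \<Longrightarrow> f \<in> mod_hom A M N \<Longrightarrow> x \<in> I \<Longrightarrow>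
      g \<in> carrier M \<Longrightarrow> fmor K M N f (\<beta> M x g) = \<beta> N x (f g)"
  shows "\<exists>\<eta>\<in>natural_transformations (small_mod A) (small_mod A) F K.
    \<forall>M\<in>Obj (small_mod A). \<forall>x\<in>I. \<forall>g\<in>carrier M. \<eta> M (t M x g) = \<beta> M x g"
proof -
  let ?Id = "identity_functor (small_mod A)"
  have Id: "fobj ?Id M = M" if "M \<in> Obj (small_mod A)" for M using that by simp
  have "\<exists>\<eta>\<in>natural_transformations (small_mod A) (small_mod A) (F \<star> ?Id) K.
    \<forall>M\<in>Obj (small_mod A). \<forall>x\<in>I. \<forall>g\<in>carrier (fobj ?Id M). \<eta> M (t (fobj ?Id M) x g) = \<beta> M x g"
  proof (rule natural_of_balanced[OF un S.linear_identity_functor K])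
    show "fmor K M N f (\<beta> M x g) = \<beta> N x (fmor ?Id M N f g)"
      if "M \<in> Obj (small_mod A)" "N \<in> Obj (small_mod A)" "f \<in> mod_hom A M N" "x \<in> I" "g \<in> carrier (fobj ?Id M)" for M N f x g
      using nat[OF that(1-4)] that Id[OF that(1)] by simp
  qed (use \<beta> lin in \<open>simp_all add: Id del: small_mod_simps\<close>)
  then show ?thesis using Id by (simp add: S.compose_identity_functor[OF tl_functor] del: small_mod_simps)
qed

lemma universal_natural_ext:
  assumes un: "universal TYPE('a small_carrier) Z I F t"
    and G: "linear_functor (small_mod A) (small_mod A) G"
    and \<eta>: "\<eta> \<in> natural_transformations (small_mod A) (small_mod A) F G"
    and \<zeta>: "\<zeta> \<in> natural_transformations (small_mod A) (small_mod A) F G"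
    and eq: "\<And>M x m. M \<in> Obj (small_mod A) \<Longrightarrow> x \<in> I \<Longrightarrow> m \<in> carrier M \<Longrightarrow> \<eta> M (t M x m) = \<zeta> M (t M x m)"
  shows "\<eta> = \<zeta>"
proof (rule natural_transformation_eqI[OF \<eta> \<zeta>])
  fix M x assume M: "M \<in> Obj (small_mod A)" and x: "x \<in> carrier (fobj F M)"
  show "\<eta> M x = \<zeta> M x"
    by (rule universal_ext[OF un M lm_abelian_group[OF small_functor_module(1)[OF G M]]
        mod_hom_additive[OF natural_component[OF \<eta> M]] mod_hom_additive[OF natural_component[OF \<zeta> M]]])
      (use x eq M in auto)
qed

end

text \<open>Uniqueness is used twice: for fixed \<open>x\<close> the two maps are compared on
  \<open>G M\<close> through the elements \<open>s M y m\<close>, and after that on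
  \<open>F (G M)\<close>.\<close>

lemma universal_natural_ext2:
  assumes F: "tensor_like Z I F t" "universal TYPE('a small_carrier) Z I F t"
    and G: "tensor_like Y J G s" "universal TYPE('a small_carrier) Y J G s"
    and K: "linear_functor (small_mod A) (small_mod A) K"
    and \<eta>: "\<eta> \<in> natural_transformations (small_mod A) (small_mod A) (F \<star> G) K"
    and \<zeta>: "\<zeta> \<in> natural_transformations (small_mod A) (small_mod A) (F \<star> G) K"
    and eq: "\<And>M x y m. M \<in> Obj (small_mod A) \<Longrightarrow> x \<in> I \<Longrightarrow> y \<in> J \<Longrightarrow> m \<in> carrier M \<Longrightarrow>
      \<eta> M (t (fobj G M) x (s M y m)) = \<zeta> M (t (fobj G M) x (s M y m))"
  shows "\<eta> = \<zeta>"
proof (rule natural_transformation_eqI[OF \<eta> \<zeta>])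
  fix M z assume M: "M \<in> Obj (small_mod A)" and z: "z \<in> carrier (fobj (F \<star> G) M)"
  note GM = small_functor_module[OF tl_functor[OF G(1)] M]
  note KM = lm_abelian_group[OF small_functor_module(1)[OF K M]]
  have a: "additive_map (fobj F (fobj G M)) (fobj K M) (\<eta> M)" "additive_map (fobj F (fobj G M)) (fobj K M) (\<zeta> M)"
    using mod_hom_additive[OF natural_component[OF \<eta> M]] mod_hom_additive[OF natural_component[OF \<zeta> M]] M by simp_all
  have *: "\<eta> M (t (fobj G M) x g) = \<zeta> M (t (fobj G M) x g)" if x: "x \<in> I" and g: "g \<in> carrier (fobj G M)" for x g
    by (rule universal_ext[OF G(1,2) M KM additive_map_compose[OF tl_additive[OF F(1) GM(2) x] a(1)]
          additive_map_compose[OF tl_additive[OF F(1) GM(2) x] a(2)]])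
      (use x g eq M in auto)
  show "\<eta> M z = \<zeta> M z"
    by (rule universal_ext[OF F(1,2) GM(2) KM a]) (use * z M in auto)
qed

text \<open>
  Finite dual bases. \<open>right_sum Z J f\<close> says that \<open>f y = \<Sum>\<^sub>p p \<phi>\<^sub>p(y)\<close> for finitely many \<open>p \<in> J\<close> and right
  \<open>Z\<close>-linear \<open>\<phi>\<^sub>p : J \<rightarrow> Z\<close>; so \<open>J\<close> is projective over \<open>Z\<close> if \<open>f\<close> can be the identity.
\<close>

inductive right_sum :: "'a set \<Rightarrow> 'a set \<Rightarrow> ('a \<Rightarrow> 'a) \<Rightarrow> bool" for Z J where
  zero: "right_sum Z J (\<lambda>y. \<zero>)"
| add: "right_sum Z J f \<Longrightarrow> p \<in> J \<Longrightarrow> \<forall>y\<in>J. \<phi> y \<in> Z \<Longrightarrow>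
    \<forall>y\<in>J. \<forall>y'\<in>J. \<phi> (y \<oplus> y') = \<phi> y \<oplus> \<phi> y' \<Longrightarrow> \<forall>y\<in>J. \<forall>z\<in>Z. \<phi> (y \<otimes> z) = \<phi> y \<otimes> z \<Longrightarrow>
    right_sum Z J (\<lambda>y. f y \<oplus> p \<otimes> \<phi> y)"

text \<open>The mirror image: \<open>f x\<close> is a sum of terms
  \<open>\<psi> x \<otimes> p\<close> with left \<open>A\<close>-linear coefficients. If
  \<open>f\<close> can be the identity, the ideal is projective as a left module.\<close>

inductive left_sum :: "'a set \<Rightarrow> ('a \<Rightarrow> 'a) \<Rightarrow> bool" for I where
  zero: "left_sum I (\<lambda>x. \<zero>)"
| add: "left_sum I f \<Longrightarrow> p \<in> I \<Longrightarrow> \<forall>x\<in>I. \<psi> x \<in> carrier A \<Longrightarrow>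
    \<forall>x\<in>I. \<forall>x'\<in>I. \<psi> (x \<oplus> x') = \<psi> x \<oplus> \<psi> x' \<Longrightarrow> \<forall>x\<in>I. \<forall>a\<in>carrier A. \<psi> (a \<otimes> x) = a \<otimes> \<psi> x \<Longrightarrow>
    left_sum I (\<lambda>x. f x \<oplus> \<psi> x \<otimes> p)"

lemma right_sum_closed:
  assumes "right_sum Z J f" "ideal J A" "Z \<subseteq> carrier A" "y \<in> J" shows "f y \<in> J"
  using assms
proof induction
  case zero
  then show ?case by (simp add: additive_subgroup.zero_closed[OF ideal.axioms(1)])
next
  case (add f p \<phi>)
  then show ?case
    by (auto intro!: additive_subgroup.a_closed[OF ideal.axioms(1)] ideal.I_r_closed)
qed

lemma left_sum_closed:
  assumes "left_sum J f" "ideal J A" "y \<in> J" shows "f y \<in> J"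
  using assms
proof induction
  case zero
  then show ?case by (simp add: additive_subgroup.zero_closed[OF ideal.axioms(1)])
next
  case (add f p \<phi>)
  then show ?case
    by (auto intro!: additive_subgroup.a_closed[OF ideal.axioms(1)] ideal.I_l_closed)
qed

section \<open>Composites of the generating functors\<close>

lemma FCat_add_eval:
  assumes "M \<in> Obj (small_mod A)" "x \<in> carrier (fobj F M)"
  shows "(\<eta> \<oplus>\<^bsub>Hom FCat F G\<^esub> \<zeta>) M x = \<eta> M x \<oplus>\<^bsub>fobj G M\<^esub> \<zeta> M x"
  using assms by simp

lemma FCat_comp_eval:
  assumes "M \<in> Obj (small_mod A)" "x \<in> carrier (fobj F M)"
  shows "Comp FCat F G K \<zeta> \<eta> M x = \<zeta> M (\<eta> M x)"
  using assms by (simp add: compose_def)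

text \<open>A dual basis term \<open>(p, \<phi>)\<close> gives \<open>U\<close> from
  \<open>F G\<close> to \<open>F\<close>, sending \<open>t a (s y m)\<close> to
  \<open>t a (\<phi> y m)\<close>, and \<open>V\<close> back, sending \<open>t a m\<close> to
  \<open>t a (s p m)\<close>. Then \<open>V U\<close> replaces \<open>y\<close> by
  \<open>p \<phi>(y)\<close>, and the sum of all terms replaces \<open>y\<close> by
  \<open>f y\<close>. The inner map from \<open>s y m\<close> to \<open>\<phi> y m\<close> is in
  general only linear over the field, which is enough because \<open>F\<close> tensors over the
  field.\<close>

lemma free_composite_sum:
  assumes F: "tensor_like (range scalar) (carrier A) F t" "universal TYPE('a small_carrier) (range scalar) (carrier A) F t"
    and G: "tensor_like Z J G s" "universal TYPE('a small_carrier) Z J G s" and f: "right_sum Z J f"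
  shows "\<exists>w\<in>factoring FCat {F} (F \<star> G) (F \<star> G). \<forall>M\<in>Obj (small_mod A). \<forall>a\<in>carrier A. \<forall>y\<in>J. \<forall>m\<in>carrier M.
    w M (t (fobj G M) a (s M y m)) = t (fobj G M) a (s M (f y) m)"
  using f
proof induction
  note GM = small_functor_module[OF tl_functor[OF G(1)]]
  case zero
  show ?case
  proof (intro bexI[OF _ factoring.zero] ballI)
    fix M a y m assume M: "M \<in> Obj (small_mod A)" and a: "a \<in> carrier A" "y \<in> J" "m \<in> carrier M"
    have "s M y m \<in> carrier (fobj G M)" by (rule tl_closed[OF G(1) M a(2,3)])
    then have "t (fobj G M) a (s M y m) \<in> carrier (fobj F (fobj G M))" by (rule tl_closed[OF F(1) GM(2)[OF M] a(1)])
    then show "\<zero>\<^bsub>Hom FCat (F \<star> G) (F \<star> G)\<^esub> M (t (fobj G M) a (s M y m)) = t (fobj G M) a (s M \<zero> m)"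
      using M tl_zero(1)[OF G(1) M a(3)] tl_zero(2)[OF F(1) GM(2)[OF M] a(1)] by simp
  qed
next
  note F0 = tl_functor[OF F(1)] and G0 = tl_functor[OF G(1)]
  note GM = small_functor_module[OF tl_functor[OF G(1)]]
  note FG0 = S.linear_compose_functors[OF G0 F0]
  case (add f p \<phi>)
  then obtain w where w: "w \<in> factoring FCat {F} (F \<star> G) (F \<star> G)"
    "\<And>M a y m. M \<in> Obj (small_mod A) \<Longrightarrow> a \<in> carrier A \<Longrightarrow> y \<in> J \<Longrightarrow> m \<in> carrier M \<Longrightarrow>
      w M (t (fobj G M) a (s M y m)) = t (fobj G M) a (s M (f y) m)" by blast
  note \<phi> = add(3-5)[rule_format]
  have \<phi>A: "\<phi> y \<in> carrier A" if "y \<in> J" for y using \<phi>(1)[OF that] tl_Z[OF G(1)] by auto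
  have ZA: "z \<in> carrier A" if "z \<in> Z" for z using that tl_Z[OF G(1)] by auto
  \<comment> \<open>Right linearity of \<open>\<phi>\<close> over \<open>Z\<close> makes this well
    defined, because \<open>G\<close> tensors over \<open>Z\<close>.\<close>
  have "\<exists>h. additive_map (fobj G M) M h \<and> (\<forall>y\<in>J. \<forall>m\<in>carrier M. h (s M y m) = \<phi> y \<odot>\<^bsub>M\<^esub> m)"
    if M: "M \<in> Obj (small_mod A)" for M
  proof (rule universal_exists[OF G(1,2) M])
    have lm: "left_module A M" using M by simp
    show "abelian_group M" using lm by (rule lm_abelian_group)
    show "balanced_map (A\<lparr>carrier := Z\<rparr>) (ideal_bimodule A J) M M (\<lambda>y m. \<phi> y \<odot>\<^bsub>M\<^esub> m)"
      using lm \<phi> \<phi>A ZA by (auto simp: balanced_map_def additive_map_def lm_smult_add_left[OF lm]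
          lm_smult_add_right[OF lm] lm_smult_smult[OF lm])
  qed
  then obtain u where u: "\<And>M. M \<in> Obj (small_mod A) \<Longrightarrow> additive_map (fobj G M) M (u M)"
    "\<And>M y m. M \<in> Obj (small_mod A) \<Longrightarrow> y \<in> J \<Longrightarrow> m \<in> carrier M \<Longrightarrow> u M (s M y m) = \<phi> y \<odot>\<^bsub>M\<^esub> m" by metis
  have u_scalar: "u M (scalar c \<odot>\<^bsub>fobj G M\<^esub> g) = scalar c \<odot>\<^bsub>M\<^esub> u M g"
    if M: "M \<in> Obj (small_mod A)" and g: "g \<in> carrier (fobj G M)" for M g c
  proof -
    have lm: "left_module A M" using M by simp
    show ?thesis
    proof (rule universal_ext[OF G(1,2) M lm_abelian_group[OF lm]
        additive_map_compose[OF additive_map_smult[OF GM(1)[OF M] scalar_closed] u(1)[OF M]]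
        additive_map_compose[OF u(1)[OF M] additive_map_smult[OF lm scalar_closed]] _ g])
      fix y m assume y: "y \<in> J" and m: "m \<in> carrier M"
      have "u M (scalar c \<odot>\<^bsub>fobj G M\<^esub> s M y m) = \<phi> y \<odot>\<^bsub>M\<^esub> (scalar c \<odot>\<^bsub>M\<^esub> m)"
        using y m lm by (simp add: tl_scalar_smult[OF G(1) M] u(2)[OF M])
      then show "u M (scalar c \<odot>\<^bsub>fobj G M\<^esub> s M y m) = scalar c \<odot>\<^bsub>M\<^esub> u M (s M y m)"
        using y m lm \<phi>A[OF y] by (simp add: u(2)[OF M] lm_smult_smult[OF lm] scalar_mult)
    qed
  qed
  have u_nat: "h (u M g) = u N (fmor G M N h g)"
    if M: "M \<in> Obj (small_mod A)" and N: "N \<in> Obj (small_mod A)" and h: "h \<in> mod_hom A M N" and g: "g \<in> carrier (fobj G M)" for M N h g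
  proof -
    have lm: "left_module A M" "left_module A N" using M N by simp_all
    show ?thesis
    proof (rule universal_ext[OF G(1,2) M lm_abelian_group[OF lm(2)]
        additive_map_compose[OF u(1)[OF M] mod_hom_additive[OF h]]
        additive_map_compose[OF mod_hom_additive[OF small_functor_hom[OF G0 M N h]] u(1)[OF N]] _ g])
      fix y m assume y: "y \<in> J" and m: "m \<in> carrier M"
      show "h (u M (s M y m)) = u N (fmor G M N h (s M y m))"
        using y m \<phi>A[OF y] mod_homD(1,3)[OF h] by (simp add: u(2)[OF M] u(2)[OF N] tl_natural[OF G(1) M N h])
    qed
  qed
  note uc = additive_mapD(1)[OF u(1)] and ua = additive_mapD(2)[OF u(1)]
  obtain U where U: "U \<in> natural_transformations (small_mod A) (small_mod A) (F \<star> G) F"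
    "\<And>M a g. M \<in> Obj (small_mod A) \<Longrightarrow> a \<in> carrier A \<Longrightarrow> g \<in> carrier (fobj G M) \<Longrightarrow> U M (t (fobj G M) a g) = t M a (u M g)"
  proof -
    have "\<exists>\<eta>\<in>natural_transformations (small_mod A) (small_mod A) (F \<star> G) F.
      \<forall>M\<in>Obj (small_mod A). \<forall>x\<in>carrier A. \<forall>g\<in>carrier (fobj G M). \<eta> M (t (fobj G M) x g) = t M x (u M g)"
    proof (rule natural_of_balanced[OF F G0 F0])
      fix M assume M: "M \<in> Obj (small_mod A)"
      show "balanced_map (A\<lparr>carrier := range scalar\<rparr>) (ideal_bimodule A (carrier A)) (fobj G M) (fobj F M) (\<lambda>x g. t M x (u M g))"
        using uc[OF M] ua[OF M] u_scalar[OF M]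
        by (auto simp: balanced_map_def additive_map_def tl_closed[OF F(1) M] tl_add_left[OF F(1) M]
            tl_add_right[OF F(1) M] tl_balance[OF F(1) M])
      show "a \<odot>\<^bsub>fobj F M\<^esub> t M x (u M g) = t M (a \<otimes> x) (u M g)"
        if "a \<in> carrier A" "x \<in> carrier A" "g \<in> carrier (fobj G M)" for a x g
        using that uc[OF M] by (simp add: tl_smult[OF F(1) M])
      show "fmor F M N h (t M x (u M g)) = t N x (u N (fmor G M N h g))"
        if "N \<in> Obj (small_mod A)" "h \<in> mod_hom A M N" "x \<in> carrier A" "g \<in> carrier (fobj G M)" for N h x g
        using that uc[OF M] u_nat[OF M] by (simp add: tl_natural[OF F(1) M])
    qed
    then show thesis using that by blast
  qed
  obtain V where V: "V \<in> natural_transformations (small_mod A) (small_mod A) F (F \<star> G)"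
    "\<And>M a m. M \<in> Obj (small_mod A) \<Longrightarrow> a \<in> carrier A \<Longrightarrow> m \<in> carrier M \<Longrightarrow> V M (t M a m) = t (fobj G M) a (s M p m)"
  proof -
    have "\<exists>\<eta>\<in>natural_transformations (small_mod A) (small_mod A) F (F \<star> G).
      \<forall>M\<in>Obj (small_mod A). \<forall>x\<in>carrier A. \<forall>g\<in>carrier M. \<eta> M (t M x g) = t (fobj G M) x (s M p g)"
    proof (rule natural_of_balanced_single[OF F FG0])
      fix M assume M: "M \<in> Obj (small_mod A)"
      have lm: "left_module A M" using M by simp
      note sM = tl_closed[OF G(1) M add(2)]
      show "balanced_map (A\<lparr>carrier := range scalar\<rparr>) (ideal_bimodule A (carrier A)) M (fobj (F \<star> G) M) (\<lambda>x g. t (fobj G M) x (s M p g))"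
        using sM add(2) M lm
        by (auto simp: balanced_map_def additive_map_def tl_closed[OF F(1) GM(2)[OF M]] tl_add_left[OF F(1) GM(2)[OF M]]
            tl_add_right[OF F(1) GM(2)[OF M]] tl_balance[OF F(1) GM(2)[OF M]] tl_add_right[OF G(1) M] tl_scalar_smult[OF G(1) M])
      show "a \<odot>\<^bsub>fobj (F \<star> G) M\<^esub> t (fobj G M) x (s M p g) = t (fobj G M) (a \<otimes> x) (s M p g)"
        if "a \<in> carrier A" "x \<in> carrier A" "g \<in> carrier M" for a x g
        using that sM M by (simp add: tl_smult[OF F(1) GM(2)[OF M]])
      show "fmor (F \<star> G) M N h (t (fobj G M) x (s M p g)) = t (fobj G N) x (s N p (h g))"
        if "N \<in> Obj (small_mod A)" "h \<in> mod_hom A M N" "x \<in> carrier A" "g \<in> carrier M" for N h x g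
        using that sM M add(2) small_functor_hom[OF G0 M that(1,2)]
        by (simp add: tl_natural[OF F(1) GM(2)[OF M] GM(2)[OF that(1)]] tl_natural[OF G(1) M that(1)])
    qed
    then show thesis using that by blast
  qed
  let ?VU = "Comp FCat (F \<star> G) F (F \<star> G) V U"
  have "w \<oplus>\<^bsub>Hom FCat (F \<star> G) (F \<star> G)\<^esub> ?VU \<in> factoring FCat {F} (F \<star> G) (F \<star> G)"
    by (rule factoring.add[OF w(1)]) (use U(1) V(1) in simp_all)
  moreover have "(w \<oplus>\<^bsub>Hom FCat (F \<star> G) (F \<star> G)\<^esub> ?VU) M (t (fobj G M) a (s M y m))
    = t (fobj G M) a (s M (f y \<oplus> p \<otimes> \<phi> y) m)"
    if M: "M \<in> Obj (small_mod A)" and a: "a \<in> carrier A" and y: "y \<in> J" and m: "m \<in> carrier M" for M a y m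
  proof -
    have lm: "left_module A M" using M by simp
    have sy: "s M y' m \<in> carrier (fobj G M)" if "y' \<in> J" for y' using tl_closed[OF G(1) M that m] .
    have fy: "f y \<in> J" "p \<otimes> \<phi> y \<in> J"
      using right_sum_closed[OF add(1) tl_ideal[OF G(1)] tl_Z[OF G(1)] y] add(2) \<phi>A[OF y] tl_I(2)[OF G(1)] by auto
    have ty: "t (fobj G M) a (s M y m) \<in> carrier (fobj (F \<star> G) M)"
      using tl_closed[OF F(1) GM(2)[OF M] a sy[OF y]] M by simp
    have "?VU M (t (fobj G M) a (s M y m)) = V M (U M (t (fobj G M) a (s M y m)))"
      by (rule FCat_comp_eval[OF M ty])
    also have "\<dots> = V M (t M a (\<phi> y \<odot>\<^bsub>M\<^esub> m))" by (simp add: U(2)[OF M a sy[OF y]] u(2)[OF M y m])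
    also have "\<dots> = t (fobj G M) a (s M p (\<phi> y \<odot>\<^bsub>M\<^esub> m))" using \<phi>A[OF y] m lm by (intro V(2)[OF M a]) simp
    also have "\<dots> = t (fobj G M) a (s M (p \<otimes> \<phi> y) m)" using tl_balance[OF G(1) M add(2) \<phi>(1)[OF y] m] by simp
    finally have VU: "?VU M (t (fobj G M) a (s M y m)) = t (fobj G M) a (s M (p \<otimes> \<phi> y) m)" .
    have "(w \<oplus>\<^bsub>Hom FCat (F \<star> G) (F \<star> G)\<^esub> ?VU) M (t (fobj G M) a (s M y m)) =
      w M (t (fobj G M) a (s M y m)) \<oplus>\<^bsub>fobj (F \<star> G) M\<^esub> ?VU M (t (fobj G M) a (s M y m))"
      by (rule FCat_add_eval[OF M ty])
    also have "\<dots> = t (fobj G M) a (s M (f y) m) \<oplus>\<^bsub>fobj F (fobj G M)\<^esub> t (fobj G M) a (s M (p \<otimes> \<phi> y) m)"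
      unfolding VU w(2)[OF M a y m] using M by simp
    also have "\<dots> = t (fobj G M) a (s M (f y \<oplus> p \<otimes> \<phi> y) m)"
      using tl_add_right[OF F(1) GM(2)[OF M] a sy[OF fy(1)] sy[OF fy(2)]] tl_add_left[OF G(1) M fy m] by simp
    finally show ?thesis .
  qed
  ultimately show ?case by blast
qed

lemma FCat_Id_eval: "M \<in> Obj (small_mod A) \<Longrightarrow> x \<in> carrier (fobj F M) \<Longrightarrow> Id FCat F M x = x"
  by simp

text \<open>With \<open>f\<close> the identity on \<open>J\<close>, the endomorphism assembled from
  the dual basis agrees with the identity on the elements that determine it. So the composite lies
  in the additive closure of the outer functor alone.\<close>

lemma free_composite:
  assumes F: "tensor_like (range scalar) (carrier A) F t" "universal TYPE('a small_carrier) (range scalar) (carrier A) F t"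
    and G: "tensor_like Z J G s" "universal TYPE('a small_carrier) Z J G s"
    and f: "right_sum Z J f" "\<And>y. y \<in> J \<Longrightarrow> f y = y"
  shows "Id FCat (F \<star> G) \<in> factoring FCat {F} (F \<star> G) (F \<star> G)"
proof -
  obtain w where w: "w \<in> factoring FCat {F} (F \<star> G) (F \<star> G)" and
    eq: "\<forall>M\<in>Obj (small_mod A). \<forall>a\<in>carrier A. \<forall>y\<in>J. \<forall>m\<in>carrier M.
      w M (t (fobj G M) a (s M y m)) = t (fobj G M) a (s M (f y) m)"
    using free_composite_sum[OF F G f(1)] by blast
  note FG = S.linear_compose_functors[OF tl_functor[OF G(1)] tl_functor[OF F(1)]]
  have FGO: "F \<star> G \<in> Obj FCat" "F \<in> Obj FCat" using FG tl_functor[OF F(1)] by simp_all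
  have "w \<in> Mor FCat (F \<star> G) (F \<star> G)" using FC.factoring_closed[OF FGO(1,1) _ w] FGO by simp
  moreover have "Id FCat (F \<star> G) \<in> Mor FCat (F \<star> G) (F \<star> G)" using FGO by (intro FC.Id_closed)
  ultimately have wI: "w \<in> natural_transformations (small_mod A) (small_mod A) (F \<star> G) (F \<star> G)"
    "Id FCat (F \<star> G) \<in> natural_transformations (small_mod A) (small_mod A) (F \<star> G) (F \<star> G)" by (simp_all only: functor_category_simps)
  have "w = Id FCat (F \<star> G)"
  proof (rule universal_natural_ext2[OF F G FG wI])
    fix M x y m assume M: "M \<in> Obj (small_mod A)" and x: "x \<in> carrier A" and y: "y \<in> J" and m: "m \<in> carrier M"
    have "t (fobj G M) x (s M y m) \<in> carrier (fobj (F \<star> G) M)"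
      using tl_closed[OF F(1) small_functor_module(2)[OF tl_functor[OF G(1)] M] x tl_closed[OF G(1) M y m]] M by simp
    then show "w M (t (fobj G M) x (s M y m)) = Id FCat (F \<star> G) M (t (fobj G M) x (s M y m))"
      using eq M x y m f(2)[OF y] FCat_Id_eval[OF M] by metis
  qed
  then show ?thesis using w by simp
qed

end

context kalgebra
begin

text \<open>Here the ideal is on the outside. Balancing gives
  \<open>t x (s a m) = t (x a) (s 1 m)\<close>, which explains the form of the claim. A term
  \<open>(\<psi>, p)\<close> yields \<open>U\<close> from \<open>F G\<close> to \<open>G\<close>,
  sending \<open>t x (s a m)\<close> to \<open>s (\<psi> (x a)) m\<close>, and \<open>V\<close>
  back, sending \<open>s a m\<close> to \<open>t (a p) (s 1 m)\<close>; so \<open>V U\<close>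
  replaces \<open>x a\<close> by \<open>\<psi> (x a) p\<close>.\<close>

lemma ideal_free_composite_sum:
  assumes F: "tensor_like (carrier A) I F t" "universal TYPE('a small_carrier) (carrier A) I F t"
    and G: "tensor_like (range scalar) (carrier A) G s" "universal TYPE('a small_carrier) (range scalar) (carrier A) G s"
    and f: "left_sum I f"
  shows "\<exists>w\<in>factoring FCat {G} (F \<star> G) (F \<star> G). \<forall>M\<in>Obj (small_mod A). \<forall>x\<in>I. \<forall>a\<in>carrier A. \<forall>m\<in>carrier M.
    w M (t (fobj G M) x (s M a m)) = t (fobj G M) (f (x \<otimes> a)) (s M \<one> m)"
  using f
proof induction
  note GM = small_functor_module[OF tl_functor[OF G(1)]]
  case zero
  show ?case
  proof (intro bexI[OF _ factoring.zero] ballI)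
    fix M x a m assume M: "M \<in> Obj (small_mod A)" and a: "x \<in> I" "a \<in> carrier A" "m \<in> carrier M"
    have s: "s M a m \<in> carrier (fobj G M)" "s M \<one> m \<in> carrier (fobj G M)" using a by (auto intro: tl_closed[OF G(1) M])
    then have "t (fobj G M) x (s M a m) \<in> carrier (fobj F (fobj G M))" using tl_closed[OF F(1) GM(2)[OF M] a(1)] by blast
    then show "\<zero>\<^bsub>Hom FCat (F \<star> G) (F \<star> G)\<^esub> M (t (fobj G M) x (s M a m)) = t (fobj G M) \<zero> (s M \<one> m)"
      using M tl_zero(1)[OF F(1) GM(2)[OF M] s(2)] by simp
  qed
next
  note F0 = tl_functor[OF F(1)] and G0 = tl_functor[OF G(1)]
  note GM = small_functor_module[OF tl_functor[OF G(1)]]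
  note FG0 = S.linear_compose_functors[OF G0 F0]
  case (add f p \<psi>)
  then obtain w where w: "w \<in> factoring FCat {G} (F \<star> G) (F \<star> G)"
    "\<And>M x a m. M \<in> Obj (small_mod A) \<Longrightarrow> x \<in> I \<Longrightarrow> a \<in> carrier A \<Longrightarrow> m \<in> carrier M \<Longrightarrow>
      w M (t (fobj G M) x (s M a m)) = t (fobj G M) (f (x \<otimes> a)) (s M \<one> m)" by blast
  note \<psi> = add(3-5)[rule_format]
  note tlI = tl_I[OF F(1)]
  have pA: "p \<in> carrier A" using tl_sub[OF F(1)] add(2) .
  have \<psi>_scalar: "\<psi> (x \<otimes> (a \<otimes> scalar c)) = \<psi> (x \<otimes> a) \<otimes> scalar c" if "x \<in> I" "a \<in> carrier A" for x a c
  proof -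
    have "x \<otimes> (a \<otimes> scalar c) = scalar c \<otimes> (x \<otimes> a)"
      using that tl_sub[OF F(1) that(1)] by (simp add: scalar_mult smult_mult_right)
    then show ?thesis using \<psi>(3)[of "x \<otimes> a" "scalar c"] \<psi>(1)[of "x \<otimes> a"] that tlI(2) by (simp add: scalar_mult)
  qed
  \<comment> \<open>For fixed \<open>x\<close>, this is the map of \<open>G M\<close> that becomes
    \<open>U\<close>. The four claims after it are what the universal property of \<open>F\<close>
    needs: additivity and balance in \<open>x\<close>, compatibility with the left action and with
    homomorphisms.\<close>
  have "\<exists>h. additive_map (fobj G M) (fobj G M) h \<and> (\<forall>a\<in>carrier A. \<forall>m\<in>carrier M. h (s M a m) = s M (\<psi> (x \<otimes> a)) m)"
    if M: "M \<in> Obj (small_mod A)" and x: "x \<in> I" for M x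
  proof (rule universal_exists[OF G(1,2) M])
    show "abelian_group (fobj G M)" by (rule lm_abelian_group[OF GM(1)[OF M]])
    show "balanced_map (A\<lparr>carrier := range scalar\<rparr>) (ideal_bimodule A (carrier A)) M (fobj G M) (\<lambda>a m. s M (\<psi> (x \<otimes> a)) m)"
      using x \<psi>(1,2) tlI tl_sub[OF F(1) x] \<psi>_scalar[OF x]
      by (auto simp: balanced_map_def additive_map_def tl_closed[OF G(1) M] tl_add_left[OF G(1) M]
          tl_add_right[OF G(1) M] tl_balance[OF G(1) M] r_distr)
  qed
  then obtain L where L: "\<And>M x. M \<in> Obj (small_mod A) \<Longrightarrow> x \<in> I \<Longrightarrow> additive_map (fobj G M) (fobj G M) (L M x)"
    "\<And>M x a m. M \<in> Obj (small_mod A) \<Longrightarrow> x \<in> I \<Longrightarrow> a \<in> carrier A \<Longrightarrow> m \<in> carrier M \<Longrightarrow>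
      L M x (s M a m) = s M (\<psi> (x \<otimes> a)) m" by metis
  have L_add: "L M (x \<oplus> y) g = L M x g \<oplus>\<^bsub>fobj G M\<^esub> L M y g"
    if M: "M \<in> Obj (small_mod A)" and x: "x \<in> I" "y \<in> I" and g: "g \<in> carrier (fobj G M)" for M x y g
    by (rule universal_ext[OF G(1,2) M lm_abelian_group[OF GM(1)[OF M]] L(1)[OF M tlI(4)[OF x]]
        additive_map_sum[OF lm_abelian_group[OF GM(1)[OF M]] L(1)[OF M x(1)] L(1)[OF M x(2)]] _ g])
      (use x tl_sub[OF F(1)] tlI \<psi>(1,2) in \<open>simp add: L(2)[OF M] l_distr tl_add_left[OF G(1) M]\<close>)
  have L_balance: "L M (x \<otimes> b) g = L M x (b \<odot>\<^bsub>fobj G M\<^esub> g)"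
    if M: "M \<in> Obj (small_mod A)" and x: "x \<in> I" and b: "b \<in> carrier A" and g: "g \<in> carrier (fobj G M)" for M x b g
    by (rule universal_ext[OF G(1,2) M lm_abelian_group[OF GM(1)[OF M]] L(1)[OF M tlI(2)[OF x b]]
        additive_map_compose[OF additive_map_smult[OF GM(1)[OF M] b] L(1)[OF M x]] _ g])
      (use x b tl_sub[OF F(1)] tlI in \<open>simp add: L(2)[OF M] tl_smult[OF G(1) M] m_assoc\<close>)
  have L_linear: "L M (b \<otimes> x) g = b \<odot>\<^bsub>fobj G M\<^esub> L M x g"
    if M: "M \<in> Obj (small_mod A)" and x: "x \<in> I" and b: "b \<in> carrier A" and g: "g \<in> carrier (fobj G M)" for M x b g
    by (rule universal_ext[OF G(1,2) M lm_abelian_group[OF GM(1)[OF M]] L(1)[OF M tlI(1)[OF x b]]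
        additive_map_compose[OF L(1)[OF M x] additive_map_smult[OF GM(1)[OF M] b]] _ g])
      (use x b tl_sub[OF F(1)] tlI \<psi>(1,3) in \<open>simp add: L(2)[OF M] tl_smult[OF G(1) M] m_assoc\<close>)
  have L_nat: "fmor G M N h (L M x g) = L N x (fmor G M N h g)"
    if M: "M \<in> Obj (small_mod A)" and N: "N \<in> Obj (small_mod A)" and h: "h \<in> mod_hom A M N"
      and x: "x \<in> I" and g: "g \<in> carrier (fobj G M)" for M N h x g
    by (rule universal_ext[OF G(1,2) M lm_abelian_group[OF GM(1)[OF N]]
        additive_map_compose[OF L(1)[OF M x] mod_hom_additive[OF small_functor_hom[OF G0 M N h]]]
        additive_map_compose[OF mod_hom_additive[OF small_functor_hom[OF G0 M N h]] L(1)[OF N x]] _ g])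
      (use x tlI \<psi>(1) mod_homD(1)[OF h] in \<open>simp add: L(2)[OF M] L(2)[OF N] tl_natural[OF G(1) M N h]\<close>)
  note Lc = additive_mapD(1)[OF L(1)] and La = additive_mapD(2)[OF L(1)]
  obtain U where U: "U \<in> natural_transformations (small_mod A) (small_mod A) (F \<star> G) G"
    "\<And>M x g. M \<in> Obj (small_mod A) \<Longrightarrow> x \<in> I \<Longrightarrow> g \<in> carrier (fobj G M) \<Longrightarrow> U M (t (fobj G M) x g) = L M x g"
  proof -
    have "\<exists>\<eta>\<in>natural_transformations (small_mod A) (small_mod A) (F \<star> G) G.
      \<forall>M\<in>Obj (small_mod A). \<forall>x\<in>I. \<forall>g\<in>carrier (fobj G M). \<eta> M (t (fobj G M) x g) = L M x g"
    proof (rule natural_of_balanced[OF F G0 G0])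
      fix M assume M: "M \<in> Obj (small_mod A)"
      show "balanced_map (A\<lparr>carrier := carrier A\<rparr>) (ideal_bimodule A I) (fobj G M) (fobj G M) (L M)"
        using Lc[OF M] La[OF M] L_add[OF M] L_balance[OF M] by (simp add: balanced_map_def additive_map_def)
      show "a \<odot>\<^bsub>fobj G M\<^esub> L M x g = L M (a \<otimes> x) g" if "a \<in> carrier A" "x \<in> I" "g \<in> carrier (fobj G M)" for a x g
        using L_linear[OF M that(2,1,3)] by simp
    qed (rule L_nat)
    then show thesis using that by blast
  qed
  obtain V where V: "V \<in> natural_transformations (small_mod A) (small_mod A) G (F \<star> G)"
    "\<And>M a m. M \<in> Obj (small_mod A) \<Longrightarrow> a \<in> carrier A \<Longrightarrow> m \<in> carrier M \<Longrightarrow>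
      V M (s M a m) = t (fobj G M) (a \<otimes> p) (s M \<one> m)"
  proof -
    have "\<exists>\<eta>\<in>natural_transformations (small_mod A) (small_mod A) G (F \<star> G).
      \<forall>M\<in>Obj (small_mod A). \<forall>x\<in>carrier A. \<forall>g\<in>carrier M. \<eta> M (s M x g) = t (fobj G M) (x \<otimes> p) (s M \<one> g)"
    proof (rule natural_of_balanced_single[OF G FG0])
      fix M assume M: "M \<in> Obj (small_mod A)"
      have lm: "left_module A M" using M by simp
      have sM: "s M \<one> m \<in> carrier (fobj G M)" if "m \<in> carrier M" for m using tl_closed[OF G(1) M _ that] by simp
      have bal: "t (fobj G M) ((x \<otimes> scalar c) \<otimes> p) (s M \<one> m) = t (fobj G M) (x \<otimes> p) (s M \<one> (scalar c \<odot>\<^bsub>M\<^esub> m))"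
        if x: "x \<in> carrier A" and m: "m \<in> carrier M" for x c m
      proof -
        have "(x \<otimes> scalar c) \<otimes> p = (x \<otimes> p) \<otimes> scalar c"
          using x pA by (simp add: scalar_mult smult_mult_left)
        then have "t (fobj G M) ((x \<otimes> scalar c) \<otimes> p) (s M \<one> m) = t (fobj G M) (x \<otimes> p) (scalar c \<odot>\<^bsub>fobj G M\<^esub> s M \<one> m)"
          using tl_balance[OF F(1) GM(2)[OF M] tlI(1)[OF add(2) x] _ sM[OF m]] by simp
        then show ?thesis using tl_scalar_smult[OF G(1) M _ m] by simp
      qed
      show "balanced_map (A\<lparr>carrier := range scalar\<rparr>) (ideal_bimodule A (carrier A)) M (fobj (F \<star> G) M) (\<lambda>x g. t (fobj G M) (x \<otimes> p) (s M \<one> g))"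
        using sM add(2) pA M lm bal tlI
        by (auto simp: balanced_map_def additive_map_def tl_closed[OF F(1) GM(2)[OF M]] tl_add_left[OF F(1) GM(2)[OF M]]
            tl_add_right[OF F(1) GM(2)[OF M]] tl_add_right[OF G(1) M] l_distr)
      show "a \<odot>\<^bsub>fobj (F \<star> G) M\<^esub> t (fobj G M) (x \<otimes> p) (s M \<one> g) = t (fobj G M) ((a \<otimes> x) \<otimes> p) (s M \<one> g)"
        if "a \<in> carrier A" "x \<in> carrier A" "g \<in> carrier M" for a x g
        using that sM M add(2) pA tlI by (simp add: tl_smult[OF F(1) GM(2)[OF M]] m_assoc)
      show "fmor (F \<star> G) M N h (t (fobj G M) (x \<otimes> p) (s M \<one> g)) = t (fobj G N) (x \<otimes> p) (s N \<one> (h g))"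
        if "N \<in> Obj (small_mod A)" "h \<in> mod_hom A M N" "x \<in> carrier A" "g \<in> carrier M" for N h x g
        using that sM M add(2) tlI small_functor_hom[OF G0 M that(1,2)]
        by (simp add: tl_natural[OF F(1) GM(2)[OF M] GM(2)[OF that(1)]] tl_natural[OF G(1) M that(1)])
    qed
    then show thesis using that by blast
  qed
  let ?VU = "Comp FCat (F \<star> G) G (F \<star> G) V U"
  have "w \<oplus>\<^bsub>Hom FCat (F \<star> G) (F \<star> G)\<^esub> ?VU \<in> factoring FCat {G} (F \<star> G) (F \<star> G)"
    by (rule factoring.add[OF w(1)]) (use U(1) V(1) in simp_all)
  moreover have "(w \<oplus>\<^bsub>Hom FCat (F \<star> G) (F \<star> G)\<^esub> ?VU) M (t (fobj G M) x (s M a m))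
    = t (fobj G M) (f (x \<otimes> a) \<oplus> \<psi> (x \<otimes> a) \<otimes> p) (s M \<one> m)"
    if M: "M \<in> Obj (small_mod A)" and x: "x \<in> I" and a: "a \<in> carrier A" and m: "m \<in> carrier M" for M x a m
  proof -
    have xa: "x \<otimes> a \<in> I" using tlI(2)[OF x a] .
    have sa: "s M a' m \<in> carrier (fobj G M)" if "a' \<in> carrier A" for a' using tl_closed[OF G(1) M that m] .
    have fI: "f (x \<otimes> a) \<in> I" "\<psi> (x \<otimes> a) \<otimes> p \<in> I"
      using left_sum_closed[OF add(1) tl_ideal[OF F(1)] xa] tlI(1)[OF add(2) \<psi>(1)[OF xa]] by auto
    have ta: "t (fobj G M) x (s M a m) \<in> carrier (fobj (F \<star> G) M)"
      using tl_closed[OF F(1) GM(2)[OF M] x sa[OF a]] M by simp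
    have "?VU M (t (fobj G M) x (s M a m)) = V M (U M (t (fobj G M) x (s M a m)))"
      by (rule FCat_comp_eval[OF M ta])
    also have "\<dots> = V M (s M (\<psi> (x \<otimes> a)) m)" by (simp add: U(2)[OF M x sa[OF a]] L(2)[OF M x a m])
    also have "\<dots> = t (fobj G M) (\<psi> (x \<otimes> a) \<otimes> p) (s M \<one> m)" by (rule V(2)[OF M \<psi>(1)[OF xa] m])
    finally have VU: "?VU M (t (fobj G M) x (s M a m)) = t (fobj G M) (\<psi> (x \<otimes> a) \<otimes> p) (s M \<one> m)" .
    have "(w \<oplus>\<^bsub>Hom FCat (F \<star> G) (F \<star> G)\<^esub> ?VU) M (t (fobj G M) x (s M a m)) =
      w M (t (fobj G M) x (s M a m)) \<oplus>\<^bsub>fobj (F \<star> G) M\<^esub> ?VU M (t (fobj G M) x (s M a m))"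
      by (rule FCat_add_eval[OF M ta])
    also have "\<dots> = t (fobj G M) (f (x \<otimes> a)) (s M \<one> m) \<oplus>\<^bsub>fobj F (fobj G M)\<^esub> t (fobj G M) (\<psi> (x \<otimes> a) \<otimes> p) (s M \<one> m)"
      unfolding VU w(2)[OF M x a m] using M by simp
    also have "\<dots> = t (fobj G M) (f (x \<otimes> a) \<oplus> \<psi> (x \<otimes> a) \<otimes> p) (s M \<one> m)"
      using tl_add_left[OF F(1) GM(2)[OF M] fI sa[OF one_closed]] by simp
    finally show ?thesis .
  qed
  ultimately show ?case by blast
qed

lemma ideal_free_composite:
  assumes F: "tensor_like (carrier A) I F t" "universal TYPE('a small_carrier) (carrier A) I F t"
    and G: "tensor_like (range scalar) (carrier A) G s" "universal TYPE('a small_carrier) (range scalar) (carrier A) G s"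
    and f: "left_sum I f" "\<And>x. x \<in> I \<Longrightarrow> f x = x"
  shows "Id FCat (F \<star> G) \<in> factoring FCat {G} (F \<star> G) (F \<star> G)"
proof -
  obtain w where w: "w \<in> factoring FCat {G} (F \<star> G) (F \<star> G)" and
    eq: "\<forall>M\<in>Obj (small_mod A). \<forall>x\<in>I. \<forall>a\<in>carrier A. \<forall>m\<in>carrier M.
      w M (t (fobj G M) x (s M a m)) = t (fobj G M) (f (x \<otimes> a)) (s M \<one> m)"
    using ideal_free_composite_sum[OF F G f(1)] by blast
  note FG = S.linear_compose_functors[OF tl_functor[OF G(1)] tl_functor[OF F(1)]]
  have FGO: "F \<star> G \<in> Obj FCat" "G \<in> Obj FCat" using FG tl_functor[OF G(1)] by simp_all
  have "w \<in> Mor FCat (F \<star> G) (F \<star> G)" using FC.factoring_closed[OF FGO(1,1) _ w] FGO by simp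
  moreover have "Id FCat (F \<star> G) \<in> Mor FCat (F \<star> G) (F \<star> G)" using FGO by (intro FC.Id_closed)
  ultimately have wI: "w \<in> natural_transformations (small_mod A) (small_mod A) (F \<star> G) (F \<star> G)"
    "Id FCat (F \<star> G) \<in> natural_transformations (small_mod A) (small_mod A) (F \<star> G) (F \<star> G)" by (simp_all only: functor_category_simps)
  have "w = Id FCat (F \<star> G)"
  proof (rule universal_natural_ext2[OF F G FG wI])
    fix M x a m assume M: "M \<in> Obj (small_mod A)" and x: "x \<in> I" and a: "a \<in> carrier A" and m: "m \<in> carrier M"
    note GM = small_functor_module(2)[OF tl_functor[OF G(1)] M]
    have s: "s M a m \<in> carrier (fobj G M)" "s M \<one> m \<in> carrier (fobj G M)" using a m by (auto intro: tl_closed[OF G(1) M])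
    then have "t (fobj G M) x (s M a m) \<in> carrier (fobj (F \<star> G) M)"
      using tl_closed[OF F(1) GM x] M by simp
    then have "Id FCat (F \<star> G) M (t (fobj G M) x (s M a m)) = t (fobj G M) x (s M a m)" by (rule FCat_Id_eval[OF M])
    also have "\<dots> = t (fobj G M) x (a \<odot>\<^bsub>fobj G M\<^esub> s M \<one> m)" using tl_smult[OF G(1) M a _ m, of \<one>] a by simp
    also have "\<dots> = t (fobj G M) (x \<otimes> a) (s M \<one> m)" using tl_balance[OF F(1) GM x a s(2)] by simp
    finally show "w M (t (fobj G M) x (s M a m)) = Id FCat (F \<star> G) M (t (fobj G M) x (s M a m))"
      using eq M x a m f(2)[OF tl_I(2)[OF F(1) x a]] by simp
  qed
  then show ?thesis using w by simp
qed

text \<open>The ideal product is an inductive set built from products and sums, and pure tensors are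
  additive in their first argument.\<close>

lemma ideal_prod_tensor_ext:
  fixes H :: "('a, 'h) module"
  assumes I: "ideal I A" and J: "ideal J A" and M: "left_module A M" and H: "abelian_group H"
    and f: "additive_map (tensor A (ideal_bimodule A (I \<cdot> J)) M) H f"
    and g: "additive_map (tensor A (ideal_bimodule A (I \<cdot> J)) M) H g"
    and eq: "\<And>x y m. x \<in> I \<Longrightarrow> y \<in> J \<Longrightarrow> m \<in> carrier M \<Longrightarrow>
      f (tensor_pure A (ideal_bimodule A (I \<cdot> J)) M (x \<otimes> y) m) = g (tensor_pure A (ideal_bimodule A (I \<cdot> J)) M (x \<otimes> y) m)"
    and z: "z \<in> carrier (tensor A (ideal_bimodule A (I \<cdot> J)) M)"
  shows "f z = g z"
proof -
  have IJ: "ideal (I \<cdot> J) A" by (rule ideal_prod_is_ideal[OF I J])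
  interpret B: kbimodule A "ideal_bimodule A (I \<cdot> J)" by (rule kbimodule_ideal[OF IJ])
  interpret T: tensor_data A "ideal_bimodule A (I \<cdot> J)" M by (rule B.tensor_data[OF M])
  note b = balanced_mapD[OF T.balanced_pure, simplified]
  show ?thesis
  proof (rule T.tensor_hom_ext[OF H f g _ z])
    fix x m assume "x \<in> carrier (ideal_bimodule A (I \<cdot> J))" and m: "m \<in> carrier M"
    then have "x \<in> I \<cdot> J" by simp
    then show "f (T.pure x m) = g (T.pure x m)"
    proof induction
      case (prod i j) then show ?case using eq m by simp
    next
      case (sum x y)
      then show ?case using m additive_mapD(2)[OF f] additive_mapD(2)[OF g] b(1,2) by simp
    qed
  qed
qed

text \<open>Sending \<open>x y \<otimes> m\<close> to \<open>x \<otimes> (y \<otimes> m)\<close> is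
  not evidently well defined on \<open>I J \<otimes> M\<close>, because an element of
  \<open>I J\<close> is a sum of products in many ways. A dual basis of \<open>I\<close> supplies
  the map: each term contributes \<open>z \<otimes> m\<close> to
  \<open>p \<otimes> (\<phi> z \<otimes> m)\<close>, which makes sense for every \<open>z\<close> in
  \<open>I J\<close>. This is where projectivity of \<open>I\<close> on the right is used.\<close>

lemma right_sum_tensor:
  assumes F: "tensor_like (carrier A) I F t" and G: "tensor_like (carrier A) J G s"
    and M: "M \<in> Obj (small_mod A)" and f: "right_sum (carrier A) I f"
  shows "\<exists>\<theta>. additive_map (tensor A (ideal_bimodule A (I \<cdot> J)) M) (fobj F (fobj G M)) \<theta> \<and>
    (\<forall>x\<in>I. \<forall>y\<in>J. \<forall>m\<in>carrier M. \<theta> (tensor_pure A (ideal_bimodule A (I \<cdot> J)) M (x \<otimes> y) m) = t (fobj G M) (f x) (s M y m))"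
  using f
proof induction
  have lm: "left_module A M" using M by simp
  note GM = small_functor_module[OF tl_functor[OF G] M]
  note FGM = small_functor_module(1)[OF tl_functor[OF F] GM(2)]
  {
    case zero
    show ?case
      by (intro exI[of _ "\<lambda>_. \<zero>\<^bsub>fobj F (fobj G M)\<^esub>"])
        (use FGM tl_zero(1)[OF F GM(2)] tl_closed[OF G M] in \<open>simp add: additive_map_def\<close>)
  next
    case (add f p \<phi>)
    then obtain \<theta> where \<theta>: "additive_map (tensor A (ideal_bimodule A (I \<cdot> J)) M) (fobj F (fobj G M)) \<theta>"
      "\<And>x y m. x \<in> I \<Longrightarrow> y \<in> J \<Longrightarrow> m \<in> carrier M \<Longrightarrow>
        \<theta> (tensor_pure A (ideal_bimodule A (I \<cdot> J)) M (x \<otimes> y) m) = t (fobj G M) (f x) (s M y m)" by blast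
    note \<phi> = add(3-5)[rule_format]
    have IJ: "ideal (I \<cdot> J) A" by (rule ideal_prod_is_ideal[OF tl_ideal[OF F] tl_ideal[OF G]])
    interpret B: kbimodule A "ideal_bimodule A (I \<cdot> J)" by (rule kbimodule_ideal[OF IJ])
    interpret T: tensor_data A "ideal_bimodule A (I \<cdot> J)" M by (rule B.tensor_data[OF lm])
    have IJI: "z \<in> I" if "z \<in> I \<cdot> J" for z
      using that
    proof induction
      case (prod i j) then show ?case using tl_I(2)[OF F] tl_sub[OF G] by simp
    next
      case (sum x y) then show ?case using tl_I(4)[OF F] by simp
    qed
    \<comment> \<open>Right linearity gives \<open>\<phi> (i j) = \<phi> i j\<close>, which lies in
      \<open>J\<close>. So the coefficient maps, a priori \<open>A\<close>-valued on
      \<open>I\<close>, send \<open>I J\<close> into \<open>J\<close>.\<close>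
    have \<phi>J: "\<phi> z \<in> J" if "z \<in> I \<cdot> J" for z
      using that
    proof induction
      case (prod i j) then show ?case using \<phi>(1,3) tl_I(1)[OF G] tl_sub[OF G] by simp
    next
      case (sum x y) then show ?case using \<phi>(2) IJI tl_I(4)[OF G] by simp
    qed
    have bal: "balanced_map A (ideal_bimodule A (I \<cdot> J)) M (fobj F (fobj G M)) (\<lambda>z m. t (fobj G M) p (s M (\<phi> z) m))"
      using add(2) \<phi>(2,3) \<phi>J IJI lm
      by (auto simp: balanced_map_def additive_map_def tl_closed[OF F GM(2)] tl_closed[OF G M]
          tl_add_right[OF F GM(2)] tl_add_left[OF G M] tl_add_right[OF G M] tl_balance[OF G M])
    have "\<exists>h. additive_map T.T (fobj F (fobj G M)) h \<and>
      (\<forall>z\<in>I \<cdot> J. \<forall>m\<in>carrier M. h (T.pure z m) = t (fobj G M) p (s M (\<phi> z) m))"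
      using T.tensor_universal[OF lm_abelian_group[OF FGM] bal] by simp
    then obtain h where h: "additive_map T.T (fobj F (fobj G M)) h"
      "\<forall>z\<in>I \<cdot> J. \<forall>m\<in>carrier M. h (T.pure z m) = t (fobj G M) p (s M (\<phi> z) m)" by blast
    have "\<theta> (T.pure (x \<otimes> y) m) \<oplus>\<^bsub>fobj F (fobj G M)\<^esub> h (T.pure (x \<otimes> y) m) = t (fobj G M) (f x \<oplus> p \<otimes> \<phi> x) (s M y m)"
      if x: "x \<in> I" and y: "y \<in> J" and m: "m \<in> carrier M" for x y m
    proof -
      have yA: "y \<in> carrier A" and sy: "s M y m \<in> carrier (fobj G M)" using tl_sub[OF G y] tl_closed[OF G M y m] by auto
      have "x \<otimes> y \<in> I \<cdot> J" using x y by (rule ideal_prod.prod)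
      then have "h (T.pure (x \<otimes> y) m) = t (fobj G M) p (s M (\<phi> x \<otimes> y) m)" using h(2) m \<phi>(3)[OF x yA] by simp
      also have "\<dots> = t (fobj G M) (p \<otimes> \<phi> x) (s M y m)"
        using tl_smult[OF G M \<phi>(1)[OF x] y m] tl_balance[OF F GM(2) add(2) \<phi>(1)[OF x] sy] by simp
      finally show ?thesis
        using tl_add_left[OF F GM(2) right_sum_closed[OF add(1) tl_ideal[OF F] subset_refl x] tl_I(2)[OF F add(2) \<phi>(1)[OF x]] sy]
          \<theta>(2)[OF x y m] by simp
    qed
    then show ?case
      by (intro exI[of _ "\<lambda>z. \<theta> z \<oplus>\<^bsub>fobj F (fobj G M)\<^esub> h z"] conjI additive_map_sum[OF lm_abelian_group[OF FGM] \<theta>(1) h(1)]) blast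
  }
qed

text \<open>The dual basis gives \<open>\<theta>\<close> out of \<open>I J \<otimes> M\<close>, and
  the two universal properties give \<open>\<kappa>\<close> back, from
  \<open>x \<otimes> (y \<otimes> m)\<close> to \<open>x y \<otimes> m\<close>. Both are known on
  generators, so it can be read off there that they are mutually inverse and that
  \<open>\<theta>\<close> is linear and natural.\<close>

lemma ideal_composite:
  assumes F: "F \<in> tensor_functors A (ideal_bimodule A I)" and I: "ideal I A"
    and G: "G \<in> tensor_functors A (ideal_bimodule A J)" and J: "ideal J A"
    and f: "right_sum (carrier A) I f" "\<And>x. x \<in> I \<Longrightarrow> f x = x"
  shows "F \<star> G \<in> tensor_functors A (ideal_bimodule A (I \<cdot> J))"
proof -
  define t where "t = pure_element (ideal_bimodule A I) F"
  define s where "s = pure_element (ideal_bimodule A J) G"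
  note Ft = tensor_functor_ideal[OF I F, folded t_def] and Gs = tensor_functor_ideal[OF J G, folded s_def]
  have FG: "linear_functor (small_mod A) (small_mod A) (F \<star> G)"
    by (rule S.linear_compose_functors[OF tl_functor[OF Gs(1)] tl_functor[OF Ft(1)]])
  have IJ: "ideal (I \<cdot> J) A" by (rule ideal_prod_is_ideal[OF I J])
  let ?B = "ideal_bimodule A (I \<cdot> J)"
  interpret B: kbimodule A ?B by (rule kbimodule_ideal[OF IJ])
  have "\<exists>\<theta>. additive_map (tensor A ?B M) (fobj F (fobj G M)) \<theta> \<and>
    (\<forall>x\<in>I. \<forall>y\<in>J. \<forall>m\<in>carrier M. \<theta> (tensor_pure A ?B M (x \<otimes> y) m) = t (fobj G M) x (s M y m))"
    if "M \<in> Obj (small_mod A)" for M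
    using right_sum_tensor[OF Ft(1) Gs(1) that f(1)] f(2) by simp
  then obtain \<theta> where \<theta>: "\<And>M. M \<in> Obj (small_mod A) \<Longrightarrow> additive_map (tensor A ?B M) (fobj F (fobj G M)) (\<theta> M)"
    "\<And>M x y m. M \<in> Obj (small_mod A) \<Longrightarrow> x \<in> I \<Longrightarrow> y \<in> J \<Longrightarrow> m \<in> carrier M \<Longrightarrow>
      \<theta> M (tensor_pure A ?B M (x \<otimes> y) m) = t (fobj G M) x (s M y m)"
    by metis
  define \<Theta> where "\<Theta> M = restrict (\<theta> M) (carrier (tensor A ?B M))" for M
  have xyIJ: "x \<otimes> y \<in> I \<cdot> J" if "x \<in> I" "y \<in> J" for x y using that by (rule ideal_prod.prod)
  have main: "\<Theta> M \<in> mod_iso A (tensor A ?B M) (fobj (F \<star> G) M) \<and>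
    (\<forall>N\<in>Obj (small_mod A). \<forall>h\<in>Mor (small_mod A) M N. \<forall>x\<in>carrier (tensor A ?B M).
        fmor (F \<star> G) M N h (\<Theta> M x) = \<Theta> N (tensor_map A ?B N (\<lambda>b. b) h x))"
    if M: "M \<in> Obj (small_mod A)" for M
  proof -
    have lm: "left_module A M" using M by simp
    interpret T: tensor_data A ?B M by (rule B.tensor_data[OF lm])
    note b = balanced_mapD[OF T.balanced_pure, simplified]
    note GM = small_functor_module[OF tl_functor[OF Gs(1)] M]
    note FGM = small_functor_module(1)[OF tl_functor[OF Ft(1)] GM(2)]
    note FGa = lm_abelian_group[OF FGM]
    have zero: "\<zero> \<in> carrier ?B" "\<zero>\<^bsub>M\<^esub> \<in> carrier M"
      using additive_subgroup.zero_closed[OF ideal.axioms(1)[OF IJ]] lm by auto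
    have add: "additive_map T.T T.T (\<lambda>z. a \<odot>\<^bsub>T.T\<^esub> z)" if "a \<in> carrier A" for a
      by (rule B.smult_pure(2)[OF lm that zero])
    have smult: "\<theta> M (a \<odot>\<^bsub>T.T\<^esub> z) = a \<odot>\<^bsub>fobj F (fobj G M)\<^esub> \<theta> M z" if a: "a \<in> carrier A" and z: "z \<in> carrier T.T" for a z
    proof (rule ideal_prod_tensor_ext[OF I J lm FGa additive_map_compose[OF add[OF a] \<theta>(1)[OF M]]
          additive_map_compose[OF \<theta>(1)[OF M] additive_map_smult[OF FGM a]] _ z])
      fix x y m assume x: "x \<in> I" and y: "y \<in> J" and m: "m \<in> carrier M"
      have xy: "x \<otimes> y \<in> carrier ?B" "x \<in> carrier A" "y \<in> carrier A"
        using xyIJ[OF x y] tl_sub[OF Ft(1) x] tl_sub[OF Gs(1) y] by auto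
      have "a \<odot>\<^bsub>T.T\<^esub> T.pure (x \<otimes> y) m = T.pure ((a \<otimes> x) \<otimes> y) m"
        using B.smult_pure(1)[OF lm a xy(1) m] a xy by (simp add: m_assoc)
      then show "\<theta> M (a \<odot>\<^bsub>T.T\<^esub> T.pure (x \<otimes> y) m) = a \<odot>\<^bsub>fobj F (fobj G M)\<^esub> \<theta> M (T.pure (x \<otimes> y) m)"
        using \<theta>(2)[OF M tl_I(1)[OF Ft(1) x a] y m] \<theta>(2)[OF M x y m]
          tl_smult[OF Ft(1) GM(2) a x tl_closed[OF Gs(1) M y m]] by simp
    qed
    \<comment> \<open>For fixed \<open>x\<close>, the map from \<open>y \<otimes> m\<close> to
      \<open>x y \<otimes> m\<close>. A second use of a universal property, now in \<open>x\<close>,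
      turns these maps into \<open>\<kappa>\<close>.\<close>
    have "\<exists>h. additive_map (fobj G M) T.T h \<and> (\<forall>y\<in>J. \<forall>m\<in>carrier M. h (s M y m) = T.pure (x \<otimes> y) m)" if x: "x \<in> I" for x
    proof (rule universal_exists[OF Gs(1,2) M T.T_abelian_group])
      show "balanced_map (A\<lparr>carrier := carrier A\<rparr>) (ideal_bimodule A J) M T.T (\<lambda>y m. T.pure (x \<otimes> y) m)"
        using b(1-3) b(4) xyIJ[OF x] tl_sub[OF Ft(1) x] tl_sub[OF Gs(1)]
        by (simp add: balanced_map_def additive_map_def r_distr m_assoc[symmetric])
    qed
    then obtain h where h: "\<And>x. x \<in> I \<Longrightarrow> additive_map (fobj G M) T.T (h x)"
      "\<And>x y m. x \<in> I \<Longrightarrow> y \<in> J \<Longrightarrow> m \<in> carrier M \<Longrightarrow> h x (s M y m) = T.pure (x \<otimes> y) m" by metis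
    have "h (x \<oplus> x') g = h x g \<oplus>\<^bsub>T.T\<^esub> h x' g" if x: "x \<in> I" "x' \<in> I" and g: "g \<in> carrier (fobj G M)" for x x' g
      by (rule universal_ext[OF Gs(1,2) M T.T_abelian_group h(1)[OF tl_I(4)[OF Ft(1) x]]
          additive_map_sum[OF T.T_abelian_group h(1)[OF x(1)] h(1)[OF x(2)]] _ g])
        (use x tl_I(4)[OF Ft(1)] xyIJ b(2) tl_sub[OF Ft(1)] tl_sub[OF Gs(1)] in \<open>simp add: h(2) l_distr\<close>)
    moreover have "h (x \<otimes> a) g = h x (a \<odot>\<^bsub>fobj G M\<^esub> g)" if x: "x \<in> I" and a: "a \<in> carrier A" and g: "g \<in> carrier (fobj G M)" for x a g
      by (rule universal_ext[OF Gs(1,2) M T.T_abelian_group h(1)[OF tl_I(2)[OF Ft(1) x a]]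
          additive_map_compose[OF additive_map_smult[OF GM(1) a] h(1)[OF x]] _ g])
        (use x a tl_I(2)[OF Ft(1)] tl_I(1)[OF Gs(1)] tl_sub[OF Ft(1)] tl_sub[OF Gs(1)] in
          \<open>simp add: h(2) tl_smult[OF Gs(1) M] m_assoc\<close>)
    ultimately have bal: "balanced_map (A\<lparr>carrier := carrier A\<rparr>) (ideal_bimodule A I) (fobj G M) T.T (\<lambda>x g. h x g)"
      using h(1) by (simp add: balanced_map_def additive_map_def)
    have "\<exists>\<kappa>. additive_map (fobj F (fobj G M)) T.T \<kappa> \<and>
      (\<forall>x\<in>I. \<forall>g\<in>carrier (fobj G M). \<kappa> (t (fobj G M) x g) = h x g)"
      by (rule universal_exists[OF Ft(1,2) GM(2) T.T_abelian_group bal])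
    then obtain \<kappa> where \<kappa>: "additive_map (fobj F (fobj G M)) T.T \<kappa>"
      "\<And>x g. x \<in> I \<Longrightarrow> g \<in> carrier (fobj G M) \<Longrightarrow> \<kappa> (t (fobj G M) x g) = h x g" by blast
    have \<kappa>\<theta>: "\<kappa> (\<theta> M z) = z" if z: "z \<in> carrier T.T" for z
      by (rule ideal_prod_tensor_ext[OF I J lm T.T_abelian_group additive_map_compose[OF \<theta>(1)[OF M] \<kappa>(1)] _ _ z])
        (use M tl_closed[OF Gs(1) M] in \<open>simp_all add: \<theta>(2) \<kappa>(2) h(2) additive_map_def\<close>)
    have \<theta>\<kappa>t: "\<theta> M (\<kappa> (t (fobj G M) x g)) = t (fobj G M) x g" if x: "x \<in> I" and g: "g \<in> carrier (fobj G M)" for x g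
      unfolding \<kappa>(2)[OF x g]
      by (rule universal_ext[OF Gs(1,2) M FGa additive_map_compose[OF h(1)[OF x] \<theta>(1)[OF M]] tl_additive[OF Ft(1) GM(2) x] _ g])
        (use x M in \<open>simp add: h(2) \<theta>(2)\<close>)
    have \<theta>\<kappa>: "\<theta> M (\<kappa> z) = z" if z: "z \<in> carrier (fobj F (fobj G M))" for z
      by (rule universal_ext[OF Ft(1,2) GM(2) FGa additive_map_compose[OF \<kappa>(1) \<theta>(1)[OF M]] _ _ z])
        (use \<theta>\<kappa>t in \<open>simp_all add: additive_map_def\<close>)
    have "bij_betw (\<theta> M) (carrier T.T) (carrier (fobj F (fobj G M)))"
      by (rule bij_betw_byWitness[where f' = \<kappa>])
        (use \<kappa>\<theta> \<theta>\<kappa> additive_mapD(1)[OF \<kappa>(1)] additive_mapD(1)[OF \<theta>(1)[OF M]] in auto)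
    then have bij: "bij_betw (\<Theta> M) (carrier T.T) (carrier (fobj F (fobj G M)))"
      by (simp add: \<Theta>_def cong: bij_betw_cong)
    interpret T: abelian_group T.T by (rule T.T_abelian_group)
    have hom: "\<Theta> M \<in> mod_hom A T.T (fobj F (fobj G M))"
      unfolding mod_hom_iff \<Theta>_def
      using additive_mapD[OF \<theta>(1)[OF M]] smult additive_mapD(1)[OF add] by simp
    have nat: "fmor (F \<star> G) M N k (\<Theta> M z) = \<Theta> N (tensor_map A ?B N (\<lambda>b. b) k z)"
      if N: "N \<in> Obj (small_mod A)" and "k \<in> Mor (small_mod A) M N" and z: "z \<in> carrier T.T" for N k z
    proof -
      have k: "k \<in> mod_hom A M N" using that(2) by simp
      have lN: "left_module A N" using N by simp
      note GN = small_functor_module[OF tl_functor[OF Gs(1)] N]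
      note FGN = small_functor_module(1)[OF tl_functor[OF Ft(1)] GN(2)]
      note Gk = small_functor_hom[OF tl_functor[OF Gs(1)] M N k]
      note FGk = small_functor_hom[OF tl_functor[OF Ft(1)] GM(2) GN(2) Gk]
      note tm = B.tensor_map_hom[OF lm lN k]
      have "fmor F (fobj G M) (fobj G N) (fmor G M N k) (\<theta> M z) = \<theta> N (tensor_map A ?B N (\<lambda>b. b) k z)"
      proof (rule ideal_prod_tensor_ext[OF I J lm lm_abelian_group[OF FGN] additive_map_compose[OF \<theta>(1)[OF M] mod_hom_additive[OF FGk]]
            additive_map_compose[OF tm(1) \<theta>(1)[OF N]] _ z])
        fix x y m assume x: "x \<in> I" and y: "y \<in> J" and m: "m \<in> carrier M"
        have "fmor F (fobj G M) (fobj G N) (fmor G M N k) (\<theta> M (T.pure (x \<otimes> y) m)) = t (fobj G N) x (s N y (k m))"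
          using \<theta>(2)[OF M x y m] tl_natural[OF Ft(1) GM(2) GN(2) Gk x tl_closed[OF Gs(1) M y m]]
            tl_natural[OF Gs(1) M N k y m] by simp
        then show "fmor F (fobj G M) (fobj G N) (fmor G M N k) (\<theta> M (T.pure (x \<otimes> y) m)) = \<theta> N (tensor_map A ?B N (\<lambda>b. b) k (T.pure (x \<otimes> y) m))"
          using tm(2)[of "x \<otimes> y" m] xyIJ[OF x y] m \<theta>(2)[OF N x y mod_homD(1)[OF k m]] by simp
      qed
      then show ?thesis using M N k z additive_mapD(1)[OF tm(1) z] by (simp add: \<Theta>_def)
    qed
    show ?thesis using hom bij nat M by (simp add: mod_iso_def del: small_mod_simps)
  qed
  show ?thesis unfolding tensor_functors_def
    using FG main by (intro CollectI conjI exI[of _ \<Theta>]) blast+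
qed

text \<open>Multiplication from \<open>a \<otimes> m\<close> to \<open>a m\<close> is inverse to
  sending \<open>m\<close> to \<open>1 \<otimes> m\<close>. Hence the identity 1-morphism is among
  the generators, as the functor of the ideal \<open>A\<close>.\<close>

lemma identity_tensor_functor:
  "identity_functor (small_mod A) \<in> tensor_functors A (ideal_bimodule A (carrier A))"
proof -
  let ?B = "ideal_bimodule A (carrier A)"
  interpret B: kbimodule A ?B by (rule kbimodule_ideal[OF oneideal])
  have "\<exists>\<theta>. additive_map (tensor A ?B M) M \<theta> \<and> (\<forall>a\<in>carrier A. \<forall>m\<in>carrier M. \<theta> (tensor_pure A ?B M a m) = a \<odot>\<^bsub>M\<^esub> m)"
    if lm: "left_module A M" for M :: "'a small_module"
  proof -
    interpret T: tensor_data A ?B M by (rule B.tensor_data[OF lm])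
    have "balanced_map A ?B M M (\<lambda>a m. a \<odot>\<^bsub>M\<^esub> m)"
      using lm by (simp add: balanced_map_def additive_map_def lm_smult_add_left[OF lm] lm_smult_add_right[OF lm] lm_smult_smult[OF lm])
    then show ?thesis using T.tensor_universal[OF lm_abelian_group[OF lm]] by simp
  qed
  then obtain \<theta> where \<theta>: "\<And>M :: 'a small_module. left_module A M \<Longrightarrow> additive_map (tensor A ?B M) M (\<theta> M)"
    "\<And>M a m. left_module A M \<Longrightarrow> a \<in> carrier A \<Longrightarrow> m \<in> carrier M \<Longrightarrow> \<theta> M (tensor_pure A ?B M a m) = a \<odot>\<^bsub>M\<^esub> m"
    by metis
  define \<Theta> where "\<Theta> M = restrict (\<theta> M) (carrier (tensor A ?B M))" for M
  have main: "\<Theta> M \<in> mod_iso A (tensor A ?B M) M \<and>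
    (\<forall>N\<in>Obj (small_mod A). \<forall>h\<in>Mor (small_mod A) M N. \<forall>x\<in>carrier (tensor A ?B M).
        h (\<Theta> M x) = \<Theta> N (tensor_map A ?B N (\<lambda>b. b) h x))"
    if M: "M \<in> Obj (small_mod A)" for M
  proof -
    have lm: "left_module A M" using M by simp
    interpret T: tensor_data A ?B M by (rule B.tensor_data[OF lm])
    note Ma = lm_abelian_group[OF lm]
    note b = balanced_mapD[OF T.balanced_pure, simplified]
    have add: "additive_map T.T T.T (\<lambda>z. a \<odot>\<^bsub>T.T\<^esub> z)" if "a \<in> carrier A" for a
      by (rule B.smult_pure(2)[OF lm that, of \<zero> "\<zero>\<^bsub>M\<^esub>"]) (use lm in auto)
    have smult: "\<theta> M (a \<odot>\<^bsub>T.T\<^esub> z) = a \<odot>\<^bsub>M\<^esub> \<theta> M z" if a: "a \<in> carrier A" and z: "z \<in> carrier T.T" for a z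
      by (rule T.tensor_hom_ext[OF Ma additive_map_compose[OF add[OF a] \<theta>(1)[OF lm]]
          additive_map_compose[OF \<theta>(1)[OF lm] additive_map_smult[OF lm a]] _ z])
        (use a lm B.smult_pure(1)[OF lm a] in \<open>simp add: \<theta>(2) lm_smult_smult[OF lm]\<close>)
    have k: "additive_map M T.T (\<lambda>m. T.pure \<one> m)" using b by (simp add: additive_map_def)
    have 1: "T.pure \<one> (\<theta> M z) = z" if z: "z \<in> carrier T.T" for z
    proof (rule T.tensor_hom_ext[OF T.T_abelian_group additive_map_compose[OF \<theta>(1)[OF lm] k] _ _ z])
      fix a m assume "a \<in> carrier ?B" "m \<in> carrier M"
      then show "T.pure \<one> (\<theta> M (T.pure a m)) = T.pure a m" using b(4)[of \<one> a m] lm by (simp add: \<theta>(2))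
    qed (simp add: additive_map_def)
    have 2: "\<theta> M (T.pure \<one> m) = m" if "m \<in> carrier M" for m using that lm by (simp add: \<theta>(2))
    have "bij_betw (\<theta> M) (carrier T.T) (carrier M)"
      by (rule bij_betw_byWitness[where f' = "\<lambda>m. T.pure \<one> m"])
        (use 1 2 additive_mapD(1)[OF k] additive_mapD(1)[OF \<theta>(1)[OF lm]] in auto)
    then have bij: "bij_betw (\<Theta> M) (carrier T.T) (carrier M)"
      by (simp add: \<Theta>_def cong: bij_betw_cong)
    interpret T: abelian_group T.T by (rule T.T_abelian_group)
    have hom: "\<Theta> M \<in> mod_hom A T.T M"
      unfolding mod_hom_iff \<Theta>_def
      using additive_mapD[OF \<theta>(1)[OF lm]] smult additive_mapD(1)[OF add] by simp
    have "h (\<Theta> M z) = \<Theta> N (tensor_map A ?B N (\<lambda>b. b) h z)"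
      if N: "N \<in> Obj (small_mod A)" and "h \<in> Mor (small_mod A) M N" and z: "z \<in> carrier T.T" for N h z
    proof -
      have h: "h \<in> mod_hom A M N" using that(2) by simp
      have lN: "left_module A N" using N by simp
      note tm = B.tensor_map_hom[OF lm lN h]
      have "h (\<theta> M z) = \<theta> N (tensor_map A ?B N (\<lambda>b. b) h z)"
        by (rule T.tensor_hom_ext[OF lm_abelian_group[OF lN] additive_map_compose[OF \<theta>(1)[OF lm] mod_hom_additive[OF h]]
            additive_map_compose[OF tm(1) \<theta>(1)[OF lN]] _ z])
          (use lm lN mod_homD[OF h] tm(2) in \<open>simp add: \<theta>(2)\<close>)
      then show ?thesis using z additive_mapD(1)[OF tm(1) z] by (simp add: \<Theta>_def)
    qed
    then show ?thesis using hom bij by (simp add: mod_iso_def del: small_mod_simps)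
  qed
  have "h \<in> Mor (small_mod A) M N \<Longrightarrow> \<Theta> M x \<in> carrier M \<Longrightarrow> M \<in> Obj (small_mod A) \<Longrightarrow> N \<in> Obj (small_mod A) \<Longrightarrow>
    fmor (identity_functor (small_mod A)) M N h = h" for M N h x
    by (rule compose_functors_simps(4))
  then show ?thesis unfolding tensor_functors_def
    using S.linear_identity_functor main
    by (intro CollectI conjI exI[of _ \<Theta>]) (auto simp: compose_functors_simps(3,4) mod_iso_def simp del: small_mod_simps)
qed

text \<open>Two functors with elements of the same kind map to each other by matching these
  elements, and uniqueness makes the composites identities. So one representative per ideal and one
  for the free bimodule account for all generators up to isomorphism.\<close>

lemma tensor_like_isomorphic:
  assumes F: "tensor_like Z I F t" "universal TYPE('a small_carrier) Z I F t"
    and G: "tensor_like Z I G s" "universal TYPE('a small_carrier) Z I G s"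
  shows "isomorphic FCat F G"
proof -
  have *: "\<exists>\<eta>\<in>natural_transformations (small_mod A) (small_mod A) F G.
    \<forall>M\<in>Obj (small_mod A). \<forall>x\<in>I. \<forall>m\<in>carrier M. \<eta> M (t M x m) = s M x m"
    if F: "tensor_like Z I F t" "universal TYPE('a small_carrier) Z I F t" and G: "tensor_like Z I G s" for F G t s
    by (rule natural_of_balanced_single[OF F tl_functor[OF G] tl_balanced[OF G] tl_smult[OF G] tl_natural[OF G]])
  have **: "Comp FCat F G F \<zeta> \<eta> = Id FCat F"
    if F: "tensor_like Z I F t" "universal TYPE('a small_carrier) Z I F t" and G: "tensor_like Z I G s"
      and \<eta>: "\<eta> \<in> natural_transformations (small_mod A) (small_mod A) F G"
        "\<forall>M\<in>Obj (small_mod A). \<forall>x\<in>I. \<forall>m\<in>carrier M. \<eta> M (t M x m) = s M x m"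
      and \<zeta>: "\<zeta> \<in> natural_transformations (small_mod A) (small_mod A) G F"
        "\<forall>M\<in>Obj (small_mod A). \<forall>x\<in>I. \<forall>m\<in>carrier M. \<zeta> M (s M x m) = t M x m" for F G t s \<eta> \<zeta>
  proof -
    have FG: "F \<in> Obj FCat" "G \<in> Obj FCat" using tl_functor[OF F(1)] tl_functor[OF G] by simp_all
    have "Comp FCat F G F \<zeta> \<eta> \<in> Mor FCat F F" using FG \<eta>(1) \<zeta>(1) by (intro FC.Comp_closed) simp_all
    moreover have "Id FCat F \<in> Mor FCat F F" using FG by (intro FC.Id_closed)
    ultimately have m: "Comp FCat F G F \<zeta> \<eta> \<in> natural_transformations (small_mod A) (small_mod A) F F"
      "Id FCat F \<in> natural_transformations (small_mod A) (small_mod A) F F" by (simp_all only: functor_category_simps)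
    show ?thesis
    proof (rule universal_natural_ext[OF F tl_functor[OF F(1)] m])
      fix M x y assume M: "M \<in> Obj (small_mod A)" and x: "x \<in> I" "y \<in> carrier M"
      show "Comp FCat F G F \<zeta> \<eta> M (t M x y) = Id FCat F M (t M x y)"
        unfolding FCat_comp_eval[OF M tl_closed[OF F(1) M x]] FCat_Id_eval[OF M tl_closed[OF F(1) M x]]
        using \<eta>(2) \<zeta>(2) M x by simp
    qed
  qed
  obtain \<eta> where \<eta>: "\<eta> \<in> natural_transformations (small_mod A) (small_mod A) F G"
    "\<forall>M\<in>Obj (small_mod A). \<forall>x\<in>I. \<forall>m\<in>carrier M. \<eta> M (t M x m) = s M x m"
    using *[OF F G(1)] by blast
  obtain \<zeta> where \<zeta>: "\<zeta> \<in> natural_transformations (small_mod A) (small_mod A) G F"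
    "\<forall>M\<in>Obj (small_mod A). \<forall>x\<in>I. \<forall>m\<in>carrier M. \<zeta> M (s M x m) = t M x m"
    using *[OF G F(1)] by blast
  have "Comp FCat F G F \<zeta> \<eta> = Id FCat F" "Comp FCat G F G \<eta> \<zeta> = Id FCat G"
    using **[OF F G(1) \<eta> \<zeta>] **[OF G F(1) \<zeta> \<eta>] by auto
  moreover have "F \<in> Obj FCat" "G \<in> Obj FCat" "\<eta> \<in> Mor FCat F G" "\<zeta> \<in> Mor FCat G F"
    using tl_functor[OF F(1)] tl_functor[OF G(1)] \<eta>(1) \<zeta>(1) by simp_all
  ultimately show ?thesis unfolding isomorphic_def by blast
qed

section \<open>Natural transformations tested at the regular module\<close>

lemma to_regular_one: "to_regular \<one> \<in> carrier small_regular"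
  by (simp add: small_regular)

text \<open>By the dual basis, \<open>t (f x) 1\<close> is a combination of the elements
  \<open>t p 1\<close> with coefficients in \<open>A\<close>. A transformation that vanishes on the
  latter vanishes on the former, because its components are linear.\<close>

lemma natural_on_generators:
  assumes F: "tensor_like Z I F t" and G: "linear_functor (small_mod A) (small_mod A) G" and f: "left_sum I f"
  shows "\<exists>S. finite S \<and> S \<subseteq> I \<and> (\<forall>\<eta>\<in>natural_transformations (small_mod A) (small_mod A) F G.
    (\<forall>p\<in>S. \<eta> small_regular (t small_regular p (to_regular \<one>)) = \<zero>\<^bsub>fobj G small_regular\<^esub>) \<longrightarrow>
    (\<forall>x\<in>I. \<eta> small_regular (t small_regular (f x) (to_regular \<one>)) = \<zero>\<^bsub>fobj G small_regular\<^esub>))"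
  using f
proof induction
  note R = small_regular(1)
  note FR = small_functor_module(1)[OF tl_functor[OF F] R] and GR = small_functor_module(1)[OF G R]
  {
    case zero
    show ?case
      using tl_zero(1)[OF F R to_regular_one] mod_hom_zero[OF FR GR natural_component[OF _ R]]
      by (intro exI[of _ "{}"]) auto
  next
    case (add f p \<psi>)
    obtain S where S: "finite S" "S \<subseteq> I" "\<forall>\<eta>\<in>natural_transformations (small_mod A) (small_mod A) F G.
    (\<forall>p\<in>S. \<eta> small_regular (t small_regular p (to_regular \<one>)) = \<zero>\<^bsub>fobj G small_regular\<^esub>) \<longrightarrow>
    (\<forall>x\<in>I. \<eta> small_regular (t small_regular (f x) (to_regular \<one>)) = \<zero>\<^bsub>fobj G small_regular\<^esub>)"
      using add.IH by (elim exE conjE) (rule that)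
    have "\<eta> small_regular (t small_regular (f x \<oplus> \<psi> x \<otimes> p) (to_regular \<one>)) = \<zero>\<^bsub>fobj G small_regular\<^esub>"
      if \<eta>: "\<eta> \<in> natural_transformations (small_mod A) (small_mod A) F G"
        and z: "\<forall>p\<in>insert p S. \<eta> small_regular (t small_regular p (to_regular \<one>)) = \<zero>\<^bsub>fobj G small_regular\<^esub>"
        and x: "x \<in> I" for \<eta> x
    proof -
      note \<eta>R = natural_component[OF \<eta> R]
      have fx: "f x \<in> I" "\<psi> x \<in> carrier A" "\<psi> x \<otimes> p \<in> I"
        using left_sum_closed[OF add(1) tl_ideal[OF F] x] add(3) x tl_I(1)[OF F add(2)] by auto
      have "t small_regular (f x \<oplus> \<psi> x \<otimes> p) (to_regular \<one>) =
        t small_regular (f x) (to_regular \<one>) \<oplus>\<^bsub>fobj F small_regular\<^esub> \<psi> x \<odot>\<^bsub>fobj F small_regular\<^esub> t small_regular p (to_regular \<one>)"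
        using tl_add_left[OF F R fx(1,3) to_regular_one] tl_smult[OF F R fx(2) add(2) to_regular_one] by simp
      then show ?thesis
        using mod_homD(2,3)[OF \<eta>R] tl_closed[OF F R _ to_regular_one] fx add(2) z S(3)[rule_format, OF \<eta> _ x] FR GR by simp
    qed
    then show ?case using S(1,2) add(2) by (intro exI[of _ "insert p S"]) auto
  }
qed

text \<open>A transformation is determined by its values at finitely many elements, and these lie in
  the value of \<open>G\<close> at the regular module, which is finite-dimensional. Forms on that
  space, evaluated at these elements, separate the transformations.\<close>

lemma separated_natural:
  assumes F: "tensor_like Z I F t" "universal TYPE('a small_carrier) Z I F t"
    and G: "linear_functor (small_mod A) (small_mod A) G" and f: "left_sum I f" "\<And>x. x \<in> I \<Longrightarrow> f x = x"
    and P: "finite P" "P \<subseteq> carrier A" "carrier A = V.vspan P"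
  shows "\<exists>n. separated (Hom FCat F G) (Mor FCat F G) n"
proof -
  let ?R = small_regular and ?e = "to_regular \<one>"
  note R = small_regular(1)
  note FR = small_functor_module(1)[OF tl_functor[OF F(1)] R] and GR = small_functor_module[OF G R]
  obtain S where S: "finite S" "S \<subseteq> I" "\<And>\<eta> x. \<eta> \<in> natural_transformations (small_mod A) (small_mod A) F G \<Longrightarrow>
      \<forall>p\<in>S. \<eta> ?R (t ?R p ?e) = \<zero>\<^bsub>fobj G ?R\<^esub> \<Longrightarrow> x \<in> I \<Longrightarrow> \<eta> ?R (t ?R x ?e) = \<zero>\<^bsub>fobj G ?R\<^esub>"
    using natural_on_generators[OF F(1) G f(1)] f(2) by auto
  have "finitely_generated A (fobj G ?R)" using GR(2) by simp
  then obtain n where "separated (restrict_scalars (fobj G ?R)) (carrier (fobj G ?R)) n"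
    using separated_module[OF P GR(1)] by blast
  then obtain \<Lambda> where \<Lambda>: "finite \<Lambda>" "\<And>l. l \<in> \<Lambda> \<Longrightarrow> linear_form (restrict_scalars (fobj G ?R)) (carrier (fobj G ?R)) l"
    "\<And>w. w \<in> carrier (fobj G ?R) \<Longrightarrow> \<forall>l\<in>\<Lambda>. l w = 0 \<Longrightarrow> w = \<zero>\<^bsub>fobj G ?R\<^esub>"
    unfolding separated_def by auto
  let ?L = "(\<lambda>(p, l) \<eta>. l (\<eta> ?R (t ?R p ?e))) ` (S \<times> \<Lambda>)"
  have FG: "F \<in> Obj FCat" "G \<in> Obj FCat" using tl_functor[OF F(1)] G by simp_all
  have "linear_form (Hom FCat F G) (Mor FCat F G) l" if "l \<in> ?L" for l
  proof -
    obtain p l' where l: "p \<in> S" "l' \<in> \<Lambda>" "l = (\<lambda>\<eta>. l' (\<eta> ?R (t ?R p ?e)))" using \<open>l \<in> ?L\<close> by auto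
    have tp: "t ?R p ?e \<in> carrier (fobj F ?R)" using tl_closed[OF F(1) R _ to_regular_one] l(1) S(2) by auto
    show ?thesis unfolding l(3)
    proof (rule linear_form_pullback[OF \<Lambda>(2)[OF l(2)]])
      fix \<eta> assume "\<eta> \<in> Mor FCat F G"
      then have \<eta>: "\<eta> \<in> natural_transformations (small_mod A) (small_mod A) F G" by simp
      show "\<eta> ?R (t ?R p ?e) \<in> carrier (fobj G ?R)" by (rule mod_homD(1)[OF natural_component[OF \<eta> R] tp])
      show "(\<eta> \<oplus>\<^bsub>Hom FCat F G\<^esub> \<zeta>) ?R (t ?R p ?e) = \<eta> ?R (t ?R p ?e) \<oplus>\<^bsub>restrict_scalars (fobj G ?R)\<^esub> \<zeta> ?R (t ?R p ?e)" for \<zeta>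
        using FCat_add_eval[OF R tp] by simp
      show "(c \<odot>\<^bsub>Hom FCat F G\<^esub> \<eta>) ?R (t ?R p ?e) = c \<odot>\<^bsub>restrict_scalars (fobj G ?R)\<^esub> \<eta> ?R (t ?R p ?e)" for c
        using R tp by simp
    qed
  qed
  moreover have "\<eta> = \<zero>\<^bsub>Hom FCat F G\<^esub>" if "\<eta> \<in> Mor FCat F G" "\<forall>l\<in>?L. l \<eta> = 0" for \<eta>
  proof -
    have \<eta>: "\<eta> \<in> natural_transformations (small_mod A) (small_mod A) F G" using that(1) by simp
    note \<eta>R = natural_component[OF \<eta> R]
    have "\<eta> ?R (t ?R p ?e) = \<zero>\<^bsub>fobj G ?R\<^esub>" if "p \<in> S" for p
    proof (rule \<Lambda>(3))
      have "t ?R p ?e \<in> carrier (fobj F ?R)" using tl_closed[OF F(1) R _ to_regular_one] that S(2) by auto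
      then show "\<eta> ?R (t ?R p ?e) \<in> carrier (fobj G ?R)" by (rule mod_homD(1)[OF \<eta>R])
      show "\<forall>l\<in>\<Lambda>. l (\<eta> ?R (t ?R p ?e)) = 0" using \<open>\<forall>l\<in>?L. l \<eta> = 0\<close> that by auto
    qed
    then have z: "\<eta> ?R (t ?R x ?e) = \<zero>\<^bsub>fobj G ?R\<^esub>" if "x \<in> I" for x using S(3)[OF \<eta> _ that] by blast
    have "\<zero>\<^bsub>Hom FCat F G\<^esub> \<in> Mor FCat F G" using FG by (intro FC.Hom_closed)
    then have zn: "\<zero>\<^bsub>Hom FCat F G\<^esub> \<in> natural_transformations (small_mod A) (small_mod A) F G" by (simp only: functor_category_simps)
    show ?thesis
    proof (rule universal_natural_ext[OF F G \<eta> zn])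
      fix M x m assume M: "M \<in> Obj (small_mod A)" and x: "x \<in> I" and m: "m \<in> carrier M"
      have lm: "left_module A M" using M by simp
      note \<rho> = regular_hom[OF lm m]
      have tx: "t ?R x ?e \<in> carrier (fobj F ?R)" by (rule tl_closed[OF F(1) R x to_regular_one])
      \<comment> \<open>Every \<open>t M x m\<close> is the image of \<open>t ?R x ?e\<close>, since
        \<open>m\<close> is the image of the generator; naturality then carries the vanishing of
        \<open>\<eta>\<close> from the regular module to \<open>M\<close>.\<close>
      have "fmor F ?R M (regular_hom M m) (t ?R x ?e) = t M x m"
        using tl_natural[OF F(1) R M \<rho>(1) x to_regular_one] \<rho>(2)[OF one_closed] lm m by simp
      then have "\<eta> M (t M x m) = fmor G ?R M (regular_hom M m) (\<eta> ?R (t ?R x ?e))"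
        using natural_transformation_eval[OF \<eta> tl_functor[OF F(1)] R M \<rho>(1) tx] by simp
      also have "\<dots> = \<zero>\<^bsub>fobj G M\<^esub>"
        using z[OF x] mod_hom_zero[OF GR(1) small_functor_module(1)[OF G M] small_functor_hom[OF G R M \<rho>(1)]] by simp
      finally show "\<eta> M (t M x m) = \<zero>\<^bsub>Hom FCat F G\<^esub> M (t M x m)"
        using M tl_closed[OF F(1) M x m] by simp
    qed
  qed
  ultimately show ?thesis
    unfolding separated_def using S(1) \<Lambda>(1) by (intro exI[of _ "card ?L"] exI[of _ ?L]) auto
qed

text \<open>Evaluation at the regular module identifies the natural endomorphisms of the identity with the centre of \<open>A\<close>.\<close>

lemma natural_endomorphism_identity:
  assumes centre: "\<And>z. z \<in> carrier A \<Longrightarrow> (\<And>a. a \<in> carrier A \<Longrightarrow> a \<otimes> z = z \<otimes> a) \<Longrightarrow> z \<in> range scalar"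
    and \<eta>: "\<eta> \<in> Mor FCat (identity_functor (small_mod A)) (identity_functor (small_mod A))"
  shows "\<exists>c. \<eta> = c \<odot>\<^bsub>Hom FCat (identity_functor (small_mod A)) (identity_functor (small_mod A))\<^esub> Id FCat (identity_functor (small_mod A))"
proof -
  let ?Id = "identity_functor (small_mod A)" and ?R = small_regular and ?e = "to_regular \<one>"
  note R = small_regular(1)
  have lR: "left_module A ?R" using R by simp
  have Id: "fobj ?Id M = M" if "M \<in> Obj (small_mod A)" for M using that by (rule compose_functors_simps(3))
  have \<eta>n: "\<eta> \<in> natural_transformations (small_mod A) (small_mod A) ?Id ?Id" using \<eta> by simp
  have \<eta>M: "\<eta> M \<in> mod_hom A M M" if "M \<in> Obj (small_mod A)" for M using natural_component[OF \<eta>n that] Id[OF that] by simp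
  have nat: "\<eta> N (f x) = f (\<eta> M x)"
    if "M \<in> Obj (small_mod A)" "N \<in> Obj (small_mod A)" "f \<in> mod_hom A M N" "x \<in> carrier M" for M N f x
  proof -
    have "fmor ?Id M N f = f" using that by (intro compose_functors_simps(4)) simp_all
    then show ?thesis
      using natural_transformation_eval[OF \<eta>n S.linear_identity_functor that(1-3), of x] that(4) Id[OF that(1)] by simp
  qed
  have "\<eta> ?R ?e \<in> carrier ?R" by (rule mod_homD(1)[OF \<eta>M[OF R] to_regular_one])
  \<comment> \<open>The value at the generator. Naturality will show that \<open>\<eta>\<close> is
    multiplication by \<open>z\<close> everywhere, and linearity of the component at the regular
    module that \<open>z\<close> is central.\<close>
  then obtain z where z: "z \<in> carrier A" "\<eta> ?R ?e = to_regular z" by (auto simp: small_regular)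
  have ev: "\<eta> M m = z \<odot>\<^bsub>M\<^esub> m" if M: "M \<in> Obj (small_mod A)" and m: "m \<in> carrier M" for M m
  proof -
    have lm: "left_module A M" using M by simp
    note \<rho> = regular_hom[OF lm m]
    show ?thesis using nat[OF R M \<rho>(1) to_regular_one] \<rho>(2) z m lm by simp
  qed
  have "a \<otimes> z = z \<otimes> a" if a: "a \<in> carrier A" for a
  proof -
    have "\<eta> ?R (a \<odot>\<^bsub>?R\<^esub> ?e) = a \<odot>\<^bsub>?R\<^esub> \<eta> ?R ?e" by (rule mod_homD(3)[OF \<eta>M[OF R] a to_regular_one])
    moreover have "to_regular a \<in> carrier ?R" using a by (simp add: small_regular)
    ultimately show ?thesis using ev[OF R, of "to_regular a"] a z by (simp add: small_regular inj_to_regular)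
  qed
  then obtain c where c: "z = scalar c" using centre z(1) by blast
  have IdO: "?Id \<in> Obj FCat" using S.linear_identity_functor by simp
  have "c \<odot>\<^bsub>Hom FCat ?Id ?Id\<^esub> Id FCat ?Id \<in> Mor FCat ?Id ?Id"
    by (rule FC.Hom_closed(3)[OF IdO IdO FC.Id_closed[OF IdO]])
  then have cn: "c \<odot>\<^bsub>Hom FCat ?Id ?Id\<^esub> Id FCat ?Id \<in> natural_transformations (small_mod A) (small_mod A) ?Id ?Id"
    by (simp only: functor_category_simps)
  have "\<eta> = c \<odot>\<^bsub>Hom FCat ?Id ?Id\<^esub> Id FCat ?Id"
  proof (rule natural_transformation_eqI[OF \<eta>n cn])
    fix M x assume M: "M \<in> Obj (small_mod A)" and x: "x \<in> carrier (fobj ?Id M)"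
    then show "\<eta> M x = (c \<odot>\<^bsub>Hom FCat ?Id ?Id\<^esub> Id FCat ?Id) M x" using ev[OF M, of x] Id[OF M] c by simp
  qed
  then show ?thesis by blast
qed

end

section \<open>Closure under composition and the general criterion\<close>

context linear_category
begin

text \<open>Horizontal composition is bilinear, so single composites suffice. By interchange the
  product of \<open>r s\<close> and \<open>r' s'\<close> is the product of \<open>r\<close> and
  \<open>r'\<close> after that of \<open>s\<close> and \<open>s'\<close>; it passes through the
  composite of two generators, whose identity factors by assumption.\<close>

lemma horizontal_factoring:
  defines "E \<equiv> functor_category K K"
  assumes S: "S \<subseteq> Obj E"
    and comp: "\<And>f g. f \<in> S \<Longrightarrow> g \<in> S \<Longrightarrow>
      Id E (compose_functors K g f) \<in> factoring E S (compose_functors K g f) (compose_functors K g f)"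
    and F: "F \<in> Obj E" "F' \<in> Obj E" "G \<in> Obj E" "G' \<in> Obj E"
    and \<alpha>: "\<alpha> \<in> factoring E S F F'" and \<beta>: "\<beta> \<in> factoring E S G G'"
  shows "horizontal_composite K K K F F' G G' \<beta> \<alpha> \<in> factoring E S (compose_functors K G F) (compose_functors K G' F')"
proof -
  interpret KK: linear_categories K K ..
  interpret E: linear_category E unfolding E_def by (rule KK.linear_functor_category)
  let ?h = "horizontal_composite K K K F F' G G'"
  let ?C = "compose_functors K G F" and ?C' = "compose_functors K G' F'"
  have lf: "linear_functor K K f \<longleftrightarrow> f \<in> Obj E" for f by (simp add: E_def)
  have OC: "f \<in> Obj E \<Longrightarrow> g \<in> Obj E \<Longrightarrow> compose_functors K g f \<in> Obj E" for f g
    using linear_compose_functors[of f g] by (simp add: lf)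
  have nt: "natural_transformations K K f g = Mor E f g" for f g by (simp add: E_def)
  note bil = horizontal_composite_bilinear[unfolded lf, folded E_def, OF F]
  have add_left: "?h (b \<oplus>\<^bsub>Hom E G G'\<^esub> b') a = ?h b a \<oplus>\<^bsub>Hom E ?C ?C'\<^esub> ?h b' a"
    and smult_left: "?h (c \<odot>\<^bsub>Hom E G G'\<^esub> b) a = c \<odot>\<^bsub>Hom E ?C ?C'\<^esub> ?h b a"
    if "b \<in> Mor E G G'" "b' \<in> Mor E G G'" "a \<in> Mor E F F'" for a b b' c
    using bil that by (simp_all add: bilinear_map_def)
  have add_right: "?h b (a \<oplus>\<^bsub>Hom E F F'\<^esub> a') = ?h b a \<oplus>\<^bsub>Hom E ?C ?C'\<^esub> ?h b a'"
    and smult_right: "?h b (c \<odot>\<^bsub>Hom E F F'\<^esub> a) = c \<odot>\<^bsub>Hom E ?C ?C'\<^esub> ?h b a"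
    if "b \<in> Mor E G G'" "a \<in> Mor E F F'" "a' \<in> Mor E F F'" for a b a' c
    using bil that by (simp_all add: bilinear_map_def)
  have natural: "horizontal_composite K K K f f' g g' b a \<in> Mor E (compose_functors K g f) (compose_functors K g' f')"
    if "f \<in> Obj E" "f' \<in> Obj E" "g \<in> Obj E" "g' \<in> Obj E" "a \<in> Mor E f f'" "b \<in> Mor E g g'" for f f' g g' a b
    by (rule horizontal_composite_natural[unfolded lf nt, OF that])
  interpret H: vspace "Hom E ?C ?C'" by (intro E.Hom_vspace OC F)
  interpret HG: vspace "Hom E G G'" using F by (intro E.Hom_vspace)
  interpret HF: vspace "Hom E F F'" using F by (intro E.Hom_vspace)
  have single: "?h (Comp E G g G' r s) a \<in> factoring E S ?C ?C'"
    if g: "g \<in> S" "s \<in> Mor E G g" "r \<in> Mor E g G'" and a: "a \<in> factoring E S F F'" for g r s a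
    using a
  proof induction
    have rs: "Comp E G g G' r s \<in> Mor E G G'" using g F S by (auto intro!: E.Comp_closed)
    {
      case zero
      have "?h (Comp E G g G' r s) (0 \<odot>\<^bsub>Hom E F F'\<^esub> \<zero>\<^bsub>Hom E F F'\<^esub>) = \<zero>\<^bsub>Hom E ?C ?C'\<^esub>"
        using smult_right[OF rs, of "\<zero>\<^bsub>Hom E F F'\<^esub>" "\<zero>\<^bsub>Hom E F F'\<^esub>" 0] natural[OF F _ rs] by simp
      then show ?case by (simp add: factoring.zero)
    next
      case (add a f s' r')
      have f: "f \<in> Obj E" and gO: "g \<in> Obj E" using add(2) g S by auto
      have rs': "Comp E F f F' r' s' \<in> Mor E F F'" using add f F by (intro E.Comp_closed) auto
      have a': "a \<in> Mor E F F'" by (rule E.factoring_closed[OF F(1,2) S add(1)])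
      have "?h (Comp E G g G' r s) (Comp E F f F' r' s') =
        Comp E ?C (compose_functors K g f) ?C' (horizontal_composite K K K f F' g G' r r')
          (Comp E ?C (compose_functors K g f) (compose_functors K g f) (Id E (compose_functors K g f))
            (horizontal_composite K K K F f G g s s'))"
        using horizontal_composite_interchange[unfolded lf nt, folded E_def, OF F(1) f F(2,3) gO F(4) add(3,4) g(2,3)]
          natural[OF F(1) f F(3) gO add(3) g(2)] OC[OF F(1,3)] OC[OF f gO] by (simp add: E.Comp_Id_left)
      moreover have "\<dots> \<in> factoring E S ?C ?C'"
        by (intro E.factoring_comp_left[OF OC[OF F(1,3)] OC[OF f gO] OC[OF F(2,4)] S]
            E.factoring_comp_right[OF OC[OF F(1,3)] OC[OF f gO] OC[OF f gO] S] comp natural f gO F add g)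
      ultimately show ?case using add.IH add_right[OF rs a' rs'] 
        by (simp add: E.factoring_add[OF OC[OF F(1,3)] OC[OF F(2,4)] S])
    }
  qed
  have \<alpha>': "\<alpha> \<in> Mor E F F'" by (rule E.factoring_closed[OF F(1,2) S \<alpha>])
  show ?thesis
    using \<beta>
  proof induction
    case zero
    have "?h (0 \<odot>\<^bsub>Hom E G G'\<^esub> \<zero>\<^bsub>Hom E G G'\<^esub>) \<alpha> = \<zero>\<^bsub>Hom E ?C ?C'\<^esub>"
      using smult_left[of "\<zero>\<^bsub>Hom E G G'\<^esub>" "\<zero>\<^bsub>Hom E G G'\<^esub>" \<alpha> 0] natural[OF F \<alpha>'] \<alpha>' by simp
    then show ?case by (simp add: factoring.zero)
  next
    case (add b g s r)
    have "b \<in> Mor E G G'" by (rule E.factoring_closed[OF F(3,4) S add(1)])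
    moreover have "Comp E G g G' r s \<in> Mor E G G'" using add S F by (intro E.Comp_closed) auto
    ultimately show ?case using add.IH single[OF add(2-4) \<alpha>] \<alpha>'
      by (simp add: add_left E.factoring_add[OF OC[OF F(1,3)] OC[OF F(2,4)] S])
  qed
qed

text \<open>The previous lemma is applied to identities, whose horizontal composite is the identity
  of the composite functor.\<close>

lemma additive_closure_compose:
  defines "E \<equiv> functor_category K K"
  assumes K: "idempotent_split K" "has_biproducts K" and S: "S \<subseteq> Obj E"
    and comp: "\<And>f g. f \<in> S \<Longrightarrow> g \<in> S \<Longrightarrow>
      Id E (compose_functors K g f) \<in> factoring E S (compose_functors K g f) (compose_functors K g f)"
    and F: "F \<in> additive_closure E S" and G: "G \<in> additive_closure E S"
  shows "compose_functors K G F \<in> additive_closure E S"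
proof -
  interpret KK: linear_categories K K ..
  interpret E: linear_category E unfolding E_def by (rule KK.linear_functor_category)
  have *: "additive_closure E S = {x \<in> Obj E. Id E x \<in> factoring E S x x}"
    by (rule E.additive_closure_iff[OF KK.functor_category_split[OF K(1), folded E_def]
        KK.functor_category_biproducts[OF K(2), folded E_def] S])
  have FG: "F \<in> Obj E" "G \<in> Obj E" "Id E F \<in> factoring E S F F" "Id E G \<in> factoring E S G G"
    using F G unfolding * by auto
  have "Id E (compose_functors K G F) \<in> factoring E S (compose_functors K G F) (compose_functors K G F)"
    using horizontal_factoring[folded E_def, OF S comp FG(1,1,2,2,3,4)] horizontal_composite_Id_Id[of F G] FG(1,2)
    by (simp add: E_def)
  moreover have "compose_functors K G F \<in> Obj E" using linear_compose_functors[of F G] FG(1,2) by (simp add: E_def)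
  ultimately show ?thesis unfolding * by simp
qed

end

context kalgebra
begin

text \<open>The coefficients of a dual basis over the field are scalars, so the finitely many
  \<open>p\<close> span all values. For \<open>f\<close> the identity this is a finite spanning set
  of \<open>A\<close>.\<close>

lemma right_sum_span:
  assumes "right_sum (range scalar) (carrier A) f"
  shows "\<exists>P. finite P \<and> P \<subseteq> carrier A \<and> (\<forall>a\<in>carrier A. f a \<in> V.vspan P)"
  using assms
proof induction
  case zero then show ?case by (intro exI[of _ "{}"]) (auto intro: V.vspan.zero)
next
  case (add f p \<phi>)
  obtain P where P: "finite P" "P \<subseteq> carrier A" "\<forall>a\<in>carrier A. f a \<in> V.vspan P" using add.IH by (elim exE conjE) (rule that)
  have "f a \<oplus> p \<otimes> \<phi> a \<in> V.vspan (insert p P)" if a: "a \<in> carrier A" for a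
  proof -
    obtain c where c: "\<phi> a = scalar c" using add(3) a by auto
    have "f a \<in> V.vspan (insert p P)" using P(3) a V.vspan_mono[of P "insert p P"] by blast
    from V.vspan.add[OF this, of p c] show ?thesis using add(2) by (simp add: c scalar_mult)
  qed
  then show ?case using P add(2) by (intro exI[of _ "insert p P"]) auto
qed

text \<open>\<open>nontrivial\<close> lets pairs be coded and keeps the identity nonzero;
  \<open>finite_ideals\<close> bounds the isomorphism classes of generators; \<open>right\<close>
  and \<open>left\<close> bring composites into the closure, and \<open>left\<close> also bounds the
  spaces of 2-morphisms; \<open>basis\<close> makes \<open>A\<close> finite-dimensional and handles
  composites of two free functors; \<open>centre\<close> makes the identity indecomposable.\<close>

theorem finitary_two_category_D':
  assumes nontrivial: "\<zero> \<noteq> \<one>" and finite_ideals: "finite {I. ideal I A}"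
    and right: "\<And>I. ideal I A \<Longrightarrow> \<exists>f. right_sum (carrier A) I f \<and> (\<forall>y\<in>I. f y = y)"
    and left: "\<And>I. ideal I A \<Longrightarrow> \<exists>f. left_sum I f \<and> (\<forall>x\<in>I. f x = x)"
    and basis: "\<exists>f. right_sum (range scalar) (carrier A) f \<and> (\<forall>y\<in>carrier A. f y = y)"
    and centre: "\<And>z. z \<in> carrier A \<Longrightarrow> (\<And>a. a \<in> carrier A \<Longrightarrow> a \<otimes> z = z \<otimes> a) \<Longrightarrow> z \<in> range scalar"
  shows "finitary_two_category (D'_two_category A)"
proof -
  define T where "T = tensor_functors A (free_bimodule A)"
  define S where "S = T \<union> (\<Union>I\<in>{I. ideal I A}. Dp A I)"
  obtain b where b: "right_sum (range scalar) (carrier A) b" "\<And>y. y \<in> carrier A \<Longrightarrow> b y = y" using basis by auto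
  have idealA: "ideal (carrier A) A" by (rule oneideal)
  have SO: "S \<subseteq> Obj FCat" by (auto simp: S_def T_def tensor_functors_def)
  have Tf: "tensor_like (range scalar) (carrier A) F (free_element F)"
    "universal TYPE('a small_carrier) (range scalar) (carrier A) F (free_element F)" if "F \<in> T" for F
    by (rule tensor_functor_free[OF that[unfolded T_def]])+
  have If: "tensor_like (carrier A) I F (pure_element (ideal_bimodule A I) F)"
    "universal TYPE('a small_carrier) (carrier A) I F (pure_element (ideal_bimodule A I) F)"
    if "ideal I A" "F \<in> Dp A I" for I F
    by (rule tensor_functor_ideal[OF that])+
  have SI: "F \<in> S" if "ideal I A" "F \<in> Dp A I" for I F using that by (auto simp: S_def)
  \<comment> \<open>With a free functor outside, the right dual basis of the inner ideal is used, or
    a basis of \<open>A\<close> over the field if the inner functor is free too. With an ideal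
    outside a free functor, its left dual basis is used. Two ideals give the functor of their
    product, again a generator.\<close>
  have comp: "Id FCat (G \<star> F) \<in> factoring FCat S (G \<star> F) (G \<star> F)" if F: "F \<in> S" and G: "G \<in> S" for F G
  proof (cases "G \<in> T")
    case True
    have "Id FCat (G \<star> F) \<in> factoring FCat {G} (G \<star> F) (G \<star> F)"
    proof (cases "F \<in> T")
      case FT: True
      show ?thesis by (rule free_composite[OF Tf[OF True] Tf[OF FT] b])
    next
      case False
      then obtain I where I: "ideal I A" "F \<in> Dp A I" using F by (auto simp: S_def)
      obtain f where f: "right_sum (carrier A) I f" "\<And>y. y \<in> I \<Longrightarrow> f y = y" using right[OF I(1)] by auto
      show ?thesis by (rule free_composite[OF Tf[OF True] If[OF I] f])
    qed
    then show ?thesis by (rule FC.factoring_mono) (use G in simp)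
  next
    case False
    then obtain I where I: "ideal I A" "G \<in> Dp A I" using G by (auto simp: S_def)
    show ?thesis
    proof (cases "F \<in> T")
      case FT: True
      obtain f where f: "left_sum I f" "\<And>y. y \<in> I \<Longrightarrow> f y = y" using left[OF I(1)] by auto
      have "Id FCat (G \<star> F) \<in> factoring FCat {F} (G \<star> F) (G \<star> F)"
        by (rule ideal_free_composite[OF If[OF I] Tf[OF FT] f])
      then show ?thesis by (rule FC.factoring_mono) (use F in simp)
    next
      case False
      then obtain J where J: "ideal J A" "F \<in> Dp A J" using F by (auto simp: S_def)
      obtain f where f: "right_sum (carrier A) I f" "\<And>y. y \<in> I \<Longrightarrow> f y = y" using right[OF I(1)] by auto
      have "G \<star> F \<in> S" by (rule SI[OF ideal_prod_is_ideal[OF I(1) J(1)] ideal_composite[OF I(2,1) J(2,1) f]])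
      then show ?thesis using SO by (intro FC.factoring_Id) auto
    qed
  qed
  have split: "idempotent_split (small_mod A)" using mod_category_split by (simp only: small_mod_def)
  have bi: "has_biproducts (small_mod A)" by (rule small_mod_biproducts[OF nontrivial])
  have E: "idempotent_split FCat" "has_biproducts FCat"
    by (rule SS.functor_category_split[OF split], rule SS.functor_category_biproducts[OF bi])
  obtain P where P: "finite P" "P \<subseteq> carrier A" "\<And>a. a \<in> carrier A \<Longrightarrow> b a \<in> V.vspan P"
    using right_sum_span[OF b(1)] by auto
  have PA: "carrier A = V.vspan P"
    using P b(2) V.vspan_closed[OF P(2)] by fastforce
  have sep: "\<exists>n. separated (Hom FCat F H) (Mor FCat F H) n" if F: "F \<in> S" and H: "H \<in> Obj FCat" for F H
  proof -
    have H: "linear_functor (small_mod A) (small_mod A) H" using H by simp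
    show ?thesis
    proof (cases "F \<in> T")
      case True
      obtain f where f: "left_sum (carrier A) f" "\<And>y. y \<in> carrier A \<Longrightarrow> f y = y" using left[OF idealA] by auto
      show ?thesis by (rule separated_natural[OF Tf[OF True] H f P(1,2) PA])
    next
      case False
      then obtain I where I: "ideal I A" "F \<in> Dp A I" using F by (auto simp: S_def)
      obtain f where f: "left_sum I f" "\<And>y. y \<in> I \<Longrightarrow> f y = y" using left[OF I(1)] by auto
      show ?thesis by (rule separated_natural[OF If[OF I] H f P(1,2) PA])
    qed
  qed
  \<comment> \<open>\<open>SOME\<close> yields an arbitrary value if a class of generators is empty;
    intersecting with \<open>S\<close> discards it unless it is a generator.\<close>
  define S' where "S' = ({SOME F. F \<in> T} \<union> (\<lambda>I. SOME F. F \<in> Dp A I) ` {I. ideal I A}) \<inter> S"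
  have rep: "\<exists>F'\<in>S'. isomorphic FCat F F'" if F: "F \<in> S" for F
  proof (cases "F \<in> T")
    case True
    then have s: "(SOME F. F \<in> T) \<in> T" by (rule someI)
    show ?thesis using tensor_like_isomorphic[OF Tf[OF True] Tf[OF s]] s
      by (intro bexI[of _ "SOME F. F \<in> T"]) (auto simp: S'_def S_def)
  next
    case False
    then obtain I where I: "ideal I A" "F \<in> Dp A I" using F by (auto simp: S_def)
    from I(2) have s: "(SOME F. F \<in> Dp A I) \<in> Dp A I" by (rule someI)
    show ?thesis using tensor_like_isomorphic[OF If[OF I] If[OF I(1) s]] SI[OF I(1) s] I(1)
      by (intro bexI[of _ "SOME F. F \<in> Dp A I"]) (auto simp: S'_def)
  qed
  have S': "finite S'" "S' \<subseteq> S" using finite_ideals by (auto simp: S'_def)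
  have D: "D'_functors A = additive_closure FCat S" by (simp only: D'_functors_def S_def T_def)
  note closure = FC.finitary_additive_closure[OF E SO S' rep sep, folded D]
  have DO: "F \<in> D'_functors A \<Longrightarrow> F \<in> Obj FCat" for F unfolding D FC.additive_closure_iff[OF E SO] by simp
  then have Dlin: "F \<in> D'_functors A \<Longrightarrow> linear_functor (small_mod A) (small_mod A) F" for F by simp
  have SD: "S \<subseteq> D'_functors A" unfolding D FC.additive_closure_iff[OF E SO] using SO FC.factoring_Id by blast
  let ?I = "identity_functor (small_mod A)"
  have Id: "?I \<in> D'_functors A" using SD SI[OF idealA identity_tensor_functor] by auto
  interpret two_category "D'_two_category A"
    unfolding D'_two_category_def
    by (rule S.two_category_endofunctors[OF Dlin Id])
      (simp_all only: D S.additive_closure_compose[OF split bi SO comp])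
  interpret F: linear_category "full_subcategory FCat (D'_functors A)" by (rule closure(1))
  have indec: "indecomposable (full_subcategory FCat (D'_functors A)) ?I"
  proof (rule F.indecomposableI)
    show "?I \<in> Obj (full_subcategory FCat (D'_functors A))" using Id by simp
    \<comment> \<open>The identity and the zero transformation differ at the generator of the
      regular module, where their values code \<open>\<one>\<close> and
      \<open>\<zero>\<close>.\<close>
    have "Id FCat ?I small_regular (to_regular \<one>) \<noteq> \<zero>\<^bsub>Hom FCat ?I ?I\<^esub> small_regular (to_regular \<one>)"
      using small_regular(1,5) to_regular_one nontrivial by (simp add: inj_to_regular)
    then show "Id (full_subcategory FCat (D'_functors A)) ?I \<noteq> \<zero>\<^bsub>Hom (full_subcategory FCat (D'_functors A)) ?I ?I\<^esub>"
      by (metis full_subcategory_simps(2,4))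
    show "\<exists>c. f = c \<odot>\<^bsub>Hom (full_subcategory FCat (D'_functors A)) ?I ?I\<^esub> Id (full_subcategory FCat (D'_functors A)) ?I"
      if "f \<in> Mor (full_subcategory FCat (D'_functors A)) ?I ?I" for f
      using natural_endomorphism_identity[OF centre, of f] that unfolding full_subcategory_simps by blast
  qed
  show ?thesis
  proof (intro finitary_two_category.intro finitary_two_category_axioms.intro two_category_axioms)
    show "finite (Ob2 (D'_two_category A))" by (simp add: D'_two_category_def)
    fix i j assume "i \<in> Ob2 (D'_two_category A)" "j \<in> Ob2 (D'_two_category A)"
    then have ij: "i = small_mod A" "j = small_mod A" by (simp_all add: D'_two_category_def)
    then have h: "HomCat (D'_two_category A) i j = full_subcategory FCat (D'_functors A)"
      by (simp add: D'_two_category_def)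
    show "linear_category (HomCat (D'_two_category A) i j)" unfolding h by (rule closure(1))
    show "idempotent_split (HomCat (D'_two_category A) i j)" unfolding h by (rule closure(2))
    show "finite ({F. indecomposable (HomCat (D'_two_category A) i j) F} //
      {(F, G). isomorphic (HomCat (D'_two_category A) i j) F G})" unfolding h by (rule closure(3))
    show "finitely_generated base_field (Hom (HomCat (D'_two_category A) i j) F G)"
      if "F \<in> Mor1 (D'_two_category A) i j" "G \<in> Mor1 (D'_two_category A) i j" for F G
      using that closure(4)[of F G] by (simp only: h)
    show "indecomposable (HomCat (D'_two_category A) i i) (Id1 (D'_two_category A) i)"
      using indec by (simp only: D'_two_category_def two_cat.simps ij)
    fix k F F' G G' assume "k \<in> Ob2 (D'_two_category A)" "F \<in> Mor1 (D'_two_category A) i j"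
      "F' \<in> Mor1 (D'_two_category A) i j" "G \<in> Mor1 (D'_two_category A) j k" "G' \<in> Mor1 (D'_two_category A) j k"
    then have k: "k = small_mod A" and FG: "F \<in> D'_functors A" "F' \<in> D'_functors A" "G \<in> D'_functors A" "G' \<in> D'_functors A"
      by (simp_all add: D'_two_category_def)
    show "bilinear_map (Hom (HomCat (D'_two_category A) j k) G G') (Hom (HomCat (D'_two_category A) i j) F F')
        (Hom (HomCat (D'_two_category A) i k) (HComp1 (D'_two_category A) i j k G F) (HComp1 (D'_two_category A) i j k G' F'))
        (HComp2 (D'_two_category A) i j k F F' G G')"
      using S.horizontal_composite_bilinear[OF FG[THEN Dlin]]
      by (simp only: D'_two_category_def two_cat.simps ij k full_subcategory_simps)
  qed
qed

end

section \<open>Paths in a finite tree quiver\<close>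

locale tree_quiver =
  fixes Q :: "('v, 'e) pre_digraph"
  assumes tree: "finite_tree_quiver Q"

sublocale tree_quiver \<subseteq> fin_digraph Q
  using tree by (simp add: finite_tree_quiver_def)

context tree_quiver
begin

lemma wf_doubled: "wf_digraph (doubled Q)"
  by unfold_locales (auto simp: doubled_def split: if_splits)

interpretation DQ: wf_digraph "doubled Q" by (rule wf_doubled)

lemma doubled_simps [simp]:
  "verts (doubled Q) = verts Q" "e \<in> arcs (doubled Q) \<longleftrightarrow> fst e \<in> arcs Q"
  "tail (doubled Q) (a, True) = tail Q a" "head (doubled Q) (a, True) = head Q a"
  "tail (doubled Q) (a, False) = head Q a" "head (doubled Q) (a, False) = tail Q a"
  by (auto simp: doubled_def mem_Times_iff)

text \<open>\<open>underlying_cycle\<close> also asks for distinct vertices. A closed walk that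
  revisits a vertex contains a strictly shorter closed walk whose edges are among its own, so
  induction on the length excludes all closed trails.\<close>

lemma no_closed_trail:
  "DQ.awalk u p u \<Longrightarrow> p \<noteq> [] \<Longrightarrow> \<not> distinct (map fst p)"
proof (induction "length p" arbitrary: u p rule: less_induct)
  case less
  show ?case
  proof (cases "distinct (tl (DQ.awalk_verts u p))")
    case True
    then have "DQ.cycle p" using less.prems by (auto simp: DQ.cycle_def)
    then show ?thesis using tree by (auto simp: finite_tree_quiver_def underlying_cycle_def)
  next
    case False
    obtain e es where p: "p = e # es" using less.prems(2) by (cases p) auto
    have "DQ.awalk (head (doubled Q) e) es u" "\<not> distinct (DQ.awalk_verts (head (doubled Q) e) es)"
      using False less.prems(1) by (auto simp: p DQ.awalk_Cons_iff)
    from DQ.awalk_not_distinct_decomp[OF this] obtain q r s w where "es = q @ r @ s" "r \<noteq> []" "DQ.awalk w r w" by auto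
    then show ?thesis using less.hyps[of r w] by (auto simp: p)
  qed
qed

lemma awalk_doubled: "awalk u p v \<Longrightarrow> DQ.awalk u (map (\<lambda>e. (e, True)) p) v"
  by (induction p arbitrary: u) (auto simp: awalk_simps DQ.awalk_simps)

lemma awalk_doubled_rev: "awalk u p v \<Longrightarrow> DQ.awalk v (rev (map (\<lambda>e. (e, False)) p)) u"
proof (induction p arbitrary: u)
  case Nil then show ?case by (auto simp: awalk_simps DQ.awalk_simps)
next
  case (Cons e es)
  then have "DQ.awalk v (rev (map (\<lambda>e. (e, False)) es)) (head Q e)" by (auto simp: awalk_simps)
  moreover have "DQ.awalk (head Q e) [(e, False)] u" using Cons.prems by (auto simp: awalk_simps DQ.awalk_simps)
  ultimately show ?case by (auto intro: DQ.awalk_appendI)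
qed

text \<open>A nonempty directed closed walk contains a directed cycle, whose arrows are distinct;
  read in the doubled quiver it would be a closed trail.\<close>

lemma closed_awalk_empty: assumes "awalk u p u" shows "p = []"
proof (rule ccontr)
  assume "p \<noteq> []"
  then have "closed_w p" using assms by (auto simp: closed_w_def)
  then obtain c where "cycle c" using closed_w_imp_cycle by blast
  then obtain w where "awalk w c w" "distinct c" "c \<noteq> []" by (auto simp: cycle_conv)
  then show False using no_closed_trail[OF awalk_doubled, of w c] by (simp add: comp_def)
qed

text \<open>Between two occurrences of the same arrow, the walk returns to the tail of that
  arrow.\<close>

lemma awalk_distinct: assumes "awalk u p v" shows "distinct p"
proof (rule ccontr)
  assume "\<not> distinct p"
  then obtain a x b c where p: "p = a @ [x] @ b @ [x] @ c" using not_distinct_decomp by blast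
  then have "awalk (tail Q x) ([x] @ b) (tail Q x)" using assms by (auto simp: awalk_simps)
  then show False using closed_awalk_empty by blast
qed

text \<open>Go along one path and back along the other. Without a common arrow this is a closed
  trail, since neither path repeats an arrow. If an arrow is shared, the parts before it are shorter
  and have the same ends, so they agree by induction, and this forces the first arrows to
  agree.\<close>

lemma awalk_unique: "awalk u p v \<Longrightarrow> awalk u q v \<Longrightarrow> p = q"
proof (induction "length p + length q" arbitrary: u v p q rule: less_induct)
  case less
  show ?case
  proof (cases "p = [] \<or> q = []")
    case True
    then show ?thesis using less.prems closed_awalk_empty[of v p] closed_awalk_empty[of v q] by (auto simp: awalk_Nil_iff)
  next
    case False
    then obtain e p' f q' where p: "p = e # p'" and q: "q = f # q'" by (auto simp: neq_Nil_conv)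
    show ?thesis
    proof (cases "e = f")
      case True
      then show ?thesis using less.prems less.hyps[of p' q' "head Q e" v] by (auto simp: p q awalk_simps)
    next
      case ef: False
      have "set p \<inter> set q = {}"
      proof (rule ccontr)
        assume "set p \<inter> set q \<noteq> {}"
        then obtain g where "g \<in> set p" "g \<in> set q" by blast
        then obtain p1 p2 q1 q2 where g: "p = p1 @ g # p2" "q = q1 @ g # q2" by (meson split_list)
        then have "awalk u p1 (tail Q g)" "awalk u q1 (tail Q g)" using less.prems by (auto simp: awalk_simps)
        then have "p1 = q1" using less.hyps[of p1 q1] g by simp
        \<comment> \<open>If the common initial part is empty, the shared arrow is itself the first
          arrow of both paths.\<close>
        then show False using g p q ef by (cases p1) auto
      qed
      moreover have "DQ.awalk u (map (\<lambda>e. (e, True)) p @ rev (map (\<lambda>e. (e, False)) q)) u"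
        using less.prems by (intro DQ.awalk_appendI awalk_doubled awalk_doubled_rev)
      ultimately show ?thesis
        using no_closed_trail[of u "map (\<lambda>e. (e, True)) p @ rev (map (\<lambda>e. (e, False)) q)"]
          awalk_distinct[OF less.prems(1)] awalk_distinct[OF less.prems(2)] False
        by (simp add: comp_def rev_map)
    qed
  qed
qed

lemma awalk_qpath: "p \<in> qpaths Q \<longleftrightarrow> awalk (fst p) (snd p) (qpath_end Q p)"
  by (auto simp: qpaths_def qpath_end_def)

lemma qpath_unique: "p \<in> qpaths Q \<Longrightarrow> q \<in> qpaths Q \<Longrightarrow> fst p = fst q \<Longrightarrow> qpath_end Q p = qpath_end Q q \<Longrightarrow> p = q"
  using awalk_unique[of "fst p" "snd p" _ "snd q"] by (auto simp: awalk_qpath prod_eq_iff)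

lemma qpath_verts: "p \<in> qpaths Q \<Longrightarrow> fst p \<in> verts Q \<and> qpath_end Q p \<in> verts Q"
  by (auto simp: awalk_qpath)

text \<open>Uniqueness embeds the paths into the pairs of vertices.\<close>

lemma finite_qpaths: "finite (qpaths Q)"
proof (rule finite_imageD)
  show "finite ((\<lambda>p. (fst p, qpath_end Q p)) ` qpaths Q)"
    by (rule finite_subset[of _ "verts Q \<times> verts Q"]) (use qpath_verts in auto)
  show "inj_on (\<lambda>p. (fst p, qpath_end Q p)) (qpaths Q)"
    by (rule inj_onI) (simp add: qpath_unique)
qed

text \<open>Connectedness is reachability in the symmetrised quiver, each step of which is an arrow
  in one direction or the other. This will compare the coefficients of a central element at
  different vertices.\<close>

lemma arc_constant:
  assumes "\<And>e. e \<in> arcs Q \<Longrightarrow> c (tail Q e) = c (head Q e)" and "u \<in> verts Q" "v \<in> verts Q"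
  shows "c u = c v"
proof -
  have "u \<rightarrow>\<^sup>*\<^bsub>mk_symmetric Q\<^esub> v"
    using tree assms(2,3) by (auto simp: finite_tree_quiver_def connected_def strongly_connected_def)
  then have "(u, v) \<in> (arcs_ends (mk_symmetric Q))\<^sup>*"
    unfolding reachable_def by (rule rtrancl_on_rtranclI)
  then show ?thesis
  proof induction
    case (step y z)
    then show ?case using assms(1) by (auto simp: arcs_ends_def arc_to_ends_def parcs_mk_symmetric)
  qed simp
qed

lemma verts_nonempty: "verts Q \<noteq> {}"
  using tree by (auto simp: finite_tree_quiver_def connected_def strongly_connected_def)

end

section \<open>The path algebra\<close>

lemma additive_on_singles:
  fixes F :: "('p \<Rightarrow>\<^sub>0 'k::ab_group_add) \<Rightarrow> 'q::ab_group_add"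
  assumes "\<And>x y. F (x + y) = F x + F y"
  shows "F y = (\<Sum>q\<in>Poly_Mapping.keys y. F (Poly_Mapping.single q (Poly_Mapping.lookup y q)))"
proof -
  have F0: "F 0 = 0" using assms[of 0 0] by simp
  have "F (\<Sum>q\<in>I. f q) = (\<Sum>q\<in>I. F (f q))" for I and f :: "'p \<Rightarrow> 'p \<Rightarrow>\<^sub>0 'k"
    by (induction I rule: infinite_finite_induct) (simp_all add: F0 assms)
  moreover have "y = (\<Sum>q\<in>Poly_Mapping.keys y. Poly_Mapping.single q (Poly_Mapping.lookup y q))"
    by (rule poly_mapping_eqI) (simp add: lookup_sum lookup_single when_def in_keys_iff)
  ultimately show ?thesis by metis
qed

text \<open>Reduces identities in the path algebra to single paths, one argument at a time. Only
  paths in the support of \<open>y\<close> are tested, so that facts about the support can be used;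
  the coefficient is kept, since additivity says nothing about scaling.\<close>

lemma additive_ext:
  fixes F G :: "('p \<Rightarrow>\<^sub>0 'k::ab_group_add) \<Rightarrow> 'q::ab_group_add"
  assumes "\<And>x y. F (x + y) = F x + F y" "\<And>x y. G (x + y) = G x + G y"
    and "\<And>q c. q \<in> Poly_Mapping.keys y \<Longrightarrow> F (Poly_Mapping.single q c) = G (Poly_Mapping.single q c)"
  shows "F y = G y"
  by (subst additive_on_singles[of F, OF assms(1)], subst additive_on_singles[of G, OF assms(2)])
    (rule sum.cong, simp_all add: assms(3))

text \<open>The linear extension of a map on paths. Multiplication and all coefficient maps of dual
  bases are brought into this form, so that their additivity comes from one lemma.\<close>

definition lin_ext :: "('p \<Rightarrow> 'q \<Rightarrow>\<^sub>0 'k::field) \<Rightarrow> ('p \<Rightarrow>\<^sub>0 'k) \<Rightarrow> ('q \<Rightarrow>\<^sub>0 'k)" where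
  "lin_ext H y = (\<Sum>p\<in>Poly_Mapping.keys y. Poly_Mapping.map ((*) (Poly_Mapping.lookup y p)) (H p))"

lemma lookup_map_mult [simp]: "Poly_Mapping.lookup (Poly_Mapping.map ((*) c) f) p = c * Poly_Mapping.lookup f p" for c :: "'k::field"
  by (simp add: Poly_Mapping.map.rep_eq when_def)

lemma map_zero [simp]: "Poly_Mapping.map (\<lambda>a. 0) f = 0" "Poly_Mapping.map ((*) (0::'k::field)) g = 0"
  by (auto intro!: poly_mapping_eqI simp: Poly_Mapping.map.rep_eq when_def)

lemma map_mult_simps [simp]:
  "Poly_Mapping.map ((*) (c :: 'k::field)) 0 = 0"
  "Poly_Mapping.map ((*) c) (f + g) = Poly_Mapping.map ((*) c) f + Poly_Mapping.map ((*) c) g"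
  "Poly_Mapping.map ((*) (c + d)) f = Poly_Mapping.map ((*) c) f + Poly_Mapping.map ((*) d) f"
  "Poly_Mapping.map ((*) c) (Poly_Mapping.map ((*) d) f) = Poly_Mapping.map ((*) (c * d)) f"
  "Poly_Mapping.map ((*) 1) f = f"
  by (auto intro!: poly_mapping_eqI simp: lookup_add algebra_simps)

lemma lin_ext_single [simp]: "lin_ext H (Poly_Mapping.single p c) = Poly_Mapping.map ((*) c) (H p)"
  by (cases "c = 0") (auto simp: lin_ext_def)

lemma lin_ext_add [simp]: "lin_ext H (x + y) = lin_ext H x + lin_ext H y"
  unfolding lin_ext_def by (rule Poly_Mapping.setsum_keys_plus_distrib) simp_all

lemma lin_ext_zero [simp]: "lin_ext H 0 = 0"
  by (simp add: lin_ext_def)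

lemma keys_lin_ext: "(\<And>p. p \<in> Poly_Mapping.keys y \<Longrightarrow> Poly_Mapping.keys (H p) \<subseteq> S) \<Longrightarrow> Poly_Mapping.keys (lin_ext H y) \<subseteq> S"
  unfolding lin_ext_def
  by (rule order_trans[OF keys_sum]) (fastforce simp: in_keys_iff)

lemma qpath_end_simps [simp]:
  "qpath_end Q (u, []) = u" "qpath_end Q (u, e # es) = qpath_end Q (head Q e, es)"
  by (simp_all add: qpath_end_def pre_digraph.awalk_verts.simps pre_digraph.awalk_verts_non_Nil)

lemma qpath_end_append [simp]: "qpath_end Q (u, es @ fs) = qpath_end Q (qpath_end Q (u, es), fs)"
  by (induction es arbitrary: u) simp_all

locale path_alg = tree_quiver Q for Q :: "('v, 'e) pre_digraph" +
  fixes A :: "('k::field, ('v, 'e) qpath \<Rightarrow>\<^sub>0 'k) module" (structure)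
  assumes A: "A = path_algebra Q"
begin

abbreviation "e \<equiv> (\<lambda>p. Poly_Mapping.single p (1::'k))"

lemma path_algebra_simps [simp]:
  "x \<in> carrier A \<longleftrightarrow> Poly_Mapping.keys x \<subseteq> qpaths Q" "x \<oplus> y = x + y" "\<zero> = 0"
  "c \<odot> x = Poly_Mapping.map ((*) c) x" "\<one> = (\<Sum>v\<in>verts Q. e (v, []))"
  by (simp_all add: A path_algebra_def)

text \<open>The double sum that defines the product becomes two nested linear extensions. Additivity
  in the left factor is then immediate, and in the right factor it follows after reduction to single
  paths on the left.\<close>

lemma mult_lin_ext:
  "x \<otimes> y = lin_ext (\<lambda>p. lin_ext (\<lambda>q. if fst p = qpath_end Q q then e (fst q, snd q @ snd p) else 0) y) x"
proof -
  have "Poly_Mapping.map ((*) c) (lin_ext H y) = (\<Sum>q\<in>Poly_Mapping.keys y. Poly_Mapping.map ((*) (c * Poly_Mapping.lookup y q)) (H q))"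
    for c and H :: "('v, 'e) qpath \<Rightarrow> ('v, 'e) qpath \<Rightarrow>\<^sub>0 'k"
    by (rule poly_mapping_eqI) (simp add: lin_ext_def lookup_sum sum_distrib_left mult.assoc)
  then show ?thesis
    unfolding lin_ext_def[of _ x] by (auto simp: A path_algebra_def intro!: sum.cong)
qed

lemma mult_add [simp]: "(x + y) \<otimes> z = x \<otimes> z + y \<otimes> z" "x \<otimes> (y + z) = x \<otimes> y + x \<otimes> z"
proof -
  show "(x + y) \<otimes> z = x \<otimes> z + y \<otimes> z" by (simp add: mult_lin_ext)
  show "x \<otimes> (y + z) = x \<otimes> y + x \<otimes> z"
    by (rule additive_ext[of "\<lambda>x. x \<otimes> (y + z)" "\<lambda>x. x \<otimes> y + x \<otimes> z"]) (simp_all add: mult_lin_ext)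
qed

lemma mult_single [simp]:
  "Poly_Mapping.single p a \<otimes> Poly_Mapping.single q b =
    (if fst p = qpath_end Q q then Poly_Mapping.single (fst q, snd q @ snd p) (a * b) else 0)"
  by (simp add: mult_lin_ext)

lemma mult_zero [simp]: "0 \<otimes> x = 0" "x \<otimes> 0 = 0"
  using mult_add(1)[of 0 0 x] mult_add(2)[of x 0 0] by simp_all

lemma mult_sum: "(\<Sum>i\<in>I. f i) \<otimes> x = (\<Sum>i\<in>I. f i \<otimes> x)" "x \<otimes> (\<Sum>i\<in>I. f i) = (\<Sum>i\<in>I. x \<otimes> f i)"
  by (induction I rule: infinite_finite_induct) simp_all

text \<open>Reduction to single paths in all three arguments leaves associativity of concatenation
  and of multiplication in the field.\<close>

lemma mult_assoc: "(x \<otimes> y) \<otimes> z = x \<otimes> (y \<otimes> z)"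
proof (rule additive_ext[of "\<lambda>x. (x \<otimes> y) \<otimes> z" "\<lambda>x. x \<otimes> (y \<otimes> z)"])
  fix p a
  show "(Poly_Mapping.single p a \<otimes> y) \<otimes> z = Poly_Mapping.single p a \<otimes> (y \<otimes> z)"
  proof (rule additive_ext[of "\<lambda>y. (Poly_Mapping.single p a \<otimes> y) \<otimes> z" "\<lambda>y. Poly_Mapping.single p a \<otimes> (y \<otimes> z)"])
    fix q :: "('v, 'e) qpath" and b
    obtain u es where q: "q = (u, es)" by force
    show "(Poly_Mapping.single p a \<otimes> Poly_Mapping.single q b) \<otimes> z = Poly_Mapping.single p a \<otimes> (Poly_Mapping.single q b \<otimes> z)"
      by (rule additive_ext[of "\<lambda>z. (Poly_Mapping.single p a \<otimes> Poly_Mapping.single q b) \<otimes> z"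
            "\<lambda>z. Poly_Mapping.single p a \<otimes> (Poly_Mapping.single q b \<otimes> z)"]) (auto simp: mult.assoc q)
  qed simp_all
qed simp_all

lemma smult_mult: "(c \<odot> x) \<otimes> y = c \<odot> (x \<otimes> y)" "x \<otimes> (c \<odot> y) = c \<odot> (x \<otimes> y)"
proof -
  have *: "(c \<odot> Poly_Mapping.single p a) \<otimes> y = c \<odot> (Poly_Mapping.single p a \<otimes> y)" for p a y
    by (rule additive_ext[of "\<lambda>y. (c \<odot> Poly_Mapping.single p a) \<otimes> y" "\<lambda>y. c \<odot> (Poly_Mapping.single p a \<otimes> y)"])
      (simp_all add: mult.assoc)
  have **: "Poly_Mapping.single p a \<otimes> (c \<odot> y) = c \<odot> (Poly_Mapping.single p a \<otimes> y)" for p a y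
    by (rule additive_ext[of "\<lambda>y. Poly_Mapping.single p a \<otimes> (c \<odot> y)" "\<lambda>y. c \<odot> (Poly_Mapping.single p a \<otimes> y)"])
      (simp_all add: mult.left_commute)
  show "(c \<odot> x) \<otimes> y = c \<odot> (x \<otimes> y)"
    by (rule additive_ext[of "\<lambda>x. (c \<odot> x) \<otimes> y" "\<lambda>x. c \<odot> (x \<otimes> y)"]) (use * in \<open>simp_all\<close>)
  show "x \<otimes> (c \<odot> y) = c \<odot> (x \<otimes> y)"
    by (rule additive_ext[of "\<lambda>x. x \<otimes> (c \<odot> y)" "\<lambda>x. c \<odot> (x \<otimes> y)"]) (use ** in \<open>simp_all\<close>)
qed

lemma qpath_append: "p \<in> qpaths Q \<Longrightarrow> q \<in> qpaths Q \<Longrightarrow> fst p = qpath_end Q q \<Longrightarrow> (fst q, snd q @ snd p) \<in> qpaths Q"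
  using awalk_appendI[of "fst q" "snd q" "fst p" "snd p" "qpath_end Q p"]
  unfolding awalk_qpath[of p] awalk_qpath[of q] by (auto simp: qpaths_def)

lemma mult_closed: assumes "Poly_Mapping.keys x \<subseteq> qpaths Q" "Poly_Mapping.keys y \<subseteq> qpaths Q"
  shows "Poly_Mapping.keys (x \<otimes> y) \<subseteq> qpaths Q"
  unfolding mult_lin_ext using assms by (intro keys_lin_ext) (auto intro: qpath_append)

lemma vertex_qpath [simp]: "(v, []) \<in> qpaths Q \<longleftrightarrow> v \<in> verts Q"
  by (auto simp: awalk_qpath awalk_Nil_iff)

lemma mult_one:
  assumes "Poly_Mapping.keys x \<subseteq> qpaths Q" shows "\<one> \<otimes> x = x" "x \<otimes> \<one> = x"
proof -
  have *: "(\<Sum>v\<in>verts Q. e (v, []) \<otimes> Poly_Mapping.single q c) = Poly_Mapping.single q c"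
    "(\<Sum>v\<in>verts Q. Poly_Mapping.single q c \<otimes> e (v, [])) = Poly_Mapping.single q c" if "q \<in> Poly_Mapping.keys x" for q c
  proof -
    have q: "fst q \<in> verts Q" "qpath_end Q q \<in> verts Q" using that assms qpath_verts[of q] by (blast+)
    show "(\<Sum>v\<in>verts Q. e (v, []) \<otimes> Poly_Mapping.single q c) = Poly_Mapping.single q c"
      "(\<Sum>v\<in>verts Q. Poly_Mapping.single q c \<otimes> e (v, [])) = Poly_Mapping.single q c"
      using q by (simp_all add: sum.delta sum.delta')
  qed
  show "\<one> \<otimes> x = x"
    by (rule additive_ext[of "\<lambda>x. \<one> \<otimes> x" "\<lambda>x. x"]) (use *(1) in \<open>simp_all only: mult_add mult_sum path_algebra_simps sum.distrib\<close>)
  show "x \<otimes> \<one> = x"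
    by (rule additive_ext[of "\<lambda>x. x \<otimes> \<one>" "\<lambda>x. x"]) (use *(2) in \<open>simp_all only: mult_add mult_sum path_algebra_simps sum.distrib\<close>)
qed

lemma keys_smult: "Poly_Mapping.keys x \<subseteq> S \<Longrightarrow> Poly_Mapping.keys (Poly_Mapping.map ((*) (c::'k)) x) \<subseteq> S"
  by (auto simp: in_keys_iff)

lemma abelian_group_A: "abelian_group A"
proof (rule abelian_groupI)
  fix x assume "x \<in> carrier A"
  then show "\<exists>y\<in>carrier A. y \<oplus> x = \<zero>" by (intro bexI[of _ "- x"]) auto
qed (auto simp: add_ac dest!: subsetD[OF keys_add])

lemma kalgebra_A: "kalgebra A"
proof -
  interpret abelian_group A by (rule abelian_group_A)
  have ring: "ring A"
  proof (rule ringI[OF abelian_group_A monoidI])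
    show "\<one> \<in> carrier A" by (auto dest!: subsetD[OF keys_sum])
  qed (use mult_closed in \<open>simp_all add: mult_assoc mult_one[unfolded path_algebra_simps]\<close>)
  have "Module.module base_field A"
    by (rule Module.moduleI[OF cring_base_field abelian_group_A])
      (auto simp: keys_smult in_keys_iff)
  then show ?thesis
    by (intro kalgebra.intro ring kalgebra_axioms.intro vspaceI smult_mult)
qed

end

sublocale path_alg \<subseteq> kalgebra A by (rule kalgebra_A)

text \<open>
  For the set \<open>B\<close> of paths in an ideal, a path in \<open>B\<close> starting at \<open>u\<close> is the product of its shortest
  final segment in \<open>B\<close> and the complementary initial segment. Extending the path at its start does
  not change the former, which makes the coefficients of the dual basis right linear.
\<close>

fun suffix_core :: "('v, 'e) pre_digraph \<Rightarrow> ('v, 'e) qpath set \<Rightarrow> 'v \<Rightarrow> 'e list \<Rightarrow> ('v, 'e) qpath" where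
  "suffix_core Q B u [] = (u, [])"
| "suffix_core Q B u (a # es) = (if (head Q a, es) \<in> B then suffix_core Q B (head Q a) es else (u, a # es))"

fun suffix_rest :: "('v, 'e) pre_digraph \<Rightarrow> ('v, 'e) qpath set \<Rightarrow> 'v \<Rightarrow> 'e list \<Rightarrow> 'e list" where
  "suffix_rest Q B u [] = []"
| "suffix_rest Q B u (a # es) = (if (head Q a, es) \<in> B then a # suffix_rest Q B (head Q a) es else [])"

lemma suffix_core_mem: "(u, es) \<in> B \<Longrightarrow> suffix_core Q B u es \<in> B"
  by (induction es arbitrary: u) simp_all

lemma suffix_core_append: "suffix_rest Q B u es @ snd (suffix_core Q B u es) = es"
  by (induction es arbitrary: u) simp_all

lemma fst_suffix_core: "qpath_end Q (u, suffix_rest Q B u es) = fst (suffix_core Q B u es)"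
  by (induction es arbitrary: u) simp_all

section \<open>Ideals of the path algebra, their dual bases, and the centre\<close>

context path_alg
begin

text \<open>Multiplication by the idempotents at the end and the start of \<open>p\<close> keeps
  exactly the paths parallel to \<open>p\<close>, which in a tree quiver is \<open>p\<close>
  alone.\<close>

lemma idempotent_isolates:
  assumes x: "x \<in> carrier A" and p: "p \<in> qpaths Q"
  shows "e (qpath_end Q p, []) \<otimes> (x \<otimes> e (fst p, [])) = Poly_Mapping.single p (Poly_Mapping.lookup x p)"
proof -
  have *: "e (qpath_end Q p, []) \<otimes> (Poly_Mapping.single q c \<otimes> e (fst p, [])) = (if q = p then Poly_Mapping.single p c else 0)"
    if "q \<in> Poly_Mapping.keys x" for q c
  proof (cases "fst q = fst p \<and> qpath_end Q q = qpath_end Q p")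
    case True
    then have "q = p" using x p that qpath_unique[of q p] by auto
    then show ?thesis by simp
  next
    case False
    then have "q \<noteq> p" by auto
    moreover obtain u es where "q = (u, es)" by force
    ultimately show ?thesis using False by (cases "u = fst p") simp_all
  qed
  show ?thesis
    by (subst additive_on_singles[of "\<lambda>x. e (qpath_end Q p, []) \<otimes> (x \<otimes> e (fst p, []))"])
      (use * in \<open>simp_all add: sum.delta in_keys_iff\<close>)
qed

lemma single_smult: "Poly_Mapping.single p c = c \<odot> e p"
  by simp

lemma ideal_smult: "ideal I A \<Longrightarrow> x \<in> I \<Longrightarrow> c \<odot> x \<in> I"
  using ideal.I_l_closed[of I A x "scalar c"] ideal.Icarr[of I A x] scalar_closed[of c] scalar_mult(1)[of x c] by metis

text \<open>The isolated term lies in the ideal, and its coefficient is invertible.\<close>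

lemma ideal_path:
  assumes I: "ideal I A" and x: "x \<in> I" and p: "p \<in> Poly_Mapping.keys x"
  shows "e p \<in> I"
proof -
  have xA: "x \<in> carrier A" by (rule ideal.Icarr[OF I x])
  then have pQ: "p \<in> qpaths Q" using p by auto
  have v: "e (qpath_end Q p, []) \<in> carrier A" "e (fst p, []) \<in> carrier A" using qpath_verts[OF pQ] by simp_all
  have "Poly_Mapping.single p (Poly_Mapping.lookup x p) \<in> I"
    using ideal.I_l_closed[OF I ideal.I_r_closed[OF I x v(2)] v(1)] unfolding idempotent_isolates[OF xA pQ] .
  then have "inverse (Poly_Mapping.lookup x p) \<odot> Poly_Mapping.single p (Poly_Mapping.lookup x p) \<in> I"
    by (rule ideal_smult[OF I])
  moreover have "Poly_Mapping.lookup x p \<noteq> 0" using p by (simp add: in_keys_iff)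
  ultimately show ?thesis by simp
qed

definition path_set :: "(('v, 'e) qpath \<Rightarrow>\<^sub>0 'k) set \<Rightarrow> ('v, 'e) qpath set" where
  "path_set I = {p. e p \<in> I}"

lemma ideal_path_set:
  assumes I: "ideal I A" shows "x \<in> I \<longleftrightarrow> Poly_Mapping.keys x \<subseteq> path_set I"
proof
  assume "x \<in> I"
  then show "Poly_Mapping.keys x \<subseteq> path_set I" using ideal_path[OF I] by (auto simp: path_set_def)
next
  assume x: "Poly_Mapping.keys x \<subseteq> path_set I"
  have sum: "(\<Sum>p\<in>C. f p) \<in> I" if "finite C" "\<And>p. p \<in> C \<Longrightarrow> f p \<in> I" for C :: "('v, 'e) qpath set" and f
    using that
  proof (induction C rule: finite_induct)
    case empty then show ?case using additive_subgroup.zero_closed[OF ideal.axioms(1)[OF I]] by simp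
  next
    case (insert p C)
    then show ?case using additive_subgroup.a_closed[OF ideal.axioms(1)[OF I], of "f p" "sum f C"] by simp
  qed
  have "x = (\<Sum>p\<in>Poly_Mapping.keys x. Poly_Mapping.single p (Poly_Mapping.lookup x p))"
    using additive_on_singles[of "\<lambda>x. x" x] by simp
  moreover have "(\<Sum>p\<in>Poly_Mapping.keys x. Poly_Mapping.single p (Poly_Mapping.lookup x p)) \<in> I"
    unfolding single_smult[of _ "Poly_Mapping.lookup x _"]
    by (rule sum) (use x in \<open>auto intro!: ideal_smult[OF I] simp: path_set_def simp del: path_algebra_simps\<close>)
  ultimately show "x \<in> I" by simp
qed

lemma path_set_qpaths: "ideal I A \<Longrightarrow> path_set I \<subseteq> qpaths Q"
  using ideal.Icarr[of I A "e _"] by (fastforce simp: path_set_def)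

lemma finite_ideals: "finite {I. ideal I A}"
proof (rule finite_imageD)
  show "finite (path_set ` {I. ideal I A})"
    by (rule finite_subset[of _ "Pow (qpaths Q)"]) (use path_set_qpaths finite_qpaths in auto)
  show "inj_on path_set {I. ideal I A}" by (rule inj_onI) (use ideal_path_set in auto)
qed

lemma path_set_right: "ideal I A \<Longrightarrow> q \<in> path_set I \<Longrightarrow> r \<in> qpaths Q \<Longrightarrow> fst q = qpath_end Q r \<Longrightarrow> (fst r, snd r @ snd q) \<in> path_set I"
  using ideal.I_r_closed[of I A "e q" "e r"] by (simp add: path_set_def)

text \<open>\<open>right_sum\<close> grows by one term at a time; this turns a sum indexed by a
  finite set of paths into such a chain.\<close>

lemma right_sum_finite:
  assumes C: "finite C" and g: "\<And>i. i \<in> C \<Longrightarrow> g i \<in> J" and \<phi>: "\<And>i y. i \<in> C \<Longrightarrow> y \<in> J \<Longrightarrow> \<phi> i y \<in> Z"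
    "\<And>i y y'. i \<in> C \<Longrightarrow> y \<in> J \<Longrightarrow> y' \<in> J \<Longrightarrow> \<phi> i (y + y') = \<phi> i y + \<phi> i y'"
    "\<And>i y z. i \<in> C \<Longrightarrow> y \<in> J \<Longrightarrow> z \<in> Z \<Longrightarrow> \<phi> i (y \<otimes> z) = \<phi> i y \<otimes> z"
  shows "right_sum Z J (\<lambda>y. \<Sum>i\<in>C. g i \<otimes> \<phi> i y)"
  using C subset_refl
proof (induction C rule: finite_subset_induct')
  case empty then show ?case using right_sum.zero[of Z J] by simp
next
  case (insert i D)
  have "right_sum Z J (\<lambda>y. (\<Sum>i\<in>D. g i \<otimes> \<phi> i y) \<oplus> g i \<otimes> \<phi> i y)"
    by (rule right_sum.add[OF insert.IH g[OF insert.hyps(2)]])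
      (simp_all add: \<phi>[OF insert.hyps(2)] del: path_algebra_simps(1))
  then show ?case using insert.hyps by (simp add: add.commute)
qed

lemma left_sum_finite:
  assumes C: "finite C" and g: "\<And>i. i \<in> C \<Longrightarrow> g i \<in> I" and \<psi>: "\<And>i x. i \<in> C \<Longrightarrow> x \<in> I \<Longrightarrow> \<psi> i x \<in> carrier A"
    "\<And>i x x'. i \<in> C \<Longrightarrow> x \<in> I \<Longrightarrow> x' \<in> I \<Longrightarrow> \<psi> i (x + x') = \<psi> i x + \<psi> i x'"
    "\<And>i x a. i \<in> C \<Longrightarrow> x \<in> I \<Longrightarrow> a \<in> carrier A \<Longrightarrow> \<psi> i (a \<otimes> x) = a \<otimes> \<psi> i x"
  shows "left_sum I (\<lambda>x. \<Sum>i\<in>C. \<psi> i x \<otimes> g i)"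
  using C subset_refl
proof (induction C rule: finite_subset_induct')
  case empty then show ?case using left_sum.zero[of I] by simp
next
  case (insert i D)
  have "left_sum I (\<lambda>x. (\<Sum>i\<in>D. \<psi> i x \<otimes> g i) \<oplus> \<psi> i x \<otimes> g i)"
    by (rule left_sum.add[OF insert.IH g[OF insert.hyps(2)]])
      (simp_all add: \<psi>[OF insert.hyps(2)] del: path_algebra_simps(1))
  then show ?case using insert.hyps by (simp add: add.commute)
qed

text \<open>The paths are a basis, and the coefficient functions, read as multiples of the unit,
  form the dual basis.\<close>

lemma basis_sum: "\<exists>f. right_sum (range scalar) (carrier A) f \<and> (\<forall>y\<in>carrier A. f y = y)"
proof (intro exI conjI ballI)
  show "right_sum (range scalar) (carrier A) (\<lambda>y. \<Sum>p\<in>qpaths Q. e p \<otimes> scalar (Poly_Mapping.lookup y p))"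
  proof (rule right_sum_finite[OF finite_qpaths])
    fix p y z assume p: "p \<in> qpaths Q" and y: "y \<in> carrier A" and "z \<in> range scalar"
    then obtain c where z: "z = scalar c" by blast
    have "scalar (c * d) = scalar d \<otimes> scalar c" for d
      unfolding scalar_mult(2)[OF scalar_closed] by simp
    then show "scalar (Poly_Mapping.lookup (y \<otimes> z) p) = scalar (Poly_Mapping.lookup y p) \<otimes> z"
      unfolding z scalar_mult(2)[OF y] by simp
  qed (simp_all add: lookup_add)
  fix y assume y: "y \<in> carrier A"
  have "(\<Sum>p\<in>qpaths Q. e p \<otimes> scalar (Poly_Mapping.lookup y p)) = (\<Sum>p\<in>qpaths Q. Poly_Mapping.single p (Poly_Mapping.lookup y p))"
    by (rule sum.cong) (simp_all add: scalar_mult(2)[unfolded path_algebra_simps])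
  also have "\<dots> = y"
    by (rule poly_mapping_eqI) (use y finite_qpaths in \<open>auto simp: lookup_sum lookup_single when_def in_keys_iff\<close>)
  finally show "(\<Sum>p\<in>qpaths Q. e p \<otimes> scalar (Poly_Mapping.lookup y p)) = y" .
qed

text \<open>The coefficient map at \<open>p\<close> sends a path with core \<open>p\<close> to its
  complementary segment \<open>rest\<close>, and other paths to zero. The segment
  \<open>rest\<close> is traversed before the core, so it is the right factor of the product. A path
  that is not a core contributes zero, so the sum may run over all of \<open>B\<close>.\<close>

lemma ideal_right_sum:
  assumes I: "ideal I A" shows "\<exists>f. right_sum (carrier A) I f \<and> (\<forall>y\<in>I. f y = y)"
proof -
  define B where "B = path_set I"
  have B: "B \<subseteq> qpaths Q" "\<And>x. x \<in> I \<longleftrightarrow> Poly_Mapping.keys x \<subseteq> B"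
    unfolding B_def by (rule path_set_qpaths[OF I], rule ideal_path_set[OF I])
  define core where "core q = suffix_core Q B (fst q) (snd q)" for q
  define rest where "rest q = suffix_rest Q B (fst q) (snd q)" for q
  have core: "core q \<in> B" "qpath_end Q (fst q, rest q) = fst (core q)" "rest q @ snd (core q) = snd q" if "q \<in> B" for q
    using that suffix_core_mem[of "fst q" "snd q" B] by (simp_all add: core_def rest_def fst_suffix_core suffix_core_append)
  have rest: "(fst q, rest q) \<in> qpaths Q" if "q \<in> B" for q
  proof -
    have "awalk (fst q) (rest q @ snd (core q)) (qpath_end Q q)" using core(3)[OF that] subsetD[OF B(1) that] awalk_qpath[of q] by simp
    then show ?thesis unfolding awalk_append_iff by (auto simp: qpaths_def)
  qed
  \<comment> \<open>Prefixing \<open>r\<close> leaves the shortest final segment unchanged: final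
    segments that reach into \<open>r\<close> stay in \<open>B\<close> by the right ideal property,
    so the recursion strips \<open>r\<close> and continues with \<open>q\<close>. Only
    \<open>rest\<close> grows, and this is right linearity of the coefficient maps.\<close>
  have comp: "core (fst r, snd r @ snd q) = core q \<and> rest (fst r, snd r @ snd q) = snd r @ rest q"
    if q: "q \<in> B" and r: "r \<in> qpaths Q" "fst q = qpath_end Q r" for q r
  proof -
    have "suffix_core Q B u (es @ snd q) = core q \<and> suffix_rest Q B u (es @ snd q) = es @ rest q"
      if "(u, es) \<in> qpaths Q" "fst q = qpath_end Q (u, es)" for u es
      using that
    proof (induction es arbitrary: u)
      case Nil then show ?case by (simp add: core_def rest_def)
    next
      case (Cons a es)
      have a: "(head Q a, es) \<in> qpaths Q" using Cons.prems(1) by (auto simp: qpaths_def awalk_simps)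
      moreover have "(head Q a, es @ snd q) \<in> B"
        using path_set_right[OF I, of q "(head Q a, es)"] q Cons.prems(2) a by (simp add: B_def)
      ultimately show ?case using Cons by simp
    qed
    from this[of "fst r" "snd r"] r show ?thesis by (simp add: core_def rest_def)
  qed
  define \<phi> where "\<phi> p = lin_ext (\<lambda>q. if core q = p then e (fst q, rest q) else 0)" for p
  have add: "\<phi> p (y + y') = \<phi> p y + \<phi> p y'" for p y y' by (simp add: \<phi>_def)
  have single: "\<phi> p (Poly_Mapping.single q c) = (if core q = p then Poly_Mapping.single (fst q, rest q) c else 0)" for p q c
    by (simp add: \<phi>_def)
  show ?thesis
  proof (intro exI conjI ballI)
    show "right_sum (carrier A) I (\<lambda>y. \<Sum>p\<in>B. e p \<otimes> \<phi> p y)"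
    proof (rule right_sum_finite[OF finite_subset[OF B(1) finite_qpaths]])
      show "\<phi> p y \<in> carrier A" if "y \<in> I" for p y
        unfolding \<phi>_def path_algebra_simps by (rule keys_lin_ext) (use that B rest in auto)
      show "\<phi> p (y \<otimes> a) = \<phi> p y \<otimes> a" if y: "y \<in> I" and a: "a \<in> carrier A" for p y a
      proof (rule additive_ext[of "\<lambda>y. \<phi> p (y \<otimes> a)" "\<lambda>y. \<phi> p y \<otimes> a"])
        fix q c assume "q \<in> Poly_Mapping.keys y"
        then have q: "q \<in> B" using y B(2) by auto
        show "\<phi> p (Poly_Mapping.single q c \<otimes> a) = \<phi> p (Poly_Mapping.single q c) \<otimes> a"
        proof (rule additive_ext[of "\<lambda>a. \<phi> p (Poly_Mapping.single q c \<otimes> a)" "\<lambda>a. \<phi> p (Poly_Mapping.single q c) \<otimes> a"])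
          fix r d assume "r \<in> Poly_Mapping.keys a"
          then have r: "r \<in> qpaths Q" using a by auto
          show "\<phi> p (Poly_Mapping.single q c \<otimes> Poly_Mapping.single r d) = \<phi> p (Poly_Mapping.single q c) \<otimes> Poly_Mapping.single r d"
          proof (cases "fst q = qpath_end Q r")
            case True then show ?thesis using comp[OF q r True] by (simp add: single)
          next
            case False then show ?thesis using \<phi>_def by (simp add: single)
          qed
        qed (simp_all add: add)
      qed (simp_all add: add)
    qed (use B(2) add in simp_all)
    fix y assume y: "y \<in> I"
    show "(\<Sum>p\<in>B. e p \<otimes> \<phi> p y) = y"
    proof (rule additive_ext[of "\<lambda>y. \<Sum>p\<in>B. e p \<otimes> \<phi> p y" "\<lambda>y. y"])
      fix q c assume "q \<in> Poly_Mapping.keys y"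
      then have q: "q \<in> B" using y B(2) by auto
      have "(\<Sum>p\<in>B. e p \<otimes> \<phi> p (Poly_Mapping.single q c)) = (\<Sum>p\<in>B. if core q = p then Poly_Mapping.single q c else 0)"
        by (rule sum.cong) (use core[OF q] in \<open>auto simp: single\<close>)
      then show "(\<Sum>p\<in>B. e p \<otimes> \<phi> p (Poly_Mapping.single q c)) = Poly_Mapping.single q c"
        using core(1)[OF q] finite_subset[OF B(1) finite_qpaths] by simp
    qed (simp_all add: add sum.distrib)
  qed
qed

text \<open>The two ends exchange roles: the core is the shortest initial segment in
  \<open>B\<close>, obtained by \<open>take\<close>, and the segment after it is the left factor of
  the product.\<close>

lemma ideal_left_sum:
  assumes I: "ideal I A" shows "\<exists>f. left_sum I f \<and> (\<forall>x\<in>I. f x = x)"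
proof -
  define B where "B = path_set I"
  have B: "B \<subseteq> qpaths Q" "\<And>x. x \<in> I \<longleftrightarrow> Poly_Mapping.keys x \<subseteq> B"
    unfolding B_def by (rule path_set_qpaths[OF I], rule ideal_path_set[OF I])
  \<comment> \<open>For \<open>q\<close> in \<open>B\<close> the least value exists, since the full
    length qualifies.\<close>
  define len where "len q = (LEAST k. (fst q, take k (snd q)) \<in> B)" for q
  define core where "core q = (fst q, take (len q) (snd q))" for q
  define rest where "rest q = (qpath_end Q (core q), drop (len q) (snd q))" for q
  have len: "core q \<in> B" "len q \<le> length (snd q)" if "q \<in> B" for q
  proof -
    have *: "(fst q, take (length (snd q)) (snd q)) \<in> B" using that by simp
    show "core q \<in> B" unfolding core_def len_def by (rule LeastI[of "\<lambda>k. (fst q, take k (snd q)) \<in> B", OF *])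
    show "len q \<le> length (snd q)" unfolding len_def by (rule Least_le[of "\<lambda>k. (fst q, take k (snd q)) \<in> B", OF *])
  qed
  have app: "qpath_end Q (rest q) = qpath_end Q q" for q
    using qpath_end_append[of Q "fst q" "take (len q) (snd q)" "drop (len q) (snd q)"] by (simp add: rest_def core_def)
  have rest: "rest q \<in> qpaths Q" if "q \<in> B" for q
  proof -
    have "awalk (fst q) (take (len q) (snd q) @ drop (len q) (snd q)) (qpath_end Q q)" using subsetD[OF B(1) that] awalk_qpath[of q] by simp
    then show ?thesis unfolding awalk_append_iff by (auto simp: qpaths_def rest_def core_def qpath_end_def)
  qed
  have comp: "core (fst q, snd q @ snd r) = core q \<and> rest (fst q, snd q @ snd r) = (fst (rest q), snd (rest q) @ snd r)"
    if q: "q \<in> B" and r: "r \<in> qpaths Q" "fst r = qpath_end Q q" for q r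
  proof -
    \<comment> \<open>Up to the length of \<open>q\<close> the initial segments of both paths
      coincide, and the least length is attained there; any larger \<open>k\<close> exceeds
      \<open>len q\<close> anyway.\<close>
    have "len (fst q, snd q @ snd r) = len q"
      unfolding len_def[of "(fst q, snd q @ snd r)"]
    proof (rule Least_equality)
      show "(fst (fst q, snd q @ snd r), take (len q) (snd (fst q, snd q @ snd r))) \<in> B"
        using len[OF q] by (simp add: core_def)
      fix k assume k: "(fst (fst q, snd q @ snd r), take k (snd (fst q, snd q @ snd r))) \<in> B"
      show "len q \<le> k"
      proof (cases "k \<le> length (snd q)")
        case True
        then have "(fst q, take k (snd q)) \<in> B" using k by simp
        then show ?thesis unfolding len_def by (rule Least_le)
      next
        case False then show ?thesis using len(2)[OF q] by simp
      qed
    qed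
    then show ?thesis using len(2)[OF q] by (simp add: core_def rest_def)
  qed
  define \<psi> where "\<psi> p = lin_ext (\<lambda>q. if core q = p then e (rest q) else 0)" for p
  have add: "\<psi> p (y + y') = \<psi> p y + \<psi> p y'" for p y y' by (simp add: \<psi>_def)
  have single: "\<psi> p (Poly_Mapping.single q c) = (if core q = p then Poly_Mapping.single (rest q) c else 0)" for p q c
    by (simp add: \<psi>_def)
  show ?thesis
  proof (intro exI conjI ballI)
    show "left_sum I (\<lambda>y. \<Sum>p\<in>B. \<psi> p y \<otimes> e p)"
    proof (rule left_sum_finite[OF finite_subset[OF B(1) finite_qpaths]])
      show "\<psi> p y \<in> carrier A" if "y \<in> I" for p y
        unfolding \<psi>_def path_algebra_simps by (rule keys_lin_ext) (use that B rest in auto)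
      show "\<psi> p (a \<otimes> y) = a \<otimes> \<psi> p y" if y: "y \<in> I" and a: "a \<in> carrier A" for p y a
      proof (rule additive_ext[of "\<lambda>y. \<psi> p (a \<otimes> y)" "\<lambda>y. a \<otimes> \<psi> p y"])
        fix q c assume "q \<in> Poly_Mapping.keys y"
        then have q: "q \<in> B" using y B(2) by auto
        show "\<psi> p (a \<otimes> Poly_Mapping.single q c) = a \<otimes> \<psi> p (Poly_Mapping.single q c)"
        proof (rule additive_ext[of "\<lambda>a. \<psi> p (a \<otimes> Poly_Mapping.single q c)" "\<lambda>a. a \<otimes> \<psi> p (Poly_Mapping.single q c)"])
          fix r d assume "r \<in> Poly_Mapping.keys a"
          then have r: "r \<in> qpaths Q" using a by auto
          show "\<psi> p (Poly_Mapping.single r d \<otimes> Poly_Mapping.single q c) = Poly_Mapping.single r d \<otimes> \<psi> p (Poly_Mapping.single q c)"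
          proof (cases "fst r = qpath_end Q q")
            case True then show ?thesis using comp[OF q r True] by (simp add: single app)
          next
            case False then show ?thesis using \<psi>_def by (simp add: single app)
          qed
        qed (simp_all add: add)
      qed (simp_all add: add)
    qed (use B(2) add in simp_all)
    fix y assume y: "y \<in> I"
    show "(\<Sum>p\<in>B. \<psi> p y \<otimes> e p) = y"
    proof (rule additive_ext[of "\<lambda>y. \<Sum>p\<in>B. \<psi> p y \<otimes> e p" "\<lambda>y. y"])
      fix q c assume "q \<in> Poly_Mapping.keys y"
      then have q: "q \<in> B" using y B(2) by auto
      have "Poly_Mapping.single (rest q) c \<otimes> e (core q) = Poly_Mapping.single q c"
        by (simp add: rest_def) (simp add: core_def)
      then have "(\<Sum>p\<in>B. \<psi> p (Poly_Mapping.single q c) \<otimes> e p) = (\<Sum>p\<in>B. if core q = p then Poly_Mapping.single q c else 0)"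
        by (intro sum.cong) (auto simp: single simp del: mult_single)
      then show "(\<Sum>p\<in>B. \<psi> p (Poly_Mapping.single q c) \<otimes> e p) = Poly_Mapping.single q c"
        using len(1)[OF q] finite_subset[OF B(1) finite_qpaths] by simp
    qed (simp_all add: add sum.distrib)
  qed
qed

text \<open>A central \<open>z\<close> satisfies \<open>e_v z = e_v z e_v\<close> for the idempotent
  \<open>e_v\<close> of a vertex, and the only path from \<open>v\<close> to \<open>v\<close> is
  trivial, so this is a multiple of \<open>e_v\<close>. An arrow forces the multiples at its two
  ends to agree, connectedness makes them all equal, and \<open>z\<close> is the sum of the
  \<open>e_v z\<close>.\<close>

lemma centre_scalar:
  assumes z: "z \<in> carrier A" and comm: "\<And>a. a \<in> carrier A \<Longrightarrow> a \<otimes> z = z \<otimes> a"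
  shows "z \<in> range scalar"
proof -
  define c where "c v = Poly_Mapping.lookup z (v, [])" for v
  have ez: "e (v, []) \<otimes> z = Poly_Mapping.single (v, []) (c v)" if v: "v \<in> verts Q" for v
  proof -
    have "e (v, []) \<otimes> z = e (v, []) \<otimes> (e (v, []) \<otimes> z)" unfolding mult_assoc[symmetric] by simp
    also have "\<dots> = e (v, []) \<otimes> (z \<otimes> e (v, []))" using comm[of "e (v, [])"] v by simp
    also have "\<dots> = Poly_Mapping.single (v, []) (c v)" using idempotent_isolates[OF z, of "(v, [])"] v by (simp add: c_def)
    finally show ?thesis .
  qed
  have "c (tail Q a) = c (head Q a)" if a: "a \<in> arcs Q" for a
  proof -
    let ?p = "(tail Q a, [a])"
    have p: "?p \<in> qpaths Q" using arc_implies_awalk[OF a] by (auto simp: qpaths_def)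
    \<comment> \<open>The product of the arrow with \<open>z\<close> is computed on both sides: to
      the right of the arrow \<open>z\<close> acts through the idempotent at the tail, to the left
      through the one at the head.\<close>
    have "Poly_Mapping.single ?p (c (tail Q a)) = e ?p \<otimes> (e (tail Q a, []) \<otimes> z)" using a by (simp add: ez)
    also have "\<dots> = e ?p \<otimes> z" unfolding mult_assoc[symmetric] by simp
    also have "\<dots> = z \<otimes> e ?p" using comm[of "e ?p"] p by simp
    also have "\<dots> = z \<otimes> (e (head Q a, []) \<otimes> e ?p)" by simp
    also have "\<dots> = (e (head Q a, []) \<otimes> z) \<otimes> e ?p"
      using comm[of "e (head Q a, [])"] a by (simp only: mult_assoc[symmetric]) simp
    also have "\<dots> = Poly_Mapping.single ?p (c (head Q a))" using a by (simp add: ez)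
    finally show ?thesis by (metis lookup_single_eq)
  qed
  note const = arc_constant[of c, OF this]
  obtain v where v: "v \<in> verts Q" using verts_nonempty by auto
  have "z = \<one> \<otimes> z" using mult_one(1) z by simp
  also have "\<dots> = (\<Sum>w\<in>verts Q. Poly_Mapping.single (w, []) (c w))"
    unfolding path_algebra_simps(5) mult_sum by (rule sum.cong) (simp_all add: ez)
  also have "\<dots> = (\<Sum>w\<in>verts Q. c v \<odot> e (w, []))"
    by (rule sum.cong) (use const[OF _ v] in simp_all)
  also have "\<dots> = scalar (c v)"
    by (rule poly_mapping_eqI) (auto simp: lookup_sum sum_distrib_left lookup_single when_def intro!: sum.cong)
  finally show ?thesis by blast
qed

lemma nontrivial: "\<zero> \<noteq> \<one>"
proof -
  obtain v where v: "v \<in> verts Q" using verts_nonempty by auto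
  have "Poly_Mapping.lookup \<one> (v, []) = 1"
    using v by (simp add: lookup_sum lookup_single when_def)
  then show ?thesis by (metis lookup_zero path_algebra_simps(3) zero_neq_one)
qed

lemma finitary_path_algebra: "finitary_two_category (D'_two_category A)"
  by (rule finitary_two_category_D'[OF nontrivial finite_ideals ideal_right_sum ideal_left_sum basis_sum centre_scalar])

end

theorem proposition15:
  fixes Q :: "('v, 'e) pre_digraph"
    and A :: "('k::alg_closed_field, ('v, 'e) qpath \<Rightarrow>\<^sub>0 'k) module"
  assumes "finite_tree_quiver Q"
    and "A = path_algebra Q"
  shows "finitary_two_category (D'_two_category A)"
proof -
  interpret path_alg Q A using assms by unfold_locales
  show ?thesis by (rule finitary_path_algebra)
qed

end
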